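(* Let $P$ be a polygonal domain in the plane with $n$ vertices, let $\phi$ be the smallest internal angle of $P$, let $0<\alpha\le\sin\tfrac{\phi}{2}$, and let $p\in P$. Then the robust inverse visibility region $\mathrm{Vis}^{\mathrm{inv}}_\alpha(p)$ can be computed in polynomial time.
   Context: A polygonal domain $P$ is a (closed) polygon in the plane, possibly with holes; $n$ is its total number of vertices. Two points of $P$ see each other if the line segment between them is contained in $P$. $D(p,r)$ denotes the disk of radius $r$ centered at $p$. A point $g\in P$ $\alpha$-robustly guards a point $p\in P$ if $p$ sees every point of $D(g,\alpha\|p-g\|)$. $\mathrm{Vis}^{\mathrm{inv}}_\alpha(p)$ is the set of points $g\in P$ such that $p$ is $\alpha$-robustly guarded by $g$. *)

theory Defs
  imports "HOL-Analysis.Analysis" "HOL-Computational_Algebra.Polynomial"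
begin

section \<open>Polygonal domains\<close>

text \<open>The plane is \<^typ>\<open>complex\<close>. A polygon is given by the cyclic list of its vertices, in either
  orientation. Vertices with internal angle \<open>\<pi>\<close> are allowed.\<close>

definition edge :: "complex list \<Rightarrow> nat \<Rightarrow> complex set" where
  "edge vs i = closed_segment (vs ! i) (vs ! (Suc i mod length vs))"

definition edge_ends :: "complex list \<Rightarrow> nat \<Rightarrow> complex set" where
  "edge_ends vs i = {vs ! i, vs ! (Suc i mod length vs)}"

definition polygon_boundary :: "complex list \<Rightarrow> complex set" where
  "polygon_boundary vs = (\<Union>i<length vs. edge vs i)"

text \<open>Two distinct edges meet exactly in the end points that they share.\<close>

definition simple_polygon :: "complex list \<Rightarrow> bool" where
  "simple_polygon vs \<longleftrightarrow> length vs \<ge> 3 \<and> distinct vs \<and>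
     (\<forall>i<length vs. \<forall>j<length vs. i \<noteq> j \<longrightarrow>
        edge vs i \<inter> edge vs j = edge_ends vs i \<inter> edge_ends vs j)"

definition polygon_interior :: "complex list \<Rightarrow> complex set" where
  "polygon_interior vs = inside (polygon_boundary vs)"

definition closed_polygon :: "complex list \<Rightarrow> complex set" where
  "closed_polygon vs = polygon_boundary vs \<union> polygon_interior vs"

record domain =
  outer :: "complex list"
  holes :: "complex list list"

definition polygonal_domain :: "domain \<Rightarrow> bool" where
  "polygonal_domain D \<longleftrightarrow> simple_polygon (outer D) \<and>
     (\<forall>h\<in>set (holes D). simple_polygon h \<and> closed_polygon h \<subseteq> polygon_interior (outer D)) \<and>
     (\<forall>i<length (holes D). \<forall>j<length (holes D). i \<noteq> j \<longrightarrow>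
        closed_polygon (holes D ! i) \<inter> closed_polygon (holes D ! j) = {})"

definition region :: "domain \<Rightarrow> complex set" where
  "region D = closed_polygon (outer D) - (\<Union>h\<in>set (holes D). polygon_interior h)"

definition boundary_cycles :: "domain \<Rightarrow> complex list list" where
  "boundary_cycles D = outer D # holes D"

definition vertices :: "domain \<Rightarrow> complex list" where
  "vertices D = concat (boundary_cycles D)"

definition num_vertices :: "domain \<Rightarrow> nat" where
  "num_vertices D = length (vertices D)"

text \<open>The internal angle of \<open>P\<close> at \<open>v\<close> is the total angle of the directions in which one can leave
  \<open>v\<close> while staying in \<open>P\<close>; at a vertex of a hole this is the angle outside of the hole.\<close>

definition internal_angle :: "complex set \<Rightarrow> complex \<Rightarrow> real" where
  "internal_angle P v =
     measure lborel {\<theta>\<in>{0..<2 * pi}. \<exists>\<epsilon>>0. \<forall>t\<in>{0<..<\<epsilon>}. v + of_real t * cis \<theta> \<in> P}"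

definition smallest_internal_angle :: "domain \<Rightarrow> real" where
  "smallest_internal_angle D = Min (internal_angle (region D) ` set (vertices D))"


section \<open>Robust visibility\<close>

definition sees :: "complex set \<Rightarrow> complex \<Rightarrow> complex \<Rightarrow> bool" where
  "sees P x y \<longleftrightarrow> x \<in> P \<and> y \<in> P \<and> closed_segment x y \<subseteq> P"

definition robustly_guards :: "complex set \<Rightarrow> real \<Rightarrow> complex \<Rightarrow> complex \<Rightarrow> bool" where
  "robustly_guards P \<alpha> g p \<longleftrightarrow>
     g \<in> P \<and> p \<in> P \<and> (\<forall>x\<in>cball g (\<alpha> * norm (p - g)). sees P p x)"

definition Vis_inv :: "complex set \<Rightarrow> real \<Rightarrow> complex \<Rightarrow> complex set" where
  "Vis_inv P \<alpha> p = {g\<in>P. robustly_guards P \<alpha> g p}"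


section \<open>The real RAM\<close>

text \<open>The machine has arrays of natural numbers and arrays of reals; the names of the arrays are
  constants of the program, their indices are computed at run time (indirect addressing).
  Programs contain no real constants except those obtained from natural numbers.

  Integers can only be added, subtracted (truncated at 0) and compared, and reals cannot be
  converted to integers: integer multiplication at unit cost, or a floor function, would make the
  machine unreasonably powerful. The reals have exact arithmetic and comparisons. As usual in
  computational geometry with curved arcs, real roots of polynomials of constant degree are
  available: in \<open>RRoot k es\<close>, both \<open>k\<close> and the number of coefficients \<open>es\<close> are fixed by the
  program text.\<close>

record state =
  nats :: "nat \<Rightarrow> nat \<Rightarrow> nat"
  reals :: "nat \<Rightarrow> nat \<Rightarrow> real"

datatype nexp =
    NConst nat
  | NCell nat nexp
  | NAdd nexp nexp
  | NSub nexp nexp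

datatype rexp =
    RNat nexp
  | RCell nat nexp
  | RAdd rexp rexp
  | RSub rexp rexp
  | RMul rexp rexp
  | RDiv rexp rexp
  | RSqrt rexp
  | RRoot nat "rexp list"

datatype bexp =
    NLess nexp nexp
  | RLess rexp rexp
  | BNot bexp
  | BAnd bexp bexp

datatype com =
    Skip
  | NAssign nat nexp nexp
  | RAssign nat nexp rexp
  | Seq com com
  | Cond bexp com com
  | While bexp com

text \<open>The real root number \<open>k\<close> (from 0, in increasing order, without multiplicities) of the
  polynomial with coefficients \<open>cs\<close>, the constant term first; 0 if there is no such root.\<close>

definition real_root :: "nat \<Rightarrow> real list \<Rightarrow> real" where
  "real_root k cs =
     (let S = {x. poly (Poly cs) x = 0}
      in if finite S \<and> k < card S then sorted_list_of_set S ! k else 0)"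

primrec nval :: "state \<Rightarrow> nexp \<Rightarrow> nat" where
  "nval s (NConst c) = c"
| "nval s (NCell a e) = nats s a (nval s e)"
| "nval s (NAdd e f) = nval s e + nval s f"
| "nval s (NSub e f) = nval s e - nval s f"

primrec rval :: "state \<Rightarrow> rexp \<Rightarrow> real" where
  "rval s (RNat e) = real (nval s e)"
| "rval s (RCell a e) = reals s a (nval s e)"
| "rval s (RAdd e f) = rval s e + rval s f"
| "rval s (RSub e f) = rval s e - rval s f"
| "rval s (RMul e f) = rval s e * rval s f"
| "rval s (RDiv e f) = rval s e / rval s f"
| "rval s (RSqrt e) = sqrt (rval s e)"
| "rval s (RRoot k es) = real_root k (map (rval s) es)"

primrec bval :: "state \<Rightarrow> bexp \<Rightarrow> bool" where
  "bval s (NLess e f) \<longleftrightarrow> nval s e < nval s f"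
| "bval s (RLess e f) \<longleftrightarrow> rval s e < rval s f"
| "bval s (BNot b) \<longleftrightarrow> \<not> bval s b"
| "bval s (BAnd b c) \<longleftrightarrow> bval s b \<and> bval s c"

definition upd2 :: "(nat \<Rightarrow> nat \<Rightarrow> 'a) \<Rightarrow> nat \<Rightarrow> nat \<Rightarrow> 'a \<Rightarrow> nat \<Rightarrow> nat \<Rightarrow> 'a" where
  "upd2 m a i x = m(a := (m a)(i := x))"

text \<open>\<open>exec c s t s'\<close>: started in \<open>s\<close>, the program \<open>c\<close> halts after \<open>t\<close> steps in \<open>s'\<close>. An assignment
  or test is one step; the size of its expressions is bounded by a constant of the program.\<close>

inductive exec :: "com \<Rightarrow> state \<Rightarrow> nat \<Rightarrow> state \<Rightarrow> bool" where
  Skip: "exec Skip s 1 s"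
| NAssign: "exec (NAssign a i e) s 1 (s\<lparr>nats := upd2 (nats s) a (nval s i) (nval s e)\<rparr>)"
| RAssign: "exec (RAssign a i e) s 1 (s\<lparr>reals := upd2 (reals s) a (nval s i) (rval s e)\<rparr>)"
| Seq: "exec c s t s' \<Longrightarrow> exec d s' u s'' \<Longrightarrow> exec (Seq c d) s (t + u) s''"
| CondTrue: "bval s b \<Longrightarrow> exec c s t s' \<Longrightarrow> exec (Cond b c d) s (Suc t) s'"
| CondFalse: "\<not> bval s b \<Longrightarrow> exec d s t s' \<Longrightarrow> exec (Cond b c d) s (Suc t) s'"
| WhileFalse: "\<not> bval s b \<Longrightarrow> exec (While b c) s 1 s"
| WhileTrue: "bval s b \<Longrightarrow> exec c s t s' \<Longrightarrow> exec (While b c) s' u s'' \<Longrightarrow>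
    exec (While b c) s (Suc (t + u)) s''"

inductive_cases SkipE: "exec Skip s t s'"
inductive_cases NAssignE: "exec (NAssign a i e) s t s'"
inductive_cases RAssignE: "exec (RAssign a i e) s t s'"
inductive_cases SeqE: "exec (Seq c d) s t s'"
inductive_cases CondE: "exec (Cond b c d) s t s'"
inductive_cases WhileE: "exec (While b c) s t s'"

lemma exec_deterministic:
  "exec c s t s' \<Longrightarrow> exec c s u s'' \<Longrightarrow> u = t \<and> s'' = s'"
proof (induction arbitrary: u s'' rule: exec.induct)
  case (Seq c s t s' d u1 s1)
  from Seq.prems show ?case by (rule SeqE) (use Seq.IH in blast)
next
  case (CondTrue s b c t s' d)
  from CondTrue.prems show ?case by (rule CondE) (use CondTrue in blast)+
next
  case (CondFalse s b d t s' c)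
  from CondFalse.prems show ?case by (rule CondE) (use CondFalse in blast)+
next
  case (WhileTrue s b c t s' u1 s1)
  from WhileTrue.prems show ?case by (rule WhileE) (use WhileTrue in blast)+
qed (auto elim: SkipE NAssignE RAssignE WhileE)


section \<open>Input and output\<close>

definition array_of :: "'a::zero list \<Rightarrow> nat \<Rightarrow> 'a" where
  "array_of xs i = (if i < length xs then xs ! i else 0)"

text \<open>Integer array 0 holds the number of boundary cycles followed by their lengths, the outer one
  first. Real arrays 0 and 1 hold the coordinates of the vertices, real array 2 holds \<open>p\<close> and
  \<open>\<alpha>\<close>. All other cells are 0.\<close>

definition input_state :: "domain \<Rightarrow> real \<Rightarrow> complex \<Rightarrow> state" where
  "input_state D \<alpha> p =
     \<lparr>nats = (\<lambda>a i. 0)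
        (0 := array_of (length (boundary_cycles D) # map length (boundary_cycles D))),
      reals = (\<lambda>a i. 0)
        (0 := array_of (map Re (vertices D)),
         1 := array_of (map Im (vertices D)),
         2 := array_of [Re p, Im p, \<alpha>])\<rparr>"

text \<open>A planar region is output as a list of curved triangles with common apex \<open>p\<close>: each of them is
  bounded by the segments from \<open>p\<close> to the two corners and by an arc between the corners of the
  conic \<open>A x\<^sup>2 + B x y + C y\<^sup>2 + D x + E y + F = 0\<close>. The corners may coincide, in which case the
  triangle is a segment, or the point \<open>p\<close>.\<close>

record piece =
  corner1 :: complex
  corner2 :: complex
  conic :: "real list"

definition conic_val :: "real list \<Rightarrow> complex \<Rightarrow> real" where
  "conic_val q z =
     q!0 * (Re z)^2 + q!1 * Re z * Im z + q!2 * (Im z)^2 + q!3 * Re z + q!4 * Im z + q!5"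

definition wedge :: "complex \<Rightarrow> complex \<Rightarrow> complex \<Rightarrow> complex set" where
  "wedge p a b =
     {p + of_real s * (a - p) + of_real t * (b - p) | s t. s \<ge> 0 \<and> t \<ge> 0}"

text \<open>The curved triangle: on every ray from \<open>p\<close> in the wedge, the part up to and including the first
  point at which the conic is met.\<close>

definition cell :: "complex \<Rightarrow> piece \<Rightarrow> complex set" where
  "cell p T = {g\<in>wedge p (corner1 T) (corner2 T).
     \<forall>x\<in>closed_segment p g - {g}. conic_val (conic T) x > 0}"

definition corners_on_arc :: "complex \<Rightarrow> piece \<Rightarrow> bool" where
  "corners_on_arc p T \<longleftrightarrow> (\<forall>c\<in>{corner1 T, corner2 T}. c \<in> cell p T \<and> conic_val (conic T) c = 0)"

text \<open>The curved triangles decompose \<open>S\<close>: they cover exactly \<open>S\<close> and do not overlap.\<close>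

definition describes :: "complex \<Rightarrow> piece list \<Rightarrow> complex set \<Rightarrow> bool" where
  "describes p Ts S \<longleftrightarrow>
     S = (\<Union>T\<in>set Ts. cell p T) \<and>
     (\<forall>T\<in>set Ts. corners_on_arc p T) \<and>
     (\<forall>i<length Ts. \<forall>j<length Ts. i \<noteq> j \<longrightarrow>
        interior (cell p (Ts ! i)) \<inter> interior (cell p (Ts ! j)) = {})"

text \<open>Cell 0 of integer array 1 holds the number of pieces; piece number \<open>i\<close> is stored in the ten
  cells from \<open>10 i\<close> on of real array 3.\<close>

definition read_piece :: "state \<Rightarrow> nat \<Rightarrow> piece" where
  "read_piece s i =
     (let r = \<lambda>k. reals s 3 (10 * i + k)
      in \<lparr>corner1 = Complex (r 0) (r 1), corner2 = Complex (r 2) (r 3), conic = map r [4..<10]\<rparr>)"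

definition read_output :: "state \<Rightarrow> piece list" where
  "read_output s = map (read_piece s) [0..<nats s 1 0]"

end

theory Submission
  imports Defs "HOL-Complex_Analysis.Complex_Analysis"
begin

text \<open>A point \<open>g \<noteq> p\<close> of \<open>P\<close> guards \<open>p\<close> robustly iff no edge meets the interior of the convex hull of \<open>p\<close>
  and of the disk \<open>D(g, \<alpha>|p - g|)\<close>: this interior is connected, so it then lies on one side of the
  boundary. The condition holds for all points of the segment from \<open>p\<close> to \<open>g\<close> if it holds for \<open>g\<close>. A vertex
  \<open>q\<close> obstructs a ray from \<open>p\<close> from the Apollonius circle \<open>|z - q| = \<alpha>|z - p|\<close> on, and the inner points of
  an edge obstruct it from a conic with focus \<open>p\<close> and the line of the edge as directrix on; hence on each
  ray the region ends at the first of these arcs. The first obstacle can change only in the roots of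
  polynomials of degree at most four in the parameter of the direction. Between two consecutive such
  directions the region is either \<open>{p}\<close> or a curved triangle bounded by one conic, and the parity of the
  edges that cross a ray to the left of a single sample point decides which.\<close>

section \<open>Crossing parity of simple polygons\<close>

text \<open>Distances along a ray are measured by their reciprocal \<open>S\<close>. Shrinking the
  disk towards \<open>p\<close> then becomes magnifying the edges by factors
  \<open>S \<ge> S0\<close>, and an obstacle hits the point \<open>u / S0\<close> iff
  \<open>S0 < sval\<close>, so the first obstacle on a ray is a maximum of explicit values. The
  obstacle is a polynomial that vanishes identically, since it has no roots at which the sweep could
  stop: then the two obstacles must be shown to agree in all directions, or the case to be
  impossible. Critical directions are neither stored nor sorted; the next one is found by scanning
  the roots of all polynomials once more. A critical direction is itself a degenerate sector and may
  contribute a segment. At the two ends of an open sector the validity conditions can fail, so the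
  ends are reached by continuity, where the boundedness of the domain keeps \<open>sval\<close> away
  from 0.\<close>

definition cross :: "complex \<Rightarrow> complex \<Rightarrow> real" where
  "cross a b = Re a * Im b - Im a * Re b"

text \<open>The half-open rule \<open>Im a < Im z \<le> Im b\<close> matches the branch cut of
  \<open>Arg\<close>: negative arguments belong to the directions with negative imaginary part, and
  the negative real axis has argument \<pi>. The sign of the cross product says that the edge passes
  to the left of \<open>z\<close>.\<close>

definition crosses :: "complex \<times> complex \<Rightarrow> complex \<Rightarrow> bool" where
  "crosses e z \<longleftrightarrow> (case e of (a, b) \<Rightarrow>
     (Im a < Im z \<and> Im z \<le> Im b \<and> cross (a - z) (b - z) < 0) \<or>
     (Im b < Im z \<and> Im z \<le> Im a \<and> cross (a - z) (b - z) > 0))"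

definition chain_edges :: "complex list \<Rightarrow> (complex \<times> complex) list" where
  "chain_edges l = zip l (tl l)"

lemma chain_edges_simps [simp]:
  "chain_edges [] = []" "chain_edges [a] = []"
  "chain_edges (a # b # l) = (a, b) # chain_edges (b # l)"
  by (auto simp: chain_edges_def)

definition cyclic_edges :: "complex list \<Rightarrow> (complex \<times> complex) list" where
  "cyclic_edges vs = map (\<lambda>i. (vs ! i, vs ! (Suc i mod length vs))) [0..<length vs]"

definition seg :: "complex \<times> complex \<Rightarrow> complex set" where
  "seg e = closed_segment (fst e) (snd e)"

lemma length_cyclic_edges [simp]: "length (cyclic_edges vs) = length vs"
  by (simp add: cyclic_edges_def)

lemma cyclic_edges_chain:
  assumes "vs \<noteq> []"
  shows "cyclic_edges vs = chain_edges (vs @ [hd vs])"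
proof (rule nth_equalityI)
  show "length (cyclic_edges vs) = length (chain_edges (vs @ [hd vs]))"
    using assms by (simp add: cyclic_edges_def chain_edges_def)
next
  fix i assume i: "i < length (cyclic_edges vs)"
  then have i: "i < length vs" by simp
  have "(vs @ [hd vs]) ! Suc i = vs ! (Suc i mod length vs)"
    using i assms by (cases "Suc i = length vs") (auto simp: nth_append hd_conv_nth)
  then show "cyclic_edges vs ! i = chain_edges (vs @ [hd vs]) ! i"
    using i assms by (auto simp: cyclic_edges_def chain_edges_def nth_append nth_tl simp del: tl_append2)
qed

lemma polygon_boundary_eq: "polygon_boundary vs = (\<Union>e\<in>set (cyclic_edges vs). seg e)"
  by (auto simp: polygon_boundary_def cyclic_edges_def edge_def seg_def)

section \<open>Polygons as simple closed paths\<close>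

fun chain_path :: "complex list \<Rightarrow> real \<Rightarrow> complex" where
  "chain_path (a # b # c # l) = linepath a b +++ chain_path (b # c # l)"
| "chain_path [a, b] = linepath a b"
| "chain_path [a] = linepath a a"
| "chain_path [] = linepath 0 0"

lemma chain_path_start: "pathstart (chain_path (a # l)) = a"
  by (induction "a # l" arbitrary: a l rule: chain_path.induct) auto

lemma chain_path_finish: "l \<noteq> [] \<Longrightarrow> pathfinish (chain_path l) = last l"
  by (induction l rule: chain_path.induct) auto

lemma path_chain_path: "path (chain_path l)"
  by (induction l rule: chain_path.induct) (auto simp: chain_path_start; simp add: path_def)+

lemma path_image_chain_path:
  "length l \<ge> 2 \<Longrightarrow> path_image (chain_path l) = (\<Union>e\<in>set (chain_edges l). seg e)"
  by (induction l rule: chain_path.induct) (auto simp: chain_path_start path_image_join seg_def)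

text \<open>Recursive because \<open>chain_path\<close> prepends one edge at a time, and phrased by
  common end points because \<open>simple_polygon\<close> provides exactly this.\<close>

fun simple_chain :: "complex list \<Rightarrow> bool" where
  "simple_chain (a # b # l) \<longleftrightarrow> a \<notin> set (b # l) \<and> simple_chain (b # l) \<and>
     (\<forall>e\<in>set (chain_edges (b # l)). seg (a, b) \<inter> seg e \<subseteq> {a, b} \<inter> {fst e, snd e})"
| "simple_chain _ \<longleftrightarrow> True"

lemma chain_edges_subset: "e \<in> set (chain_edges l) \<Longrightarrow> fst e \<in> set l \<and> snd e \<in> set l"
  unfolding chain_edges_def using set_zip_leftD set_zip_rightD list.set_sel(2)
  by (metis prod.collapse tl_Nil)

lemma arc_chain_path: "length l \<ge> 2 \<Longrightarrow> simple_chain l \<Longrightarrow> arc (chain_path l)"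
proof (induction l rule: chain_path.induct)
  case (1 a b c l)
  have "path_image (linepath a b) \<inter> path_image (chain_path (b # c # l)) \<subseteq> {b}"
  proof
    fix x assume x: "x \<in> path_image (linepath a b) \<inter> path_image (chain_path (b # c # l))"
    then obtain e where e: "e \<in> set (chain_edges (b # c # l))" "x \<in> seg e" "x \<in> seg (a, b)"
      using path_image_chain_path[of "b # c # l"] by (force simp: seg_def)
    then have "x \<in> {a, b}" "x \<in> {fst e, snd e}" using 1(3) by auto
    \<comment> \<open>The vertex \<open>a\<close> does not occur again, so the only end point that
      can be shared with a later edge is \<open>b\<close>.\<close>
    moreover have "a \<notin> {fst e, snd e}" using chain_edges_subset[OF e(1)] 1(3) by auto
    ultimately show "x \<in> {b}" by blast
  qed
  then show ?case using 1 by (auto simp: chain_path_start intro!: arc_join)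
qed auto

lemma simple_chain_if:
  assumes "distinct l"
    and "\<And>i j. i < j \<Longrightarrow> Suc j < length l \<Longrightarrow>
      seg (l ! i, l ! Suc i) \<inter> seg (l ! j, l ! Suc j) \<subseteq> {l ! i, l ! Suc i} \<inter> {l ! j, l ! Suc j}"
  shows "simple_chain l"
  using assms
proof (induction l rule: simple_chain.induct)
  case (1 a b l)
  have "simple_chain (b # l)"
  proof (rule 1(1))
    show "seg ((b # l) ! i, (b # l) ! Suc i) \<inter> seg ((b # l) ! j, (b # l) ! Suc j)
      \<subseteq> {(b # l) ! i, (b # l) ! Suc i} \<inter> {(b # l) ! j, (b # l) ! Suc j}"
      if "i < j" "Suc j < length (b # l)" for i j
      using 1(3)[of "Suc i" "Suc j"] that by simp
  qed (use 1 in auto)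
  moreover have "seg (a, b) \<inter> seg e \<subseteq> {a, b} \<inter> {fst e, snd e}" if e: "e \<in> set (chain_edges (b # l))" for e
  proof -
    obtain j where "j < length l" "e = ((b # l) ! j, l ! j)"
      using e by (auto simp: chain_edges_def in_set_conv_nth)
    then show ?thesis using 1(3)[of 0 "Suc j"] by simp
  qed
  ultimately show ?case using 1(2) by auto
qed auto

definition polygon_path :: "complex list \<Rightarrow> real \<Rightarrow> complex" where
  "polygon_path vs = chain_path (vs @ [hd vs])"

lemma simple_polygon_edge_inter:
  assumes "simple_polygon vs" "i < length vs" "j < length vs" "i \<noteq> j"
  shows "seg (cyclic_edges vs ! i) \<inter> seg (cyclic_edges vs ! j) =
    {fst (cyclic_edges vs ! i), snd (cyclic_edges vs ! i)} \<inter> {fst (cyclic_edges vs ! j), snd (cyclic_edges vs ! j)}"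
  using assms by (auto simp: simple_polygon_def cyclic_edges_def seg_def edge_def edge_ends_def)

text \<open>Cutting the closed chain after its first edge leaves two arcs, since the rest runs from
  \<open>b\<close> to \<open>a\<close> through distinct vertices. They meet in \<open>a\<close> and
  \<open>b\<close> only and therefore join to a simple closed path.\<close>

lemma polygon_path_props:
  assumes vs: "simple_polygon vs"
  shows "simple_path (polygon_path vs)" "pathfinish (polygon_path vs) = pathstart (polygon_path vs)"
    "path_image (polygon_path vs) = polygon_boundary vs"
proof -
  from vs have len: "length vs \<ge> 3" and dist: "distinct vs" by (auto simp: simple_polygon_def)
  then obtain a b c l where l: "vs = a # b # c # l"
    by (metis One_nat_def Suc_le_length_iff numeral_3_eq_3)
  have ce: "cyclic_edges vs = (a, b) # chain_edges (b # c # l @ [a])"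
    using cyclic_edges_chain[of vs] l by simp
  have nth: "cyclic_edges vs ! Suc i = ((b # c # l @ [a]) ! i, (b # c # l @ [a]) ! Suc i)"
    if "Suc i < length vs" for i
    using that l unfolding ce by (auto simp: chain_edges_def nth_Cons split: nat.split)
  have sc: "simple_chain (b # c # l @ [a])"
  proof (rule simple_chain_if)
    fix i j :: nat assume ij: "i < j" "Suc j < length (b # c # l @ [a])"
    show "seg ((b # c # l @ [a]) ! i, (b # c # l @ [a]) ! Suc i) \<inter>
        seg ((b # c # l @ [a]) ! j, (b # c # l @ [a]) ! Suc j)
      \<subseteq> {(b # c # l @ [a]) ! i, (b # c # l @ [a]) ! Suc i} \<inter>
        {(b # c # l @ [a]) ! j, (b # c # l @ [a]) ! Suc j}"
      using simple_polygon_edge_inter[OF vs, of "Suc i" "Suc j"] ij nth[of i] nth[of j]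
      by (simp add: l)
  qed (use dist l in auto)
  have pp: "polygon_path vs = linepath a b +++ chain_path (b # c # l @ [a])"
    by (simp add: polygon_path_def l)
  show fin: "pathfinish (polygon_path vs) = pathstart (polygon_path vs)"
    by (simp add: pp chain_path_finish)
  have img: "path_image (chain_path (b # c # l @ [a])) = (\<Union>e\<in>set (chain_edges (b # c # l @ [a])). seg e)"
    by (rule path_image_chain_path) auto
  show "path_image (polygon_path vs) = polygon_boundary vs"
    unfolding polygon_boundary_eq ce pp
    by (subst path_image_join) (use img in \<open>auto simp: chain_path_start seg_def\<close>)
  have "path_image (linepath a b) \<inter> path_image (chain_path (b # c # l @ [a])) \<subseteq> {a, b}"
  proof
    fix x assume x: "x \<in> path_image (linepath a b) \<inter> path_image (chain_path (b # c # l @ [a]))"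
    then obtain e where e: "e \<in> set (chain_edges (b # c # l @ [a]))" "x \<in> seg e" "x \<in> seg (a, b)"
      using img by (force simp: seg_def)
    then obtain i where i: "i < length (chain_edges (b # c # l @ [a]))" "e = chain_edges (b # c # l @ [a]) ! i"
      by (metis in_set_conv_nth)
    have "Suc i < length vs" using i(1) by (simp add: l chain_edges_def)
    then show "x \<in> {a, b}" using simple_polygon_edge_inter[OF vs, of 0 "Suc i"] e i l ce by auto
  qed
  then show "simple_path (polygon_path vs)"
    unfolding pp using arc_chain_path[OF _ sc] dist l
    by (intro simple_path_join_loop) (auto simp: chain_path_start chain_path_finish)
qed

text \<open>Measuring angles by \<open>Arg\<close>, whose branch cut is the negative real axis, the angles along a closed
  chain sum up to \<open>2\<pi>\<close> times the signed number of edges that cross the ray to the left of the point.\<close>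

lemma winding_number_linepath_Arg:
  assumes z: "z \<notin> closed_segment a b"
  shows "Re (winding_number (linepath a b) z) = Arg ((b - z) / (a - z)) / (2 * pi)"
proof -
  have az: "a \<noteq> z" and bz: "b \<noteq> z" using z by auto
  let ?S = "closed_segment a b"
  \<comment> \<open>A quotient on the closed negative real axis would place \<open>z\<close> between
    \<open>w\<close> and \<open>a\<close>. Hence \<open>Ln ((w - z) / (a - z))\<close> is a
    primitive along the whole segment.\<close>
  have nonneg: "(w - z) / (a - z) \<notin> \<real>\<^sub>\<le>\<^sub>0" if w: "w \<in> ?S" for w
  proof
    assume "(w - z) / (a - z) \<in> \<real>\<^sub>\<le>\<^sub>0"
    then obtain r where r: "r \<le> 0" "(w - z) / (a - z) = of_real r" by (auto elim!: nonpos_Reals_cases)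
    define k where "k = - r"
    have k: "k \<ge> 0" "w - z = - of_real k * (a - z)" using r az by (auto simp: k_def field_simps)
    then have "of_real (1 + k) * z = w + of_real k * a" by (simp add: algebra_simps)
    moreover have "complex_of_real (1 + k) \<noteq> 0" using k
      by (metis add_nonneg_eq_0_iff of_real_eq_0_iff zero_le_one zero_neq_one)
    ultimately have "z = (w + of_real k * a) / of_real (1 + k)" by (metis nonzero_mult_div_cancel_left)
    also have "\<dots> = (1 - k / (1 + k)) *\<^sub>R w + (k / (1 + k)) *\<^sub>R a"
      using k by (simp add: scaleR_conv_of_real divide_simps add_eq_0_iff) 
         (metis (no_types, opaque_lifting) add.right_neutral add_diff_cancel_right' add_neg_numeral_special(7) \<open>complex_of_real (1 + k) \<noteq> 0\<close> of_real_1 of_real_add)?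
    finally have "z \<in> closed_segment w a"
      unfolding in_segment using k by (intro exI[of _ "k / (1 + k)"]) auto
    moreover have "closed_segment w a \<subseteq> ?S"
      using w by (metis closed_segment_subset convex_closed_segment ends_in_segment(1))
    ultimately show False using z by auto
  qed
  have der: "((\<lambda>w. Ln ((w - z) / (a - z))) has_field_derivative (1 / (w - z))) (at w within ?S)" if w: "w \<in> ?S" for w
  proof -
    have "w \<noteq> z" using w z by auto
    then show ?thesis using nonneg[OF w] az
      by (auto intro!: derivative_eq_intros)
  qed
  have "((\<lambda>w. 1 / (w - z)) has_contour_integral
      (Ln ((b - z) / (a - z)) - Ln ((a - z) / (a - z)))) (linepath a b)"
    using contour_integral_primitive[of ?S "\<lambda>w. Ln ((w - z) / (a - z))" "\<lambda>w. 1 / (w - z)" "linepath a b"] der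
    by auto
  then have "contour_integral (linepath a b) (\<lambda>w. 1 / (w - z)) = Ln ((b - z) / (a - z))"
    using az by (simp add: contour_integral_unique)
  then have "winding_number (linepath a b) z = 1 / (2 * of_real pi * \<i>) * Ln ((b - z) / (a - z))"
    using winding_number_valid_path[of "linepath a b" z] z by simp
  then show ?thesis
    using az bz by (simp add: Arg_eq_Im_Ln Re_divide power2_eq_square)
qed

lemma cross_Arg: "cross a b = cmod a * cmod b * sin (Arg b - Arg a)"
proof -
  have "Re x = cmod x * cos (Arg x)" "Im x = cmod x * sin (Arg x)" for x
    using rcis_cmod_Arg[of x] by (metis Re_rcis, metis Im_rcis)
  then show ?thesis unfolding cross_def
    by (simp add: sin_diff algebra_simps)
qed

text \<open>Both arguments lie in (-\<pi>, \<pi>], so the angle of the quotient is their difference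
  \<open>d\<close> up to one full turn. A turn is added or removed iff
  \<open>\<bar>d\<bar> > \<pi>\<close>, and this happens when the segment runs across the branch
  cut, the ray to the left of \<open>z\<close>.\<close>

lemma Arg_diff_crosses:
  assumes z: "z \<notin> closed_segment a b"
  shows "\<exists>k::int. Arg ((b - z) / (a - z)) = Arg (b - z) - Arg (a - z) + 2 * pi * k \<and>
     (odd k \<longleftrightarrow> crosses (a, b) z)"
proof -
  define d where "d = Arg (b - z) - Arg (a - z)"
  have az: "a \<noteq> z" and bz: "b \<noteq> z" using z by auto
  have range: "- pi < Arg x" "Arg x \<le> pi" for x by (auto simp: Arg_bounded)
  have cr: "cross (a - z) (b - z) = cmod (a - z) * cmod (b - z) * sin d"
    unfolding d_def by (rule cross_Arg)
  have pos: "cmod (a - z) * cmod (b - z) > 0" using az bz by simp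
  have not_pi: "\<bar>d\<bar> \<noteq> pi"
  proof
    \<comment> \<open>Opposite directions from \<open>z\<close> put \<open>z\<close> on the segment,
      which it divides in the ratio of the distances \<open>s\<close> and \<open>t\<close>.\<close>
    assume d: "\<bar>d\<bar> = pi"
    define s where "s = cmod (a - z)" define t where "t = cmod (b - z)"
    have st: "s > 0" "t > 0" using az bz by (auto simp: s_def t_def)
    have "cis (Arg (b - z)) = - cis (Arg (a - z))"
    proof -
      have "d = pi \<or> d = - pi" using d by linarith
      then have "cis d = -1" by (auto simp: complex_eq_iff)
      then show ?thesis unfolding d_def cis_divide[symmetric] by (simp add: field_simps)
    qed
    then have "(b - z) * of_real s = - (a - z) * of_real t"
      using rcis_cmod_Arg[of "a - z"] rcis_cmod_Arg[of "b - z"]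
      unfolding rcis_def s_def[symmetric] t_def[symmetric]
      by (metis (no_types, opaque_lifting) minus_mult_minus mult.assoc mult.commute mult_minus_left)
    then have "z * of_real (s + t) = b * of_real s + a * of_real t" by (simp add: algebra_simps)
    moreover have "of_real (s + t) \<noteq> (0::complex)" using st by (metis add_pos_pos less_irrefl of_real_eq_0_iff)
    ultimately have "z = (b * of_real s + a * of_real t) / of_real (s + t)"
      by (metis nonzero_mult_div_cancel_right)
    also have "\<dots> = (1 - s / (s + t)) *\<^sub>R a + (s / (s + t)) *\<^sub>R b"
    proof -
      have "1 - s / (s + t) = t / (s + t)" using st by (simp add: field_simps)
      then show ?thesis by (simp add: scaleR_conv_of_real add_divide_distrib mult.commute)
    qed
    finally have "z \<in> closed_segment a b"
      unfolding in_segment using st by (intro exI[of _ "s / (s + t)"]) auto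
    then show False using z by simp
  qed
  have iff: "crosses (a, b) z \<longleftrightarrow> \<bar>d\<bar> > pi"
  proof -
    have n: "Arg (x - z) < 0 \<longleftrightarrow> Im x < Im z" for x by (simp add: Arg_neg_iff)
    \<comment> \<open>Upward edges, downward edges, and edges with both ends on the same side of the
      horizontal line. In the first two cases the sign of \<open>sin d\<close> tells whether
      \<open>d\<close> exceeds a half turn.\<close>
    consider "Im a < Im z" "Im z \<le> Im b" | "Im b < Im z" "Im z \<le> Im a"
      | "Im a < Im z \<longleftrightarrow> Im b < Im z" by linarith
    then show ?thesis
    proof cases
      case 1
      then have "Arg (a - z) < 0" "Arg (b - z) \<ge> 0" using n[of a] n[of b] by auto
      then have d: "0 < d" "d < 2 * pi" using range[of "a - z"] range[of "b - z"] by (auto simp: d_def)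
      have "sin d < 0 \<longleftrightarrow> d > pi"
      proof
        assume "sin d < 0" then show "d > pi" using d sin_ge_zero[of d] by (meson leD le_less_linear less_imp_le)
      qed (use d in \<open>auto intro: sin_lt_zero\<close>)
      then show ?thesis using 1 d pos cr by (auto simp: crosses_def mult_less_0_iff)
    next
      case 2
      then have "Arg (b - z) < 0" "Arg (a - z) \<ge> 0" using n[of a] n[of b] by auto
      then have d: "0 < - d" "- d < 2 * pi" using range[of "a - z"] range[of "b - z"] by (auto simp: d_def)
      have "sin (- d) < 0 \<longleftrightarrow> - d > pi"
      proof
        assume "sin (- d) < 0" then show "- d > pi" using d sin_ge_zero[of "- d"] by (meson leD le_less_linear less_imp_le)
      qed (use d in \<open>auto intro: sin_lt_zero simp del: sin_minus\<close>)
      then show ?thesis using 2 d pos cr less_asym[OF pos] by (auto simp: crosses_def zero_less_mult_iff)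
    next
      case 3
      have "\<bar>d\<bar> \<le> pi" using 3 n[of a] n[of b] range[of "a - z"] range[of "b - z"] by (auto simp: d_def)
      then show ?thesis using 3 by (auto simp: crosses_def)
    qed
  qed
  have "Arg ((b - z) / (a - z)) = (if d \<in> {-pi<..pi} then d else if d > pi then d - 2 * pi else d + 2 * pi)"
    using Arg_divide'[of "b - z" "a - z"] az bz by (simp add: d_def)
  then show ?thesis
    unfolding d_def[symmetric] iff using not_pi
    by (cases "\<bar>d\<bar> < pi"; cases "d > pi")
       (intro exI[of _ 0] conjI; force | intro exI[of _ "-1"] conjI; force | intro exI[of _ 1] conjI; force)+
qed

text \<open>The principal arguments telescope along the chain, and every edge adds an integer that
  is odd iff the edge crosses the ray. On a closed chain the two remaining arguments cancel.\<close>

lemma winding_number_chain_path: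
  assumes "length l \<ge> 2" "z \<notin> (\<Union>e\<in>set (chain_edges l). seg e)"
  shows "\<exists>k::int. Re (winding_number (chain_path l) z) = (Arg (last l - z) - Arg (hd l - z)) / (2 * pi) + k \<and>
    (odd k \<longleftrightarrow> odd (length (filter (\<lambda>e. crosses e z) (chain_edges l))))"
  using assms
proof (induction l rule: chain_path.induct)
  case (1 a b c l)
  obtain k :: int where k: "Re (winding_number (chain_path (b # c # l)) z) =
      (Arg (last (b # c # l) - z) - Arg (hd (b # c # l) - z)) / (2 * pi) + k"
    "odd k \<longleftrightarrow> odd (length (filter (\<lambda>e. crosses e z) (chain_edges (b # c # l))))"
    using 1 by auto
  have z: "z \<notin> closed_segment a b" using 1(3) by (simp add: seg_def)
  obtain j :: int where j: "Arg ((b - z) / (a - z)) = Arg (b - z) - Arg (a - z) + 2 * pi * j"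
      "odd j \<longleftrightarrow> crosses (a, b) z"
    using Arg_diff_crosses[OF z] by blast
  have zi: "z \<notin> path_image (chain_path (b # c # l))"
    using 1(3) path_image_chain_path[of "b # c # l"] by simp
  have "winding_number (chain_path (a # b # c # l)) z =
      winding_number (linepath a b) z + winding_number (chain_path (b # c # l)) z"
    using z zi by (simp add: winding_number_join path_chain_path chain_path_start)
  then have "Re (winding_number (chain_path (a # b # c # l)) z) =
      (Arg (last (a # b # c # l) - z) - Arg (hd (a # b # c # l) - z)) / (2 * pi) + of_int (j + k)"
    using k(1) j(1) winding_number_linepath_Arg[OF z] by (simp add: field_simps)
  then show ?case using k(2) j(2) by (intro exI[of _ "j + k"]) auto
next
  case (2 a b)
  then have z: "z \<notin> closed_segment a b" by (simp add: seg_def)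
  obtain j :: int where j: "Arg ((b - z) / (a - z)) = Arg (b - z) - Arg (a - z) + 2 * pi * j"
      "odd j \<longleftrightarrow> crosses (a, b) z"
    using Arg_diff_crosses[OF z] by blast
  show ?case using winding_number_linepath_Arg[OF z] j
    by (intro exI[of _ j]) (auto simp: field_simps)
qed auto

text \<open>A simple closed path winds once, in one direction or the other, around inner points and
  not at all around outer points; so the parity of the winding number decides for both
  orientations.\<close>

lemma simple_polygon_crossings:
  assumes vs: "simple_polygon vs" and z: "z \<notin> polygon_boundary vs"
  shows "z \<in> polygon_interior vs \<longleftrightarrow> odd (length (filter (\<lambda>e. crosses e z) (cyclic_edges vs)))"
proof -
  note pp = polygon_path_props[OF vs]
  have ne: "vs \<noteq> []" using vs by (auto simp: simple_polygon_def)
  obtain k :: int where k: "Re (winding_number (polygon_path vs) z) = k"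
      "odd k \<longleftrightarrow> odd (length (filter (\<lambda>e. crosses e z) (cyclic_edges vs)))"
    using winding_number_chain_path[of "vs @ [hd vs]" z] z ne
    by (auto simp: polygon_path_def polygon_boundary_eq cyclic_edges_chain Suc_le_eq)
  show ?thesis
  proof (cases "z \<in> polygon_interior vs")
    case True
    then have "\<bar>Re (winding_number (polygon_path vs) z)\<bar> = 1"
      using simple_closed_path_abs_winding_number_inside[OF pp(1)] pp(3)
      by (simp add: polygon_interior_def)
    then have "real_of_int k = -1 \<or> real_of_int k = 1" using k(1) by auto
    then have "k = -1 \<or> k = 1" by linarith
    then show ?thesis using True k(2) by auto
  next
    case False
    then have "z \<in> outside (path_image (polygon_path vs))"
      using z pp(3) inside_outside union_with_inside by (fastforce simp: polygon_interior_def)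
    then have "winding_number (polygon_path vs) z = 0"
      using pp winding_number_zero_in_outside simple_path_imp_path by blast
    then have "k = 0" using k(1) by simp
    then show ?thesis using False k(2) by auto
  qed
qed

section \<open>Robust guards of a polygonal domain\<close>

text \<open>Consequences of the Jordan curve theorem. The two closure statements say that boundary
  points are approached from both sides; this later keeps them out of the interior of the
  region.\<close>

lemma simple_polygon_topology:
  assumes vs: "simple_polygon vs"
  shows "compact (polygon_boundary vs)" "open (polygon_interior vs)" "bounded (polygon_interior vs)"
    "polygon_boundary vs \<subseteq> closure (polygon_interior vs)"
    "polygon_boundary vs \<subseteq> closure (- closed_polygon vs)"
    "polygon_boundary vs \<inter> polygon_interior vs = {}"
    "compact (closed_polygon vs)" "polygon_boundary vs \<noteq> {}"
proof -
  note pp = polygon_path_props[OF vs]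
  note J = Jordan_inside_outside[OF pp(1,2), unfolded pp(3)]
  show c: "compact (polygon_boundary vs)" unfolding pp(3)[symmetric]
    using pp(1) compact_simple_path_image by blast
  show o: "open (polygon_interior vs)" and b: "bounded (polygon_interior vs)"
    using J by (auto simp: polygon_interior_def)
  show cl: "polygon_boundary vs \<subseteq> closure (polygon_interior vs)"
    using J unfolding polygon_interior_def frontier_def by blast
  show d: "polygon_boundary vs \<inter> polygon_interior vs = {}"
    using inside_no_overlap[of "polygon_boundary vs"] by (metis inf_commute polygon_interior_def)
  have "- closed_polygon vs = outside (polygon_boundary vs)"
    using union_with_inside[of "polygon_boundary vs"] by (auto simp: closed_polygon_def polygon_interior_def)
  then show "polygon_boundary vs \<subseteq> closure (- closed_polygon vs)"
    using J unfolding frontier_def by auto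
  have "closed_polygon vs = closure (polygon_interior vs)"
    using J unfolding closed_polygon_def polygon_interior_def closure_Un_frontier by auto
  then show "compact (closed_polygon vs)" using b by (simp add: compact_closure)
  show "polygon_boundary vs \<noteq> {}" unfolding pp(3)[symmetric] by simp
qed

section \<open>Topology and crossing parity of a region with holes\<close>

definition domain_edges :: "domain \<Rightarrow> (complex \<times> complex) list" where
  "domain_edges D = concat (map cyclic_edges (boundary_cycles D))"

definition domain_boundary :: "domain \<Rightarrow> complex set" where
  "domain_boundary D = (\<Union>vs\<in>set (boundary_cycles D). polygon_boundary vs)"

lemma domain_boundary_eq: "domain_boundary D = (\<Union>e\<in>set (domain_edges D). seg e)"
  by (auto simp: domain_boundary_def domain_edges_def polygon_boundary_eq)

context
  fixes D :: domain
  assumes D: "polygonal_domain D"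
begin

lemma outer_simple: "simple_polygon (outer D)"
  using D by (simp add: polygonal_domain_def)

lemma hole_simple: "h \<in> set (holes D) \<Longrightarrow> simple_polygon h"
  using D by (simp add: polygonal_domain_def)

lemma hole_inside: "h \<in> set (holes D) \<Longrightarrow> closed_polygon h \<subseteq> polygon_interior (outer D)"
  using D by (simp add: polygonal_domain_def)

lemma compact_region: "compact (region D)"
  unfolding region_def using simple_polygon_topology(2)[OF hole_simple]
  by (intro compact_diff simple_polygon_topology(7)[OF outer_simple]) auto

text \<open>Points of the region that lie on no cycle belong to the open set \<open>U\<close>, which
  is contained in the region; they are interior.\<close>

lemma frontier_region_subset: "frontier (region D) \<subseteq> domain_boundary D"
proof
  fix z assume z: "z \<in> frontier (region D)"
  then have zP: "z \<in> region D" using compact_region by (metis compact_imp_closed frontier_subset_closed subsetD)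
  show "z \<in> domain_boundary D"
  proof (rule ccontr)
    assume nz: "z \<notin> domain_boundary D"
    define U where "U = polygon_interior (outer D) \<inter> (\<Inter>h\<in>set (holes D). - closed_polygon h)"
    have "open U" unfolding U_def
      using simple_polygon_topology(7)[OF hole_simple] simple_polygon_topology(2)[OF outer_simple]
      by (intro open_Int open_INT) (auto simp: compact_imp_closed)
    moreover have "z \<in> U" using zP nz
      by (auto simp: U_def region_def closed_polygon_def domain_boundary_def boundary_cycles_def)
    moreover have "U \<subseteq> region D" by (auto simp: U_def region_def closed_polygon_def)
    ultimately have "z \<in> interior (region D)" by (meson interior_maximal subsetD)
    then show False using z by (simp add: frontier_def)
  qed
qed

text \<open>Each point of a cycle is a limit of points outside of the region: of the exterior for
  the outer cycle, and of the hole for the cycle of a hole.\<close>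

lemma domain_boundary_not_interior: "domain_boundary D \<inter> interior (region D) = {}"
proof -
  have "z \<notin> interior (region D)" if "z \<in> closure S" "S \<inter> region D = {}" for z S
    using that open_interior[of "region D"] interior_subset[of "region D"]
    by (metis disjoint_iff open_Int_closure_eq_empty subsetD)
  moreover have "(- closed_polygon (outer D)) \<inter> region D = {}" by (auto simp: region_def)
  moreover have "polygon_interior h \<inter> region D = {}" if "h \<in> set (holes D)" for h
    using that by (auto simp: region_def)
  ultimately show ?thesis
    using simple_polygon_topology(5)[OF outer_simple] simple_polygon_topology(4)[OF hole_simple]
    by (auto simp: domain_boundary_def boundary_cycles_def) blast+
qed

text \<open>Crossing numbers add up over the cycles. The holes are disjoint and lie inside the outer
  cycle, so the holes together contribute an odd number exactly at the points of a hole, and there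
  this cancels the parity of the outer cycle.\<close>

lemma region_crossings:
  assumes z: "z \<notin> domain_boundary D"
  shows "z \<in> region D \<longleftrightarrow> odd (length (filter (\<lambda>e. crosses e z) (domain_edges D)))"
proof -
  define c where "c = (\<lambda>vs. length (filter (\<lambda>e. crosses e z) (cyclic_edges vs)))"
  have len: "length (filter (\<lambda>e. crosses e z) (domain_edges D)) = c (outer D) + sum_list (map c (holes D))"
    by (simp add: domain_edges_def boundary_cycles_def c_def filter_concat length_concat o_def)
  have co: "odd (c (outer D)) \<longleftrightarrow> z \<in> polygon_interior (outer D)"
    using simple_polygon_crossings[OF outer_simple, of z] z
    by (simp add: c_def domain_boundary_def boundary_cycles_def)
  have ch: "odd (c h) \<longleftrightarrow> z \<in> polygon_interior h" if "h \<in> set (holes D)" for h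
    using simple_polygon_crossings[OF hole_simple[OF that], of z] z that
    by (simp add: c_def domain_boundary_def boundary_cycles_def)
  \<comment> \<open>Generalised to lists of pairwise disjoint holes, so that the induction can drop
    the first one.\<close>
  have ch': "odd (sum_list (map c hs)) \<longleftrightarrow> (\<exists>h\<in>set hs. z \<in> polygon_interior h)"
    if "\<And>i j. i < length hs \<Longrightarrow> j < length hs \<Longrightarrow> i \<noteq> j \<Longrightarrow> closed_polygon (hs ! i) \<inter> closed_polygon (hs ! j) = {}"
      "set hs \<subseteq> set (holes D)" for hs
    using that
  proof (induction hs)
    case (Cons h hs)
    have IH: "odd (sum_list (map c hs)) \<longleftrightarrow> (\<exists>h\<in>set hs. z \<in> polygon_interior h)"
    proof (rule Cons.IH)
      show "closed_polygon (hs ! i) \<inter> closed_polygon (hs ! j) = {}"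
        if "i < length hs" "j < length hs" "i \<noteq> j" for i j
        using Cons.prems(1)[of "Suc i" "Suc j"] that by simp
    qed (use Cons.prems in auto)
    have "closed_polygon h \<inter> closed_polygon h' = {}" if "h' \<in> set hs" for h'
    proof -
      obtain j where "j < length hs" "h' = hs ! j" using \<open>h' \<in> set hs\<close> by (metis in_set_conv_nth)
      then show ?thesis using Cons.prems(1)[of 0 "Suc j"] by simp
    qed
    then have "\<not> (z \<in> polygon_interior h \<and> (\<exists>h\<in>set hs. z \<in> polygon_interior h))"
      by (auto simp: closed_polygon_def)
    moreover have "odd (c h) \<longleftrightarrow> z \<in> polygon_interior h" using ch Cons.prems by simp
    ultimately show ?case using IH by auto
  qed simp
  have "odd (sum_list (map c (holes D))) \<longleftrightarrow> (\<exists>h\<in>set (holes D). z \<in> polygon_interior h)"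
    using D by (intro ch') (auto simp: polygonal_domain_def)
  moreover have "z \<in> polygon_interior (outer D)" if "h \<in> set (holes D)" "z \<in> polygon_interior h" for h
    using that hole_inside[OF that(1)] by (auto simp: closed_polygon_def)
  moreover have "z \<in> region D \<longleftrightarrow> z \<in> polygon_interior (outer D) \<and> \<not> (\<exists>h\<in>set (holes D). z \<in> polygon_interior h)"
    using z by (auto simp: region_def closed_polygon_def domain_boundary_def boundary_cycles_def)
  ultimately show ?thesis unfolding len using co by auto
qed

end

section \<open>Robust guarding as clearness of a cone\<close>

text \<open>The union of the disks around \<open>\<tau> z\<close> of radius \<open>\<alpha> |\<tau> z|\<close> is the interior of the convex hull of
  the origin and of the disk around \<open>z\<close>.\<close>

definition clear :: "real \<Rightarrow> (complex \<times> complex) list \<Rightarrow> complex \<Rightarrow> bool" where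
  "clear \<alpha> es z \<longleftrightarrow> (\<forall>e\<in>set es. \<forall>x\<in>seg e. \<forall>\<tau>\<in>{0<..1}. \<alpha> * \<tau> * norm z \<le> norm (x - of_real \<tau> * z))"

text \<open>Counterclockwise as seen from \<open>p\<close>, which fixes the sign in the polar
  equation of the conic of the edge. Neither the segment nor the crossing test depends on the order
  of the ends.\<close>

definition orient :: "complex \<times> complex \<Rightarrow> complex \<times> complex" where
  "orient e = (if cross (fst e) (snd e) < 0 then (snd e, fst e) else e)"

definition centred_edges :: "domain \<Rightarrow> complex \<Rightarrow> (complex \<times> complex) list" where
  "centred_edges D p = map (\<lambda>(a, b). orient (a - p, b - p)) (domain_edges D)"

lemma seg_orient [simp]: "seg (orient e) = seg e"
  by (simp add: orient_def seg_def insert_commute)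

lemma cross_commute: "cross b a = - cross a b"
  by (simp add: cross_def)

lemma crosses_orient [simp]: "crosses (orient e) z = crosses e z"
  using cross_commute[of "fst e - z" "snd e - z"]
  by (cases e) (auto simp: orient_def crosses_def)

lemma seg_translate: "seg (a - p, b - p) = (\<lambda>x. x - p) ` seg (a, b)"
  using closed_segment_translation[of "- p" a b] by (simp add: seg_def)

lemma centred_edges_seg: "(\<Union>e\<in>set (centred_edges D p). seg e) = (\<lambda>x. x - p) ` domain_boundary D"
  unfolding domain_boundary_eq centred_edges_def
  by (auto simp: seg_translate image_UN split_beta)

lemma clear_centred:
  "clear \<alpha> (centred_edges D p) z \<longleftrightarrow>
    (\<forall>x\<in>domain_boundary D. \<forall>\<tau>\<in>{0<..1}. \<alpha> * \<tau> * norm z \<le> norm (x - p - of_real \<tau> * z))"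
proof -
  have "clear \<alpha> (centred_edges D p) z \<longleftrightarrow> (\<forall>x\<in>(\<Union>e\<in>set (centred_edges D p). seg e).
      \<forall>\<tau>\<in>{0<..1}. \<alpha> * \<tau> * norm z \<le> norm (x - of_real \<tau> * z))"
    by (auto simp: clear_def)
  then show ?thesis unfolding centred_edges_seg by simp
qed

lemma crosses_centred:
  "length (filter (\<lambda>e. crosses e z) (centred_edges D p)) =
   length (filter (\<lambda>e. crosses e (p + z)) (domain_edges D))"
proof -
  have "crosses (a - p, b - p) z \<longleftrightarrow> crosses (a, b) (p + z)" for a b
    by (simp add: crosses_def less_diff_eq diff_less_eq diff_le_eq le_diff_eq algebra_simps cross_def)
  then show ?thesis
    by (simp add: centred_edges_def filter_map o_def split_beta)
qed

text \<open>Collects what the sweep uses of a polygonal domain; \<open>es\<close> are its edges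
  relative to \<open>p\<close>. The assumption \<open>connected_P\<close> replaces the topology of
  the boundary, and \<open>parity\<close> provides point location.\<close>

locale star_region =
  fixes P V :: "complex set" and p :: complex and \<alpha> :: real and es :: "(complex \<times> complex) list"
  assumes alpha: "0 < \<alpha>" "\<alpha> \<le> 1"
    and bounded_P: "bounded P"
    and closed_V: "closed V"
    and V_iff: "\<And>z. p + z \<in> V \<longleftrightarrow> p + z \<in> P \<and> clear \<alpha> es z"
    and p_V: "p \<in> V"
    and connected_P: "\<And>U. connected U \<Longrightarrow> (\<And>z e. z \<in> U \<Longrightarrow> e \<in> set es \<Longrightarrow> z - p \<notin> seg e) \<Longrightarrow> U \<inter> P \<noteq> {} \<Longrightarrow> U \<subseteq> P"
    and parity: "\<And>z. (\<And>e. e \<in> set es \<Longrightarrow> z \<notin> seg e) \<Longrightarrow>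
       p + z \<in> P \<longleftrightarrow> odd (length (filter (\<lambda>e. crosses e z) es))"
    and oriented: "\<And>a b. (a, b) \<in> set es \<Longrightarrow> cross a b \<ge> 0 \<and> a \<noteq> b"

text \<open>\<open>U\<close> is the open cone from \<open>p\<close> over the disk. If
  \<open>g\<close> guards \<open>p\<close>, then \<open>U\<close> is an open subset of the region
  and misses the boundary. Conversely \<open>U\<close> is connected, contains the guard and avoids
  the frontier, so it lies in the region; so does its closure, which contains the segments from
  \<open>p\<close> to the closed disk apart from \<open>p\<close> itself.\<close>

lemma Vis_inv_iff:
  assumes D: "polygonal_domain D" and p: "p \<in> region D" and \<alpha>: "0 < \<alpha>"
  shows "p + z \<in> Vis_inv (region D) \<alpha> p \<longleftrightarrow> p + z \<in> region D \<and> clear \<alpha> (centred_edges D p) z"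
proof (cases "z = 0")
  case True
  then show ?thesis using p
    by (auto simp: Vis_inv_def robustly_guards_def sees_def clear_centred)
next
  case False
  let ?P = "region D"
  define U where "U = (\<Union>\<tau>\<in>{0<..1}. ball (p + of_real \<tau> * z) (\<alpha> * \<tau> * norm z))"
  have clear: "clear \<alpha> (centred_edges D p) z \<longleftrightarrow> U \<inter> domain_boundary D = {}"
  proof -
    have "dist (p + of_real \<tau> * z) x = norm (x - p - of_real \<tau> * z)" for x \<tau>
      by (simp add: dist_norm norm_minus_commute algebra_simps)
    then have "clear \<alpha> (centred_edges D p) z \<longleftrightarrow>
        (\<forall>x\<in>domain_boundary D. \<forall>\<tau>\<in>{0<..1}. x \<notin> ball (p + of_real \<tau> * z) (\<alpha> * \<tau> * norm z))"
      by (simp add: clear_centred not_less)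
    then show ?thesis unfolding U_def by blast
  qed
  have scale: "p + of_real t * (x - p) \<in> U" if xU: "x \<in> U" and "0 < t" "t \<le> 1" for x t
  proof -
    obtain \<tau> where \<tau>: "0 < \<tau>" "\<tau> \<le> 1" "norm (p + of_real \<tau> * z - x) < \<alpha> * \<tau> * norm z"
      using xU by (auto simp: U_def dist_norm)
    have "norm (p + of_real (t * \<tau>) * z - (p + of_real t * (x - p))) = t * norm (p + of_real \<tau> * z - x)"
    proof -
      have "p + of_real (t * \<tau>) * z - (p + of_real t * (x - p)) = of_real t * (p + of_real \<tau> * z - x)"
        by (simp add: algebra_simps)
      then show ?thesis using that by (simp add: norm_mult)
    qed
    also have "\<dots> < \<alpha> * (t * \<tau>) * norm z" using \<tau>(3) that by (simp add: mult.assoc mult.left_commute)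
    finally show ?thesis using \<tau> that unfolding U_def
      by (intro UN_I[of "t * \<tau>"]) (auto simp: dist_norm mult_le_one)
  qed
  have pU: "p + z \<in> U" using False \<alpha> unfolding U_def by (intro UN_I[of 1]) auto
  have star: "x \<in> U \<Longrightarrow> x \<noteq> p \<Longrightarrow> y \<in> closed_segment p x \<Longrightarrow> y \<noteq> p \<Longrightarrow> y \<in> U" for x y
  proof -
    assume x: "x \<in> U" and y: "y \<in> closed_segment p x" "y \<noteq> p"
    then obtain t where t: "0 \<le> t" "t \<le> 1" "y = (1 - t) *\<^sub>R p + t *\<^sub>R x" by (auto simp: in_segment)
    then have "y = p + of_real t * (x - p)" by (simp add: scaleR_conv_of_real algebra_simps)
    then show "y \<in> U" using scale[OF x, of t] t y by (cases "t = 0") auto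
  qed
  have conU: "connected U"
  proof -
    \<comment> \<open>The half-open segment from \<open>p\<close> to the guard passes through all
      centres and connects the balls with each other.\<close>
    define L where "L = (\<lambda>\<tau>. p + of_real \<tau> * z) ` {0<..1::real}"
    have "connected L" unfolding L_def
      by (intro connected_continuous_image continuous_intros) auto
    moreover have "U = (\<Union>\<tau>\<in>{0<..1}. L \<union> ball (p + of_real \<tau> * z) (\<alpha> * \<tau> * norm z))"
      using \<alpha> False unfolding U_def L_def by force
    moreover have "connected (\<Union>\<tau>\<in>{0<..1}. L \<union> ball (p + of_real \<tau> * z) (\<alpha> * \<tau> * norm z))"
    proof (rule connected_Union)
      show "\<And>s. s \<in> (\<lambda>\<tau>. L \<union> ball (p + of_real \<tau> * z) (\<alpha> * \<tau> * norm z)) ` {0<..1} \<Longrightarrow> connected s"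
        using \<open>connected L\<close> \<alpha> False by (auto intro!: connected_Un simp: L_def)
      show "\<Inter> ((\<lambda>\<tau>. L \<union> ball (p + of_real \<tau> * z) (\<alpha> * \<tau> * norm z)) ` {0<..1}) \<noteq> {}"
        by (auto simp: L_def)
    qed
    ultimately show ?thesis by simp
  qed
  have openU: "open U" by (auto simp: U_def)
  show ?thesis
  proof
    assume g: "p + z \<in> Vis_inv ?P \<alpha> p"
    then have gP: "p + z \<in> ?P" and sees: "\<And>x. x \<in> cball (p + z) (\<alpha> * norm z) \<Longrightarrow> closed_segment p x \<subseteq> ?P"
      by (auto simp: Vis_inv_def robustly_guards_def sees_def)
    have "U \<subseteq> ?P"
    proof
      fix x assume "x \<in> U"
      then obtain \<tau> where \<tau>: "0 < \<tau>" "\<tau> \<le> 1" "norm (p + of_real \<tau> * z - x) < \<alpha> * \<tau> * norm z"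
        by (auto simp: U_def dist_norm)
      \<comment> \<open>The homothety about \<open>p\<close> with factor \<open>1 / \<tau>\<close>
        takes the ball around the intermediate centre to the ball around the guard.\<close>
      define y where "y = p + (x - p) / of_real \<tau>"
      have "norm (p + z - y) * \<tau> = norm (of_real \<tau> * (p + z - y))" using \<tau> by (simp add: norm_mult)
      also have "of_real \<tau> * (p + z - y) = p + of_real \<tau> * z - x" using \<tau> by (simp add: y_def field_simps)
      finally have "norm (p + z - y) * \<tau> < (\<alpha> * norm z) * \<tau>" using \<tau> by (simp add: mult_ac)
      then have "y \<in> cball (p + z) (\<alpha> * norm z)" using \<tau> by (simp add: dist_norm)
      moreover have "x = (1 - \<tau>) *\<^sub>R p + \<tau> *\<^sub>R y" using \<tau> by (simp add: y_def scaleR_conv_of_real field_simps)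
      then have "x \<in> closed_segment p y" unfolding in_segment using \<tau> by (intro exI[of _ \<tau>]) auto
      ultimately show "x \<in> ?P" using sees[of y] by blast
    qed
    then have "U \<subseteq> interior ?P" using openU by (rule interior_maximal)
    then show "p + z \<in> ?P \<and> clear \<alpha> (centred_edges D p) z"
      using gP clear domain_boundary_not_interior[OF D] by auto
  next
    assume g: "p + z \<in> ?P \<and> clear \<alpha> (centred_edges D p) z"
    have "U \<subseteq> ?P"
      using connected_Int_frontier[OF conU, of ?P] g pU clear frontier_region_subset[OF D] by blast
    then have clU: "closure U \<subseteq> ?P"
      using compact_region[OF D] by (simp add: closure_minimal compact_imp_closed)
    have "closed_segment p x \<subseteq> ?P" if x: "x \<in> cball (p + z) (\<alpha> * norm z)" for x
    proof
      fix y assume "y \<in> closed_segment p x"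
      then obtain t where t: "0 \<le> t" "t \<le> 1" "y = (1 - t) *\<^sub>R p + t *\<^sub>R x" by (auto simp: in_segment)
      show "y \<in> ?P"
      proof (cases "t = 0")
        case True then show ?thesis using t p by simp
      next
        case False
        then have t0: "0 < t" using t by simp
        have y: "y = p + of_real t * (x - p)" using t by (simp add: scaleR_conv_of_real algebra_simps)
        have "norm (p + of_real t * z - y) = norm (of_real t * (p + z - x))"
          unfolding y by (simp add: algebra_simps)
        also have "\<dots> \<le> \<alpha> * t * norm z" using x t0 by (simp add: norm_mult dist_norm mult.left_commute mult.assoc)
        finally have "y \<in> cball (p + of_real t * z) (\<alpha> * t * norm z)" by (simp add: dist_norm)
        \<comment> \<open>The radius is positive because \<open>\<alpha>\<close>, \<open>t\<close>
          and \<open>|z|\<close> are, so the closed ball is the closure of the open one.\<close>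
        also have "\<dots> = closure (ball (p + of_real t * z) (\<alpha> * t * norm z))"
          using \<alpha> t0 \<open>z \<noteq> 0\<close> by simp
        also have "\<dots> \<subseteq> closure U" using t0 t by (intro closure_mono) (auto simp: U_def)
        finally show ?thesis using clU by auto
      qed
    qed
    then show "p + z \<in> Vis_inv ?P \<alpha> p"
      using g p by (fastforce simp: Vis_inv_def robustly_guards_def sees_def)
  qed
qed

text \<open>Closedness of \<open>V\<close> comes from writing it as the intersection of the compact
  region with closed conditions, one for each boundary point and each \<open>\<tau>\<close>.\<close>

lemma star_region_Vis_inv:
  assumes D: "polygonal_domain D" and p: "p \<in> region D" and \<alpha>: "0 < \<alpha>" "\<alpha> \<le> 1"
  shows "star_region (region D) (Vis_inv (region D) \<alpha> p) p \<alpha> (centred_edges D p)"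
proof
  let ?P = "region D" and ?V = "Vis_inv (region D) \<alpha> p"
  note iff = Vis_inv_iff[OF D p \<alpha>(1)]
  show "bounded ?P" using compact_region[OF D] by (simp add: compact_imp_bounded)
  have V: "?V = {g. g \<in> ?P} \<inter> (\<Inter>x\<in>domain_boundary D. \<Inter>\<tau>\<in>{0<..1}.
      {g. \<alpha> * \<tau> * norm (g - p) \<le> norm (x - p - of_real \<tau> * (g - p))})"
    using iff[of "g - p" for g] by (auto simp: clear_centred)
  show "closed ?V" unfolding V
    by (intro closed_Int closed_INT ballI closed_Collect_le continuous_intros)
       (use compact_region[OF D] in \<open>auto simp: compact_imp_closed\<close>)
  show "p + z \<in> ?V \<longleftrightarrow> p + z \<in> ?P \<and> clear \<alpha> (centred_edges D p) z" for z by (rule iff)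
  show "p \<in> ?V" using iff[of 0] p by (simp add: clear_def)
  have nb: "g \<notin> domain_boundary D" if "\<And>e. e \<in> set (centred_edges D p) \<Longrightarrow> g - p \<notin> seg e" for g
    using centred_edges_seg[of D p] that by (metis UN_E imageI)
  show "U \<subseteq> ?P" if "connected U" "\<And>z e. z \<in> U \<Longrightarrow> e \<in> set (centred_edges D p) \<Longrightarrow> z - p \<notin> seg e"
    "U \<inter> ?P \<noteq> {}" for U
    using connected_Int_frontier[OF that(1), of ?P] that(3) nb[OF that(2)] frontier_region_subset[OF D] by blast
  show "p + z \<in> ?P \<longleftrightarrow> odd (length (filter (\<lambda>e. crosses e z) (centred_edges D p)))"
    if "\<And>e. e \<in> set (centred_edges D p) \<Longrightarrow> z \<notin> seg e" for z
    using region_crossings[OF D nb[of "p + z"]] that crosses_centred[of z D p] by simp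
  show "cross a b \<ge> 0 \<and> a \<noteq> b" if ab: "(a, b) \<in> set (centred_edges D p)" for a b
  proof -
    obtain c d where cd: "(c, d) \<in> set (domain_edges D)" "(a, b) = orient (c - p, d - p)"
      using ab by (auto simp: centred_edges_def)
    then obtain vs where vs: "vs \<in> set (boundary_cycles D)" "(c, d) \<in> set (cyclic_edges vs)"
      by (auto simp: domain_edges_def)
    then have sp: "simple_polygon vs"
      using outer_simple[OF D] hole_simple[OF D] by (auto simp: boundary_cycles_def)
    obtain i where i: "i < length vs" "c = vs ! i" "d = vs ! (Suc i mod length vs)"
      using vs by (auto simp: cyclic_edges_def)
    \<comment> \<open>Every cycle has at least three vertices; as these are distinct, the ends of an
      edge differ.\<close>
    have "Suc i mod length vs \<noteq> i" using i(1) sp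
      by (cases "Suc i = length vs") (auto simp: simple_polygon_def)
    moreover have "Suc i mod length vs < length vs" using i(1) by (intro mod_less_divisor) auto
    moreover have "distinct vs" using sp by (simp add: simple_polygon_def)
    ultimately have "c \<noteq> d" using i by (metis nth_eq_iff_index_eq)
    then show ?thesis using cd(2) cross_commute[of "c - p" "d - p"] by (auto simp: orient_def split: if_splits)
  qed
qed (use \<alpha> in auto)

section \<open>Obstructing vertices and edges\<close>

definition dot :: "complex \<Rightarrow> complex \<Rightarrow> real" where
  "dot a b = Re a * Re b + Im a * Im b"

lemma dot_self: "dot a a = (norm a)\<^sup>2"
  unfolding cmod_power2 by (simp add: dot_def power2_eq_square)

text \<open>Coefficients of \<open>|z - q|^2 - \<alpha>^2 |z|^2\<close>; for
  \<open>\<alpha> = 1\<close> and \<open>q \<noteq> 0\<close> the circle becomes the perpendicular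
  bisector of the origin and \<open>q\<close>.\<close>

definition pt_conic :: "real \<Rightarrow> complex \<Rightarrow> real list" where
  "pt_conic \<alpha> q = [1 - \<alpha>\<^sup>2, 0, 1 - \<alpha>\<^sup>2, -2 * Re q, -2 * Im q, dot q q]"

text \<open>Coefficients of \<open>(cross a b - cross z d)^2 - \<alpha>^2 |d|^2 |z|^2\<close>, which
  compares the distance from the line with \<open>\<alpha>\<close> times the distance from the
  origin, both squared and multiplied by \<open>|d|^2\<close>.\<close>

definition ln_conic :: "real \<Rightarrow> complex \<Rightarrow> complex \<Rightarrow> real list" where
  "ln_conic \<alpha> a b = (let d = b - a; c = cross a b; l = \<alpha>\<^sup>2 * dot d d in
     [(Im d)\<^sup>2 - l, -2 * Re d * Im d, (Re d)\<^sup>2 - l, -2 * c * Im d, 2 * c * Re d, c\<^sup>2])"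

text \<open>For a conic \<open>Q(z) + L(z) + A\<close> the points \<open>u / S\<close> of the ray in direction \<open>u\<close> on the conic are
  given by \<open>A S\<^sup>2 - 2 \<beta> S + \<gamma> = 0\<close>; the one closest to the origin has the largest \<open>S\<close>.\<close>

definition sbeta :: "real list \<Rightarrow> complex \<Rightarrow> real" where
  "sbeta k u = - (k!3 * Re u + k!4 * Im u) / 2"

definition sgamma :: "real list \<Rightarrow> complex \<Rightarrow> real" where
  "sgamma k u = k!0 * (Re u)\<^sup>2 + k!1 * Re u * Im u + k!2 * (Im u)\<^sup>2"

definition sdisc :: "real list \<Rightarrow> complex \<Rightarrow> real" where
  "sdisc k u = (sbeta k u)\<^sup>2 - k!5 * sgamma k u"

definition sval :: "real list \<Rightarrow> complex \<Rightarrow> real" where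
  "sval k u = (sbeta k u + sqrt (sdisc k u)) / k!5"

definition pt_disc :: "real \<Rightarrow> complex \<Rightarrow> complex \<Rightarrow> real" where
  "pt_disc \<alpha> q u = (dot q u)\<^sup>2 - dot q q * ((1 - \<alpha>\<^sup>2) * (norm u)\<^sup>2)"

text \<open>Strict inequalities, because an obstacle needs a point in the open disk: a ray that only
  touches the circle is free. The sign of \<open>dot q u\<close> distinguishes the ray from its
  opposite.\<close>

definition pt_valid :: "real \<Rightarrow> complex \<Rightarrow> complex \<Rightarrow> bool" where
  "pt_valid \<alpha> q u \<longleftrightarrow> pt_disc \<alpha> q u > 0 \<and> dot q u > 0"

text \<open>This is \<open>|b - a|\<close> times \<open>cross a y\<close>, where \<open>y\<close> is
  the extreme point of the disk around \<open>u\<close> in the direction normal to the edge, away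
  from the origin; \<open>ln_T2\<close> is likewise built from \<open>cross y b\<close>. Both are
  positive iff \<open>y\<close> lies strictly inside the cone over the edge.\<close>

definition ln_T1 :: "real \<Rightarrow> complex \<Rightarrow> complex \<Rightarrow> complex \<Rightarrow> real" where
  "ln_T1 \<alpha> a b u = norm (b - a) * cross a u - \<alpha> * norm u * dot a (b - a)"

definition ln_T2 :: "real \<Rightarrow> complex \<Rightarrow> complex \<Rightarrow> complex \<Rightarrow> real" where
  "ln_T2 \<alpha> a b u = norm (b - a) * cross u b + \<alpha> * norm u * dot b (b - a)"

definition ln_valid :: "real \<Rightarrow> complex \<Rightarrow> complex \<Rightarrow> complex \<Rightarrow> bool" where
  "ln_valid \<alpha> a b u \<longleftrightarrow> cross a b > 0 \<and> ln_T1 \<alpha> a b u > 0 \<and> ln_T2 \<alpha> a b u > 0"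

lemma sbeta_pt: "sbeta (pt_conic \<alpha> q) u = dot q u"
  by (simp add: sbeta_def pt_conic_def dot_def algebra_simps)

lemma sgamma_pt: "sgamma (pt_conic \<alpha> q) u = (1 - \<alpha>\<^sup>2) * (norm u)\<^sup>2"
  unfolding cmod_power2 by (simp add: sgamma_def pt_conic_def algebra_simps numeral_2_eq_2)

lemma sdisc_pt: "sdisc (pt_conic \<alpha> q) u = pt_disc \<alpha> q u"
  by (simp add: sdisc_def sbeta_pt sgamma_pt pt_disc_def) (simp add: pt_conic_def)

lemma sval_pt: "sval (pt_conic \<alpha> q) u = (dot q u + sqrt (pt_disc \<alpha> q u)) / dot q q"
  by (simp add: sval_def sbeta_pt sdisc_pt) (simp add: pt_conic_def)

text \<open>A perfect square, as the origin is a focus of the conic.\<close>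

lemma sdisc_ln: "sdisc (ln_conic \<alpha> a b) u = (cross a b * (\<alpha> * norm (b - a) * norm u))\<^sup>2"
proof -
  have n: "(cross a b * (\<alpha> * norm (b - a) * norm u))\<^sup>2 =
      (cross a b)\<^sup>2 * \<alpha>\<^sup>2 * ((Re (b - a))\<^sup>2 + (Im (b - a))\<^sup>2) * ((Re u)\<^sup>2 + (Im u)\<^sup>2)"
    by (simp add: power_mult_distrib cmod_power2)
  define c where "c = cross a b"
  show ?thesis unfolding n
    unfolding sdisc_def sbeta_def sgamma_def ln_conic_def Let_def dot_def c_def[symmetric]
    by simp (simp add: power2_eq_square field_simps)
qed

text \<open>The polar equation of a conic with focus at the origin: the reciprocal radius is linear
  in \<open>u\<close> and \<open>|u|\<close>.\<close>

lemma sval_ln: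
  assumes "cross a b > 0" "\<alpha> > 0"
  shows "sval (ln_conic \<alpha> a b) u = (cross u (b - a) + \<alpha> * norm (b - a) * norm u) / cross a b"
proof -
  have "sqrt (sdisc (ln_conic \<alpha> a b) u) = cross a b * (\<alpha> * norm (b - a) * norm u)"
    unfolding sdisc_ln using assms by (simp add: zero_le_mult_iff)
  moreover have "sbeta (ln_conic \<alpha> a b) u = cross a b * cross u (b - a)"
    unfolding sbeta_def ln_conic_def Let_def
    by (simp add: cross_def[of u] field_simps)
  moreover have "ln_conic \<alpha> a b ! 5 = (cross a b)\<^sup>2" by (simp add: ln_conic_def Let_def)
  ultimately show ?thesis using assms
    by (simp add: sval_def power2_eq_square flip: distrib_left)
qed

text \<open>The parabola opens upwards, so its negative values lie strictly between two distinct
  roots. The witness is \<open>S0\<close>, or the vertex \<open>\<beta> / A\<close> if that is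
  larger.\<close>

lemma quadratic_negative_beyond:
  fixes A \<beta> \<gamma> S0 :: real
  assumes "A > 0"
  shows "(\<exists>S\<ge>S0. A * S\<^sup>2 - 2 * \<beta> * S + \<gamma> < 0) \<longleftrightarrow>
    \<beta>\<^sup>2 - A * \<gamma> > 0 \<and> S0 < (\<beta> + sqrt (\<beta>\<^sup>2 - A * \<gamma>)) / A"
proof -
  have eq: "A * (A * S\<^sup>2 - 2 * \<beta> * S + \<gamma>) = (A * S - \<beta>)\<^sup>2 - (\<beta>\<^sup>2 - A * \<gamma>)" for S
    by (simp add: power2_eq_square algebra_simps)
  have neg: "A * S\<^sup>2 - 2 * \<beta> * S + \<gamma> < 0 \<longleftrightarrow> \<bar>A * S - \<beta>\<bar> < sqrt (\<beta>\<^sup>2 - A * \<gamma>)" for S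
  proof -
    have "A * S\<^sup>2 - 2 * \<beta> * S + \<gamma> < 0 \<longleftrightarrow> A * (A * S\<^sup>2 - 2 * \<beta> * S + \<gamma>) < 0"
      using assms by (simp add: mult_less_0_iff)
    also have "\<dots> \<longleftrightarrow> (A * S - \<beta>)\<^sup>2 < \<beta>\<^sup>2 - A * \<gamma>" unfolding eq by simp
    also have "\<dots> \<longleftrightarrow> \<bar>A * S - \<beta>\<bar> < sqrt (\<beta>\<^sup>2 - A * \<gamma>)"
      by (metis real_sqrt_abs real_sqrt_less_iff)
    finally show ?thesis .
  qed
  show ?thesis
  proof
    assume "\<exists>S\<ge>S0. A * S\<^sup>2 - 2 * \<beta> * S + \<gamma> < 0"
    then obtain S where S: "S \<ge> S0" "\<bar>A * S - \<beta>\<bar> < sqrt (\<beta>\<^sup>2 - A * \<gamma>)" using neg by auto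
    then have "sqrt (\<beta>\<^sup>2 - A * \<gamma>) > 0" "A * S < \<beta> + sqrt (\<beta>\<^sup>2 - A * \<gamma>)"
      using abs_ge_zero[of "A * S - \<beta>"] by linarith+
    then have "\<beta>\<^sup>2 - A * \<gamma> > 0" "S < (\<beta> + sqrt (\<beta>\<^sup>2 - A * \<gamma>)) / A"
      using assms by (simp, simp add: field_simps)
    then show "\<beta>\<^sup>2 - A * \<gamma> > 0 \<and> S0 < (\<beta> + sqrt (\<beta>\<^sup>2 - A * \<gamma>)) / A" using S by simp
  next
    assume a: "\<beta>\<^sup>2 - A * \<gamma> > 0 \<and> S0 < (\<beta> + sqrt (\<beta>\<^sup>2 - A * \<gamma>)) / A"
    define S where "S = max S0 (\<beta> / A)"
    have "A * S \<ge> \<beta>" "S \<ge> S0" using assms by (auto simp: S_def max_def field_simps)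
    moreover have "A * S < \<beta> + sqrt (\<beta>\<^sup>2 - A * \<gamma>)"
      using assms a by (auto simp: S_def max_def field_simps)
    ultimately show "\<exists>S\<ge>S0. A * S\<^sup>2 - 2 * \<beta> * S + \<gamma> < 0"
      unfolding neg by (intro exI[of _ S]) auto
  qed
qed

section \<open>Obstruction by a point\<close>

lemma pt_disc_le: "\<alpha> > 0 \<Longrightarrow> \<alpha> \<le> 1 \<Longrightarrow> pt_disc \<alpha> q u \<le> (dot q u)\<^sup>2"
proof -
  assume "\<alpha> > 0" "\<alpha> \<le> 1"
  then have "\<alpha>\<^sup>2 \<le> 1" by (simp add: power_le_one)
  then show ?thesis by (simp add: pt_disc_def dot_self)
qed

lemma norm_less_iff_power2: "0 \<le> r \<Longrightarrow> norm v < r \<longleftrightarrow> (norm v)\<^sup>2 < r\<^sup>2"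
  by (metis norm_ge_zero pos2 power2_less_imp_less power_strict_mono)

text \<open>For a single point \<open>q\<close> the condition is a quadratic inequality in the
  magnification \<open>S\<close>. Since \<open>\<alpha> \<le> 1\<close>, the product of its roots is
  nonnegative; a root beyond \<open>S0 > 0\<close> therefore forces their sum, and with it
  \<open>dot q u\<close>, to be positive.\<close>

lemma pt_block:
  assumes \<alpha>: "\<alpha> > 0" "\<alpha> \<le> 1" and S0: "S0 > 0"
  shows "(\<exists>S\<ge>S0. norm (of_real S * q - u) < \<alpha> * norm u) \<longleftrightarrow>
    pt_valid \<alpha> q u \<and> S0 < sval (pt_conic \<alpha> q) u"
proof (cases "q = 0")
  case True
  then show ?thesis using \<alpha> mult_right_mono[of \<alpha> 1 "norm u"] by (auto simp: pt_valid_def dot_def)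
next
  case False
  then have A: "dot q q > 0" by (simp add: dot_self)
  have "norm (of_real S * q - u) < \<alpha> * norm u \<longleftrightarrow>
      dot q q * S\<^sup>2 - 2 * dot q u * S + (1 - \<alpha>\<^sup>2) * (norm u)\<^sup>2 < 0" for S
  proof -
    have "norm (of_real S * q - u) < \<alpha> * norm u \<longleftrightarrow> (norm (of_real S * q - u))\<^sup>2 < (\<alpha> * norm u)\<^sup>2"
      using \<alpha> by (intro norm_less_iff_power2) auto
    also have "(norm (of_real S * q - u))\<^sup>2 = dot q q * S\<^sup>2 - 2 * dot q u * S + (norm u)\<^sup>2"
      unfolding cmod_power2 by (simp add: dot_def power2_eq_square algebra_simps)
    finally show ?thesis by (simp add: power_mult_distrib algebra_simps)
  qed
  then have "(\<exists>S\<ge>S0. norm (of_real S * q - u) < \<alpha> * norm u) \<longleftrightarrow>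
      pt_disc \<alpha> q u > 0 \<and> S0 < sval (pt_conic \<alpha> q) u"
    using quadratic_negative_beyond[OF A, of S0 "dot q u" "(1 - \<alpha>\<^sup>2) * (norm u)\<^sup>2"]
    by (simp add: sval_pt pt_disc_def)
  moreover have "dot q u > 0" if "S0 < sval (pt_conic \<alpha> q) u" "pt_disc \<alpha> q u > 0"
  proof (rule ccontr)
    assume "\<not> dot q u > 0"
    moreover have "sqrt (pt_disc \<alpha> q u) \<le> \<bar>dot q u\<bar>"
      using pt_disc_le[OF \<alpha>, of q u] real_sqrt_le_mono by fastforce
    ultimately have "sval (pt_conic \<alpha> q) u \<le> 0"
      using A by (simp add: sval_pt divide_nonpos_pos)
    then show False using that S0 by simp
  qed
  ultimately show ?thesis by (auto simp: pt_valid_def)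
qed

lemma sval_pt_pos: "pt_valid \<alpha> q u \<Longrightarrow> sval (pt_conic \<alpha> q) u > 0"
proof -
  assume v: "pt_valid \<alpha> q u"
  then have "q \<noteq> 0" by (auto simp: pt_valid_def dot_def)
  then show ?thesis using v by (simp add: sval_pt dot_self pt_valid_def add_pos_pos)
qed

section \<open>Obstruction by the inner points of an edge\<close>

lemma cross_le: "cross a b \<le> norm a * norm b"
proof -
  have "cross a b \<le> \<bar>norm a * norm b * sin (Arg b - Arg a)\<bar>" by (simp add: cross_Arg)
  also have "\<dots> \<le> norm a * norm b * 1" unfolding abs_mult by (intro mult_mono) auto
  finally show ?thesis by simp
qed

lemma cross_eq_inner: "cross a y = inner (Complex (- Im a) (Re a)) y"
  by (simp add: cross_def inner_complex_def)

text \<open>\<open>W\<close> is the part of the open disk on or beyond the edge line magnified by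
  \<open>S0\<close>. By \<open>no\<close> it avoids the line through the origin and
  \<open>a\<close>; being convex, it lies on one side, that of the edge. The extreme point
  \<open>ystar\<close> of the disk is a limit of \<open>W\<close>. If it were not strictly on this
  side, a small shift into \<open>W\<close> would give a point of \<open>W\<close> on the wrong
  side.\<close>

lemma edge_block_T1:
  fixes a b u :: complex
  assumes c: "cross a b > 0" and \<alpha>: "\<alpha> > 0" and u: "u \<noteq> 0" and S0: "S0 > 0"
    and S1: "S1 \<ge> S0" "x1 \<in> closed_segment a b" "norm (of_real S1 * x1 - u) < \<alpha> * norm u"
    and no: "\<And>S. S \<ge> S0 \<Longrightarrow> norm (of_real S * a - u) \<ge> \<alpha> * norm u"
    and ST: "S0 * cross a b < cross u (b - a) + \<alpha> * norm (b - a) * norm u"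
  shows "ln_T1 \<alpha> a b u > 0"
proof (rule ccontr)
  assume neg: "\<not> ln_T1 \<alpha> a b u > 0"
  define d where "d = b - a"
  define L where "L = norm d"
  define \<kappa> where "\<kappa> = \<alpha> * norm u / L"
  define N where "N = Complex (Im d) (- Re d)"
  \<comment> \<open>\<open>N\<close> is normal to the edge, points away from the origin and has
    length \<open>L\<close>; hence \<open>ystar\<close> lies on the circle of radius
    \<open>\<alpha> * norm u\<close> around \<open>u\<close>, as far in this direction as
    possible.\<close>
  define ystar where "ystar = u + of_real \<kappa> * N"
  have ad: "cross a d = cross a b" by (simp add: d_def cross_def algebra_simps)
  have "d \<noteq> 0" using c by (auto simp: d_def cross_def)
  then have L: "L > 0" by (simp add: L_def)
  have \<kappa>: "\<kappa> > 0" using \<alpha> u L by (simp add: \<kappa>_def)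
  have L2: "L\<^sup>2 = (Re d)\<^sup>2 + (Im d)\<^sup>2" by (simp add: L_def cmod_power2)
  define W where "W = ball u (\<alpha> * norm u) \<inter> {y. cross y d \<ge> S0 * cross a b}"
  have "convex W" unfolding W_def
  proof (intro convex_Int convex_ball)
    have "{y. cross y d \<ge> S0 * cross a b} = {y. inner (Complex (Im d) (- Re d)) y \<ge> S0 * cross a b}"
      by (auto simp: cross_def inner_complex_def algebra_simps)
    then show "convex {y. cross y d \<ge> S0 * cross a b}" by (simp add: convex_halfspace_ge)
  qed
  have nz: "cross a y \<noteq> 0" if "y \<in> W" for y
  proof
    assume z: "cross a y = 0"
    define S where "S = cross y d / cross a b"
    \<comment> \<open>Cramer's rule for \<open>y\<close> in the basis \<open>a\<close>,
      \<open>d\<close>.\<close>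
    have "y * of_real (cross a d) = a * of_real (cross y d) + d * of_real (cross a y)"
      by (simp add: complex_eq_iff cross_def algebra_simps)
    then have "y = of_real S * a" using z c by (simp add: ad S_def field_simps)
    moreover have "S \<ge> S0" using that c by (simp add: W_def S_def field_simps)
    ultimately show False using no[of S] that by (simp add: W_def dist_norm norm_minus_commute)
  qed
  have pos: "cross a y > 0" if y: "y \<in> W" and z: "z \<in> W" "cross a z \<ge> 0" for y z
  proof (rule ccontr)
    assume "\<not> cross a y > 0"
    then obtain w where "w \<in> W" "cross a w = 0"
      using connected_ivt_hyperplane[OF convex_connected[OF \<open>convex W\<close>] y z(1), of "Complex (- Im a) (Re a)" 0] z(2)
      unfolding cross_eq_inner by auto
    then show False using nz by blast
  qed
  have x1: "cross x1 d = cross a b" "cross a x1 \<ge> 0"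
  proof -
    obtain t where t: "0 \<le> t" "t \<le> 1" "x1 = (1 - t) *\<^sub>R a + t *\<^sub>R b" using S1(2) by (auto simp: in_segment)
    show "cross x1 d = cross a b" unfolding t(3) by (simp add: cross_def d_def algebra_simps)
    have "cross a x1 = t * cross a b" unfolding t(3) by (simp add: cross_def algebra_simps)
    then show "cross a x1 \<ge> 0" using c t by simp
  qed
  have y1: "of_real S1 * x1 \<in> W" "cross a (of_real S1 * x1) \<ge> 0"
  proof -
    have "cross (of_real S1 * x1) d = S1 * cross x1 d" "cross a (of_real S1 * x1) = S1 * cross a x1"
      by (simp_all add: cross_def algebra_simps)
    then show "of_real S1 * x1 \<in> W" "cross a (of_real S1 * x1) \<ge> 0"
      using S1 S0 x1 c by (auto simp: W_def dist_norm norm_minus_commute)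
  qed
  have yd: "cross ystar d = cross u d + \<alpha> * L * norm u"
  proof -
    have "cross ystar d = cross u d + \<kappa> * L\<^sup>2" unfolding L2
      by (simp add: ystar_def cross_def N_def power2_eq_square algebra_simps)
    then show ?thesis using L by (simp add: \<kappa>_def power2_eq_square)
  qed
  have ya: "cross a ystar \<le> 0"
  proof -
    have "L * cross a ystar = L * cross a u - L * \<kappa> * dot a d"
      by (simp add: ystar_def cross_def N_def dot_def algebra_simps)
    also have "\<dots> = ln_T1 \<alpha> a b u" using L by (simp add: ln_T1_def \<kappa>_def d_def[symmetric] L_def[symmetric])
    finally show ?thesis using neg L mult_pos_pos[of L "cross a ystar"] by linarith
  qed
  \<comment> \<open>A shift by \<open>\<epsilon>\<close> against \<open>N\<close> changes
    \<open>cross a y\<close> by at most \<open>\<epsilon> * \<bar>dot a d\<bar>\<close>. The shift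
    by \<open>K * \<epsilon>\<close> against \<open>d\<close> lowers it by that amount and by
    \<open>\<epsilon>\<close> more.\<close>
  define K where "K = (\<bar>dot a d\<bar> + 1) / cross a b"
  \<comment> \<open>The first bound keeps \<open>y\<close> in the open disk, the second one on or
    beyond the magnified edge line.\<close>
  define \<epsilon> where "\<epsilon> = min (\<kappa> / (1 + K\<^sup>2)) ((cross ystar d - S0 * cross a b) / L\<^sup>2)"
  have K1: "1 + K\<^sup>2 > 0" by (simp add: add_pos_nonneg)
  have "cross ystar d - S0 * cross a b > 0" using ST unfolding yd by (simp add: d_def L_def)
  then have \<epsilon>: "\<epsilon> > 0" "\<epsilon> \<le> \<kappa> / (1 + K\<^sup>2)" "\<epsilon> \<le> (cross ystar d - S0 * cross a b) / L\<^sup>2"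
    using \<kappa> L K1 by (auto simp: \<epsilon>_def)
  define y where "y = ystar - of_real \<epsilon> * N - of_real (K * \<epsilon>) * d"
  have "cross y d = cross ystar d - \<epsilon> * L\<^sup>2" unfolding L2
    by (simp add: y_def N_def cross_def power2_eq_square algebra_simps)
  then have "cross y d \<ge> S0 * cross a b" using \<epsilon>(3) L by (simp add: field_simps)
  moreover have "norm (y - u) < \<alpha> * norm u"
  proof -
    have "\<epsilon> * (1 + K\<^sup>2) < 2 * \<kappa>" using \<epsilon>(2) K1 \<kappa> by (simp add: pos_le_divide_eq)
    then have "\<epsilon> * (\<epsilon> * (1 + K\<^sup>2)) < \<epsilon> * (2 * \<kappa>)" using \<epsilon>(1) by simp
    then have *: "(\<kappa> - \<epsilon>)\<^sup>2 + (K * \<epsilon>)\<^sup>2 < \<kappa>\<^sup>2" by (simp add: power2_eq_square algebra_simps)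
    have "(norm (y - u))\<^sup>2 = ((\<kappa> - \<epsilon>)\<^sup>2 + (K * \<epsilon>)\<^sup>2) * L\<^sup>2"
      unfolding L2 cmod_power2 by (simp add: y_def ystar_def N_def power2_eq_square algebra_simps)
    also have "\<dots> < \<kappa>\<^sup>2 * L\<^sup>2" using * L by simp
    also have "\<dots> = (\<alpha> * norm u)\<^sup>2" using L by (simp add: \<kappa>_def power_divide)
    finally show ?thesis using \<alpha> by (meson mult_nonneg_nonneg norm_ge_zero less_imp_le power_less_imp_less_base)
  qed
  ultimately have "y \<in> W" by (simp add: W_def dist_norm norm_minus_commute)
  then have "cross a y > 0" using pos y1 by blast
  moreover have "cross a y = cross a ystar + \<epsilon> * dot a d - K * \<epsilon> * cross a b" unfolding ad[symmetric]
    by (simp add: y_def N_def cross_def dot_def algebra_simps)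
  moreover have "K * \<epsilon> * cross a b = \<epsilon> * (\<bar>dot a d\<bar> + 1)" using c by (simp add: K_def)
  moreover have "\<epsilon> * dot a d \<le> \<epsilon> * \<bar>dot a d\<bar>" using \<epsilon>(1) by simp
  ultimately show False using ya \<epsilon>(1) by (simp add: algebra_simps)
qed

text \<open>If neither end obstructs, the largest magnification of the edge that still reaches the
  closed disk is a tangency at \<open>ystar\<close>. Conversely, shrinking the edge a little from
  this position moves its point of contact into the open disk.\<close>

lemma edge_block:
  assumes c: "cross a b > 0" and \<alpha>: "\<alpha> > 0" and u: "u \<noteq> 0" and S0: "S0 > 0"
  shows "(\<exists>S\<ge>S0. \<exists>x\<in>closed_segment a b. norm (of_real S * x - u) < \<alpha> * norm u) \<longleftrightarrow>
    (\<exists>S\<ge>S0. norm (of_real S * a - u) < \<alpha> * norm u) \<or>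
    (\<exists>S\<ge>S0. norm (of_real S * b - u) < \<alpha> * norm u) \<or>
    (ln_valid \<alpha> a b u \<and> S0 < sval (ln_conic \<alpha> a b) u)" (is "?L \<longleftrightarrow> ?A \<or> ?B \<or> ?T")
proof
  assume ?L
  then obtain S1 x1 where S1: "S1 \<ge> S0" "x1 \<in> closed_segment a b" "norm (of_real S1 * x1 - u) < \<alpha> * norm u"
    by blast
  \<comment> \<open>The form \<open>cross _ (b - a)\<close> is constant on the edge, and on the open
    disk it stays below its value at the extreme point.\<close>
  have ST: "S0 * cross a b < cross u (b - a) + \<alpha> * norm (b - a) * norm u"
  proof -
    obtain t where t: "0 \<le> t" "t \<le> 1" "x1 = (1 - t) *\<^sub>R a + t *\<^sub>R b" using S1(2) by (auto simp: in_segment)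
    have "cross x1 (b - a) = cross a b" unfolding t(3) by (simp add: cross_def algebra_simps)
    moreover have "cross (of_real S1 * x1 - u) (b - a) = S1 * cross x1 (b - a) - cross u (b - a)"
      by (simp add: cross_def algebra_simps)
    moreover have "cross (of_real S1 * x1 - u) (b - a) \<le> norm (of_real S1 * x1 - u) * norm (b - a)"
      by (rule cross_le)
    moreover have "\<dots> < \<alpha> * norm u * norm (b - a)" using S1(3) c
      by (intro mult_strict_right_mono) (auto simp: cross_def)
    moreover have "S0 * cross a b \<le> S1 * cross a b" using S1(1) c by simp
    ultimately show ?thesis by (simp add: mult_ac)
  qed
  show "?A \<or> ?B \<or> ?T"
  proof (rule ccontr)
    assume n: "\<not> (?A \<or> ?B \<or> ?T)"
    have T1: "ln_T1 \<alpha> a b u > 0"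
      using n by (intro edge_block_T1[OF c \<alpha> u S0 S1 _ ST]) (auto simp: not_less)
    \<comment> \<open>Conjugation reverses orientations, so after exchanging \<open>a\<close> and
      \<open>b\<close> the condition at \<open>b\<close> becomes the one at
      \<open>a\<close>.\<close>
    have cc: "cross (cnj b) (cnj a) = cross a b" "cross (cnj u) (cnj a - cnj b) = cross u (b - a)"
      "norm (cnj a - cnj b) = norm (b - a)" "norm (cnj u) = norm u"
      by (auto simp: cross_def algebra_simps norm_minus_commute simp flip: complex_cnj_diff)
    have eq: "norm (of_real S * cnj x - cnj u) = norm (of_real S * x - u)" for S x
      by (metis complex_cnj_complex_of_real complex_cnj_diff complex_cnj_mult complex_mod_cnj)
    have x1: "cnj x1 \<in> closed_segment (cnj b) (cnj a)"
    proof -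
      obtain t where t: "0 \<le> t" "t \<le> 1" "x1 = (1 - t) *\<^sub>R b + t *\<^sub>R a"
        using S1(2) unfolding closed_segment_commute[of a b] by (auto simp: in_segment)
      then show ?thesis unfolding in_segment by (intro exI[of _ t]) simp
    qed
    have n1: "norm (of_real S1 * cnj x1 - cnj u) < \<alpha> * norm (cnj u)" using S1 by (simp add: eq)
    have n2: "norm (of_real S * cnj b - cnj u) \<ge> \<alpha> * norm (cnj u)" if S: "S \<ge> S0" for S
      using n S by (auto simp: eq not_less)
    have "ln_T1 \<alpha> (cnj b) (cnj a) (cnj u) > 0"
      by (rule edge_block_T1[OF _ \<alpha> _ S0 S1(1) x1 n1 n2]) (use c u ST cc in auto)
    then have T2: "ln_T2 \<alpha> a b u > 0"
      by (simp add: ln_T1_def ln_T2_def cross_def dot_def cc algebra_simps)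
    have "S0 < sval (ln_conic \<alpha> a b) u" using ST c by (simp add: sval_ln[OF c \<alpha>] field_simps)
    then show False using n T1 T2 c by (simp add: ln_valid_def)
  qed
next
  assume "?A \<or> ?B \<or> ?T"
  then consider ?A | ?B | ?T by blast
  then show ?L
  proof cases
    case 3
    define d where "d = b - a"
    define L where "L = norm d"
    define \<kappa> where "\<kappa> = \<alpha> * norm u / L"
    define N where "N = Complex (Im d) (- Re d)"
    define ystar where "ystar = u + of_real \<kappa> * N"
    define ST where "ST = sval (ln_conic \<alpha> a b) u"
    have "d \<noteq> 0" using c by (auto simp: d_def cross_def)
    then have L: "L > 0" by (simp add: L_def)
    have \<kappa>: "\<kappa> > 0" using \<alpha> u L by (simp add: \<kappa>_def)
    have L2: "L\<^sup>2 = (Re d)\<^sup>2 + (Im d)\<^sup>2" by (simp add: L_def cmod_power2)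
    have ST0: "ST > S0" using 3 by (simp add: ST_def)
    have yd: "cross ystar d = ST * cross a b"
    proof -
      have "cross ystar d = cross u d + \<kappa> * L\<^sup>2" unfolding L2
        by (simp add: ystar_def cross_def N_def power2_eq_square algebra_simps)
      then show ?thesis using L c by (simp add: ST_def sval_ln[OF c \<alpha>] \<kappa>_def power2_eq_square d_def L_def)
    qed
    have "L * cross a ystar = L * cross a u - L * \<kappa> * dot a d"
      by (simp add: ystar_def cross_def N_def dot_def algebra_simps)
    also have "\<dots> = ln_T1 \<alpha> a b u" using L by (simp add: ln_T1_def \<kappa>_def d_def[symmetric] L_def[symmetric])
    finally have ya: "cross a ystar > 0" using 3 L by (metis ln_valid_def zero_less_mult_pos)
    have "L * cross ystar b = L * cross u b + L * \<kappa> * dot b d"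
      by (simp add: ystar_def cross_def N_def dot_def algebra_simps)
    also have "\<dots> = ln_T2 \<alpha> a b u" using L by (simp add: ln_T2_def \<kappa>_def d_def[symmetric] L_def[symmetric])
    finally have yb: "cross ystar b > 0" using 3 L by (metis ln_valid_def zero_less_mult_pos)
    \<comment> \<open>The point of the edge that touches the disk under the magnification
      \<open>ST\<close>. It is a convex combination of the ends because both cross products with
      \<open>ystar\<close> are positive.\<close>
    define x where "x = ystar / of_real ST"
    have ST1: "ST > 0" using ST0 S0 by simp
    have sum: "cross ystar b + cross a ystar = ST * cross a b"
      unfolding yd[symmetric] by (simp add: d_def cross_def algebra_simps)
    have x: "x \<in> closed_segment a b"
    proof -
      define t where "t = cross a ystar / (ST * cross a b)"
      have "ystar * of_real (cross a b) = a * of_real (cross ystar b) + b * of_real (cross a ystar)"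
        by (simp add: complex_eq_iff cross_def algebra_simps)
      then have "x * of_real (ST * cross a b) = a * of_real (cross ystar b) + b * of_real (cross a ystar)"
        using ST1 by (simp add: x_def)
      then have "x = (a * of_real (cross ystar b) + b * of_real (cross a ystar)) / of_real (ST * cross a b)"
        using ST1 c by (simp add: field_simps)
      moreover have "1 - t = cross ystar b / (ST * cross a b)"
        using sum ST1 c by (simp add: t_def field_simps)
      ultimately have "x = (1 - t) *\<^sub>R a + t *\<^sub>R b"
        by (simp add: t_def scaleR_conv_of_real add_divide_distrib mult.commute)
      moreover have "0 \<le> t" "t \<le> 1" using ya yb sum ST1 c by (auto simp: t_def divide_simps)
      ultimately show ?thesis by (auto simp: in_segment)
    qed
    have xd: "cross x d = cross a b"
    proof -
      have "ST * cross x d = cross ystar d" using ST1 by (simp add: x_def cross_def field_simps)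
      then show ?thesis using yd ST1 by simp
    qed
    then have "x \<noteq> 0" using c by (auto simp: cross_def)
    then have nx: "norm x > 0" by simp
    \<comment> \<open>Then the linear term \<open>- 2 * \<epsilon> * \<kappa> * cross a b\<close> in
      the squared distance dominates the quadratic one.\<close>
    define \<epsilon> where "\<epsilon> = min (ST - S0) (\<kappa> * cross a b / (norm x)\<^sup>2)"
    have \<epsilon>: "\<epsilon> > 0" "\<epsilon> \<le> ST - S0" "\<epsilon> \<le> \<kappa> * cross a b / (norm x)\<^sup>2" using ST0 \<kappa> c nx by (auto simp: \<epsilon>_def)
    have "norm (of_real (ST - \<epsilon>) * x - u) < \<alpha> * norm u"
    proof -
      have "\<epsilon> * (norm x)\<^sup>2 \<le> \<kappa> * cross a b" using \<epsilon>(3) nx by (simp add: pos_le_divide_eq)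
      then have "\<epsilon> * (norm x)\<^sup>2 < 2 * (\<kappa> * cross a b)" using \<kappa> c by (smt (verit) mult_pos_pos)
      then have *: "\<epsilon> * (\<epsilon> * (norm x)\<^sup>2) < \<epsilon> * (2 * (\<kappa> * cross a b))" using \<epsilon>(1) by simp
      have eq: "of_real (ST - \<epsilon>) * x - u = of_real \<kappa> * N - of_real \<epsilon> * x"
        using ST1 by (simp add: x_def ystar_def field_simps)
      have "(norm (of_real (ST - \<epsilon>) * x - u))\<^sup>2 = \<kappa>\<^sup>2 * L\<^sup>2 - \<epsilon> * (2 * (\<kappa> * cross x d)) + \<epsilon> * (\<epsilon> * (norm x)\<^sup>2)"
        unfolding eq L2 cmod_power2 by (simp add: N_def cross_def power2_eq_square algebra_simps)
      also have "\<dots> < \<kappa>\<^sup>2 * L\<^sup>2" using * by (simp add: xd)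
      also have "\<dots> = (\<alpha> * norm u)\<^sup>2" using L by (simp add: \<kappa>_def power_divide)
      finally show ?thesis using \<alpha> by (meson mult_nonneg_nonneg norm_ge_zero less_imp_le power_less_imp_less_base)
    qed
    then show ?L using x \<epsilon> by (intro exI[of _ "ST - \<epsilon>"]) auto
  qed auto
qed

section \<open>Edges on a line through the origin\<close>

lemma collinear_eq:
  assumes "cross a b = 0" "a \<noteq> 0"
  shows "b = of_real (dot a b / dot a a) * a"
proof -
  have "b * of_real (dot a a) = a * of_real (dot a b)"
    using assms(1) by (auto simp: complex_eq_iff dot_def cross_def algebra_simps)
  moreover have "dot a a \<noteq> 0" using assms by (simp add: dot_self)
  ultimately show ?thesis by (simp add: field_simps)
qed

text \<open>All points of the edge are multiples, by factors of at least 1, of the end that is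
  nearer to the origin; such a factor is absorbed by the magnification.\<close>

lemma edge_block_collinear_away:
  assumes ab: "cross a b = 0" "dot a b > 0" and S0: "S0 > 0"
  shows "(\<exists>S\<ge>S0. \<exists>x\<in>closed_segment a b. norm (of_real S * x - u) < r) \<longleftrightarrow>
    (\<exists>S\<ge>S0. norm (of_real S * a - u) < r) \<or> (\<exists>S\<ge>S0. norm (of_real S * b - u) < r)"
proof -
  have *: "\<exists>S\<ge>S0. norm (of_real S * a - u) < r"
    if "b = of_real \<rho> * a" "\<rho> \<ge> 1" "S \<ge> S0" and x: "x \<in> closed_segment a b" and "norm (of_real S * x - u) < r" for a b \<rho> S x
  proof -
    obtain t where t: "0 \<le> t" "t \<le> 1" "x = (1 - t) *\<^sub>R a + t *\<^sub>R b" using x by (auto simp: in_segment)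
    define m where "m = 1 - t + t * \<rho>"
    have "x = of_real m * a" unfolding t that(1) m_def by (simp add: scaleR_conv_of_real algebra_simps)
    moreover have "m \<ge> 1" using t that(2) mult_left_mono[of 1 \<rho> t] by (simp add: m_def)
    ultimately show ?thesis using that(3,5) S0 mult_mono[of S0 S 1 m]
      by (intro exI[of _ "S * m"]) (auto simp: mult.assoc)
  qed
  have ne: "a \<noteq> 0" "b \<noteq> 0" using ab by (auto simp: dot_def)
  have cs: "(dot a b)\<^sup>2 = dot a a * dot b b"
  proof -
    have "dot a a * dot b b = (dot a b)\<^sup>2 + (cross a b)\<^sup>2"
      by (simp add: dot_def cross_def power2_eq_square algebra_simps)
    then show ?thesis using ab by simp
  qed
  have pos: "dot a a > 0" "dot b b > 0" using ne by (auto simp: dot_self)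
  show ?thesis
  proof
    assume "\<exists>S\<ge>S0. \<exists>x\<in>closed_segment a b. norm (of_real S * x - u) < r"
    then obtain S x where S: "S \<ge> S0" "x \<in> closed_segment a b" "norm (of_real S * x - u) < r" by blast
    show "(\<exists>S\<ge>S0. norm (of_real S * a - u) < r) \<or> (\<exists>S\<ge>S0. norm (of_real S * b - u) < r)"
    \<comment> \<open>The ends lie on one ray from the origin, where this compares their
      norms.\<close>
    proof (cases "dot a b \<ge> dot a a")
      case True
      then show ?thesis using *[OF collinear_eq[OF ab(1) ne(1)] _ S] pos by simp
    next
      case False
      then have "dot a a * dot b b \<le> dot a a * dot a b"
        using ab(2) unfolding cs[symmetric] power2_eq_square by (intro mult_right_mono) auto
      then have "dot b b \<le> dot b a" using pos by (simp add: dot_def mult.commute)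
      moreover have "cross b a = 0" using ab(1) cross_commute[of b a] by simp
      ultimately show ?thesis
        using *[OF collinear_eq[of b a] _ S(1) _ S(3)] S(2) ne pos closed_segment_commute[of a b] by simp
    qed
  qed (auto intro: bexI[of _ a] bexI[of _ b])
qed

text \<open>The edge contains the origin and hence all small multiples of its ends. An end that
  obstructs the ray for some magnification then does so beyond any \<open>S0\<close>, so the
  condition is independent of \<open>S0\<close>.\<close>

lemma edge_block_collinear_through:
  assumes ab: "cross a b = 0" "dot a b \<le> 0" "a \<noteq> b" and \<alpha>: "\<alpha> > 0" "\<alpha> \<le> 1" and S0: "S0 > 0"
  shows "(\<exists>S\<ge>S0. \<exists>x\<in>closed_segment a b. norm (of_real S * x - u) < \<alpha> * norm u) \<longleftrightarrow>
    pt_valid \<alpha> a u \<or> pt_valid \<alpha> b u"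
proof -
  have zero: "0 \<in> closed_segment a b" and decomp: "\<And>x. x \<in> closed_segment a b \<Longrightarrow>
      \<exists>\<rho>\<ge>0. x = of_real \<rho> * a \<or> x = of_real \<rho> * b"
  proof -
    have "0 \<in> closed_segment a b \<and> (\<forall>x\<in>closed_segment a b. \<exists>\<rho>\<ge>0. x = of_real \<rho> * a \<or> x = of_real \<rho> * b)"
    proof (cases "a = 0")
      case True
      then show ?thesis by (auto simp: in_segment scaleR_conv_of_real)
    next
      case False
      \<comment> \<open>\<open>b\<close> is the opposite multiple \<open>- r * a\<close>, and the
        origin is the convex combination with weight \<open>1 / (1 + r)\<close> at
        \<open>b\<close>.\<close>
      define r where "r = - (dot a b / dot a a)"
      have r: "r \<ge> 0" using ab(2) False by (simp add: r_def dot_self divide_nonpos_pos)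
      have b: "b = - of_real r * a" using collinear_eq[OF ab(1) False] by (simp add: r_def)
      have x: "\<exists>\<rho>\<ge>0. x = of_real \<rho> * a \<or> x = of_real \<rho> * b" if "x \<in> closed_segment a b" for x
      proof -
        obtain t where t: "0 \<le> t" "t \<le> 1" "x = (1 - t) *\<^sub>R a + t *\<^sub>R b" using \<open>x \<in> _\<close> by (auto simp: in_segment)
        define m where "m = 1 - t - t * r"
        have xm: "x = of_real m * a" unfolding t b m_def by (simp add: scaleR_conv_of_real algebra_simps)
        show ?thesis
        proof (cases "m \<ge> 0")
          case False
          then have "r > 0" using t r by (cases "r = 0") (auto simp: m_def)
          then have "x = of_real (- m / r) * b" unfolding xm b by simp
          then show ?thesis using False \<open>r > 0\<close> by (intro exI[of _ "- m / r"]) (auto simp: divide_nonpos_pos)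
        qed (use xm in blast)
      qed
      have "0 = (1 - 1 / (1 + r)) *\<^sub>R a + (1 / (1 + r)) *\<^sub>R b"
      proof -
        define s where "s = 1 / (1 + r)"
        have "(1 - s) *\<^sub>R a + s *\<^sub>R b = of_real (1 - s - s * r) * a"
          unfolding b by (simp add: scaleR_conv_of_real algebra_simps)
        moreover have "1 - s - s * r = 0" using r by (simp add: s_def field_simps)
        ultimately show ?thesis unfolding s_def[symmetric] by (metis mult_zero_left of_real_0)
      qed
      then have "0 \<in> closed_segment a b"
        unfolding in_segment using r by (intro exI[of _ "1 / (1 + r)"]) auto
      then show ?thesis using x by blast
    qed
    then show "0 \<in> closed_segment a b" "\<And>x. x \<in> closed_segment a b \<Longrightarrow>
      \<exists>\<rho>\<ge>0. x = of_real \<rho> * a \<or> x = of_real \<rho> * b" by blast+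
  qed
  have valid: "pt_valid \<alpha> q u" if "norm (of_real \<rho> * q - u) < \<alpha> * norm u" "\<rho> \<ge> 0" for \<rho> q
  proof -
    have "\<rho> \<noteq> 0" using that(1) \<alpha> mult_right_mono[of \<alpha> 1 "norm u"] by auto
    then show ?thesis using pt_block[OF \<alpha>, of \<rho> q u] that by auto
  qed
  have conv: "\<exists>S\<ge>S0. \<exists>x\<in>closed_segment a b. norm (of_real S * x - u) < \<alpha> * norm u"
    if q: "q \<in> {a, b}" and v: "pt_valid \<alpha> q u" for q
  proof -
    \<comment> \<open>Half of the positive root is a threshold at which \<open>pt_block\<close>
      yields an obstructing magnification \<open>S1\<close>.\<close>
    have "sval (pt_conic \<alpha> q) u / 2 > 0" using sval_pt_pos[OF v] by simp
    moreover have "sval (pt_conic \<alpha> q) u / 2 < sval (pt_conic \<alpha> q) u" using sval_pt_pos[OF v] by simp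
    ultimately have "\<exists>S\<ge>sval (pt_conic \<alpha> q) u / 2. norm (of_real S * q - u) < \<alpha> * norm u"
      using pt_block[OF \<alpha>, of "sval (pt_conic \<alpha> q) u / 2" q u] v by blast
    then obtain S1 where S1: "S1 \<ge> sval (pt_conic \<alpha> q) u / 2" "norm (of_real S1 * q - u) < \<alpha> * norm u"
      by blast
    then have "S1 > 0" using sval_pt_pos[OF v] by linarith
    note S1 = S1 this
    \<comment> \<open>\<open>S\<close> reaches \<open>S0\<close>, and \<open>S1 / S \<le> 1\<close>
      keeps the compensating multiple of \<open>q\<close> on the edge.\<close>
    define S where "S = max S0 S1"
    have S: "S \<ge> S0" "S \<ge> S1" "S > 0" using S0 by (auto simp: S_def)
    have "of_real (S1 / S) * q \<in> closed_segment 0 q"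
    proof -
      have "0 \<le> S1 / S" "S1 / S \<le> 1" using S S1(3) by simp_all
      then show ?thesis unfolding in_segment by (intro exI[of _ "S1 / S"]) (simp add: scaleR_conv_of_real)
    qed
    also have "closed_segment 0 q \<subseteq> closed_segment a b"
      using zero q by (intro closed_segment_subset) auto
    finally have "of_real (S1 / S) * q \<in> closed_segment a b" .
    moreover have "of_real S * (of_real (S1 / S) * q) = of_real S1 * q" using S(3) by simp
    ultimately show ?thesis using S(1) S1(2) by metis
  qed
  show ?thesis
  proof
    assume "\<exists>S\<ge>S0. \<exists>x\<in>closed_segment a b. norm (of_real S * x - u) < \<alpha> * norm u"
    then obtain S x where S: "S \<ge> S0" "x \<in> closed_segment a b" "norm (of_real S * x - u) < \<alpha> * norm u" by blast
    then obtain \<rho> where \<rho>: "\<rho> \<ge> 0" "x = of_real \<rho> * a \<or> x = of_real \<rho> * b" using decomp by blast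
    have nn: "S * \<rho> \<ge> 0" using S(1) S0 \<rho>(1) by simp
    have "of_real S * x = of_real (S * \<rho>) * a \<or> of_real S * x = of_real (S * \<rho>) * b"
      using \<rho>(2) by (metis mult.assoc of_real_mult)
    then show "pt_valid \<alpha> a u \<or> pt_valid \<alpha> b u" using valid[OF _ nn] S(3) by metis
  next
    assume "pt_valid \<alpha> a u \<or> pt_valid \<alpha> b u"
    then show "\<exists>S\<ge>S0. \<exists>x\<in>closed_segment a b. norm (of_real S * x - u) < \<alpha> * norm u"
      using conv by blast
  qed
qed

text \<open>An edge through \<open>p\<close> rules out a direction at all distances at once, so it
  is kept apart from the obstacles that have a definite root.\<close>

definition blocked :: "real \<Rightarrow> (complex \<times> complex) list \<Rightarrow> complex \<Rightarrow> bool" where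
  "blocked \<alpha> es u \<longleftrightarrow> (\<exists>(a, b)\<in>set es. cross a b = 0 \<and> dot a b \<le> 0 \<and> (pt_valid \<alpha> a u \<or> pt_valid \<alpha> b u))"

definition feats :: "real \<Rightarrow> (complex \<times> complex) list \<Rightarrow> complex \<Rightarrow> real list set" where
  "feats \<alpha> es u = {pt_conic \<alpha> q | q. q \<in> fst ` set es \<union> snd ` set es \<and> pt_valid \<alpha> q u} \<union>
     {ln_conic \<alpha> a b | a b. (a, b) \<in> set es \<and> ln_valid \<alpha> a b u}"

text \<open>The substitution \<open>S = S0 / \<tau>\<close> turns shrinking disks into magnified
  edges; the range (0, 1] of \<open>\<tau>\<close> corresponds to \<open>S \<ge> S0\<close>.\<close>

lemma clear_divide_iff:
  assumes S0: "S0 > 0"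
  shows "clear \<alpha> es (u / of_real S0) \<longleftrightarrow>
    (\<forall>e\<in>set es. \<not> (\<exists>S\<ge>S0. \<exists>x\<in>seg e. norm (of_real S * x - u) < \<alpha> * norm u))"
proof -
  have *: "\<alpha> * \<tau> * norm (u / of_real S0) \<le> norm (x - of_real \<tau> * (u / of_real S0)) \<longleftrightarrow>
      \<not> norm (of_real (S0 / \<tau>) * x - u) < \<alpha> * norm u" if "\<tau> > 0" for \<tau> x
  proof -
    have "of_real (S0 / \<tau>) * x - u = of_real (S0 / \<tau>) * (x - of_real \<tau> * (u / of_real S0))"
      using S0 that by (simp add: field_simps)
    then have "norm (of_real (S0 / \<tau>) * x - u) = S0 / \<tau> * norm (x - of_real \<tau> * (u / of_real S0))"
      using S0 that by (simp add: norm_mult norm_divide)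
    then show ?thesis using S0 that by (simp add: norm_divide not_less field_simps)
  qed
  show ?thesis
  proof
    assume c: "clear \<alpha> es (u / of_real S0)"
    show "\<forall>e\<in>set es. \<not> (\<exists>S\<ge>S0. \<exists>x\<in>seg e. norm (of_real S * x - u) < \<alpha> * norm u)"
    proof clarify
      fix a b S x assume e: "(a, b) \<in> set es" "S \<ge> S0" "x \<in> seg (a, b)" "norm (of_real S * x - u) < \<alpha> * norm u"
      then have t: "S0 / S \<in> {0<..1}" and SS: "S0 / (S0 / S) = S" using S0 by auto
      then have "\<alpha> * (S0 / S) * norm (u / of_real S0) \<le> norm (x - of_real (S0 / S) * (u / of_real S0))"
        using c e(1,3) unfolding clear_def by blast
      then show False using *[of "S0 / S" x] t SS e(4) by simp
    qed
  next
    assume n: "\<forall>e\<in>set es. \<not> (\<exists>S\<ge>S0. \<exists>x\<in>seg e. norm (of_real S * x - u) < \<alpha> * norm u)"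
    show "clear \<alpha> es (u / of_real S0)"
      unfolding clear_def
    proof (intro ballI)
      fix e x \<tau> assume e: "e \<in> set es" "x \<in> seg e" and \<tau>: "\<tau> \<in> {0<..1::real}"
      then have "S0 / \<tau> \<ge> S0" using S0 by (simp add: field_simps)
      then have "\<not> norm (of_real (S0 / \<tau>) * x - u) < \<alpha> * norm u" using n e by blast
      then show "\<alpha> * \<tau> * norm (u / of_real S0) \<le> norm (x - of_real \<tau> * (u / of_real S0))"
        using *[of \<tau> x] \<tau> by simp
    qed
  qed
qed

text \<open>Edges on a line through the origin are covered by the two collinear lemmas, all others
  by \<open>edge_block\<close>. The result compares \<open>S0\<close> with finitely many roots,
  hence with their maximum.\<close>

lemma clear_iff:
  assumes \<alpha>: "\<alpha> > 0" "\<alpha> \<le> 1" and S0: "S0 > 0" and u: "u \<noteq> 0"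
    and es: "\<And>a b. (a, b) \<in> set es \<Longrightarrow> cross a b \<ge> 0 \<and> a \<noteq> b"
  shows "clear \<alpha> es (u / of_real S0) \<longleftrightarrow> \<not> blocked \<alpha> es u \<and> (\<forall>k\<in>feats \<alpha> es u. sval k u \<le> S0)"
proof -
  define bl where "bl a b \<longleftrightarrow> cross a b = 0 \<and> dot a b \<le> 0 \<and> (pt_valid \<alpha> a u \<or> pt_valid \<alpha> b u)" for a b
  define pt where "pt q \<longleftrightarrow> pt_valid \<alpha> q u \<and> S0 < sval (pt_conic \<alpha> q) u" for q
  define ln where "ln a b \<longleftrightarrow> ln_valid \<alpha> a b u \<and> S0 < sval (ln_conic \<alpha> a b) u" for a b
  have e: "(\<exists>S\<ge>S0. \<exists>x\<in>seg (a, b). norm (of_real S * x - u) < \<alpha> * norm u) \<longleftrightarrow> bl a b \<or> pt a \<or> pt b \<or> ln a b"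
    if "(a, b) \<in> set es" for a b
  proof (cases "cross a b = 0")
    case True
    then show ?thesis
      using edge_block_collinear_away[OF True _ S0, of u "\<alpha> * norm u"]
        edge_block_collinear_through[OF True _ _ \<alpha> S0, of u] es[OF that]
      by (cases "dot a b > 0") (auto simp: pt_block[OF \<alpha> S0] bl_def pt_def ln_def seg_def ln_valid_def)
  next
    case False
    then have "cross a b > 0" using es[OF that] by simp
    then show ?thesis
      using edge_block[OF _ \<alpha>(1) u S0, of a b]
      by (auto simp: pt_block[OF \<alpha> S0] bl_def pt_def ln_def seg_def)
  qed
  have "clear \<alpha> es (u / of_real S0) \<longleftrightarrow> (\<forall>(a, b)\<in>set es. \<not> (bl a b \<or> pt a \<or> pt b \<or> ln a b))"
    unfolding clear_divide_iff[OF S0] by (intro ball_cong refl) (use e in auto)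
  also have "\<dots> \<longleftrightarrow> \<not> blocked \<alpha> es u \<and> (\<forall>k\<in>feats \<alpha> es u. sval k u \<le> S0)"
  proof -
    have "(\<forall>k\<in>feats \<alpha> es u. sval k u \<le> S0) \<longleftrightarrow>
        (\<forall>q\<in>fst ` set es \<union> snd ` set es. \<not> pt q) \<and> (\<forall>(a, b)\<in>set es. \<not> ln a b)"
      unfolding feats_def pt_def ln_def not_less[symmetric] by blast
    also have "\<dots> \<longleftrightarrow> (\<forall>(a, b)\<in>set es. \<not> (pt a \<or> pt b \<or> ln a b))" by (auto simp: split_beta)
    finally show ?thesis unfolding blocked_def bl_def[symmetric] by (auto simp: split_beta)
  qed
  finally show ?thesis .
qed

section \<open>Critical directions\<close>

text \<open>The stereographic parametrisation of the half circles; \<open>sg\<close> is \<open>1\<close> or \<open>-1\<close>.\<close>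

definition dir :: "real \<Rightarrow> real \<Rightarrow> complex" where
  "dir sg t = Complex (sg * (1 - t\<^sup>2)) (sg * (2 * t))"

lemma Re_dir [simp]: "Re (dir sg t) = sg * (1 - t\<^sup>2)" and Im_dir [simp]: "Im (dir sg t) = sg * (2 * t)"
  by (simp_all add: dir_def)

lemma norm_dir: "\<bar>sg\<bar> = 1 \<Longrightarrow> norm (dir sg t) = 1 + t\<^sup>2"
proof -
  assume "\<bar>sg\<bar> = 1"
  then have "sg\<^sup>2 = 1" by (simp add: power2_eq_1_iff abs_if split: if_splits)
  then have "(norm (dir sg t))\<^sup>2 = (1 + t\<^sup>2)\<^sup>2"
    unfolding cmod_power2 by (simp add: power_mult_distrib) (simp add: power2_eq_square algebra_simps)
  then show ?thesis by (simp add: power2_eq_iff_nonneg)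
qed

lemma dir_nonzero: "\<bar>sg\<bar> = 1 \<Longrightarrow> dir sg t \<noteq> 0"
  using norm_dir[of sg t] by (metis add_pos_nonneg norm_zero less_irrefl zero_le_power2 zero_less_one)

lemma continuous_dir [continuous_intros]: "continuous_on S (dir sg)"
  unfolding dir_def Complex_eq by (intro continuous_intros)

text \<open>For parameters in [-1, 1] the last factor is nonnegative, so directions are ordered like
  their parameters.\<close>

lemma cross_dir: "\<bar>sg\<bar> = 1 \<Longrightarrow> cross (dir sg t) (dir sg t') = 2 * (t' - t) * (1 + t * t')"
proof -
  assume "\<bar>sg\<bar> = 1"
  then have "sg * sg = 1" by (auto simp: abs_if split: if_splits)
  then have "cross (dir sg t) (dir sg t') = 1 * ((1 - t\<^sup>2) * (2 * t') - 2 * t * (1 - t'\<^sup>2))"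
    unfolding cross_def Re_dir Im_dir by (metis (no_types, opaque_lifting) mult.assoc mult.left_commute right_diff_distrib)
  then show ?thesis by (simp add: power2_eq_square algebra_simps)
qed

text \<open>The equations of two vertices have the same constant term, so their difference gives
  \<open>S = l / d\<close> for a common nonzero root. Inserting this into the first equation and
  clearing \<open>d\<close> leads to the polynomial.\<close>

definition Rpp :: "real \<Rightarrow> complex \<Rightarrow> complex \<Rightarrow> complex \<Rightarrow> real" where
  "Rpp \<alpha> q q' u = (let l = 2 * dot (q - q') u; d = dot q q - dot q' q' in
     dot q q * l\<^sup>2 - 2 * dot q u * l * d + (1 - \<alpha>\<^sup>2) * d\<^sup>2 * (norm u)\<^sup>2)"

definition ln_num :: "real \<Rightarrow> complex \<Rightarrow> complex \<Rightarrow> complex \<Rightarrow> real" where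
  "ln_num \<alpha> a b u = cross u (b - a) + \<alpha> * norm (b - a) * norm u"

text \<open>The equation of the vertex at \<open>S = ln_num / cross a b\<close>, multiplied by
  \<open>(cross a b)^2\<close>.\<close>

definition Rpl :: "real \<Rightarrow> complex \<Rightarrow> complex \<Rightarrow> complex \<Rightarrow> complex \<Rightarrow> real" where
  "Rpl \<alpha> q a b u = dot q q * (ln_num \<alpha> a b u)\<^sup>2 - 2 * cross a b * dot q u * ln_num \<alpha> a b u
     + (1 - \<alpha>\<^sup>2) * (cross a b)\<^sup>2 * (norm u)\<^sup>2"

definition Rll :: "real \<Rightarrow> complex \<Rightarrow> complex \<Rightarrow> complex \<Rightarrow> complex \<Rightarrow> complex \<Rightarrow> real" where
  "Rll \<alpha> a b a' b' u = cross a' b' * ln_num \<alpha> a b u - cross a b * ln_num \<alpha> a' b' u"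

definition ends :: "(complex \<times> complex) list \<Rightarrow> complex set" where
  "ends es = fst ` set es \<union> snd ` set es"

definition crit_funs :: "real \<Rightarrow> (complex \<times> complex) list \<Rightarrow> (complex \<Rightarrow> real) set" where
  "crit_funs \<alpha> es = pt_disc \<alpha> ` ends es
     \<union> (\<lambda>(a, b). ln_T1 \<alpha> a b) ` set es \<union> (\<lambda>(a, b). ln_T2 \<alpha> a b) ` set es
     \<union> (\<lambda>(q, q'). Rpp \<alpha> q q') ` (ends es \<times> ends es)
     \<union> (\<lambda>(q, a, b). Rpl \<alpha> q a b) ` (ends es \<times> set es)
     \<union> (\<lambda>((a, b), (a', b')). Rll \<alpha> a b a' b') ` (set es \<times> set es)"

text \<open>Vanishing is demanded for all \<open>t\<close>, not just on \<open>I\<close>, because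
  the functions are polynomials in \<open>t\<close>. The singleton case serves the critical
  directions themselves.\<close>

definition uniform :: "real \<Rightarrow> real set \<Rightarrow> (complex \<Rightarrow> real) \<Rightarrow> bool" where
  "uniform sg I f \<longleftrightarrow> (\<forall>t\<in>I. f (dir sg t) > 0) \<or> (\<forall>t\<in>I. f (dir sg t) < 0) \<or>
     (\<forall>t. f (dir sg t) = 0) \<or> (\<exists>t. I = {t})"

section \<open>Coincidence of two obstacles\<close>

lemma sval_root:
  assumes "sdisc k u \<ge> 0" "k ! 5 \<noteq> 0"
  shows "k ! 5 * (sval k u)\<^sup>2 - 2 * sbeta k u * sval k u + sgamma k u = 0"
proof -
  have "k ! 5 * sval k u - sbeta k u = sqrt (sdisc k u)" using assms by (simp add: sval_def)
  then have "(k ! 5 * sval k u - sbeta k u)\<^sup>2 = (sbeta k u)\<^sup>2 - k ! 5 * sgamma k u"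
    using assms by (simp add: sdisc_def)
  then have "k ! 5 * (k ! 5 * (sval k u)\<^sup>2 - 2 * sbeta k u * sval k u + sgamma k u) = 0"
    by (simp add: power2_eq_square algebra_simps)
  then show ?thesis using assms by simp
qed

lemma pt_root:
  assumes "pt_valid \<alpha> q u"
  shows "dot q q * (sval (pt_conic \<alpha> q) u)\<^sup>2 - 2 * dot q u * sval (pt_conic \<alpha> q) u + (1 - \<alpha>\<^sup>2) * (norm u)\<^sup>2 = 0"
proof -
  have "q \<noteq> 0" using assms by (auto simp: pt_valid_def dot_def)
  then show ?thesis using sval_root[of "pt_conic \<alpha> q" u] assms
    by (simp add: sdisc_pt sbeta_pt sgamma_pt pt_valid_def) (simp add: pt_conic_def dot_self)
qed

text \<open>The sum of the two positive conditions is \<open>|b - a|\<close> times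
  \<open>ln_num\<close>.\<close>

lemma ln_num_pos: "ln_valid \<alpha> a b u \<Longrightarrow> ln_num \<alpha> a b u > 0"
proof -
  assume v: "ln_valid \<alpha> a b u"
  then have "norm (b - a) > 0" by (auto simp: ln_valid_def cross_def)
  moreover have "ln_T1 \<alpha> a b u + ln_T2 \<alpha> a b u = norm (b - a) * cross u (b - a) + \<alpha> * norm u * dot (b - a) (b - a)"
    by (simp add: ln_T1_def ln_T2_def cross_def dot_def algebra_simps)
  then have "ln_T1 \<alpha> a b u + ln_T2 \<alpha> a b u = norm (b - a) * ln_num \<alpha> a b u"
    by (simp add: dot_self ln_num_def power2_eq_square algebra_simps)
  ultimately show ?thesis using v by (metis add_pos_pos ln_valid_def zero_less_mult_pos)
qed

lemma Rpp_zero: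
  assumes "pt_valid \<alpha> q u" "pt_valid \<alpha> q' u" "sval (pt_conic \<alpha> q) u = sval (pt_conic \<alpha> q') u"
  shows "Rpp \<alpha> q q' u = 0"
proof -
  define S where "S = sval (pt_conic \<alpha> q) u"
  have S: "S > 0" using sval_pt_pos assms by (simp add: S_def)
  note r = pt_root[OF assms(1), folded S_def] pt_root[OF assms(2), folded assms(3), folded S_def]
  define d l where "d = dot q q - dot q' q'" and "l = 2 * dot (q - q') u"
  have l: "l = 2 * dot q u - 2 * dot q' u" by (simp add: l_def dot_def algebra_simps)
  have "S * (d * S - l) = 0" using r unfolding d_def l by (simp add: power2_eq_square algebra_simps)
  then have ld: "l = d * S" using S by simp
  have "Rpp \<alpha> q q' u = d\<^sup>2 * (dot q q * S\<^sup>2 - 2 * dot q u * S + (1 - \<alpha>\<^sup>2) * (norm u)\<^sup>2)"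
    unfolding Rpp_def Let_def l_def[symmetric] d_def[symmetric] ld
    by (simp add: power2_eq_square algebra_simps)
  then show ?thesis using r by simp
qed

lemma Rpl_zero:
  assumes "pt_valid \<alpha> q u" "ln_valid \<alpha> a b u" "\<alpha> > 0" "sval (pt_conic \<alpha> q) u = sval (ln_conic \<alpha> a b) u"
  shows "Rpl \<alpha> q a b u = 0"
proof -
  define S where "S = sval (pt_conic \<alpha> q) u"
  note r = pt_root[OF assms(1), folded S_def]
  have c: "cross a b > 0" using assms by (simp add: ln_valid_def)
  have n: "ln_num \<alpha> a b u = cross a b * S" using assms(4) sval_ln[OF c assms(3), of u] c
    by (simp add: S_def ln_num_def)
  have "Rpl \<alpha> q a b u = (cross a b)\<^sup>2 * (dot q q * S\<^sup>2 - 2 * dot q u * S + (1 - \<alpha>\<^sup>2) * (norm u)\<^sup>2)"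
    unfolding Rpl_def n by (simp add: power2_eq_square algebra_simps)
  then show ?thesis using r by simp
qed

lemma Rll_zero_iff:
  assumes "cross a b > 0" "cross a' b' > 0" "\<alpha> > 0"
  shows "Rll \<alpha> a b a' b' u = 0 \<longleftrightarrow> sval (ln_conic \<alpha> a b) u = sval (ln_conic \<alpha> a' b') u"
  unfolding Rll_def sval_ln[OF assms(1,3)] sval_ln[OF assms(2,3)] ln_num_def[symmetric]
  using assms by (simp add: frac_eq_eq mult.commute)

text \<open>A quartic that vanishes identically also vanishes at \<open>\<i>\<close>, where \<open>|u|\<^sup>2 = (1 + t\<^sup>2)\<^sup>2\<close> is zero and
  \<open>u\<close> is isotropic.\<close>

lemma quartic_at_i:
  fixes f :: "real \<Rightarrow> real"
  assumes f: "\<And>t. f t = c0 + c1 * t + c2 * t^2 + c3 * t^3 + c4 * t^4" and z: "\<And>t. f t = 0"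
  shows "c0 - c2 + c4 = 0" "c1 - c3 = 0"
  using f[of 0] f[of 1] f[of "-1"] f[of 2] f[of "-2"] z by simp_all

text \<open>At \<open>t = \<i>\<close> the form \<open>dot q u\<close> takes the complex value
  \<open>2 sg q\<close> and \<open>|u|^2\<close> becomes 0, so the value of the quartic is
  \<open>-16 q q' |q - q'|^2\<close>.\<close>

lemma Rpp_identically_zero:
  assumes sg: "\<bar>sg\<bar> = 1" and z: "\<And>t. Rpp \<alpha> q q' (dir sg t) = 0" and q: "q \<noteq> 0" "q' \<noteq> 0"
  shows "q = q'"
proof -
  obtain x y x' y' where xy: "q = Complex x y" "q' = Complex x' y'" by (metis complex.exhaust)
  define d where "d = (x * x + y * y) - (x' * x' + y' * y')"
  define e where "e = (1 - \<alpha>\<^sup>2) * d\<^sup>2"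
  define m where "m = x * x + y * y"
  define X Y where "X = 2 * (x - x')" and "Y = 2 * (y - y')"
  have sg2: "sg * sg = 1" using sg by (auto simp: abs_if split: if_splits)
  have R: "Rpp \<alpha> q q' (dir sg t) = m * (X * (1 - t\<^sup>2) + Y * (2 * t))\<^sup>2
      - 2 * (x * (1 - t\<^sup>2) + y * (2 * t)) * (X * (1 - t\<^sup>2) + Y * (2 * t)) * d + e * (1 + t\<^sup>2)\<^sup>2" for t
  proof -
    have "Rpp \<alpha> q q' (dir sg t) = (sg * sg) * (m * (X * (1 - t\<^sup>2) + Y * (2 * t))\<^sup>2)
      - (sg * sg) * (2 * (x * (1 - t\<^sup>2) + y * (2 * t)) * (X * (1 - t\<^sup>2) + Y * (2 * t)) * d) + e * (1 + t\<^sup>2)\<^sup>2"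
      unfolding Rpp_def Let_def norm_dir[OF sg] dot_def xy m_def e_def d_def X_def Y_def
      by (simp add: power2_eq_square algebra_simps)
    then show ?thesis by (simp add: sg2)
  qed
  define c0 c1 c2 c3 c4 where "c0 = m * X * X - 2 * x * X * d + e"
    and "c1 = m * 4 * X * Y - 4 * d * (x * Y + y * X)"
    and "c2 = m * (4 * Y * Y - 2 * X * X) - 2 * d * (4 * y * Y - 2 * x * X) + 2 * e"
    and "c3 = - m * 4 * X * Y + 4 * d * (x * Y + y * X)"
    and "c4 = m * X * X - 2 * x * X * d + e"
  have "Rpp \<alpha> q q' (dir sg t) = c0 + c1 * t + c2 * t^2 + c3 * t^3 + c4 * t^4" for t
    unfolding R c0_def c1_def c2_def c3_def c4_def
    by (simp add: power2_eq_square power3_eq_cube power4_eq_xxxx algebra_simps)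
  from quartic_at_i[OF this z]
  have *: "c0 - c2 + c4 = 0" "c1 - c3 = 0" by blast+
  have "(q * q') * of_real ((norm (q - q'))\<^sup>2) = Complex (- (c0 - c2 + c4) / 16) (- (c1 - c3) / 16)"
    unfolding cmod_power2 complex_eq_iff c0_def c1_def c2_def c3_def c4_def m_def X_def Y_def d_def
    by (simp add: xy power2_eq_square field_simps)
  then have "(q * q') * of_real ((norm (q - q'))\<^sup>2) = 0" using * by (simp add: complex_eq_iff)
  then show ?thesis using q by simp
qed

text \<open>At \<open>t = \<i>\<close> the value is \<open>4 d (2 \<i> C q - |q|^2 d)\<close>, so
  \<open>q\<close> would have to be the mirror image of the origin in the edge line. In this case
  the factor \<open>1 + t^2\<close> splits off, and the remaining quadratic cannot vanish at both 1
  and -1.\<close>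

lemma Rpl_not_identically_zero:
  assumes sg: "\<bar>sg\<bar> = 1" and z: "\<And>t. Rpl \<alpha> q a b (dir sg t) = 0" and q: "q \<noteq> 0"
    and c: "cross a b > 0" and \<alpha>: "\<alpha> > 0" "\<alpha> \<le> 1"
  shows False
proof -
  obtain x y where xy: "q = Complex x y" by (metis complex.exhaust)
  obtain v w where vw: "b - a = Complex v w" by (metis complex.exhaust)
  define C where "C = cross a b"
  define l where "l = \<alpha> * norm (b - a)"
  define m where "m = x * x + y * y"
  define e where "e = (1 - \<alpha>\<^sup>2) * C\<^sup>2"
  have sg2: "sg * sg = 1" using sg by (auto simp: abs_if split: if_splits)
  \<comment> \<open>The value of \<open>cross (dir sg t) (b - a)\<close>; its square no longer
    contains \<open>sg\<close>.\<close>
  define \<nu> where "\<nu> t = sg * ((1 - t\<^sup>2) * w - 2 * t * v)" for t :: real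
  have nu2: "\<nu> t * \<nu> t = ((1 - t\<^sup>2) * w - 2 * t * v)\<^sup>2" for t
  proof -
    have "\<nu> t * \<nu> t = (sg * sg) * ((1 - t\<^sup>2) * w - 2 * t * v)\<^sup>2" by (simp add: \<nu>_def power2_eq_square)
    then show ?thesis by (simp add: sg2)
  qed
  have R: "Rpl \<alpha> q a b (dir sg t) = m * (\<nu> t + l * (1 + t\<^sup>2))\<^sup>2
      - 2 * C * (sg * (x * (1 - t\<^sup>2) + y * (2 * t))) * (\<nu> t + l * (1 + t\<^sup>2)) + e * (1 + t\<^sup>2)\<^sup>2" for t
  proof -
    have "cross (dir sg t) (b - a) = \<nu> t" unfolding vw by (simp add: cross_def \<nu>_def algebra_simps)
    then have "ln_num \<alpha> a b (dir sg t) = \<nu> t + l * (1 + t\<^sup>2)" by (simp add: ln_num_def norm_dir[OF sg] l_def)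
    moreover have "dot q (dir sg t) = sg * (x * (1 - t\<^sup>2) + y * (2 * t))" by (simp add: dot_def xy algebra_simps)
    moreover have "dot q q = m" by (simp add: dot_def xy m_def)
    ultimately show ?thesis
      unfolding Rpl_def norm_dir[OF sg] C_def[symmetric] e_def by simp
  qed
  define c0 c1 c2 c3 c4 where
        "c0 = m * w * w + 2 * m * sg * w * l + m * l * l - 2 * C * x * w - 2 * C * sg * x * l + e"
    and "c1 = - 4 * m * w * v - 4 * m * sg * v * l + 4 * C * x * v - 4 * C * y * w - 4 * C * sg * y * l"
    and "c2 = m * (4 * v * v - 2 * w * w) + 2 * m * l * l + 4 * C * x * w + 8 * C * y * v + 2 * e"
    and "c3 = 4 * m * w * v - 4 * m * sg * v * l - 4 * C * x * v + 4 * C * y * w - 4 * C * sg * y * l"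
    and "c4 = m * w * w - 2 * m * sg * w * l + m * l * l - 2 * C * x * w + 2 * C * sg * x * l + e"
  have "Rpl \<alpha> q a b (dir sg t) = c0 + c1 * t + c2 * t^2 + c3 * t^3 + c4 * t^4" for t
  proof -
    have E1: "(\<nu> t + l * (1 + t\<^sup>2))\<^sup>2 = ((1 - t\<^sup>2) * w - 2 * t * v)\<^sup>2 + 2 * \<nu> t * l * (1 + t\<^sup>2) + (l * (1 + t\<^sup>2))\<^sup>2"
      unfolding nu2[symmetric] by (simp add: power2_eq_square algebra_simps)
    define K where "K = x * (1 - t\<^sup>2) + y * (2 * t)"
    have "sg * K * \<nu> t = (sg * sg) * (K * ((1 - t\<^sup>2) * w - 2 * t * v))"
      by (simp add: \<nu>_def)
    then have K: "sg * K * \<nu> t = K * ((1 - t\<^sup>2) * w - 2 * t * v)" by (simp add: sg2)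
    have E2: "2 * C * (sg * K) * (\<nu> t + l * (1 + t\<^sup>2)) =
        2 * C * (K * ((1 - t\<^sup>2) * w - 2 * t * v) + sg * K * (l * (1 + t\<^sup>2)))"
      unfolding K[symmetric] by (simp add: algebra_simps)
    show ?thesis
      unfolding R E1 K_def[symmetric] E2 unfolding K_def c0_def c1_def c2_def c3_def c4_def
      by (simp add: \<nu>_def power2_eq_square power3_eq_cube power4_eq_xxxx algebra_simps)
  qed
  from quartic_at_i[OF this z]
  have *: "c0 - c2 + c4 = 0" "c1 - c3 = 0" by blast+
  define d where "d = b - a"
  have d0: "d \<noteq> 0" using c by (auto simp: d_def cross_def)
  have m: "m = (norm q)\<^sup>2" unfolding cmod_power2 by (simp add: m_def xy power2_eq_square)
  have "4 * d * (- of_real m * d + 2 * \<i> * of_real C * q) = Complex (c0 - c2 + c4) (c1 - c3)"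
    unfolding complex_eq_iff c0_def c1_def c2_def c3_def c4_def
    by (simp add: d_def vw xy power2_eq_square algebra_simps)
  then have "d * (- of_real m * d + 2 * \<i> * of_real C * q) = 0" using * by (simp add: complex_eq_iff)
  then have "of_real m * d = 2 * \<i> * of_real C * q" using d0 by simp
  then have dm: "m * v = - 2 * C * y" "m * w = 2 * C * x" by (simp_all add: d_def vw xy complex_eq_iff)
  have R': "Rpl \<alpha> q a b (dir sg t) = (1 + t\<^sup>2) * (m * l * (\<nu> t + l * (1 + t\<^sup>2)) + e * (1 + t\<^sup>2))" for t
  proof -
    have "2 * C * (sg * (x * (1 - t\<^sup>2) + y * (2 * t))) = sg * ((2 * C * x) * (1 - t\<^sup>2) - (- 2 * C * y) * (2 * t))"
      by (simp add: algebra_simps)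
    also have "\<dots> = m * \<nu> t" unfolding dm[symmetric] by (simp add: \<nu>_def algebra_simps)
    finally show ?thesis unfolding R by (simp add: power2_eq_square algebra_simps)
  qed
  \<comment> \<open>In the sum of the values at 1 and -1 the terms with \<open>\<nu>\<close> cancel;
    what is left is positive.\<close>
  have "\<nu> 1 = - \<nu> (-1)" by (simp add: \<nu>_def)
  moreover have "m * l * (\<nu> t + l * (1 + t\<^sup>2)) + e * (1 + t\<^sup>2) = 0" for t
    using R'[of t] z[of t] by (simp add: add_pos_nonneg order_less_imp_not_eq2)
  from this[of 1] this[of "-1"] have "m * l * \<nu> 1 + m * l * (l * 2) + e * 2 = 0" "m * l * \<nu> (-1) + m * l * (l * 2) + e * 2 = 0"
    by (simp_all add: algebra_simps)
  ultimately have "m * l * l + e = 0" by simp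
  moreover have "m > 0" "l > 0" using q d0 \<alpha> by (auto simp: m l_def d_def)
  moreover have "e \<ge> 0" using \<alpha> by (simp add: e_def power_le_one)
  ultimately show False by (smt (verit) mult_pos_pos)
qed

section \<open>Sectors without critical directions\<close>

lemma continuous_sbeta: "continuous_on S (\<lambda>t. sbeta k (dir sg t))"
  unfolding sbeta_def Re_dir Im_dir by (intro continuous_intros) simp

lemma continuous_sgamma: "continuous_on S (\<lambda>t. sgamma k (dir sg t))"
  unfolding sgamma_def Re_dir Im_dir by (intro continuous_intros)

lemma continuous_sdisc: "continuous_on S (\<lambda>t. sdisc k (dir sg t))"
  unfolding sdisc_def
  by (intro continuous_on_diff continuous_on_power continuous_on_mult continuous_on_const continuous_sbeta continuous_sgamma)

lemma continuous_sval: "continuous_on S (\<lambda>t. sval k (dir sg t))"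
proof (cases "k ! 5 = 0")
  case False
  then show ?thesis unfolding sval_def
    by (intro continuous_on_divide continuous_on_add continuous_sbeta continuous_on_real_sqrt
      continuous_sdisc continuous_on_const) simp
qed (simp add: sval_def)

lemma positive_on_interval:
  fixes f :: "real \<Rightarrow> real"
  assumes "connected I" "continuous_on I f" "\<And>t. t \<in> I \<Longrightarrow> f t \<noteq> 0" "t \<in> I" "t' \<in> I" "f t > 0"
  shows "f t' > 0"
proof (rule ccontr)
  assume n: "\<not> f t' > 0"
  have "connected (f ` I)" using assms by (simp add: connected_continuous_image)
  then have "{f t'..f t} \<subseteq> f ` I" using assms(4,5) by (intro connected_contains_Icc) auto
  moreover have "0 \<in> {f t'..f t}" using n assms(6) by auto
  ultimately have "0 \<in> f ` I" by blast
  then show False using assms(3) by auto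
qed

lemma crit_funs_Rpp: "q \<in> ends es \<Longrightarrow> q' \<in> ends es \<Longrightarrow> Rpp \<alpha> q q' \<in> crit_funs \<alpha> es"
  unfolding crit_funs_def by (rule UnI1, rule UnI1, rule UnI2, rule image_eqI[of _ _ "(q, q')"]) simp_all

lemma crit_funs_Rpl: "q \<in> ends es \<Longrightarrow> (a, b) \<in> set es \<Longrightarrow> Rpl \<alpha> q a b \<in> crit_funs \<alpha> es"
  unfolding crit_funs_def by (rule UnI1, rule UnI2, rule image_eqI[of _ _ "(q, a, b)"]) simp_all

lemma crit_funs_Rll: "(a, b) \<in> set es \<Longrightarrow> (a', b') \<in> set es \<Longrightarrow> Rll \<alpha> a b a' b' \<in> crit_funs \<alpha> es"
  unfolding crit_funs_def by (rule UnI2, rule image_eqI[of _ _ "((a, b), a', b')"]) simp_all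

section \<open>Constancy of the obstacles and of their order on a sector\<close>

locale sector =
  fixes \<alpha> sg :: real and I :: "real set" and es :: "(complex \<times> complex) list"
  assumes alpha: "0 < \<alpha>" "\<alpha> \<le> 1"
    and sg: "\<bar>sg\<bar> = 1"
    and connected_I: "connected I"
    and uniform: "\<And>f. f \<in> crit_funs \<alpha> es \<Longrightarrow> uniform sg I f"
begin

lemma uniform_pos:
  assumes "f \<in> crit_funs \<alpha> es" "t \<in> I" "t' \<in> I" "f (dir sg t) > 0"
  shows "f (dir sg t') > 0"
proof -
  consider "\<forall>t\<in>I. f (dir sg t) > 0" | "\<forall>t\<in>I. f (dir sg t) < 0" | "\<forall>t. f (dir sg t) = 0" | x where "I = {x}"
    using uniform[OF assms(1)] unfolding uniform_def by blast
  then show ?thesis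
  proof cases
    case 2 then show ?thesis using bspec[OF 2 assms(2)] assms(4) by linarith
  next
    case 3 then show ?thesis using spec[OF 3, of t] assms(4) by linarith
  qed (use assms in auto)
qed

lemma uniform_zero:
  assumes "f \<in> crit_funs \<alpha> es" "t \<in> I" "f (dir sg t) = 0"
  shows "(\<forall>t. f (dir sg t) = 0) \<or> I = {t}"
proof -
  consider "\<forall>t\<in>I. f (dir sg t) > 0" | "\<forall>t\<in>I. f (dir sg t) < 0" | "\<forall>t. f (dir sg t) = 0" | x where "I = {x}"
    using uniform[OF assms(1)] unfolding uniform_def by blast
  then show ?thesis
  proof cases
    case 1 then show ?thesis using bspec[OF 1 assms(2)] assms(3) by linarith
  next
    case 2 then show ?thesis using bspec[OF 2 assms(2)] assms(3) by linarith
  qed (use assms in auto)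
qed

text \<open>The sign of \<open>dot q u\<close> is controlled by the discriminant: as long as this is
  positive, its upper bound \<open>(dot q u)^2\<close> cannot vanish, and continuity does the
  rest.\<close>

lemma pt_valid_transfer:
  assumes q: "q \<in> ends es" and t: "t \<in> I" "t' \<in> I" and v: "pt_valid \<alpha> q (dir sg t)"
  shows "pt_valid \<alpha> q (dir sg t')"
proof -
  have f: "pt_disc \<alpha> q \<in> crit_funs \<alpha> es" using q by (auto simp: crit_funs_def)
  have d: "pt_disc \<alpha> q (dir sg s) > 0" if "s \<in> I" for s
    using uniform_pos[OF f t(1) that] v by (simp add: pt_valid_def)
  have nz: "dot q (dir sg s) \<noteq> 0" if "s \<in> I" for s
    using d[OF that] pt_disc_le[OF alpha, of q "dir sg s"] by auto
  have "continuous_on I (\<lambda>s. dot q (dir sg s))"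
    unfolding dot_def Re_dir Im_dir by (intro continuous_intros)
  then have "dot q (dir sg t') > 0"
    using positive_on_interval[OF connected_I, of "\<lambda>s. dot q (dir sg s)", OF _ nz t] v by (simp add: pt_valid_def)
  then show ?thesis using d[OF t(2)] by (simp add: pt_valid_def)
qed

lemma ln_valid_transfer:
  assumes e: "(a, b) \<in> set es" and t: "t \<in> I" "t' \<in> I" and v: "ln_valid \<alpha> a b (dir sg t)"
  shows "ln_valid \<alpha> a b (dir sg t')"
proof -
  have "ln_T1 \<alpha> a b \<in> crit_funs \<alpha> es" "ln_T2 \<alpha> a b \<in> crit_funs \<alpha> es"
    using e by (force simp: crit_funs_def)+
  then show ?thesis using uniform_pos t v unfolding ln_valid_def by blast
qed

lemma feats_transfer: "t \<in> I \<Longrightarrow> t' \<in> I \<Longrightarrow> feats \<alpha> es (dir sg t) = feats \<alpha> es (dir sg t')"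
proof -
  have "feats \<alpha> es (dir sg t) \<subseteq> feats \<alpha> es (dir sg t')" if "t \<in> I" "t' \<in> I" for t t'
    unfolding feats_def ends_def[symmetric]
    using pt_valid_transfer[OF _ that] ln_valid_transfer[OF _ that] by blast
  then show "t \<in> I \<Longrightarrow> t' \<in> I \<Longrightarrow> ?thesis" by blast
qed

lemma blocked_transfer:
  assumes t: "t \<in> I" "t' \<in> I" and b: "blocked \<alpha> es (dir sg t)"
  shows "blocked \<alpha> es (dir sg t')"
proof -
  obtain a b where ab: "(a, b) \<in> set es" "cross a b = 0" "dot a b \<le> 0"
    "pt_valid \<alpha> a (dir sg t) \<or> pt_valid \<alpha> b (dir sg t)"
    using b unfolding blocked_def by blast
  have "a \<in> ends es" "b \<in> ends es" using ab(1) by (force simp: ends_def)+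
  then have "pt_valid \<alpha> a (dir sg t') \<or> pt_valid \<alpha> b (dir sg t')"
    using ab(4) pt_valid_transfer[OF _ t] by blast
  then show ?thesis using ab unfolding blocked_def by blast
qed

lemma sval_feat_pos: "k \<in> feats \<alpha> es u \<Longrightarrow> sval k u > 0"
  using sval_pt_pos ln_num_pos alpha(1)
  by (auto simp: feats_def sval_ln ln_valid_def ln_num_def[symmetric])

lemma feat_coeff_pos: "k \<in> feats \<alpha> es u \<Longrightarrow> k ! 5 > 0"
  by (auto simp: feats_def pt_conic_def ln_conic_def Let_def ln_valid_def pt_valid_def dot_self)
    (auto simp: dot_def)

lemma feat_disc: "k \<in> feats \<alpha> es u \<Longrightarrow> sdisc k u \<ge> 0"
  by (auto simp: feats_def sdisc_pt sdisc_ln pt_valid_def)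

text \<open>Equal roots make the resultant vanish in one direction of the sector, hence identically
  unless the sector is a single direction. For two vertices this forces \<open>q = q'\<close>, for a
  vertex and a line it is impossible, and for two lines it is the claim itself.\<close>

lemma sval_eq_transfer:
  assumes k: "k \<in> feats \<alpha> es (dir sg t)" "k' \<in> feats \<alpha> es (dir sg t)" and t: "t \<in> I" "t' \<in> I"
    and eq: "sval k (dir sg t) = sval k' (dir sg t)"
  shows "sval k (dir sg t') = sval k' (dir sg t')"
proof -
  have pp: ?thesis if q: "q \<in> ends es" "q' \<in> ends es" "pt_valid \<alpha> q (dir sg t)" "pt_valid \<alpha> q' (dir sg t)"
    "k = pt_conic \<alpha> q" "k' = pt_conic \<alpha> q'" for q q'
  proof -
    have "Rpp \<alpha> q q' \<in> crit_funs \<alpha> es" using q(1,2) by (rule crit_funs_Rpp)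
    then have "(\<forall>t. Rpp \<alpha> q q' (dir sg t) = 0) \<or> I = {t}"
      using uniform_zero[OF _ t(1)] Rpp_zero[OF q(3,4)] eq q(5,6) by blast
    moreover have "q \<noteq> 0" "q' \<noteq> 0" using q(3,4) by (auto simp: pt_valid_def dot_def)
    ultimately have "q = q' \<or> I = {t}" using Rpp_identically_zero[OF sg, of \<alpha> q q'] by blast
    then show ?thesis using q(5,6) t eq by auto
  qed
  have pl: ?thesis if q: "q \<in> ends es" "(a, b) \<in> set es" "pt_valid \<alpha> q (dir sg t)" "ln_valid \<alpha> a b (dir sg t)"
    "sval (pt_conic \<alpha> q) (dir sg t) = sval (ln_conic \<alpha> a b) (dir sg t)" for q a b
  proof -
    have "Rpl \<alpha> q a b \<in> crit_funs \<alpha> es" using q(1,2) by (rule crit_funs_Rpl)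
    then have "(\<forall>t. Rpl \<alpha> q a b (dir sg t) = 0) \<or> I = {t}"
      using uniform_zero[OF _ t(1)] Rpl_zero[OF q(3,4) alpha(1) q(5)] by blast
    moreover have "q \<noteq> 0" using q(3) by (auto simp: pt_valid_def dot_def)
    moreover have "cross a b > 0" using q(4) by (simp add: ln_valid_def)
    ultimately have "I = {t}" using Rpl_not_identically_zero[OF sg, of \<alpha> q a b] alpha by blast
    then show ?thesis using t eq by simp
  qed
  have ll: ?thesis if q: "(a, b) \<in> set es" "(a', b') \<in> set es" "ln_valid \<alpha> a b (dir sg t)" "ln_valid \<alpha> a' b' (dir sg t)"
    "k = ln_conic \<alpha> a b" "k' = ln_conic \<alpha> a' b'" for a b a' b'
  proof -
    have c: "cross a b > 0" "cross a' b' > 0" using q by (auto simp: ln_valid_def)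
    note iff = Rll_zero_iff[OF c alpha(1)]
    have "Rll \<alpha> a b a' b' \<in> crit_funs \<alpha> es" using q(1,2) by (rule crit_funs_Rll)
    then have "(\<forall>t. Rll \<alpha> a b a' b' (dir sg t) = 0) \<or> I = {t}"
      using uniform_zero[OF _ t(1)] iff eq q(5,6) by blast
    then show ?thesis
    proof
      assume "I = {t}" then show ?thesis using t eq by simp
    qed (use iff q(5,6) in simp)
  qed
  have c: "(\<exists>q. q \<in> ends es \<and> pt_valid \<alpha> q (dir sg t) \<and> k = pt_conic \<alpha> q) \<or>
      (\<exists>a b. (a, b) \<in> set es \<and> ln_valid \<alpha> a b (dir sg t) \<and> k = ln_conic \<alpha> a b)"
    if "k \<in> feats \<alpha> es (dir sg t)" for k
    using that unfolding feats_def ends_def[symmetric] by blast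
  from c[OF k(1)] show ?thesis
  proof (elim disjE exE conjE)
    fix q assume q: "q \<in> ends es" "pt_valid \<alpha> q (dir sg t)" "k = pt_conic \<alpha> q"
    from c[OF k(2)] show ?thesis
    proof (elim disjE exE conjE)
      fix q' assume "q' \<in> ends es" "pt_valid \<alpha> q' (dir sg t)" "k' = pt_conic \<alpha> q'"
      then show ?thesis using pp[OF q(1) _ q(2) _ q(3)] by simp
    next
      fix a b assume "(a, b) \<in> set es" "ln_valid \<alpha> a b (dir sg t)" "k' = ln_conic \<alpha> a b"
      then show ?thesis using pl[OF q(1) _ q(2)] eq q(3) by simp
    qed
  next
    fix a b assume q: "(a, b) \<in> set es" "ln_valid \<alpha> a b (dir sg t)" "k = ln_conic \<alpha> a b"
    from c[OF k(2)] show ?thesis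
    proof (elim disjE exE conjE)
      fix q' assume "q' \<in> ends es" "pt_valid \<alpha> q' (dir sg t)" "k' = pt_conic \<alpha> q'"
      then show ?thesis using pl[OF _ q(1) _ q(2)] eq q(3) by simp
    next
      fix a' b' assume "(a', b') \<in> set es" "ln_valid \<alpha> a' b' (dir sg t)" "k' = ln_conic \<alpha> a' b'"
      then show ?thesis using ll[OF q(1) _ q(2) _ q(3)] by simp
    qed
  qed
qed

text \<open>A change of the order would pass through an equality, which would then hold on the whole
  sector.\<close>

lemma sval_le_transfer:
  assumes k: "k \<in> feats \<alpha> es (dir sg t)" "k' \<in> feats \<alpha> es (dir sg t)" and t: "t \<in> I" "t' \<in> I"
    and le: "sval k' (dir sg t) \<le> sval k (dir sg t)"
  shows "sval k' (dir sg t') \<le> sval k (dir sg t')"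
proof (rule ccontr)
  assume n: "\<not> ?thesis"
  have "sval k' (dir sg s) - sval k (dir sg s) \<noteq> 0" if s: "s \<in> I" for s
  proof
    assume "sval k' (dir sg s) - sval k (dir sg s) = 0"
    then have eq: "sval k (dir sg s) = sval k' (dir sg s)" by linarith
    have "k \<in> feats \<alpha> es (dir sg s)" "k' \<in> feats \<alpha> es (dir sg s)"
      using k unfolding feats_transfer[OF t(1) s] by blast+
    from sval_eq_transfer[OF this s t(2) eq] show False using n by linarith
  qed
  moreover have "continuous_on I (\<lambda>s. sval k' (dir sg s) - sval k (dir sg s))"
    by (rule continuous_on_diff[OF continuous_sval continuous_sval])
  moreover have "sval k' (dir sg t') - sval k (dir sg t') > 0" using n by linarith
  ultimately have "sval k' (dir sg t) - sval k (dir sg t) > 0"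
    using positive_on_interval[of I "\<lambda>s. sval k' (dir sg s) - sval k (dir sg s)" t' t, OF connected_I _ _ t(2) t(1)]
    by blast
  then show False using le by simp
qed

end

section \<open>Sectors of curved triangles\<close>

definition shift_conic :: "complex \<Rightarrow> real list \<Rightarrow> real list" where
  "shift_conic p k = [k!0, k!1, k!2,
     k!3 - 2 * k!0 * Re p - k!1 * Im p,
     k!4 - 2 * k!2 * Im p - k!1 * Re p,
     k!5 + k!0 * (Re p)\<^sup>2 + k!1 * Re p * Im p + k!2 * (Im p)\<^sup>2 - k!3 * Re p - k!4 * Im p]"

lemma conic_val_shift: "conic_val (shift_conic p k) (p + z) = conic_val k z"
  by (simp add: conic_val_def shift_conic_def power2_eq_square algebra_simps)

lemma conic_val_ray:
  "conic_val k (of_real \<tau> * u) = k!5 - 2 * \<tau> * sbeta k u + \<tau>\<^sup>2 * sgamma k u"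
  by (simp add: conic_val_def sbeta_def sgamma_def power_mult_distrib) (simp add: power2_eq_square algebra_simps)

text \<open>On the ray the conic is a quadratic in \<open>s = 1 / \<tau>\<close>, divided by
  \<open>s^2\<close>, and beyond its largest root this quadratic is positive.\<close>

lemma conic_val_ray_pos:
  assumes k: "k ! 5 > 0" "sdisc k u \<ge> 0" "sval k u > 0" and \<tau>: "0 \<le> \<tau>" "\<tau> < 1 / sval k u"
  shows "conic_val k (of_real \<tau> * u) > 0"
proof (cases "\<tau> = 0")
  case True
  then show ?thesis using k by (simp add: conic_val_def)
next
  case False
  define s where "s = 1 / \<tau>"
  have s: "s > 0" "\<tau> = 1 / s" using \<tau> False by (auto simp: s_def)
  have "s > sval k u" using \<tau> k(3) s by (simp add: field_simps)
  then have "k ! 5 * s - sbeta k u > sqrt (sdisc k u)" using k(1) by (simp add: sval_def field_simps)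
  then have "(k ! 5 * s - sbeta k u)\<^sup>2 > (sqrt (sdisc k u))\<^sup>2"
    using k(2) by (intro power_strict_mono) auto
  then have "k ! 5 * (k ! 5 * s\<^sup>2 - 2 * s * sbeta k u + sgamma k u) > 0"
    using k(2) by (simp add: sdisc_def power2_eq_square algebra_simps)
  then have "k ! 5 * s\<^sup>2 - 2 * s * sbeta k u + sgamma k u > 0" using k(1) by (simp add: zero_less_mult_iff)
  moreover have "conic_val k (of_real \<tau> * u) = (k ! 5 * s\<^sup>2 - 2 * s * sbeta k u + sgamma k u) / s\<^sup>2"
    unfolding conic_val_ray s(2) using s(1) by (simp add: field_simps power2_eq_square)
  ultimately show ?thesis using s(1) by simp
qed

lemma conic_val_ray_zero:
  assumes k: "k ! 5 > 0" "sdisc k u \<ge> 0" "sval k u > 0"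
  shows "conic_val k (of_real (1 / sval k u) * u) = 0"
proof -
  have "conic_val k (of_real (1 / sval k u) * u) =
      (k ! 5 * (sval k u)\<^sup>2 - 2 * sbeta k u * sval k u + sgamma k u) / (sval k u)\<^sup>2"
    unfolding conic_val_ray using k(3) by (simp add: field_simps power2_eq_square)
  then show ?thesis using sval_root[of k u] k by simp
qed

section \<open>Directions, wedges and cells in the stereographic parameter\<close>

definition sector_set :: "complex \<Rightarrow> real \<Rightarrow> real \<Rightarrow> real \<Rightarrow> complex set" where
  "sector_set p sg t1 t2 = {p + of_real l * dir sg t | l t. l > 0 \<and> t1 < t \<and> t < t2}"

text \<open>The parameter \<open>Y / (r + X)\<close> is the tangent of half the polar angle, and the
  factor \<open>(r + X) / 2\<close> compensates the norm \<open>1 + t^2\<close> of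
  \<open>dir\<close>.\<close>

lemma half_plane_dir:
  assumes sg: "\<bar>sg\<bar> = 1" and X: "sg * Re z \<ge> 0" and z: "z \<noteq> 0"
  shows "\<exists>l>0. \<exists>t. \<bar>t\<bar> \<le> 1 \<and> z = of_real l * dir sg t"
proof -
  define X where "X = sg * Re z" define Y where "Y = sg * Im z"
  define r where "r = norm z"
  have sg2: "sg * sg = 1" using sg by (auto simp: abs_if split: if_splits)
  have r2: "r\<^sup>2 = X\<^sup>2 + Y\<^sup>2"
  proof -
    have "X\<^sup>2 + Y\<^sup>2 = (sg * sg) * ((Re z)\<^sup>2 + (Im z)\<^sup>2)"
      by (simp add: X_def Y_def power2_eq_square algebra_simps)
    then show ?thesis by (simp add: sg2 r_def cmod_power2)
  qed
  have r: "r > 0" using z by (simp add: r_def)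
  have s: "r + X > 0" using X r by (simp add: X_def)
  define t where "t = Y / (r + X)"
  have "\<bar>Y\<bar> \<le> r" using sg abs_Im_le_cmod[of z] by (simp add: Y_def r_def abs_mult)
  then have "\<bar>t\<bar> \<le> 1" using s X by (simp add: t_def X_def)
  moreover have "z = of_real ((r + X) / 2) * dir sg t"
  proof -
    have tY: "t * (r + X) = Y" using s by (simp add: t_def)
    have "(r + X) * (r + X) * (1 - t\<^sup>2) = (r + X)\<^sup>2 - (t * (r + X))\<^sup>2"
      by (simp add: power2_eq_square algebra_simps)
    also have "\<dots> = (r + X) * (2 * X)" unfolding tY using r2 by (simp add: power2_eq_square algebra_simps)
    finally have "(r + X) * (1 - t\<^sup>2) = 2 * X" using s by simp
    moreover have "(r + X) / 2 * (sg * (1 - t\<^sup>2)) = sg * ((r + X) * (1 - t\<^sup>2)) / 2" by simp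
    ultimately have "(r + X) / 2 * (sg * (1 - t\<^sup>2)) = sg * X" by simp
    moreover have "(r + X) / 2 * (sg * (2 * t)) = sg * Y" unfolding tY[symmetric] by simp
    moreover have "sg * X = Re z" "sg * Y = Im z" using sg2 by (simp_all add: X_def Y_def flip: mult.assoc)
    ultimately show ?thesis by (simp add: complex_eq_iff)
  qed
  ultimately show ?thesis using s by (intro exI[of _ "(r + X) / 2"] conjI exI[of _ t]) auto
qed

text \<open>The direction \<open>t = 1\<close> of one chart is the direction \<open>t = -1\<close>
  of the other, so the charts are used half-open; the choice of \<open>sg\<close> on the imaginary
  axis avoids \<open>t = 1\<close>.\<close>

lemma dir_cover:
  assumes "z \<noteq> 0"
  shows "\<exists>sg\<in>{1, -1}. \<exists>t. -1 \<le> t \<and> t < 1 \<and> (\<exists>l>0. z = of_real l * dir sg t)"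
proof -
  define sg :: real where "sg = (if Re z > 0 \<or> Re z = 0 \<and> Im z < 0 then 1 else -1)"
  have "\<bar>sg\<bar> = 1" "sg * Re z \<ge> 0" by (auto simp: sg_def)
  from half_plane_dir[OF this assms] obtain l t where lt: "l > 0" "\<bar>t\<bar> \<le> 1" "z = of_real l * dir sg t" by blast
  have "t \<noteq> 1"
  proof
    assume "t = 1"
    then have "Re z = 0" "Im z = 2 * l * sg" using lt(3) by auto
    then show False using lt(1) by (auto simp: sg_def mult_less_0_iff split: if_splits)
  qed
  then show ?thesis using lt by (intro bexI[of _ sg] exI[of _ t] conjI exI[of _ l]) (auto simp: sg_def)
qed

lemma dir_unique:
  assumes "\<bar>sg\<bar> = 1" "\<bar>sg'\<bar> = 1" "l > 0" "l' > 0" "\<bar>t\<bar> < 1" "\<bar>t'\<bar> < 1"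
    and eq: "of_real l * dir sg t = of_real l' * dir sg' t'"
  shows "sg = sg' \<and> t = t'"
proof -
  have p: "1 - s\<^sup>2 > 0" if "\<bar>s\<bar> < 1" for s :: real
    using that by (simp add: abs_square_less_1)
  have re: "l * (sg * (1 - t\<^sup>2)) = l' * (sg' * (1 - t'\<^sup>2))" and im: "l * (sg * (2 * t)) = l' * (sg' * (2 * t'))"
    using eq by (simp_all add: complex_eq_iff)
  have "norm (of_real l * dir sg t) = norm (of_real l' * dir sg' t')" using eq by simp
  then have n: "l * (1 + t\<^sup>2) = l' * (1 + t'\<^sup>2)" using assms(1-4) by (simp add: norm_mult norm_dir)
  define X X' where "X = l * (1 - t\<^sup>2)" and "X' = l' * (1 - t'\<^sup>2)"
  have "X > 0" "X' > 0" using p assms(3-6) by (simp_all add: X_def X'_def)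
  moreover have "sg * X = sg' * X'" using re by (simp add: X_def X'_def mult.left_commute)
  ultimately have sg: "sg = sg'" using assms(1,2) by (auto simp: abs_if split: if_splits)
  then have "l * (1 - t\<^sup>2) = l' * (1 - t'\<^sup>2)" using re assms(1) by auto
  then have "l = l'" using n by (simp add: algebra_simps)
  then show ?thesis using im sg assms(1,3) by auto
qed

lemma one_plus_mult_nonneg:
  fixes v s :: real
  assumes "\<bar>v\<bar> \<le> 1" "\<bar>s\<bar> \<le> 1"
  shows "1 + v * s \<ge> 0"
proof -
  have "\<bar>v * s\<bar> \<le> 1" unfolding abs_mult using assms by (intro mult_le_one) auto
  then show ?thesis by linarith
qed

lemma one_plus_mult_pos:
  fixes v s :: real
  assumes "\<bar>v\<bar> < 1" "\<bar>s\<bar> \<le> 1"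
  shows "1 + v * s > 0"
proof -
  have "\<bar>v * s\<bar> \<le> \<bar>v\<bar> * 1" unfolding abs_mult using assms by (intro mult_left_mono) auto
  then show ?thesis using assms by linarith
qed

text \<open>The full range from -1 to 1 is excluded because opposite end directions span only a
  line. Otherwise Cramer's rule gives the coefficients of a direction by its cross products with the
  end directions, whose signs say that \<open>t\<close> lies between \<open>t1\<close> and
  \<open>t2\<close>.\<close>

lemma wedge_dir:
  assumes sg: "\<bar>sg\<bar> = 1" and t: "-1 \<le> t1" "t1 \<le> t2" "t2 \<le> 1" "t1 < 1" "\<not> (t1 = -1 \<and> t2 = 1)" and m: "m1 > 0" "m2 > 0"
  shows "wedge p (p + of_real m1 * dir sg t1) (p + of_real m2 * dir sg t2) =
    {p + of_real l * dir sg t | l t. l \<ge> 0 \<and> t1 \<le> t \<and> t \<le> t2}"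
proof -
  let ?u = "dir sg"
  have W: "wedge p (p + of_real m1 * ?u t1) (p + of_real m2 * ?u t2) =
      {p + of_real x * ?u t1 + of_real y * ?u t2 | x y. x \<ge> 0 \<and> y \<ge> 0}" (is "?L = ?R")
  proof
    show "?L \<subseteq> ?R"
    proof
      fix g assume "g \<in> ?L"
      then obtain x y where "x \<ge> 0" "y \<ge> 0"
        "g = p + of_real x * (of_real m1 * ?u t1) + of_real y * (of_real m2 * ?u t2)"
        unfolding wedge_def by auto
      then show "g \<in> ?R" using m
        by (intro CollectI exI[of _ "x * m1"] exI[of _ "y * m2"]) (simp add: mult.assoc)
    qed
    show "?R \<subseteq> ?L"
    proof clarify
      fix x y :: real assume "x \<ge> 0" "y \<ge> 0"
      then show "p + of_real x * ?u t1 + of_real y * ?u t2 \<in> ?L" unfolding wedge_def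
        using m by (intro CollectI exI[of _ "x / m1"] exI[of _ "y / m2"]) auto
    qed
  qed
  show ?thesis
  proof (cases "t1 = t2")
    case True
    have "p + of_real x * ?u t2 + of_real y * ?u t2 = p + of_real (x + y) * ?u t2" for x y :: real
      by (simp add: algebra_simps)
    note sum = this
    have "{p + of_real x * ?u t2 + of_real y * ?u t2 | x y. x \<ge> 0 \<and> y \<ge> 0} =
      {p + of_real l * ?u t | l t. l \<ge> 0 \<and> t2 \<le> t \<and> t \<le> t2}"
    proof (intro equalityI subsetI)
      fix g assume "g \<in> {p + of_real x * ?u t2 + of_real y * ?u t2 | x y. x \<ge> 0 \<and> y \<ge> 0}"
      then obtain x y where "x \<ge> 0" "y \<ge> 0" "g = p + of_real x * ?u t2 + of_real y * ?u t2" by blast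
      then show "g \<in> {p + of_real l * ?u t | l t. l \<ge> 0 \<and> t2 \<le> t \<and> t \<le> t2}"
        unfolding sum by (intro CollectI exI[of _ "x + y"] exI[of _ t2]) simp
    next
      fix g assume "g \<in> {p + of_real l * ?u t | l t. l \<ge> 0 \<and> t2 \<le> t \<and> t \<le> t2}"
      then obtain l where "l \<ge> 0" "g = p + of_real l * ?u t2" by force
      then show "g \<in> {p + of_real x * ?u t2 + of_real y * ?u t2 | x y. x \<ge> 0 \<and> y \<ge> 0}"
        by (intro CollectI exI[of _ l] exI[of _ 0]) simp
    qed
    then show ?thesis unfolding W using True by simp
  next
    case False
    then have lt: "t1 < t2" using t by simp
    have cr: "cross (?u t1) (?u t2) > 0"
    proof -
      have a: "\<bar>t1\<bar> \<le> 1" "\<bar>t2\<bar> \<le> 1" using t by auto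
      have "1 + t1 * t2 > 0"
      proof (cases "\<bar>t1\<bar> < 1 \<or> \<bar>t2\<bar> < 1")
        case True
        then show ?thesis using one_plus_mult_pos[of t1 t2] one_plus_mult_pos[of t2 t1] a by (auto simp: mult.commute)
      next
        case False
        then have "t1 = -1" "t2 = -1 \<or> t2 = 1" using t a by linarith+
        then show ?thesis using t lt by auto
      qed
      then show ?thesis using lt by (simp add: cross_dir[OF sg])
    qed
    show ?thesis unfolding W
    proof (intro equalityI subsetI)
      fix g assume "g \<in> {p + of_real x * ?u t1 + of_real y * ?u t2 | x y. x \<ge> 0 \<and> y \<ge> 0}"
      then obtain x y where xy: "x \<ge> 0" "y \<ge> 0" "g = p + (of_real x * ?u t1 + of_real y * ?u t2)"
        by (auto simp: add.assoc)
      define z where "z = of_real x * ?u t1 + of_real y * ?u t2"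
      show "g \<in> {p + of_real l * ?u t | l t. l \<ge> 0 \<and> t1 \<le> t \<and> t \<le> t2}"
      proof (cases "z = 0")
        case True
        then have "g = p + of_real 0 * ?u t1" using xy(3) unfolding z_def[symmetric] by simp
        then show ?thesis using t by (intro CollectI exI[of _ 0] exI[of _ t1]) simp
      next
        case False
        have "sg * Re z = (sg * sg) * (x * (1 - t1\<^sup>2) + y * (1 - t2\<^sup>2))"
          by (simp add: z_def algebra_simps)
        moreover have "sg * sg = 1" using sg by (auto simp: abs_if split: if_splits)
        moreover have "t1\<^sup>2 \<le> 1" "t2\<^sup>2 \<le> 1" using t by (auto simp: abs_square_le_1)
        ultimately have "sg * Re z \<ge> 0" using xy by simp
        from half_plane_dir[OF sg this False] obtain l s where ls: "l > 0" "\<bar>s\<bar> \<le> 1" "z = of_real l * ?u s" by blast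
        have "cross (?u t1) z = y * cross (?u t1) (?u t2)" "cross z (?u t2) = x * cross (?u t1) (?u t2)"
          by (simp_all add: z_def cross_def algebra_simps)
        then have "cross (?u t1) z \<ge> 0" "cross z (?u t2) \<ge> 0" using xy cr by simp_all
        moreover have "cross (?u t1) z = l * cross (?u t1) (?u s)" "cross z (?u t2) = l * cross (?u s) (?u t2)"
          by (simp_all add: ls(3) cross_def algebra_simps)
        ultimately have *: "(s - t1) * (1 + t1 * s) \<ge> 0" "(t2 - s) * (1 + s * t2) \<ge> 0"
          using ls(1) by (simp_all add: cross_dir[OF sg] zero_le_mult_iff)
        note pr = one_plus_mult_pos[OF _ ls(2)]
        have "t1 \<le> s"
        \<comment> \<open>For \<open>t1 = -1\<close> the factor \<open>1 + t1 * s\<close> may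
          vanish, but then \<open>\<bar>s\<bar> \<le> 1\<close> already gives the claim.\<close>
        proof (cases "t1 = -1")
          case False
          then have "1 + t1 * s > 0" using pr[of t1] t by auto
          then show ?thesis using *(1) by (simp add: zero_le_mult_iff)
        qed (use ls in auto)
        moreover have "s \<le> t2"
        proof (cases "t2 = 1")
          case False
          then have "1 + s * t2 > 0" using pr[of t2] t lt by (auto simp: mult.commute)
          then show ?thesis using *(2) by (simp add: zero_le_mult_iff)
        qed (use ls in auto)
        ultimately show ?thesis using ls xy unfolding z_def[symmetric]
          by (intro CollectI exI[of _ l] exI[of _ s]) auto
      qed
    next
      fix g assume "g \<in> {p + of_real l * ?u t | l t. l \<ge> 0 \<and> t1 \<le> t \<and> t \<le> t2}"
      then obtain l s where ls: "l \<ge> 0" "t1 \<le> s" "s \<le> t2" "g = p + of_real l * ?u s" by blast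
      define c where "c = cross (?u t1) (?u t2)"
      have "\<bar>s\<bar> \<le> 1" using ls t by auto
      note ge = one_plus_mult_nonneg[OF _ this]
      have "cross (?u t1) (?u s) \<ge> 0" "cross (?u s) (?u t2) \<ge> 0"
        unfolding cross_dir[OF sg] using ls t ge[of t1] ge[of t2] by (auto simp: mult.commute)
      moreover have "of_real l * ?u s = of_real (l * cross (?u s) (?u t2) / c) * ?u t1 + of_real (l * cross (?u t1) (?u s) / c) * ?u t2"
      proof -
        have "?u s * of_real c = of_real (cross (?u s) (?u t2)) * ?u t1 + of_real (cross (?u t1) (?u s)) * ?u t2"
          unfolding c_def complex_eq_iff cross_def by (simp add: algebra_simps)
        then have "?u s = (of_real (cross (?u s) (?u t2)) * ?u t1 + of_real (cross (?u t1) (?u s)) * ?u t2) / of_real c"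
          using cr by (simp add: c_def field_simps)
        then have "of_real l * ?u s = of_real l * ((of_real (cross (?u s) (?u t2)) * ?u t1 + of_real (cross (?u t1) (?u s)) * ?u t2) / of_real c)"
          by (rule arg_cong)
        then show ?thesis by (simp add: field_simps add_divide_distrib)
      qed
      ultimately have "g = p + of_real (l * cross (?u s) (?u t2) / c) * ?u t1 + of_real (l * cross (?u t1) (?u s) / c) * ?u t2"
        "l * cross (?u s) (?u t2) / c \<ge> 0" "l * cross (?u t1) (?u s) / c \<ge> 0"
        using ls(1,4) cr by (simp_all add: c_def[symmetric] add.assoc)
      then show "g \<in> {p + of_real x * ?u t1 + of_real y * ?u t2 | x y. x \<ge> 0 \<and> y \<ge> 0}" by blast
    qed
  qed
qed

text \<open>The set lies in two closed half planes through \<open>p\<close>, whose interiors are the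
  open ones. Strictness excludes \<open>p\<close> and the end directions.\<close>

lemma interior_wedge_dir:
  assumes sg: "\<bar>sg\<bar> = 1" and t: "-1 \<le> t1" "t1 \<le> t2" "t2 \<le> 1"
    and S: "S \<subseteq> {p + of_real l * dir sg t | l t. l \<ge> 0 \<and> t1 \<le> t \<and> t \<le> t2}"
  shows "interior S \<subseteq> sector_set p sg t1 t2"
proof -
  let ?u = "dir sg"
  define v1 where "v1 = Complex (- Im (?u t1)) (Re (?u t1))"
  define v2 where "v2 = Complex (Im (?u t2)) (- Re (?u t2))"
  have v: "inner v1 z = cross (?u t1) z" "inner v2 z = cross z (?u t2)" for z
    by (simp_all add: v1_def v2_def cross_def inner_complex_def)
  have v0: "v1 \<noteq> 0" "v2 \<noteq> 0"
    using dir_nonzero[OF sg, of t1] dir_nonzero[OF sg, of t2] by (auto simp: v1_def v2_def complex_eq_iff)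
  note ge = one_plus_mult_nonneg
  have cl: "cross (?u t1) (of_real l * ?u s) = l * (2 * (s - t1) * (1 + t1 * s))"
    "cross (of_real l * ?u s) (?u t2) = l * (2 * (t2 - s) * (1 + s * t2))" for l s
    unfolding cross_dir[OF sg, symmetric] by (simp_all add: cross_def algebra_simps)
  have iv: "inner v1 (p + of_real l * ?u s) = inner v1 p + l * (2 * (s - t1) * (1 + t1 * s))"
    "inner v2 (p + of_real l * ?u s) = inner v2 p + l * (2 * (t2 - s) * (1 + s * t2))" for l s
    unfolding inner_add_right v(1)[of "of_real l * ?u s"] v(2)[of "of_real l * ?u s"] cl by simp_all
  have "S \<subseteq> {z. inner v1 z \<ge> inner v1 p} \<inter> {z. inner v2 z \<ge> inner v2 p}"
  proof
    fix g assume "g \<in> S"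
    then obtain l s where ls: "l \<ge> 0" "t1 \<le> s" "s \<le> t2" "g = p + of_real l * ?u s" using S by blast
    have "1 + t1 * s \<ge> 0" "1 + s * t2 \<ge> 0" by (rule ge; use ls t in linarith)+
    then have "l * (2 * (s - t1) * (1 + t1 * s)) \<ge> 0" "l * (2 * (t2 - s) * (1 + s * t2)) \<ge> 0"
      using ls(1-3) by simp_all
    then show "g \<in> {z. inner v1 z \<ge> inner v1 p} \<inter> {z. inner v2 z \<ge> inner v2 p}"
      unfolding ls(4) by (simp only: iv mem_Collect_eq Int_iff) linarith
  qed
  then have "interior S \<subseteq> interior {z. inner v1 z \<ge> inner v1 p} \<inter> interior {z. inner v2 z \<ge> inner v2 p}"
    unfolding interior_Int[symmetric] by (rule interior_mono)
  then have sub: "interior S \<subseteq> {z. inner v1 z > inner v1 p} \<inter> {z. inner v2 z > inner v2 p}"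
    unfolding interior_halfspace_ge[OF v0(1)] interior_halfspace_ge[OF v0(2)] by auto
  show ?thesis
  proof
    fix g assume g: "g \<in> interior S"
    then obtain l s where ls: "l \<ge> 0" "t1 \<le> s" "s \<le> t2" "g = p + of_real l * ?u s" using S interior_subset[of S] by blast
    have "inner v1 g > inner v1 p" "inner v2 g > inner v2 p" using sub g by blast+
    then have "l * (2 * (s - t1) * (1 + t1 * s)) > 0" "l * (2 * (t2 - s) * (1 + s * t2)) > 0"
      unfolding ls(4) iv by linarith+
    then have "l \<noteq> 0" "s \<noteq> t1" "s \<noteq> t2" by auto
    then show "g \<in> sector_set p sg t1 t2" unfolding sector_set_def using ls
      by (intro CollectI exI[of _ l] exI[of _ s]) auto
  qed
qed

text \<open>In polar form the curved triangle has the radius \<open>1 / sval\<close>: before it the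
  conic is positive, and at it the conic is zero.\<close>

lemma cell_dir:
  assumes sg: "\<bar>sg\<bar> = 1" and t: "-1 \<le> t1" "t1 \<le> t2" "t2 \<le> 1" "t1 < 1" "\<not> (t1 = -1 \<and> t2 = 1)"
    and k: "k ! 5 > 0" "\<And>t. t1 \<le> t \<Longrightarrow> t \<le> t2 \<Longrightarrow> sdisc k (dir sg t) \<ge> 0 \<and> sval k (dir sg t) > 0"
    and T: "T = \<lparr>corner1 = p + of_real (1 / sval k (dir sg t1)) * dir sg t1,
      corner2 = p + of_real (1 / sval k (dir sg t2)) * dir sg t2, conic = shift_conic p k\<rparr>"
  shows "cell p T = {p + of_real l * dir sg t | l t. 0 \<le> l \<and> t1 \<le> t \<and> t \<le> t2 \<and> l \<le> 1 / sval k (dir sg t)}" (is "_ = ?R")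
    and "corners_on_arc p T"
proof -
  let ?u = "dir sg"
  have W: "wedge p (corner1 T) (corner2 T) = {p + of_real l * ?u t | l t. l \<ge> 0 \<and> t1 \<le> t \<and> t \<le> t2}"
  proof -
    have "1 / sval k (?u t1) > 0" "1 / sval k (?u t2) > 0" using k(2)[of t1] k(2)[of t2] t(2) by auto
    from wedge_dir[OF sg t this] show ?thesis unfolding T by simp
  qed
  have seg: "closed_segment p (p + of_real l * ?u s) - {p + of_real l * ?u s} = {p + of_real m * ?u s | m. 0 \<le> m \<and> m < l}"
    if "l > 0" for l s
  proof (intro equalityI subsetI)
    fix x assume x: "x \<in> closed_segment p (p + of_real l * ?u s) - {p + of_real l * ?u s}"
    then obtain \<eta> where \<eta>: "0 \<le> \<eta>" "\<eta> \<le> 1" "x = (1 - \<eta>) *\<^sub>R p + \<eta> *\<^sub>R (p + of_real l * ?u s)" by (auto simp: in_segment)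
    then have x': "x = p + of_real (\<eta> * l) * ?u s" by (simp add: scaleR_conv_of_real algebra_simps)
    then have "\<eta> \<noteq> 1" using x by auto
    then have "\<eta> * l < l" using \<eta> that by simp
    then show "x \<in> {p + of_real m * ?u s | m. 0 \<le> m \<and> m < l}"
      unfolding x' using \<eta>(1) that by (intro CollectI exI[of _ "\<eta> * l"]) simp
  next
    fix x assume "x \<in> {p + of_real m * ?u s | m. 0 \<le> m \<and> m < l}"
    then obtain m where m: "0 \<le> m" "m < l" "x = p + of_real m * ?u s" by blast
    have "x = (1 - m / l) *\<^sub>R p + (m / l) *\<^sub>R (p + of_real l * ?u s)"
      using that by (simp add: m(3) scaleR_conv_of_real algebra_simps)
    moreover have "0 \<le> m / l" "m / l \<le> 1" using m that by simp_all
    ultimately have "x \<in> closed_segment p (p + of_real l * ?u s)" unfolding in_segment by blast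
    moreover have "x \<noteq> p + of_real l * ?u s" using m dir_nonzero[OF sg] by simp
    ultimately show "x \<in> closed_segment p (p + of_real l * ?u s) - {p + of_real l * ?u s}" by simp
  qed
  have conic: "conic_val (conic T) (p + z) = conic_val k z" for z
    by (simp add: T conic_val_shift)
  have iff: "(\<forall>x\<in>closed_segment p (p + of_real l * ?u s) - {p + of_real l * ?u s}. conic_val (conic T) x > 0)
      \<longleftrightarrow> l \<le> 1 / sval k (?u s)" if "l \<ge> 0" "t1 \<le> s" "s \<le> t2" for l s
  proof (cases "l = 0")
    case True
    then show ?thesis using k(2)[OF that(2,3)] by simp
  next
    case False
    then have l: "l > 0" using that by simp
    have ks: "sdisc k (?u s) \<ge> 0" "sval k (?u s) > 0" using k(2)[OF that(2,3)] by auto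
    show ?thesis unfolding seg[OF l]
    proof
      assume *: "\<forall>x\<in>{p + of_real m * ?u s | m. 0 \<le> m \<and> m < l}. conic_val (conic T) x > 0"
      show "l \<le> 1 / sval k (?u s)"
      proof (rule ccontr)
        assume "\<not> l \<le> 1 / sval k (?u s)"
        then have "p + of_real (1 / sval k (?u s)) * ?u s \<in> {p + of_real m * ?u s | m. 0 \<le> m \<and> m < l}"
          using ks(2) by (intro CollectI exI[of _ "1 / sval k (?u s)"]) simp
        then have "conic_val k (of_real (1 / sval k (?u s)) * ?u s) > 0" using * unfolding conic[symmetric] by blast
        then show False using conic_val_ray_zero[OF k(1) ks] by linarith
      qed
    next
      assume le: "l \<le> 1 / sval k (?u s)"
      show "\<forall>x\<in>{p + of_real m * ?u s | m. 0 \<le> m \<and> m < l}. conic_val (conic T) x > 0"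
      proof
        fix x assume "x \<in> {p + of_real m * ?u s | m. 0 \<le> m \<and> m < l}"
        then obtain m where m: "x = p + of_real m * ?u s" "0 \<le> m" "m < l" by blast
        show "conic_val (conic T) x > 0"
          unfolding m(1) conic by (rule conic_val_ray_pos[OF k(1) ks m(2)]) (use m(3) le in linarith)
      qed
    qed
  qed
  show c: "cell p T = ?R"
  proof (intro equalityI subsetI)
    fix g assume "g \<in> cell p T"
    then have g: "g \<in> wedge p (corner1 T) (corner2 T)" "\<forall>x\<in>closed_segment p g - {g}. conic_val (conic T) x > 0"
      by (auto simp: cell_def)
    then obtain l s where ls: "l \<ge> 0" "t1 \<le> s" "s \<le> t2" "g = p + of_real l * ?u s" unfolding W by blast
    then have "l \<le> 1 / sval k (?u s)" using g(2) iff[OF ls(1-3)] by blast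
    then show "g \<in> ?R" using ls by blast
  next
    fix g assume "g \<in> ?R"
    then obtain l s where ls: "l \<ge> 0" "t1 \<le> s" "s \<le> t2" "g = p + of_real l * ?u s" "l \<le> 1 / sval k (?u s)" by blast
    then have "g \<in> wedge p (corner1 T) (corner2 T)" unfolding W by blast
    moreover have "\<forall>x\<in>closed_segment p g - {g}. conic_val (conic T) x > 0"
      unfolding ls(4) using iff[OF ls(1-3)] ls(5) by blast
    ultimately show "g \<in> cell p T" unfolding cell_def by blast
  qed
  have corner: "p + of_real (1 / sval k (?u s)) * ?u s \<in> cell p T \<and>
      conic_val (conic T) (p + of_real (1 / sval k (?u s)) * ?u s) = 0" if "t1 \<le> s" "s \<le> t2" for s
  proof
    have ks: "sdisc k (?u s) \<ge> 0" "sval k (?u s) > 0" using k(2)[OF that] by auto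
    show "conic_val (conic T) (p + of_real (1 / sval k (?u s)) * ?u s) = 0"
      unfolding conic by (rule conic_val_ray_zero[OF k(1) ks])
    show "p + of_real (1 / sval k (?u s)) * ?u s \<in> cell p T"
      unfolding c by (intro CollectI exI[of _ "1 / sval k (?u s)"] exI[of _ s] conjI) (use that ks in simp_all)
  qed
  show "corners_on_arc p T"
    using corner[of t1] corner[of t2] t(2) by (simp add: corners_on_arc_def T)
qed

section \<open>The region along a ray and in one sector\<close>

lemma clear_scale:
  assumes "clear \<alpha> es z" "0 < l" "l \<le> 1"
  shows "clear \<alpha> es (of_real l * z)"
  unfolding clear_def
proof (intro ballI)
  fix e x \<tau> assume e: "e \<in> set es" "x \<in> seg e" "\<tau> \<in> {0<..1::real}"
  then have "\<tau> * l \<in> {0<..1}" using assms by (auto simp: mult_le_one)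
  then have "\<alpha> * (\<tau> * l) * norm z \<le> norm (x - of_real (\<tau> * l) * z)" using assms(1) e unfolding clear_def by blast
  then show "\<alpha> * \<tau> * norm (of_real l * z) \<le> norm (x - of_real \<tau> * (of_real l * z))"
    using assms by (simp add: norm_mult mult.assoc)
qed

lemma clear_avoids:
  assumes "clear \<alpha> es z" "z \<noteq> 0" "\<alpha> > 0" "e \<in> set es"
  shows "z \<notin> seg e"
proof
  assume "z \<in> seg e"
  then have "\<alpha> * 1 * norm z \<le> norm (z - of_real 1 * z)" using assms(1,4) unfolding clear_def
    by (metis greaterThanAtMost_iff order_refl zero_less_one)
  then show False using assms by (simp add: mult_le_0_iff)
qed

definition tip_at :: "complex \<Rightarrow> real list \<Rightarrow> real \<Rightarrow> real \<Rightarrow> complex" where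
  "tip_at p k sg t = p + of_real (1 / sval k (dir sg t)) * dir sg t"

definition sector_piece :: "complex \<Rightarrow> real list \<Rightarrow> real \<Rightarrow> real \<Rightarrow> real \<Rightarrow> piece" where
  "sector_piece p k sg t1 t2 = \<lparr>corner1 = tip_at p k sg t1, corner2 = tip_at p k sg t2, conic = shift_conic p k\<rparr>"

context star_region
begin

text \<open>A clear part of a ray meets no edge, so it is a connected set to which
  \<open>connected_P\<close> applies.\<close>

lemma ray_in_P:
  assumes clr: "\<And>l. l \<in> L \<Longrightarrow> clear \<alpha> es (of_real l * u) \<and> of_real l * u \<noteq> 0" and L: "connected L"
    and m: "m \<in> L" "p + of_real m * u \<in> P" "l \<in> L"
  shows "p + of_real l * u \<in> P"
proof -
  have "(\<lambda>l. p + of_real l * u) ` L \<subseteq> P"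
  proof (rule connected_P)
    show "connected ((\<lambda>l. p + of_real l * u) ` L)"
      by (intro connected_continuous_image continuous_intros L)
    show "z - p \<notin> seg e" if "z \<in> (\<lambda>l. p + of_real l * u) ` L" "e \<in> set es" for z e
      using clear_avoids[OF _ _ alpha(1) that(2)] clr that(1) by auto
    show "(\<lambda>l. p + of_real l * u) ` L \<inter> P \<noteq> {}" using m by blast
  qed
  then show ?thesis using m by blast
qed

text \<open>Clearness is inherited towards \<open>p\<close>, and the half-open segment stays in
  \<open>P\<close>; the end \<open>p\<close> is in \<open>V\<close> by assumption.\<close>

lemma V_star:
  assumes "p + z \<in> V" "0 \<le> l" "l \<le> 1"
  shows "p + of_real l * z \<in> V"
proof (cases "l = 0 \<or> z = 0")
  case True
  then show ?thesis using p_V by auto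
next
  case False
  have z: "p + z \<in> P" "clear \<alpha> es z" using assms V_iff by auto
  have c: "clear \<alpha> es (of_real m * z) \<and> of_real m * z \<noteq> 0" if "m \<in> {0<..1}" for m
    using clear_scale[OF z(2), of m] that False by auto
  have "p + of_real l * z \<in> P"
    by (rule ray_in_P[where L = "{0<..1}" and m = 1]) (use c z assms False in auto)
  then show ?thesis using c[of l] assms False V_iff by auto
qed

text \<open>One setting for both kinds of sectors. A critical direction is the case
  \<open>t1 = tt = t2\<close>, where the open interval is empty; otherwise \<open>tt\<close> is a
  sample direction inside.\<close>

context
  fixes sg t1 tt t2 :: real and I
  assumes sg: "\<bar>sg\<bar> = 1" and t: "-1 \<le> t1" "t2 \<le> 1" "t1 < 1" "\<not> (t1 = -1 \<and> t2 = 1)"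
    and tt: "(t1 = tt \<and> tt = t2) \<or> (t1 < tt \<and> tt < t2)"
    and I_def: "I = {t1<..<t2} \<union> {tt}"
    and unif: "\<And>f. f \<in> crit_funs \<alpha> es \<Longrightarrow> uniform sg I f"
begin

lemma I_props: "connected I" "tt \<in> I" "closure I = {t1..t2}" "t1 \<le> t2"
proof -
  have "I = (if t1 = t2 then {tt} else {t1<..<t2})" using tt I_def by auto
  then show "connected I" "closure I = {t1..t2}" using tt by auto
  show "tt \<in> I" "t1 \<le> t2" using tt I_def by auto
qed

interpretation sector \<alpha> sg I es
  by unfold_locales (use alpha sg I_props unif in auto)

lemma clear_dir_iff:
  assumes "l > 0"
  shows "clear \<alpha> es (of_real l * dir sg s) \<longleftrightarrow>
    \<not> blocked \<alpha> es (dir sg s) \<and> (\<forall>k\<in>feats \<alpha> es (dir sg s). sval k (dir sg s) \<le> 1 / l)"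
  using clear_iff[OF alpha, of "1 / l" "dir sg s" es] dir_nonzero[OF sg] assms oriented
  by (simp add: mult.commute)

lemma dir_scale_nonzero: "l > 0 \<Longrightarrow> of_real l * dir sg s \<noteq> 0"
  using dir_nonzero[OF sg] by simp

lemma blocked_empty:
  assumes "blocked \<alpha> es (dir sg tt)" "s \<in> I" "l > 0"
  shows "p + of_real l * dir sg s \<notin> V"
  using blocked_transfer[OF I_props(2) assms(2,1)] clear_dir_iff[OF assms(3)] V_iff by blast

text \<open>Without any obstacle the whole ray is clear; a single point of \<open>V\<close> would
  put all of it into the bounded set \<open>P\<close>.\<close>

lemma no_feats_empty:
  assumes nf: "feats \<alpha> es (dir sg tt) = {}" and s: "s \<in> I" and l: "l > 0"
  shows "p + of_real l * dir sg s \<notin> V"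
proof
  assume "p + of_real l * dir sg s \<in> V"
  then have P: "p + of_real l * dir sg s \<in> P" and nb: "\<not> blocked \<alpha> es (dir sg s)"
    using V_iff clear_dir_iff[OF l] by blast+
  have "feats \<alpha> es (dir sg s) = {}" using feats_transfer[OF I_props(2) s] nf by simp
  then have c: "clear \<alpha> es (of_real m * dir sg s) \<and> of_real m * dir sg s \<noteq> 0" if "m \<in> {0<..}" for m
    using clear_dir_iff[of m s] nb that dir_scale_nonzero by auto
  have inP: "p + of_real m * dir sg s \<in> P" if "m > 0" for m
    by (rule ray_in_P[where L = "{0<..}" and m = l, OF c]) (use P l that in auto)
  obtain B where B: "\<And>x. x \<in> P \<Longrightarrow> norm x \<le> B" using bounded_P by (auto simp: bounded_iff)
  \<comment> \<open>As \<open>|dir sg s| \<ge> 1\<close>, the point with factor \<open>m\<close> has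
    distance greater than \<open>B\<close> from the origin.\<close>
  define m where "m = \<bar>B\<bar> + norm p + 1"
  have m: "m > 0" by (simp add: m_def add_nonneg_pos)
  have "norm (of_real m * dir sg s) \<le> norm (p + of_real m * dir sg s) + norm p"
    using norm_triangle_ineq4[of "p + of_real m * dir sg s" p] by simp
  also have "\<dots> \<le> B + norm p" using B[OF inP[OF m]] by simp
  finally have "m * (1 + s\<^sup>2) \<le> B + norm p" using m by (simp add: norm_mult norm_dir[OF sg])
  moreover have "m * 1 \<le> m * (1 + s\<^sup>2)" using m by (intro mult_left_mono) auto
  ultimately show False by (simp add: m_def)
qed

context
  fixes k
  assumes k: "k \<in> feats \<alpha> es (dir sg tt)"
    and k_max: "\<And>k'. k' \<in> feats \<alpha> es (dir sg tt) \<Longrightarrow> sval k' (dir sg tt) \<le> sval k (dir sg tt)"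
    and not_blocked: "\<not> blocked \<alpha> es (dir sg tt)"
begin

lemma k_feat: "s \<in> I \<Longrightarrow> k \<in> feats \<alpha> es (dir sg s)"
  using feats_transfer[OF I_props(2)] k by blast

text \<open>The obstacle with the largest root in the sample direction has the largest root in the
  whole sector.\<close>

lemma clear_k_iff:
  assumes "s \<in> I" "l > 0"
  shows "clear \<alpha> es (of_real l * dir sg s) \<longleftrightarrow> l \<le> 1 / sval k (dir sg s)"
proof -
  have nb: "\<not> blocked \<alpha> es (dir sg s)" using blocked_transfer[OF assms(1) I_props(2)] not_blocked by blast
  have mx: "sval k' (dir sg s) \<le> sval k (dir sg s)" if "k' \<in> feats \<alpha> es (dir sg s)" for k'
    using sval_le_transfer[OF k _ I_props(2) assms(1) k_max] that feats_transfer[OF I_props(2) assms(1)] by blast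
  have "sval k (dir sg s) > 0" using sval_feat_pos[OF k_feat[OF assms(1)]] .
  then have "l \<le> 1 / sval k (dir sg s) \<longleftrightarrow> sval k (dir sg s) \<le> 1 / l" using assms(2) by (simp add: field_simps)
  then show ?thesis using clear_dir_iff[OF assms(2)] nb mx k_feat[OF assms(1)] by (meson order_trans)
qed

lemma tip_clear:
  assumes "s \<in> I"
  shows "clear \<alpha> es (tip_at p k sg s - p)" "tip_at p k sg s - p \<noteq> 0"
proof -
  have S: "1 / sval k (dir sg s) > 0" using sval_feat_pos[OF k_feat[OF assms]] by simp
  show "clear \<alpha> es (tip_at p k sg s - p)" unfolding tip_at_def using clear_k_iff[OF assms S] by simp
  show "tip_at p k sg s - p \<noteq> 0" unfolding tip_at_def using dir_scale_nonzero[OF S] by simp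
qed

text \<open>The ends of the clear parts of the rays form a connected curve that avoids all
  edges.\<close>

lemma tips_in_P:
  assumes "s \<in> I" "tip_at p k sg s \<in> P" "s' \<in> I"
  shows "tip_at p k sg s' \<in> P"
proof -
  have "tip_at p k sg ` I \<subseteq> P"
  proof (rule connected_P)
    have "continuous_on I (tip_at p k sg)" unfolding tip_at_def
    proof (intro continuous_on_add continuous_on_mult continuous_on_of_real continuous_on_divide
        continuous_on_const continuous_sval continuous_dir ballI)
      show "sval k (dir sg x) \<noteq> 0" if "x \<in> I" for x using sval_feat_pos[OF k_feat[OF that]] by simp
    qed
    then show "connected (tip_at p k sg ` I)" using I_props(1) by (simp add: connected_continuous_image)
    show "z - p \<notin> seg e" if "z \<in> tip_at p k sg ` I" "e \<in> set es" for z e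
      using clear_avoids[OF _ _ alpha(1) that(2)] tip_clear that(1) by blast
    show "tip_at p k sg ` I \<inter> P \<noteq> {}" using assms by blast
  qed
  then show ?thesis using assms by blast
qed

lemma tip_parity:
  "tip_at p k sg tt \<in> P \<longleftrightarrow> odd (length (filter (\<lambda>e. crosses e (of_real (1 / sval k (dir sg tt)) * dir sg tt)) es))"
  using parity[of "tip_at p k sg tt - p"] clear_avoids[OF tip_clear[OF I_props(2)] alpha(1)] by (simp add: tip_at_def)

text \<open>A point of \<open>V\<close> on one ray carries the tip of this ray into
  \<open>P\<close>, then the tip of the sample ray, whose parity would be odd.\<close>

lemma even_empty:
  assumes ev: "even (length (filter (\<lambda>e. crosses e (of_real (1 / sval k (dir sg tt)) * dir sg tt)) es))"
    and s: "s \<in> I" and l: "l > 0"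
  shows "p + of_real l * dir sg s \<notin> V"
proof
  assume v: "p + of_real l * dir sg s \<in> V"
  let ?m = "1 / sval k (dir sg s)"
  have m: "?m > 0" using sval_feat_pos[OF k_feat[OF s]] by simp
  have P: "p + of_real l * dir sg s \<in> P" "l \<le> ?m" using v V_iff clear_k_iff[OF s l] by blast+
  have "p + of_real ?m * dir sg s \<in> P"
  proof (rule ray_in_P[where L = "{0<..?m}" and m = l])
    show "clear \<alpha> es (of_real x * dir sg s) \<and> of_real x * dir sg s \<noteq> 0" if "x \<in> {0<..?m}" for x
      using clear_k_iff[OF s, of x] dir_scale_nonzero[of x s] that by auto
  qed (use P l m in auto)
  then have "tip_at p k sg tt \<in> P" using tips_in_P[OF s _ I_props(2)] by (simp add: tip_at_def)
  then show False using tip_parity ev by simp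
qed

text \<open>Within the sector all tips belong to \<open>V\<close>. At the ends \<open>t1\<close> and
  \<open>t2\<close> a limit is taken: the tips stay in the bounded set \<open>P\<close>, which gives
  a positive lower bound for \<open>sval\<close>, so the tips extend continuously, and
  \<open>V\<close> is closed.\<close>

lemma odd_piece:
  assumes odd: "odd (length (filter (\<lambda>e. crosses e (of_real (1 / sval k (dir sg tt)) * dir sg tt)) es))"
  defines "T \<equiv> sector_piece p k sg t1 t2"
  shows "corners_on_arc p T" "cell p T \<subseteq> V" "interior (cell p T) \<subseteq> sector_set p sg t1 t2"
    "\<And>s l. s \<in> I \<Longrightarrow> l > 0 \<Longrightarrow> p + of_real l * dir sg s \<in> V \<Longrightarrow> p + of_real l * dir sg s \<in> cell p T"
proof -
  have tipV: "tip_at p k sg s \<in> V" if "s \<in> I" for s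
    using tips_in_P[OF I_props(2) _ that] tip_parity odd tip_clear[OF that] V_iff[of "tip_at p k sg s - p"] by simp
  obtain B where B: "B > 0" "\<And>x. x \<in> P \<Longrightarrow> norm (x - p) \<le> B"
  proof -
    obtain B where "\<And>x. x \<in> P \<Longrightarrow> norm x \<le> B" using bounded_P by (auto simp: bounded_iff)
    then have "norm (x - p) \<le> \<bar>B\<bar> + norm p + 1" if "x \<in> P" for x
      using norm_triangle_ineq4[of x p] that by fastforce
    moreover have "\<bar>B\<bar> + norm p + 1 > 0" by (simp add: add_nonneg_pos)
    ultimately show ?thesis using that by blast
  qed
  have lower: "sval k (dir sg s) \<ge> 1 / B" if s: "s \<in> I" for s
  proof -
    have S: "sval k (dir sg s) > 0" using sval_feat_pos[OF k_feat[OF s]] .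
    have "norm (tip_at p k sg s - p) \<le> B" using B(2) tipV[OF s] V_iff[of "tip_at p k sg s - p"] by simp
    then have "(1 + s\<^sup>2) / sval k (dir sg s) \<le> B"
      using S by (simp add: tip_at_def norm_mult norm_divide norm_dir[OF sg])
    then have "1 + s\<^sup>2 \<le> B * sval k (dir sg s)" using S by (simp add: pos_divide_le_eq)
    then have "1 \<le> B * sval k (dir sg s)" using zero_le_power2[of s] by linarith
    then show ?thesis using B(1) by (simp add: pos_divide_le_eq mult.commute)
  qed
  have cl: "s \<in> closure I \<longleftrightarrow> t1 \<le> s \<and> s \<le> t2" for s using I_props(3) by auto
  have pos: "sval k (dir sg s) > 0" if "s \<in> closure I" for s
  proof -
    have "sval k (dir sg s) \<ge> 1 / B"
      by (rule continuous_ge_on_closure[OF continuous_sval that lower])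
    moreover have "1 / B > 0" using B(1) by simp
    ultimately show ?thesis by linarith
  qed
  have disc: "sdisc k (dir sg s) \<ge> 0" if "s \<in> closure I" for s
    by (rule continuous_ge_on_closure[OF continuous_sdisc that]) (use feat_disc[OF k_feat] in auto)
  have "continuous_on (closure I) (tip_at p k sg)" unfolding tip_at_def
  proof (intro continuous_on_add continuous_on_mult continuous_on_of_real continuous_on_divide
      continuous_on_const continuous_sval continuous_dir ballI)
    show "sval k (dir sg x) \<noteq> 0" if "x \<in> closure I" for x using pos[OF that] by simp
  qed
  then have "tip_at p k sg ` closure I \<subseteq> V" using closed_V tipV by (intro image_closure_subset) auto
  then have tipV': "tip_at p k sg s \<in> V" if "t1 \<le> s" "s \<le> t2" for s using that cl by blast
  have kpos: "k ! 5 > 0" using feat_coeff_pos[OF k] .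
  have kk: "sdisc k (dir sg s) \<ge> 0 \<and> sval k (dir sg s) > 0" if "t1 \<le> s" "s \<le> t2" for s
    using pos disc that cl by blast
  note cd = cell_dir[OF sg t(1) I_props(4) t(2,3,4) kpos _ T_def[THEN meta_eq_to_obj_eq, unfolded sector_piece_def tip_at_def]]
  have c: "cell p T = {p + of_real l * dir sg t | l t. 0 \<le> l \<and> t1 \<le> t \<and> t \<le> t2 \<and> l \<le> 1 / sval k (dir sg t)}"
    by (rule cd(1)) (use kk in blast)
  show "corners_on_arc p T" by (rule cd(2)) (use kk in blast)
  show "cell p T \<subseteq> V"
  proof
    fix g assume "g \<in> cell p T"
    then obtain l s where ls: "0 \<le> l" "t1 \<le> s" "s \<le> t2" "l \<le> 1 / sval k (dir sg s)" "g = p + of_real l * dir sg s"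
      unfolding c by blast
    have S: "sval k (dir sg s) > 0" using kk ls by blast
    have "p + of_real (l * sval k (dir sg s)) * (tip_at p k sg s - p) \<in> V"
      by (rule V_star) (use tipV'[OF ls(2,3)] ls S in \<open>auto simp: field_simps\<close>)
    moreover have "of_real (l * sval k (dir sg s)) * (tip_at p k sg s - p) = of_real l * dir sg s"
      using S by (simp add: tip_at_def)
    ultimately show "g \<in> V" by (simp only: ls(5))
  qed
  show "interior (cell p T) \<subseteq> sector_set p sg t1 t2"
    by (rule interior_wedge_dir[OF sg t(1) I_props(4) t(2)]) (unfold c, blast)
  show "p + of_real l * dir sg s \<in> cell p T" if "s \<in> I" "l > 0" "p + of_real l * dir sg s \<in> V" for s l
  proof -
    have "l \<le> 1 / sval k (dir sg s)" using that V_iff clear_k_iff by blast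
    moreover have "s \<in> closure I" using that(1) closure_subset by blast
    then have "t1 \<le> s \<and> s \<le> t2" using cl by blast
    ultimately show ?thesis unfolding c using that(2) by (intro CollectI exI[of _ l] exI[of _ s]) auto
  qed
qed

end
end
end

section \<open>Running time of programs\<close>

primrec nats_written :: "com \<Rightarrow> nat set" where
  "nats_written Skip = {}"
| "nats_written (NAssign a i e) = {a}"
| "nats_written (RAssign a i e) = {}"
| "nats_written (Seq c d) = nats_written c \<union> nats_written d"
| "nats_written (Cond b c d) = nats_written c \<union> nats_written d"
| "nats_written (While b c) = nats_written c"

primrec reals_written :: "com \<Rightarrow> nat set" where
  "reals_written Skip = {}"
| "reals_written (NAssign a i e) = {}"
| "reals_written (RAssign a i e) = {a}"
| "reals_written (Seq c d) = reals_written c \<union> reals_written d"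
| "reals_written (Cond b c d) = reals_written c \<union> reals_written d"
| "reals_written (While b c) = reals_written c"

lemma upd2_apply: "upd2 m a i x a' = (if a' = a then (m a)(i := x) else m a')"
  by (simp add: upd2_def)

text \<open>The frame condition of the program logic. It speaks of whole arrays, because indices are
  computed at run time while array names are fixed.\<close>

definition unchanged :: "com \<Rightarrow> state \<Rightarrow> state \<Rightarrow> bool" where
  "unchanged c s s' \<longleftrightarrow> (\<forall>a. a \<notin> nats_written c \<longrightarrow> nats s' a = nats s a) \<and>
     (\<forall>a. a \<notin> reals_written c \<longrightarrow> reals s' a = reals s a)"

lemma unchangedD:
  assumes "unchanged c s s'"
  shows "a \<notin> nats_written c \<Longrightarrow> nats s' a = nats s a" "a \<notin> reals_written c \<Longrightarrow> reals s' a = reals s a"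
  using assms by (auto simp: unchanged_def)

lemma exec_unchanged: "exec c s t s' \<Longrightarrow> unchanged c s s'"
  by (induction rule: exec.induct) (auto simp: unchanged_def upd2_apply)

text \<open>Total correctness with an upper bound on the time.\<close>

definition runs :: "com \<Rightarrow> state \<Rightarrow> nat \<Rightarrow> (state \<Rightarrow> bool) \<Rightarrow> bool" where
  "runs c s T Q \<longleftrightarrow> (\<exists>t s'. exec c s t s' \<and> t \<le> T \<and> Q s')"

lemma runs_mono: "runs c s T Q \<Longrightarrow> T \<le> T' \<Longrightarrow> (\<And>s'. Q s' \<Longrightarrow> unchanged c s s' \<Longrightarrow> Q' s') \<Longrightarrow> runs c s T' Q'"
  unfolding runs_def using exec_unchanged by (meson order_trans)

lemma runs_Skip: "Q s \<Longrightarrow> runs Skip s 1 Q"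
  unfolding runs_def using exec.Skip by blast

lemma runs_NAssign: "Q (s\<lparr>nats := upd2 (nats s) a (nval s i) (nval s e)\<rparr>) \<Longrightarrow> runs (NAssign a i e) s 1 Q"
  unfolding runs_def using exec.NAssign by blast

lemma runs_RAssign: "Q (s\<lparr>reals := upd2 (reals s) a (nval s i) (rval s e)\<rparr>) \<Longrightarrow> runs (RAssign a i e) s 1 Q"
  unfolding runs_def using exec.RAssign by blast

lemma runs_Seq:
  assumes "runs c s T Q" "\<And>s'. Q s' \<Longrightarrow> unchanged c s s' \<Longrightarrow> runs d s' U R"
  shows "runs (Seq c d) s (T + U) R"
proof -
  obtain t s' where 1: "exec c s t s'" "t \<le> T" "Q s'" using assms(1) by (auto simp: runs_def)
  then obtain u s'' where 2: "exec d s' u s''" "u \<le> U" "R s''"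
    using assms(2)[OF 1(3) exec_unchanged[OF 1(1)]] by (auto simp: runs_def)
  show ?thesis unfolding runs_def using exec.Seq[OF 1(1) 2(1)] 1 2 by (meson add_mono)
qed

lemma runs_Cond:
  assumes "bval s b \<Longrightarrow> runs c s T Q" "\<not> bval s b \<Longrightarrow> runs d s T Q"
  shows "runs (Cond b c d) s (Suc T) Q"
proof (cases "bval s b")
  case True
  then obtain t s' where "exec c s t s'" "t \<le> T" "Q s'" using assms by (auto simp: runs_def)
  then show ?thesis unfolding runs_def using exec.CondTrue[OF True] by (metis Suc_le_mono)
next
  case False
  then obtain t s' where "exec d s t s'" "t \<le> T" "Q s'" using assms by (auto simp: runs_def)
  then show ?thesis unfolding runs_def using exec.CondFalse[OF False] by (metis Suc_le_mono)
qed

text \<open>The measure bounds the number of rounds; each costs one step for the test in addition to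
  the body.\<close>

lemma runs_While:
  assumes "I s"
    and "\<And>s. I s \<Longrightarrow> bval s b \<Longrightarrow> runs c s T (\<lambda>s'. I s' \<and> m s' < m s)"
    and "m s \<le> M"
  shows "runs (While b c) s (1 + M * Suc T) (\<lambda>s'. I s' \<and> \<not> bval s' b)"
  using assms(1,3)
proof (induction M arbitrary: s rule: less_induct)
  case (less M)
  show ?case
  proof (cases "bval s b")
    case False
    then show ?thesis unfolding runs_def using exec.WhileFalse[OF False] less(2)
      by (intro exI[of _ 1] exI[of _ s]) simp
  next
    case True
    obtain t s' where 1: "exec c s t s'" "t \<le> T" "I s'" "m s' < m s"
      using assms(2)[OF less(2) True] by (auto simp: runs_def)
    then have lt: "m s' < M" using less(3) by simp
    obtain u s'' where 2: "exec (While b c) s' u s''" "u \<le> 1 + m s' * Suc T" "I s'' \<and> \<not> bval s'' b"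
      using less(1)[OF lt 1(3)] by (auto simp: runs_def)
    have "Suc (t + u) \<le> Suc T + 1 + m s' * Suc T" using 1(2) 2(2) by simp
    also have "\<dots> = 1 + Suc (m s') * Suc T" by simp
    also have "\<dots> \<le> 1 + M * Suc T" using lt by (intro add_left_mono mult_right_mono) auto
    finally show ?thesis unfolding runs_def using exec.WhileTrue[OF True 1(1) 2(1)] 2(3) by blast
  qed
qed

section \<open>Counting loops\<close>

definition For :: "nat \<Rightarrow> nexp \<Rightarrow> com \<Rightarrow> com" where
  "For v n c = Seq (NAssign v (NConst 0) (NConst 0))
     (While (NLess (NCell v (NConst 0)) n)
       (Seq c (NAssign v (NConst 0) (NAdd (NCell v (NConst 0)) (NConst 1)))))"

lemma written_For [simp]:
  "nats_written (For v n c) = insert v (nats_written c)" "reals_written (For v n c) = reals_written c"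
  by (auto simp: For_def)

text \<open>The invariant is required of the state whose counter is already set, so it has to be
  stable under the update of the counter. The limit \<open>n\<close> is evaluated anew in every
  round and must keep the value \<open>N\<close>.\<close>

lemma runs_For:
  assumes init: "I 0 (s\<lparr>nats := upd2 (nats s) v 0 0\<rparr>)"
    and step: "\<And>k s. I k s \<Longrightarrow> k < N \<Longrightarrow> nats s v 0 = k \<Longrightarrow>
      runs c s T (\<lambda>s'. nats s' v 0 = k \<and> I (Suc k) (s'\<lparr>nats := upd2 (nats s') v 0 (Suc k)\<rparr>))"
    and bound: "\<And>k s. I k s \<Longrightarrow> nval s n = N"
  shows "runs (For v n c) s (2 + N * (T + 2)) (\<lambda>s'. I N s')"
proof -
  define J where "J s \<longleftrightarrow> I (nats s v 0) s \<and> nats s v 0 \<le> N" for s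
  define s1 where "s1 = s\<lparr>nats := upd2 (nats s) v 0 0\<rparr>"
  have "runs (While (NLess (NCell v (NConst 0)) n) (Seq c (NAssign v (NConst 0) (NAdd (NCell v (NConst 0)) (NConst 1)))))
      s1 (1 + N * Suc (T + 1)) (\<lambda>s'. J s' \<and> \<not> bval s' (NLess (NCell v (NConst 0)) n))"
  proof (rule runs_While[where m = "\<lambda>s. N - nats s v 0"])
    show "J s1" using init by (simp add: J_def s1_def upd2_apply)
    fix s assume J: "J s" and b: "bval s (NLess (NCell v (NConst 0)) n)"
    then have lt: "nats s v 0 < N" using bound by (auto simp: J_def)
    show "runs (Seq c (NAssign v (NConst 0) (NAdd (NCell v (NConst 0)) (NConst 1)))) s (T + 1)
        (\<lambda>s'. J s' \<and> N - nats s' v 0 < N - nats s v 0)"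
    proof (rule runs_Seq[OF step[of "nats s v 0" s]])
      fix s' assume *: "nats s' v 0 = nats s v 0 \<and> I (Suc (nats s v 0)) (s'\<lparr>nats := upd2 (nats s') v 0 (Suc (nats s v 0))\<rparr>)"
      show "runs (NAssign v (NConst 0) (NAdd (NCell v (NConst 0)) (NConst 1))) s' 1 (\<lambda>s'. J s' \<and> N - nats s' v 0 < N - nats s v 0)"
        by (rule runs_NAssign) (use * lt in \<open>simp add: J_def upd2_apply\<close>)
    qed (use J lt in \<open>simp_all add: J_def\<close>)
  qed (simp add: s1_def upd2_apply)
  then have "runs (For v n c) s (1 + (1 + N * Suc (T + 1))) (\<lambda>s'. J s' \<and> \<not> bval s' (NLess (NCell v (NConst 0)) n))"
    unfolding For_def by (intro runs_Seq[where Q = "\<lambda>s'. s' = s1"] runs_NAssign) (auto simp: s1_def)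
  then show ?thesis
  proof (rule runs_mono)
    fix s' assume "J s' \<and> \<not> bval s' (NLess (NCell v (NConst 0)) n)"
    then have "I (nats s' v 0) s'" "nats s' v 0 = N" using bound unfolding J_def by fastforce+
    then show "I N s'" by simp
  qed simp
qed

section \<open>Polynomials given by expressions, and their roots\<close>

primrec rfree :: "nat \<Rightarrow> rexp \<Rightarrow> bool" where
  "rfree a (RNat e) \<longleftrightarrow> True"
| "rfree a (RCell b i) \<longleftrightarrow> a \<noteq> b"
| "rfree a (RAdd e f) \<longleftrightarrow> rfree a e \<and> rfree a f"
| "rfree a (RSub e f) \<longleftrightarrow> rfree a e \<and> rfree a f"
| "rfree a (RMul e f) \<longleftrightarrow> rfree a e \<and> rfree a f"
| "rfree a (RDiv e f) \<longleftrightarrow> rfree a e \<and> rfree a f"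
| "rfree a (RSqrt e) \<longleftrightarrow> rfree a e"
| "rfree a (RRoot k es) \<longleftrightarrow> list_all (\<lambda>e. rfree a e) es"

lemma nval_reals [simp]: "nval (s\<lparr>reals := r\<rparr>) e = nval s e"
  by (induction e) auto

lemma rval_rfree: "rfree a e \<Longrightarrow> rval (s\<lparr>reals := upd2 (reals s) a i x\<rparr>) e = rval s e"
proof (induction e)
  case (RRoot k es)
  then have "map (rval (s\<lparr>reals := upd2 (reals s) a i x\<rparr>)) es = map (rval s) es"
    by (auto simp: list_all_iff)
  then show ?case by (simp only: rval.simps)
qed (auto simp: upd2_apply)

fun peval :: "state \<Rightarrow> rexp list \<Rightarrow> real \<Rightarrow> real" where
  "peval s [] t = 0"
| "peval s (e # es) t = rval s e + t * peval s es t"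

lemma poly_peval: "poly (Poly (map (rval s) es)) t = peval s es t"
  by (induction es) auto

fun padd :: "rexp list \<Rightarrow> rexp list \<Rightarrow> rexp list" where
  "padd (e # es) (f # fs) = RAdd e f # padd es fs"
| "padd [] fs = fs"
| "padd es [] = es"

definition pscale :: "rexp \<Rightarrow> rexp list \<Rightarrow> rexp list" where
  "pscale e es = map (RMul e) es"

fun pmul :: "rexp list \<Rightarrow> rexp list \<Rightarrow> rexp list" where
  "pmul [] fs = []"
| "pmul (e # es) fs = padd (pscale e fs) (RNat (NConst 0) # pmul es fs)"

lemma peval_padd [simp]: "peval s (padd es fs) t = peval s es t + peval s fs t"
  by (induction es fs rule: padd.induct) (auto simp: algebra_simps)

lemma peval_pscale [simp]: "peval s (pscale e es) t = rval s e * peval s es t"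
  by (induction es) (auto simp: pscale_def algebra_simps)

lemma peval_pmul [simp]: "peval s (pmul es fs) t = peval s es t * peval s fs t"
  by (induction es) (auto simp: algebra_simps)

lemma rfree_padd [simp]: "list_all (rfree a) es \<Longrightarrow> list_all (rfree a) fs \<Longrightarrow> list_all (rfree a) (padd es fs)"
  by (induction es fs rule: padd.induct) auto

lemma rfree_pscale [simp]: "rfree a e \<Longrightarrow> list_all (rfree a) es \<Longrightarrow> list_all (rfree a) (pscale e es)"
  by (induction es) (auto simp: pscale_def)

lemma rfree_pmul [simp]: "list_all (rfree a) es \<Longrightarrow> list_all (rfree a) fs \<Longrightarrow> list_all (rfree a) (pmul es fs)"
  by (induction es) auto

text \<open>A nonzero polynomial with \<open>n\<close> coefficients has fewer than \<open>n\<close>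
  roots, so the indices below \<open>length cs\<close> reach all of them.\<close>

lemma real_root_covers:
  assumes "Poly cs \<noteq> 0" "poly (Poly cs) t = 0"
  shows "\<exists>k<length cs. t = real_root k cs"
proof -
  let ?S = "{x. poly (Poly cs) x = 0}"
  have fin: "finite ?S" using assms(1) by (simp add: poly_roots_finite)
  then have "t \<in> set (sorted_list_of_set ?S)" using assms(2) by simp
  then obtain k where k: "k < card ?S" "t = sorted_list_of_set ?S ! k"
    using fin by (metis distinct_card distinct_sorted_list_of_set in_set_conv_nth set_sorted_list_of_set)
  have "card ?S \<le> degree (Poly cs)" using assms(1) by (rule card_poly_roots_bound)
  also have "\<dots> \<le> length cs - 1"
    by (rule degree_le) (auto simp: coeff_Poly_eq nth_default_def)
  finally have "k < length cs" using k(1) by simp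
  then show ?thesis using k fin by (auto simp: real_root_def)
qed

text \<open>The default value 0 is indistinguishable from a root, so the search must accept 0 as a
  candidate.\<close>

lemma real_root_cases: "real_root k cs = 0 \<or> (Poly cs \<noteq> 0 \<and> poly (Poly cs) (real_root k cs) = 0)"
proof (cases "finite {x. poly (Poly cs) x = 0} \<and> k < card {x. poly (Poly cs) x = 0}")
  case True
  then have "k < length (sorted_list_of_set {x. poly (Poly cs) x = 0})"
    by (metis distinct_card distinct_sorted_list_of_set set_sorted_list_of_set)
  then have "real_root k cs \<in> set (sorted_list_of_set {x. poly (Poly cs) x = 0})"
    using True by (simp only: real_root_def Let_def if_True simp_thms nth_mem)
  then have "poly (Poly cs) (real_root k cs) = 0" using True by simp
  moreover have "Poly cs \<noteq> 0" using True infinite_UNIV_char_0[where 'a = real] by auto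
  ultimately show ?thesis by simp
qed (auto simp: real_root_def)

section \<open>Searching the next critical direction\<close>

type_synonym cexp = "rexp \<times> rexp"

abbreviation nv :: "nat \<Rightarrow> nexp" where "nv x \<equiv> NCell x (NConst 0)"
abbreviation rv :: "nat \<Rightarrow> rexp" where "rv x \<equiv> RCell x (NConst 0)"
abbreviation rnum :: "nat \<Rightarrow> rexp" where "rnum k \<equiv> RNat (NConst k)"
abbreviation rneg :: "rexp \<Rightarrow> rexp" where "rneg e \<equiv> RSub (rnum 0) e"

definition cval :: "state \<Rightarrow> cexp \<Rightarrow> complex" where
  "cval s e = Complex (rval s (fst e)) (rval s (snd e))"

lemma Re_cval [simp]: "Re (cval s e) = rval s (fst e)" and Im_cval [simp]: "Im (cval s e) = rval s (snd e)"
  by (simp_all add: cval_def)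

definition e_sq :: "rexp \<Rightarrow> rexp" where "e_sq e = RMul e e"
definition e_sub :: "cexp \<Rightarrow> cexp \<Rightarrow> cexp" where "e_sub a b = (RSub (fst a) (fst b), RSub (snd a) (snd b))"
definition e_dot :: "cexp \<Rightarrow> cexp \<Rightarrow> rexp" where
  "e_dot a b = RAdd (RMul (fst a) (fst b)) (RMul (snd a) (snd b))"
definition e_cross :: "cexp \<Rightarrow> cexp \<Rightarrow> rexp" where
  "e_cross a b = RSub (RMul (fst a) (snd b)) (RMul (snd a) (fst b))"
definition e_norm :: "cexp \<Rightarrow> rexp" where "e_norm a = RSqrt (e_dot a a)"

lemma rval_e_sq [simp]: "rval s (e_sq e) = (rval s e)\<^sup>2"
  by (simp add: e_sq_def power2_eq_square)
lemma cval_e_sub [simp]: "cval s (e_sub a b) = cval s a - cval s b"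
  by (simp add: e_sub_def complex_eq_iff)
lemma rval_e_sub [simp]: "rval s (fst (e_sub a b)) = rval s (fst a) - rval s (fst b)"
    "rval s (snd (e_sub a b)) = rval s (snd a) - rval s (snd b)"
  by (simp_all add: e_sub_def)
lemma rval_e_dot [simp]: "rval s (e_dot a b) = dot (cval s a) (cval s b)"
  by (simp add: e_dot_def dot_def)
lemma rval_e_cross [simp]: "rval s (e_cross a b) = cross (cval s a) (cval s b)"
  by (simp add: e_cross_def cross_def)
lemma rval_e_norm [simp]: "rval s (e_norm a) = norm (cval s a)"
  by (simp add: e_norm_def dot_self)

lemma rfree_e [simp]:
  "rfree x (e_sq e) \<longleftrightarrow> rfree x e"
  "rfree x (e_dot a b) \<longleftrightarrow> rfree x (fst a) \<and> rfree x (snd a) \<and> rfree x (fst b) \<and> rfree x (snd b)"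
  "rfree x (e_cross a b) \<longleftrightarrow> rfree x (fst a) \<and> rfree x (snd a) \<and> rfree x (fst b) \<and> rfree x (snd b)"
  "rfree x (e_norm a) \<longleftrightarrow> rfree x (fst a) \<and> rfree x (snd a)"
  "rfree x (fst (e_sub a b)) \<longleftrightarrow> rfree x (fst a) \<and> rfree x (fst b)"
  "rfree x (snd (e_sub a b)) \<longleftrightarrow> rfree x (snd a) \<and> rfree x (snd b)"
  by (auto simp: e_sq_def e_dot_def e_cross_def e_norm_def e_sub_def)

text \<open>Real arrays: 4, 5 vertices and 6, 7 and 8, 9 end points of the edges, all relative to \<open>p\<close>.
  Real variables: 10 chart, 11 current and 12 next critical direction, 13 probed direction,
  14, 15 sector to be output, 16 largest root, 17 its conic. Natural variables: 2 number of
  vertices, 3 to 7 loops, 9 output position, 10 blocked, 11 parity of crossings.\<close>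

definition e_alpha :: rexp where "e_alpha = RCell 2 (NConst 2)"
definition e_p :: cexp where "e_p = (RCell 2 (NConst 0), RCell 2 (NConst 1))"
definition e_dir :: "rexp \<Rightarrow> cexp" where
  "e_dir t = (RMul (rv 10) (RSub (rnum 1) (e_sq t)), RMul (rv 10) (RMul (rnum 2) t))"
definition qe :: "nexp \<Rightarrow> cexp" where "qe i = (RCell 4 i, RCell 5 i)"
definition ae :: "nexp \<Rightarrow> cexp" where "ae i = (RCell 6 i, RCell 7 i)"
definition be :: "nexp \<Rightarrow> cexp" where "be i = (RCell 8 i, RCell 9 i)"

lemma cval_e_dir: "cval s (e_dir t) = dir (reals s 10 0) (rval s t)"
  by (simp add: e_dir_def complex_eq_iff)

definition p_dot :: "cexp \<Rightarrow> rexp list" where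
  "p_dot v = [RMul (rv 10) (fst v), RMul (rnum 2) (RMul (rv 10) (snd v)), rneg (RMul (rv 10) (fst v))]"
definition p_cross :: "cexp \<Rightarrow> rexp list" where "p_cross v = p_dot (snd v, rneg (fst v))"
definition p_w :: "rexp list" where "p_w = [rnum 1, rnum 0, rnum 1]"

lemma peval_p_dot [simp]: "peval s (p_dot v) t = dot (cval s v) (dir (reals s 10 0) t)"
  by (simp add: p_dot_def dot_def power2_eq_square algebra_simps)
lemma peval_p_cross [simp]: "peval s (p_cross v) t = cross (dir (reals s 10 0) t) (cval s v)"
  by (simp add: p_cross_def) (simp add: dot_def cross_def algebra_simps)
lemma peval_p_w [simp]: "peval s p_w t = 1 + t\<^sup>2"
  by (simp add: p_w_def power2_eq_square)

definition p_disc :: "cexp \<Rightarrow> rexp list" where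
  "p_disc q = padd (pmul (p_dot q) (p_dot q))
     (pscale (rneg (RMul (e_dot q q) (RSub (rnum 1) (e_sq e_alpha)))) (pmul p_w p_w))"
definition p_T1 :: "cexp \<Rightarrow> cexp \<Rightarrow> rexp list" where
  "p_T1 a b = padd (pscale (rneg (e_norm (e_sub b a))) (p_cross a))
     (pscale (rneg (RMul e_alpha (e_dot a (e_sub b a)))) p_w)"
definition p_T2 :: "cexp \<Rightarrow> cexp \<Rightarrow> rexp list" where
  "p_T2 a b = padd (pscale (e_norm (e_sub b a)) (p_cross b))
     (pscale (RMul e_alpha (e_dot b (e_sub b a))) p_w)"
definition p_num :: "cexp \<Rightarrow> cexp \<Rightarrow> rexp list" where
  "p_num a b = padd (p_cross (e_sub b a)) (pscale (RMul e_alpha (e_norm (e_sub b a))) p_w)"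
definition p_Rpp :: "cexp \<Rightarrow> cexp \<Rightarrow> rexp list" where
  "p_Rpp q r = (let l = pscale (rnum 2) (p_dot (e_sub q r)); d = RSub (e_dot q q) (e_dot r r) in
     padd (pscale (e_dot q q) (pmul l l))
       (padd (pscale (rneg (RMul (rnum 2) d)) (pmul (p_dot q) l))
         (pscale (RMul (RSub (rnum 1) (e_sq e_alpha)) (e_sq d)) (pmul p_w p_w))))"
definition p_Rpl :: "cexp \<Rightarrow> cexp \<Rightarrow> cexp \<Rightarrow> rexp list" where
  "p_Rpl q a b = padd (pscale (e_dot q q) (pmul (p_num a b) (p_num a b)))
     (padd (pscale (rneg (RMul (rnum 2) (e_cross a b))) (pmul (p_dot q) (p_num a b)))
       (pscale (RMul (RSub (rnum 1) (e_sq e_alpha)) (e_sq (e_cross a b))) (pmul p_w p_w)))"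
definition p_Rll :: "cexp \<Rightarrow> cexp \<Rightarrow> cexp \<Rightarrow> cexp \<Rightarrow> rexp list" where
  "p_Rll a b a' b' = padd (pscale (e_cross a' b') (p_num a b)) (pscale (rneg (e_cross a b)) (p_num a' b'))"

lemma rval_e_alpha: "rval s e_alpha = reals s 2 2"
  by (simp add: e_alpha_def)

context
  fixes s :: state and \<alpha> sg :: real
  assumes sg: "\<bar>sg\<bar> = 1" and s: "reals s 2 2 = \<alpha>" "reals s 10 0 = sg"
begin

lemma peval_p_disc: "peval s (p_disc q) t = pt_disc \<alpha> (cval s q) (dir sg t)"
  by (simp add: p_disc_def pt_disc_def norm_dir[OF sg] rval_e_alpha s power2_eq_square[of "1 + t\<^sup>2"]
    power2_eq_square[of "dot (cval s q) (dir sg t)"])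

lemma peval_p_T1: "peval s (p_T1 a b) t = ln_T1 \<alpha> (cval s a) (cval s b) (dir sg t)"
  using cross_commute[of "cval s a" "dir sg t"]
  by (simp add: p_T1_def ln_T1_def norm_dir[OF sg] rval_e_alpha s)

lemma peval_p_T2: "peval s (p_T2 a b) t = ln_T2 \<alpha> (cval s a) (cval s b) (dir sg t)"
  by (simp add: p_T2_def ln_T2_def norm_dir[OF sg] rval_e_alpha s)

lemma peval_p_num: "peval s (p_num a b) t = ln_num \<alpha> (cval s a) (cval s b) (dir sg t)"
  by (simp add: p_num_def ln_num_def norm_dir[OF sg] rval_e_alpha s)

lemma peval_p_Rpp: "peval s (p_Rpp q r) t = Rpp \<alpha> (cval s q) (cval s r) (dir sg t)"
  by (simp add: p_Rpp_def Rpp_def Let_def norm_dir[OF sg] rval_e_alpha s) (simp add: power2_eq_square algebra_simps)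

lemma peval_p_Rpl: "peval s (p_Rpl q a b) t = Rpl \<alpha> (cval s q) (cval s a) (cval s b) (dir sg t)"
  by (simp add: p_Rpl_def Rpl_def peval_p_num norm_dir[OF sg] rval_e_alpha s) (simp add: power2_eq_square)

lemma peval_p_Rll: "peval s (p_Rll a b a' b') t =
    Rll \<alpha> (cval s a) (cval s b) (cval s a') (cval s b') (dir sg t)"
  by (simp add: p_Rll_def Rll_def peval_p_num)

end

abbreviation cfree :: "nat \<Rightarrow> cexp \<Rightarrow> bool" where "cfree x a \<equiv> rfree x (fst a) \<and> rfree x (snd a)"

lemma rfree_polys [simp]:
  assumes "x \<noteq> 2" "x \<noteq> 10"
  shows "cfree x q \<Longrightarrow> list_all (rfree x) (p_disc q)"
    "cfree x a \<Longrightarrow> cfree x b \<Longrightarrow> list_all (rfree x) (p_T1 a b)"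
    "cfree x a \<Longrightarrow> cfree x b \<Longrightarrow> list_all (rfree x) (p_T2 a b)"
    "cfree x q \<Longrightarrow> cfree x r \<Longrightarrow> list_all (rfree x) (p_Rpp q r)"
    "cfree x q \<Longrightarrow> cfree x a \<Longrightarrow> cfree x b \<Longrightarrow> list_all (rfree x) (p_Rpl q a b)"
    "cfree x a \<Longrightarrow> cfree x b \<Longrightarrow> cfree x a' \<Longrightarrow> cfree x b' \<Longrightarrow> list_all (rfree x) (p_Rll a b a' b')"
  using assms
  by (simp_all add: p_disc_def p_T1_def p_T2_def p_Rpp_def p_Rpl_def p_Rll_def p_num_def p_dot_def p_cross_def p_w_def
    Let_def e_alpha_def)

section \<open>Scanning the roots of one polynomial\<close>

definition scan_root :: "rexp list \<Rightarrow> nat \<Rightarrow> com" where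
  "scan_root cs k = Cond (BAnd (RLess (rv 11) (RRoot k cs)) (RLess (RRoot k cs) (rv 12)))
     (RAssign 12 (NConst 0) (RRoot k cs)) Skip"

text \<open>The loop over the roots is unrolled, since the index in \<open>RRoot\<close> is part of
  the program text.\<close>

definition scan :: "rexp list \<Rightarrow> com" where
  "scan cs = foldr (\<lambda>k c. Seq (scan_root cs k) c) [0..<length cs] Skip"

lemma written_scan_root [simp]: "nats_written (scan_root cs k) = {}" "reals_written (scan_root cs k) = {12}"
  by (auto simp: scan_root_def)

lemma written_scan [simp]: "nats_written (scan cs) = {}"
  and reals_written_scan: "a \<in> reals_written (scan cs) \<Longrightarrow> a = 12"
proof -
  have "nats_written (foldr (\<lambda>k c. Seq (scan_root cs k) c) ks Skip) = {} \<and>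
      reals_written (foldr (\<lambda>k c. Seq (scan_root cs k) c) ks Skip) \<subseteq> {12}" for ks
    by (induction ks) auto
  then show "nats_written (scan cs) = {}" "a \<in> reals_written (scan cs) \<Longrightarrow> a = 12" unfolding scan_def by blast+
qed

lemma runs_scan_roots:
  assumes cs: "list_all (rfree 12) cs" and c: "map (rval s) cs = c" and cur: "reals s 11 0 < reals s 12 0"
  shows "runs (foldr (\<lambda>k c. Seq (scan_root cs k) c) ks Skip) s (2 * length ks + 1) (\<lambda>s'.
     reals s 11 0 < reals s' 12 0 \<and> reals s' 12 0 \<le> reals s 12 0 \<and>
     (reals s' 12 0 = reals s 12 0 \<or> (\<exists>k\<in>set ks. reals s' 12 0 = real_root k c)) \<and>
     (\<forall>k\<in>set ks. \<not> (reals s 11 0 < real_root k c \<and> real_root k c < reals s' 12 0)))"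
  using c cur
proof (induction ks arbitrary: s)
  case Nil
  then show ?case
    by (simp only: foldr.simps id_apply) (rule runs_mono[OF runs_Skip[where Q = "\<lambda>s'. s' = s"]], auto)
next
  case (Cons k ks)
  have inv: "map (rval (s\<lparr>reals := upd2 (reals s) 12 0 x\<rparr>)) cs = c" for x
    using cs Cons.prems(1) by (auto simp: list_all_iff rval_rfree)
  have one: "runs (scan_root cs k) s 2 (\<lambda>s'. s' = s \<and> \<not> (reals s 11 0 < real_root k c \<and> real_root k c < reals s 12 0) \<or>
      s' = s\<lparr>reals := upd2 (reals s) 12 0 (real_root k c)\<rparr> \<and> reals s 11 0 < real_root k c \<and> real_root k c < reals s 12 0)"
    unfolding scan_root_def
    by (rule runs_mono[OF runs_Cond[OF runs_RAssign runs_mono[OF runs_Skip]]])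
      (use Cons.prems in \<open>auto simp: upd2_apply\<close>)
  have "runs (Seq (scan_root cs k) (foldr (\<lambda>k c. Seq (scan_root cs k) c) ks Skip)) s (2 + (2 * length ks + 1)) (\<lambda>s'.
     reals s 11 0 < reals s' 12 0 \<and> reals s' 12 0 \<le> reals s 12 0 \<and>
     (reals s' 12 0 = reals s 12 0 \<or> (\<exists>k\<in>set (k # ks). reals s' 12 0 = real_root k c)) \<and>
     (\<forall>k\<in>set (k # ks). \<not> (reals s 11 0 < real_root k c \<and> real_root k c < reals s' 12 0)))"
  proof (rule runs_Seq[OF one])
    fix s1 assume "s1 = s \<and> \<not> (reals s 11 0 < real_root k c \<and> real_root k c < reals s 12 0) \<or>
      s1 = s\<lparr>reals := upd2 (reals s) 12 0 (real_root k c)\<rparr> \<and> reals s 11 0 < real_root k c \<and> real_root k c < reals s 12 0"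
    then consider "s1 = s" "\<not> (reals s 11 0 < real_root k c \<and> real_root k c < reals s 12 0)"
      | "s1 = s\<lparr>reals := upd2 (reals s) 12 0 (real_root k c)\<rparr>" "reals s 11 0 < real_root k c" "real_root k c < reals s 12 0"
      by blast
    then show "runs (foldr (\<lambda>k c. Seq (scan_root cs k) c) ks Skip) s1 (2 * length ks + 1) (\<lambda>s'.
     reals s 11 0 < reals s' 12 0 \<and> reals s' 12 0 \<le> reals s 12 0 \<and>
     (reals s' 12 0 = reals s 12 0 \<or> (\<exists>k\<in>set (k # ks). reals s' 12 0 = real_root k c)) \<and>
     (\<forall>k\<in>set (k # ks). \<not> (reals s 11 0 < real_root k c \<and> real_root k c < reals s' 12 0)))"
    proof cases
      case 1
      show ?thesis unfolding 1(1)
        by (rule runs_mono[OF Cons.IH[OF Cons.prems]]) (use 1(2) in auto)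
    next
      case 2
      have r: "reals s1 11 0 = reals s 11 0" "reals s1 12 0 = real_root k c" by (simp_all add: 2(1) upd2_apply)
      show ?thesis
        by (rule runs_mono[OF Cons.IH]) (use 2 inv r in auto)
    qed
  qed
  then show ?case by simp
qed

text \<open>Functions that vanish identically are let through; they contribute no critical
  direction.\<close>

definition gap :: "(real \<Rightarrow> real) \<Rightarrow> real \<Rightarrow> real \<Rightarrow> bool" where
  "gap f x y \<longleftrightarrow> (\<forall>t. f t = 0) \<or> (\<forall>t. x < t \<and> t < y \<longrightarrow> f t \<noteq> 0)"

text \<open>Empty for the zero function, so that it is finite for every polynomial.\<close>

definition zeros :: "(real \<Rightarrow> real) \<Rightarrow> real set" where
  "zeros f = (if \<forall>t. f t = 0 then {} else {t. f t = 0})"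

text \<open>Real variable 11 is the current and 12 the best candidate for the next critical
  direction. The set \<open>Z\<close> will be finite; membership of the candidate bounds the number
  of rounds of the sweep.\<close>

definition next_inv :: "real \<Rightarrow> real \<Rightarrow> real set \<Rightarrow> (real \<Rightarrow> real) set \<Rightarrow> state \<Rightarrow> bool" where
  "next_inv x y Z F s \<longleftrightarrow> reals s 11 0 = x \<and> x < reals s 12 0 \<and> reals s 12 0 \<le> y \<and> reals s 12 0 \<in> Z \<and>
     (\<forall>f\<in>F. gap f x (reals s 12 0))"

lemma runs_scan:
  assumes inv: "next_inv x y Z F s" and cs: "list_all (rfree 12) cs"
    and f: "\<And>t. peval s cs t = f t" and Z: "zeros f \<subseteq> Z" "0 \<in> Z"
  shows "runs (scan cs) s (2 * length cs + 1) (next_inv x y Z (insert f F))"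
proof -
  define c where "c = map (rval s) cs"
  have cf: "poly (Poly c) t = f t" for t using f by (simp add: c_def poly_peval)
  have c0: "Poly c = 0 \<longleftrightarrow> (\<forall>t. f t = 0)" using poly_all_0_iff_0[of "Poly c"] cf by simp
  have lt: "reals s 11 0 < reals s 12 0" using inv by (simp add: next_inv_def)
  have s12: "set [0..<length cs] = {..<length c}" by (auto simp: c_def)
  show ?thesis unfolding scan_def
  proof (rule runs_mono[OF runs_scan_roots[OF cs c_def[symmetric] lt]], unfold s12)
    fix s' assume *: "reals s 11 0 < reals s' 12 0 \<and> reals s' 12 0 \<le> reals s 12 0 \<and>
     (reals s' 12 0 = reals s 12 0 \<or> (\<exists>k\<in>{..<length c}. reals s' 12 0 = real_root k c)) \<and>
     (\<forall>k\<in>{..<length c}. \<not> (reals s 11 0 < real_root k c \<and> real_root k c < reals s' 12 0))"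
      and u: "unchanged (foldr (\<lambda>k c. Seq (scan_root cs k) c) [0..<length cs] Skip) s s'"
    have "11 \<notin> reals_written (scan cs)" using reals_written_scan[of 11 cs] by auto
    then have r11: "reals s' 11 0 = reals s 11 0" using unchangedD(2)[OF u] by (simp add: scan_def)
    have "reals s' 12 0 \<in> Z"
    proof (cases "reals s' 12 0 = reals s 12 0")
      case True
      then show ?thesis using inv by (simp add: next_inv_def)
    next
      case False
      then obtain k where "reals s' 12 0 = real_root k c" using * by blast
      \<comment> \<open>Either a proper root or the default value; the latter is in \<open>Z\<close>
        by the assumption \<open>0 \<in> Z\<close>.\<close>
      then have "reals s' 12 0 = 0 \<or> (Poly c \<noteq> 0 \<and> f (reals s' 12 0) = 0)"
        using real_root_cases[of k c] cf by simp
      then show ?thesis using Z c0 by (auto simp: zeros_def split: if_splits)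
    qed
    moreover have "gap f x (reals s' 12 0)"
    proof (cases "Poly c = 0")
      case False
      have "f t \<noteq> 0" if "x < t" "t < reals s' 12 0" for t
      proof
        assume "f t = 0"
        then obtain k where "k < length c" "t = real_root k c" using real_root_covers[OF False] cf by auto
        then show False using * that inv by (auto simp: next_inv_def)
      qed
      then show ?thesis by (auto simp: gap_def)
    qed (use c0 in \<open>simp add: gap_def\<close>)
    \<comment> \<open>The candidate never increases, so gaps established before persist.\<close>
    moreover have "gap h x (reals s' 12 0)" if "h \<in> F" for h
    proof -
      have "gap h x (reals s 12 0)" using inv that by (simp add: next_inv_def)
      then show ?thesis using * unfolding gap_def by (meson less_le_trans)
    qed
    ultimately show "next_inv x y Z (insert f F) s'" using * inv r11 by (auto simp: next_inv_def)
  qed simp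
qed

text \<open>Vertices and edges share one index range, as every cycle has as many edges as
  vertices.\<close>

definition mem :: "(complex \<times> complex) list \<Rightarrow> complex list \<Rightarrow> real \<Rightarrow> complex \<Rightarrow> real \<Rightarrow> state \<Rightarrow> bool" where
  "mem es qs \<alpha> p sg s \<longleftrightarrow> nats s 2 0 = length es \<and> length qs = length es \<and>
     reals s 2 0 = Re p \<and> reals s 2 1 = Im p \<and> reals s 2 2 = \<alpha> \<and> reals s 10 0 = sg \<and>
     (\<forall>i<length es. Complex (reals s 4 i) (reals s 5 i) = qs ! i \<and>
       Complex (reals s 6 i) (reals s 7 i) = fst (es ! i) \<and> Complex (reals s 8 i) (reals s 9 i) = snd (es ! i))"

lemma mem_cong:
  assumes "mem es qs \<alpha> p sg s" "nats s' 2 = nats s 2" "\<And>a. a \<in> {2,4,5,6,7,8,9,10} \<Longrightarrow> reals s' a = reals s a"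
  shows "mem es qs \<alpha> p sg s'"
  using assms(1,2) assms(3)[of 2] assms(3)[of 4] assms(3)[of 5] assms(3)[of 6] assms(3)[of 7]
    assms(3)[of 8] assms(3)[of 9] assms(3)[of 10]
  unfolding mem_def by simp

lemma mem_unchanged:
  assumes m: "mem es qs \<alpha> p sg s" and u: "unchanged c s s'" and n: "2 \<notin> nats_written c"
    and r: "\<And>a. a \<in> reals_written c \<Longrightarrow> a \<notin> {2,4,5,6,7,8,9,10}"
  shows "mem es qs \<alpha> p sg s'"
proof (rule mem_cong[OF m unchangedD(1)[OF u n]])
  show "reals s' a = reals s a" if "a \<in> {2,4,5,6,7,8,9,10}" for a
    using unchangedD(2)[OF u] r that by blast
qed

lemma mem_cvals:
  assumes "mem es qs \<alpha> p sg s" "nval s i < length es"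
  shows "cval s (qe i) = qs ! nval s i" "cval s (ae i) = fst (es ! nval s i)" "cval s (be i) = snd (es ! nval s i)"
  using assms by (auto simp: mem_def cval_def qe_def ae_def be_def)

section \<open>Loops over all pairs of vertices and edges\<close>

definition next_inner :: com where
  "next_inner = Seq (scan (p_Rpp (qe (nv 3)) (qe (nv 4))))
     (Seq (scan (p_Rpl (qe (nv 3)) (ae (nv 4)) (be (nv 4))))
       (scan (p_Rll (ae (nv 3)) (be (nv 3)) (ae (nv 4)) (be (nv 4)))))"

definition next_outer :: com where
  "next_outer = Seq (scan (p_disc (qe (nv 3)))) (Seq (scan (p_T1 (ae (nv 3)) (be (nv 3))))
     (Seq (scan (p_T2 (ae (nv 3)) (be (nv 3)))) (For 4 (nv 2) next_inner)))"

definition next_crit :: com where "next_crit = For 3 (nv 2) next_outer"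

lemma written_next [simp]:
  "nats_written next_inner = {}" "nats_written next_outer = {4}" "nats_written next_crit = {3, 4}"
  by (auto simp: next_inner_def next_outer_def next_crit_def)

lemma reals_written_next:
  "a \<in> reals_written next_inner \<Longrightarrow> a = 12" "a \<in> reals_written next_outer \<Longrightarrow> a = 12"
  "a \<in> reals_written next_crit \<Longrightarrow> a = 12"
  by (auto simp: next_inner_def next_outer_def next_crit_def dest: reals_written_scan)

definition pair_funs :: "real \<Rightarrow> real \<Rightarrow> complex \<Rightarrow> complex \<times> complex \<Rightarrow> complex \<Rightarrow> complex \<times> complex \<Rightarrow> (real \<Rightarrow> real) set" where
  "pair_funs \<alpha> sg q e r e' = {\<lambda>t. Rpp \<alpha> q r (dir sg t), \<lambda>t. Rpl \<alpha> q (fst e') (snd e') (dir sg t),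
     \<lambda>t. Rll \<alpha> (fst e) (snd e) (fst e') (snd e') (dir sg t)}"

definition single_funs :: "real \<Rightarrow> real \<Rightarrow> complex \<Rightarrow> complex \<times> complex \<Rightarrow> (real \<Rightarrow> real) set" where
  "single_funs \<alpha> sg q e = {\<lambda>t. pt_disc \<alpha> q (dir sg t), \<lambda>t. ln_T1 \<alpha> (fst e) (snd e) (dir sg t),
     \<lambda>t. ln_T2 \<alpha> (fst e) (snd e) (dir sg t)}"

definition all_funs :: "real \<Rightarrow> real \<Rightarrow> (complex \<times> complex) list \<Rightarrow> complex list \<Rightarrow> (real \<Rightarrow> real) set" where
  "all_funs \<alpha> sg es qs = (\<Union>i<length es. single_funs \<alpha> sg (qs ! i) (es ! i) \<union>
     (\<Union>j<length es. pair_funs \<alpha> sg (qs ! i) (es ! i) (qs ! j) (es ! j)))"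

lemma next_inv_mono: "next_inv x y Z F s \<Longrightarrow> G \<subseteq> F \<Longrightarrow> next_inv x y Z G s"
  by (auto simp: next_inv_def)

lemma next_inv_cong: "next_inv x y Z F s \<Longrightarrow> reals s' 11 = reals s 11 \<Longrightarrow> reals s' 12 = reals s 12 \<Longrightarrow> next_inv x y Z F s'"
  by (simp add: next_inv_def)

text \<open>Kept symbolic: the lengths of the coefficient lists are constants of the
  program.\<close>

definition T_inner :: nat where
  "T_inner = 2 * length (p_Rpp (qe (nv 3)) (qe (nv 4))) + 1 + (2 * length (p_Rpl (qe (nv 3)) (ae (nv 4)) (be (nv 4))) + 1 +
     (2 * length (p_Rll (ae (nv 3)) (be (nv 3)) (ae (nv 4)) (be (nv 4))) + 1))"

definition T_outer :: nat where
  "T_outer = 2 * length (p_disc (qe (nv 3))) + 1 + (2 * length (p_T1 (ae (nv 3)) (be (nv 3))) + 1 +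
     (2 * length (p_T2 (ae (nv 3)) (be (nv 3))) + 1))"

lemma mem_scan:
  assumes "mem es qs \<alpha> p sg s" "unchanged (scan cs) s s'"
  shows "mem es qs \<alpha> p sg s'" "nats s' = nats s"
proof -
  show "mem es qs \<alpha> p sg s'"
    by (rule mem_unchanged[OF assms]) (auto dest: reals_written_scan)
  show "nats s' = nats s" by (rule ext) (simp add: unchangedD(1)[OF assms(2)])
qed

lemma runs_next_inner:
  assumes m: "mem es qs \<alpha> p sg s" and sg: "\<bar>sg\<bar> = 1" and inv: "next_inv x y Z F s"
    and i: "nats s 3 0 = i" "i < length es" and j: "nats s 4 0 = j" "j < length es"
    and Z: "\<And>f. f \<in> all_funs \<alpha> sg es qs \<Longrightarrow> zeros f \<subseteq> Z" "0 \<in> Z"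
  shows "runs next_inner s T_inner (next_inv x y Z (F \<union> pair_funs \<alpha> sg (qs ! i) (es ! i) (qs ! j) (es ! j)))"
proof -
  have pf: "pair_funs \<alpha> sg (qs ! i) (es ! i) (qs ! j) (es ! j) \<subseteq> all_funs \<alpha> sg es qs"
    using i j unfolding all_funs_def by blast
  have sr: "reals s 2 2 = \<alpha>" "reals s 10 0 = sg" if "mem es qs \<alpha> p sg s" for s
    using that by (auto simp: mem_def)
  have cv: "cval s (qe (nv 3)) = qs ! i" "cval s (ae (nv 3)) = fst (es ! i)" "cval s (be (nv 3)) = snd (es ! i)"
    "cval s (qe (nv 4)) = qs ! j" "cval s (ae (nv 4)) = fst (es ! j)" "cval s (be (nv 4)) = snd (es ! j)"
    if "mem es qs \<alpha> p sg s" "nats s 3 0 = i" "nats s 4 0 = j" for s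
    using mem_cvals[OF that(1), of "nv 3"] mem_cvals[OF that(1), of "nv 4"] that(2,3) i j by auto
  have fr: "cfree 12 (qe k)" "cfree 12 (ae k)" "cfree 12 (be k)" for k
    by (auto simp: qe_def ae_def be_def)
  show ?thesis unfolding next_inner_def T_inner_def
  proof (rule runs_Seq[OF runs_scan[OF inv, where f = "\<lambda>t. Rpp \<alpha> (qs ! i) (qs ! j) (dir sg t)"]])
    show "peval s (p_Rpp (qe (nv 3)) (qe (nv 4))) t = Rpp \<alpha> (qs ! i) (qs ! j) (dir sg t)" for t
      using peval_p_Rpp[OF sg sr[OF m]] cv[OF m i(1) j(1)] by simp
    show "zeros (\<lambda>t. Rpp \<alpha> (qs ! i) (qs ! j) (dir sg t)) \<subseteq> Z" using Z(1) pf by (simp add: pair_funs_def)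
    fix s1 assume inv1: "next_inv x y Z (insert (\<lambda>t. Rpp \<alpha> (qs ! i) (qs ! j) (dir sg t)) F) s1"
      and u1: "unchanged (scan (p_Rpp (qe (nv 3)) (qe (nv 4)))) s s1"
    note m1 = mem_scan[OF m u1]
    have n1: "nats s1 3 0 = i" "nats s1 4 0 = j" using m1 i j by simp_all
    show "runs (Seq (scan (p_Rpl (qe (nv 3)) (ae (nv 4)) (be (nv 4))))
       (scan (p_Rll (ae (nv 3)) (be (nv 3)) (ae (nv 4)) (be (nv 4))))) s1
       (2 * length (p_Rpl (qe (nv 3)) (ae (nv 4)) (be (nv 4))) + 1 +
         (2 * length (p_Rll (ae (nv 3)) (be (nv 3)) (ae (nv 4)) (be (nv 4))) + 1))
       (next_inv x y Z (F \<union> pair_funs \<alpha> sg (qs ! i) (es ! i) (qs ! j) (es ! j)))"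
    proof (rule runs_Seq[OF runs_scan[OF inv1, where f = "\<lambda>t. Rpl \<alpha> (qs ! i) (fst (es ! j)) (snd (es ! j)) (dir sg t)"]])
      show "peval s1 (p_Rpl (qe (nv 3)) (ae (nv 4)) (be (nv 4))) t = Rpl \<alpha> (qs ! i) (fst (es ! j)) (snd (es ! j)) (dir sg t)" for t
        using peval_p_Rpl[OF sg sr[OF m1(1)]] cv[OF m1(1) n1] by simp
      show "zeros (\<lambda>t. Rpl \<alpha> (qs ! i) (fst (es ! j)) (snd (es ! j)) (dir sg t)) \<subseteq> Z" using Z(1) pf by (simp add: pair_funs_def)
      fix s2 assume inv2: "next_inv x y Z (insert (\<lambda>t. Rpl \<alpha> (qs ! i) (fst (es ! j)) (snd (es ! j)) (dir sg t))
          (insert (\<lambda>t. Rpp \<alpha> (qs ! i) (qs ! j) (dir sg t)) F)) s2"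
        and u2: "unchanged (scan (p_Rpl (qe (nv 3)) (ae (nv 4)) (be (nv 4)))) s1 s2"
      note m2 = mem_scan[OF m1(1) u2]
      have n2: "nats s2 3 0 = i" "nats s2 4 0 = j" using m2 n1 by simp_all
      show "runs (scan (p_Rll (ae (nv 3)) (be (nv 3)) (ae (nv 4)) (be (nv 4)))) s2
         (2 * length (p_Rll (ae (nv 3)) (be (nv 3)) (ae (nv 4)) (be (nv 4))) + 1)
         (next_inv x y Z (F \<union> pair_funs \<alpha> sg (qs ! i) (es ! i) (qs ! j) (es ! j)))"
      proof (rule runs_mono[OF runs_scan[OF inv2, where f = "\<lambda>t. Rll \<alpha> (fst (es ! i)) (snd (es ! i)) (fst (es ! j)) (snd (es ! j)) (dir sg t)"]])
        show "peval s2 (p_Rll (ae (nv 3)) (be (nv 3)) (ae (nv 4)) (be (nv 4))) t =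
            Rll \<alpha> (fst (es ! i)) (snd (es ! i)) (fst (es ! j)) (snd (es ! j)) (dir sg t)" for t
          using peval_p_Rll[OF sg sr[OF m2(1)]] cv[OF m2(1) n2] by simp
        show "zeros (\<lambda>t. Rll \<alpha> (fst (es ! i)) (snd (es ! i)) (fst (es ! j)) (snd (es ! j)) (dir sg t)) \<subseteq> Z"
          using Z(1) pf by (simp add: pair_funs_def)
        fix s3 assume "next_inv x y Z (insert (\<lambda>t. Rll \<alpha> (fst (es ! i)) (snd (es ! i)) (fst (es ! j)) (snd (es ! j)) (dir sg t))
          (insert (\<lambda>t. Rpl \<alpha> (qs ! i) (fst (es ! j)) (snd (es ! j)) (dir sg t))
          (insert (\<lambda>t. Rpp \<alpha> (qs ! i) (qs ! j) (dir sg t)) F))) s3"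
        then show "next_inv x y Z (F \<union> pair_funs \<alpha> sg (qs ! i) (es ! i) (qs ! j) (es ! j)) s3"
          by (rule next_inv_mono) (auto simp: pair_funs_def)
      qed (use fr Z in auto)
    qed (use fr Z in auto)
  qed (use fr Z in auto)
qed

lemma runs_next_outer:
  assumes m: "mem es qs \<alpha> p sg s" and sg: "\<bar>sg\<bar> = 1" and inv: "next_inv x y Z F s"
    and i: "nats s 3 0 = i" "i < length es"
    and Z: "\<And>f. f \<in> all_funs \<alpha> sg es qs \<Longrightarrow> zeros f \<subseteq> Z" "0 \<in> Z"
  shows "runs next_outer s (T_outer + (2 + length es * (T_inner + 2)))
    (next_inv x y Z (F \<union> single_funs \<alpha> sg (qs ! i) (es ! i) \<union>
      (\<Union>j<length es. pair_funs \<alpha> sg (qs ! i) (es ! i) (qs ! j) (es ! j))))"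
proof -
  let ?f1 = "\<lambda>t. pt_disc \<alpha> (qs ! i) (dir sg t)"
  let ?f2 = "\<lambda>t. ln_T1 \<alpha> (fst (es ! i)) (snd (es ! i)) (dir sg t)"
  let ?f3 = "\<lambda>t. ln_T2 \<alpha> (fst (es ! i)) (snd (es ! i)) (dir sg t)"
  let ?c1 = "p_disc (qe (nv 3))"
  let ?c2 = "p_T1 (ae (nv 3)) (be (nv 3))"
  let ?c3 = "p_T2 (ae (nv 3)) (be (nv 3))"
  let ?P = "\<lambda>j. pair_funs \<alpha> sg (qs ! i) (es ! i) (qs ! j) (es ! j)"
  have sf: "single_funs \<alpha> sg (qs ! i) (es ! i) \<subseteq> all_funs \<alpha> sg es qs"
    using i unfolding all_funs_def by blast
  have sr: "reals s 2 2 = \<alpha>" "reals s 10 0 = sg" if "mem es qs \<alpha> p sg s" for s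
    using that by (auto simp: mem_def)
  have cv: "cval s (qe (nv 3)) = qs ! i" "cval s (ae (nv 3)) = fst (es ! i)" "cval s (be (nv 3)) = snd (es ! i)"
    if "mem es qs \<alpha> p sg s" "nats s 3 0 = i" for s
    using mem_cvals[OF that(1), of "nv 3"] that(2) i by auto
  have fr: "cfree 12 (qe k)" "cfree 12 (ae k)" "cfree 12 (be k)" for k
    by (auto simp: qe_def ae_def be_def)
  have loop: "runs (For 4 (nv 2) next_inner) s (2 + length es * (T_inner + 2)) (next_inv x y Z (G \<union> (\<Union>j<length es. ?P j)))"
    if m: "mem es qs \<alpha> p sg s" and n: "nats s 3 0 = i" and inv: "next_inv x y Z G s" for s G
  proof (rule runs_mono[OF runs_For[where N = "length es" and T = T_inner and
        I = "\<lambda>k s. mem es qs \<alpha> p sg s \<and> nats s 3 0 = i \<and> next_inv x y Z (G \<union> (\<Union>j<k. ?P j)) s"]])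
    show "mem es qs \<alpha> p sg (s\<lparr>nats := upd2 (nats s) 4 0 0\<rparr>) \<and> nats (s\<lparr>nats := upd2 (nats s) 4 0 0\<rparr>) 3 0 = i \<and>
        next_inv x y Z (G \<union> (\<Union>j<0. ?P j)) (s\<lparr>nats := upd2 (nats s) 4 0 0\<rparr>)"
      using n by (auto intro!: mem_cong[OF m] next_inv_cong[OF inv] simp: upd2_apply)
    fix k s assume I: "mem es qs \<alpha> p sg s \<and> nats s 3 0 = i \<and> next_inv x y Z (G \<union> (\<Union>j<k. ?P j)) s"
      and k: "k < length es" "nats s 4 0 = k"
    have m: "mem es qs \<alpha> p sg s" and n: "nats s 3 0 = i" and inv: "next_inv x y Z (G \<union> (\<Union>j<k. ?P j)) s"
      using I by auto
    show "runs next_inner s T_inner (\<lambda>s'. nats s' 4 0 = k \<and>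
        mem es qs \<alpha> p sg (s'\<lparr>nats := upd2 (nats s') 4 0 (Suc k)\<rparr>) \<and> nats (s'\<lparr>nats := upd2 (nats s') 4 0 (Suc k)\<rparr>) 3 0 = i \<and>
        next_inv x y Z (G \<union> (\<Union>j<Suc k. ?P j)) (s'\<lparr>nats := upd2 (nats s') 4 0 (Suc k)\<rparr>))"
    proof (rule runs_mono[OF runs_next_inner[OF m sg inv n i(2) k(2,1) Z]])
      fix s' assume inv': "next_inv x y Z (G \<union> (\<Union>j<k. ?P j) \<union> ?P k) s'" and u: "unchanged next_inner s s'"
      have m': "mem es qs \<alpha> p sg s'"
        by (rule mem_unchanged[OF m u]) (auto dest: reals_written_next)
      have n': "nats s' = nats s" by (rule ext) (simp add: unchangedD(1)[OF u])
      have "next_inv x y Z (G \<union> (\<Union>j<Suc k. ?P j)) s'"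
        by (rule next_inv_mono[OF inv']) (auto simp: lessThan_Suc)
      then show "nats s' 4 0 = k \<and>
        mem es qs \<alpha> p sg (s'\<lparr>nats := upd2 (nats s') 4 0 (Suc k)\<rparr>) \<and> nats (s'\<lparr>nats := upd2 (nats s') 4 0 (Suc k)\<rparr>) 3 0 = i \<and>
        next_inv x y Z (G \<union> (\<Union>j<Suc k. ?P j)) (s'\<lparr>nats := upd2 (nats s') 4 0 (Suc k)\<rparr>)"
        using n n' k by (auto intro!: mem_cong[OF m'] elim!: next_inv_cong simp: upd2_apply)
    qed auto
  qed (auto simp: mem_def)
  have inv1: "runs (scan ?c1) s (2 * length ?c1 + 1) (next_inv x y Z (insert ?f1 F))"
    by (rule runs_scan[OF inv]) (use peval_p_disc[OF sg sr[OF m]] cv[OF m i(1)] fr Z sf in \<open>auto simp: single_funs_def\<close>)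
  have "runs next_outer s (2 * length ?c1 + 1 + (2 * length ?c2 + 1 + (2 * length ?c3 + 1 + (2 + length es * (T_inner + 2)))))
    (next_inv x y Z (insert ?f3 (insert ?f2 (insert ?f1 F)) \<union> (\<Union>j<length es. ?P j)))"
    unfolding next_outer_def
  proof (rule runs_Seq[OF inv1])
    fix s1 assume inv1: "next_inv x y Z (insert ?f1 F) s1" and u1: "unchanged (scan ?c1) s s1"
    note m1 = mem_scan[OF m u1]
    have n1: "nats s1 3 0 = i" using m1 i by simp
    have inv2: "runs (scan ?c2) s1 (2 * length ?c2 + 1) (next_inv x y Z (insert ?f2 (insert ?f1 F)))"
      by (rule runs_scan[OF inv1]) (use peval_p_T1[OF sg sr[OF m1(1)]] cv[OF m1(1) n1] fr Z sf in \<open>auto simp: single_funs_def\<close>)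
    show "runs (Seq (scan ?c2) (Seq (scan ?c3) (For 4 (nv 2) next_inner))) s1
       (2 * length ?c2 + 1 + (2 * length ?c3 + 1 + (2 + length es * (T_inner + 2))))
       (next_inv x y Z (insert ?f3 (insert ?f2 (insert ?f1 F)) \<union> (\<Union>j<length es. ?P j)))"
    proof (rule runs_Seq[OF inv2])
      fix s2 assume inv2: "next_inv x y Z (insert ?f2 (insert ?f1 F)) s2" and u2: "unchanged (scan ?c2) s1 s2"
      note m2 = mem_scan[OF m1(1) u2]
      have n2: "nats s2 3 0 = i" using m2 n1 by simp
      have inv3: "runs (scan ?c3) s2 (2 * length ?c3 + 1) (next_inv x y Z (insert ?f3 (insert ?f2 (insert ?f1 F))))"
        by (rule runs_scan[OF inv2]) (use peval_p_T2[OF sg sr[OF m2(1)]] cv[OF m2(1) n2] fr Z sf in \<open>auto simp: single_funs_def\<close>)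
      show "runs (Seq (scan ?c3) (For 4 (nv 2) next_inner)) s2 (2 * length ?c3 + 1 + (2 + length es * (T_inner + 2)))
         (next_inv x y Z (insert ?f3 (insert ?f2 (insert ?f1 F)) \<union> (\<Union>j<length es. ?P j)))"
      proof (rule runs_Seq[OF inv3])
        fix s3 assume inv3: "next_inv x y Z (insert ?f3 (insert ?f2 (insert ?f1 F))) s3" and u3: "unchanged (scan ?c3) s2 s3"
        note m3 = mem_scan[OF m2(1) u3]
        show "runs (For 4 (nv 2) next_inner) s3 (2 + length es * (T_inner + 2))
           (next_inv x y Z (insert ?f3 (insert ?f2 (insert ?f1 F)) \<union> (\<Union>j<length es. ?P j)))"
          by (rule loop[OF m3(1) _ inv3]) (use m3 n2 in simp)
      qed
    qed
  qed
  then show ?thesis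
    by (rule runs_mono) (auto simp: T_outer_def single_funs_def elim!: next_inv_mono)
qed

lemma runs_next_crit:
  assumes m: "mem es qs \<alpha> p sg s" and sg: "\<bar>sg\<bar> = 1" and inv: "next_inv x y Z {} s"
    and Z: "\<And>f. f \<in> all_funs \<alpha> sg es qs \<Longrightarrow> zeros f \<subseteq> Z" "0 \<in> Z"
  shows "runs next_crit s (2 + length es * (T_outer + (2 + length es * (T_inner + 2)) + 2))
    (next_inv x y Z (all_funs \<alpha> sg es qs))"
proof -
  let ?F = "\<lambda>i. single_funs \<alpha> sg (qs ! i) (es ! i) \<union>
     (\<Union>j<length es. pair_funs \<alpha> sg (qs ! i) (es ! i) (qs ! j) (es ! j))"
  show ?thesis unfolding next_crit_def
  proof (rule runs_mono[OF runs_For[where N = "length es" and T = "T_outer + (2 + length es * (T_inner + 2))" and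
        I = "\<lambda>k s. mem es qs \<alpha> p sg s \<and> next_inv x y Z (\<Union>i<k. ?F i) s"]])
    show "mem es qs \<alpha> p sg (s\<lparr>nats := upd2 (nats s) 3 0 0\<rparr>) \<and>
        next_inv x y Z (\<Union>i<0. ?F i) (s\<lparr>nats := upd2 (nats s) 3 0 0\<rparr>)"
      using inv by (auto intro!: mem_cong[OF m] elim!: next_inv_cong simp: upd2_apply)
    fix k s assume I: "mem es qs \<alpha> p sg s \<and> next_inv x y Z (\<Union>i<k. ?F i) s"
      and k: "k < length es" "nats s 3 0 = k"
    have m: "mem es qs \<alpha> p sg s" and inv: "next_inv x y Z (\<Union>i<k. ?F i) s" using I by auto
    show "runs next_outer s (T_outer + (2 + length es * (T_inner + 2))) (\<lambda>s'. nats s' 3 0 = k \<and>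
        mem es qs \<alpha> p sg (s'\<lparr>nats := upd2 (nats s') 3 0 (Suc k)\<rparr>) \<and>
        next_inv x y Z (\<Union>i<Suc k. ?F i) (s'\<lparr>nats := upd2 (nats s') 3 0 (Suc k)\<rparr>))"
    proof (rule runs_mono[OF runs_next_outer[OF m sg inv k(2,1) Z]])
      fix s' assume inv': "next_inv x y Z ((\<Union>i<k. ?F i) \<union> single_funs \<alpha> sg (qs ! k) (es ! k) \<union>
          (\<Union>j<length es. pair_funs \<alpha> sg (qs ! k) (es ! k) (qs ! j) (es ! j))) s'" and u: "unchanged next_outer s s'"
      have m': "mem es qs \<alpha> p sg s'"
        by (rule mem_unchanged[OF m u]) (auto dest: reals_written_next)
      have n': "nats s' 3 = nats s 3" by (simp add: unchangedD(1)[OF u])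
      have "next_inv x y Z (\<Union>i<Suc k. ?F i) s'"
        by (rule next_inv_mono[OF inv']) (auto simp: lessThan_Suc)
      then show "nats s' 3 0 = k \<and>
        mem es qs \<alpha> p sg (s'\<lparr>nats := upd2 (nats s') 3 0 (Suc k)\<rparr>) \<and>
        next_inv x y Z (\<Union>i<Suc k. ?F i) (s'\<lparr>nats := upd2 (nats s') 3 0 (Suc k)\<rparr>)"
        using n' k by (auto intro!: mem_cong[OF m'] elim!: next_inv_cong simp: upd2_apply)
    qed auto
  qed (auto simp: mem_def all_funs_def)
qed

section \<open>Probing a direction\<close>

primrec store :: "nat \<Rightarrow> nexp \<Rightarrow> nat \<Rightarrow> rexp list \<Rightarrow> com" where
  "store a b j [] = Skip"
| "store a b j (e # es) = Seq (RAssign a (NAdd b (NConst j)) e) (store a b (Suc j) es)"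

lemma written_store [simp]: "nats_written (store a b j es) = {}"
  and reals_written_store: "x \<in> reals_written (store a b j es) \<Longrightarrow> x = a"
  by (induction es arbitrary: j) auto

text \<open>The expressions do not read the array that is being written, so each of them has the
  value of the initial state.\<close>

lemma runs_store:
  assumes "list_all (rfree a) es" "nval s b = B"
  shows "runs (store a b j es) s (length es + 1) (\<lambda>s'. \<forall>y. reals s' a y =
    (if B + j \<le> y \<and> y < B + j + length es then rval s (es ! (y - (B + j))) else reals s a y))"
  using assms
proof (induction es arbitrary: j s)
  case Nil
  then show ?case by (auto intro: runs_mono[OF runs_Skip[where Q = "\<lambda>s'. s' = s"]])
next
  case (Cons e es)
  define s1 where "s1 = s\<lparr>reals := upd2 (reals s) a (B + j) (rval s e)\<rparr>"
  have v: "rval s1 f = rval s f" if "f \<in> set es" for f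
    using Cons.prems(1) that unfolding s1_def by (auto simp: list_all_iff rval_rfree)
  have n: "nval s1 b = B" using Cons.prems(2) by (simp add: s1_def)
  have r: "reals s1 a y = (if y = B + j then rval s e else reals s a y)" for y by (simp add: s1_def upd2_apply)
  have 1: "runs (RAssign a (NAdd b (NConst j)) e) s 1 (\<lambda>s'. s' = s1)"
    by (rule runs_RAssign) (simp add: s1_def Cons.prems(2))
  have 2: "runs (store a b (Suc j) es) s1 (length es + 1) (\<lambda>s'. \<forall>y. reals s' a y =
    (if B + Suc j \<le> y \<and> y < B + Suc j + length es then rval s1 (es ! (y - (B + Suc j))) else reals s1 a y))"
    using Cons by (intro Cons.IH) (auto simp: n)
  have "runs (store a b j (e # es)) s (1 + (length es + 1)) (\<lambda>s'. \<forall>y. reals s' a y =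
    (if B + j \<le> y \<and> y < B + j + length (e # es) then rval s ((e # es) ! (y - (B + j))) else reals s a y))"
    unfolding store.simps
  proof (rule runs_Seq[OF 1], rule runs_mono)
    fix s1' assume "s1' = s1"
    then show "runs (store a b (Suc j) es) s1' (length es + 1) (\<lambda>s'. \<forall>y. reals s' a y =
      (if B + Suc j \<le> y \<and> y < B + Suc j + length es then rval s1 (es ! (y - (B + Suc j))) else reals s1 a y))"
      using 2 by simp
  next
    fix s' assume *: "\<forall>y. reals s' a y =
      (if B + Suc j \<le> y \<and> y < B + Suc j + length es then rval s1 (es ! (y - (B + Suc j))) else reals s1 a y)"
    show "\<forall>y. reals s' a y =
      (if B + j \<le> y \<and> y < B + j + length (e # es) then rval s ((e # es) ! (y - (B + j))) else reals s a y)"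
    proof
      fix y
      consider "y < B + j" | "y = B + j" | "B + Suc j \<le> y" "y < B + Suc j + length es" | "y \<ge> B + Suc j + length es"
        by linarith
      then show "reals s' a y =
        (if B + j \<le> y \<and> y < B + j + length (e # es) then rval s ((e # es) ! (y - (B + j))) else reals s a y)"
      proof cases
        case 3
        then have "y - (B + j) = Suc (y - (B + Suc j))" "y - (B + Suc j) < length es" by simp_all
        then show ?thesis using * 3 v by simp
      qed (use * r in simp_all)
    qed
  qed simp
  then show ?case by simp
qed

section \<open>Evaluating the obstacles in one direction\<close>

definition e_sbeta :: "rexp list \<Rightarrow> cexp \<Rightarrow> rexp" where
  "e_sbeta ks u = RDiv (rneg (RAdd (RMul (ks ! 3) (fst u)) (RMul (ks ! 4) (snd u)))) (rnum 2)"
definition e_sgamma :: "rexp list \<Rightarrow> cexp \<Rightarrow> rexp" where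
  "e_sgamma ks u = RAdd (RAdd (RMul (ks ! 0) (e_sq (fst u))) (RMul (RMul (ks ! 1) (fst u)) (snd u)))
     (RMul (ks ! 2) (e_sq (snd u)))"
definition e_sval :: "rexp list \<Rightarrow> cexp \<Rightarrow> rexp" where
  "e_sval ks u = RDiv (RAdd (e_sbeta ks u)
     (RSqrt (RSub (e_sq (e_sbeta ks u)) (RMul (ks ! 5) (e_sgamma ks u))))) (ks ! 5)"

lemma rval_e_sval: "length ks = 6 \<Longrightarrow> rval s (e_sval ks u) = sval (map (rval s) ks) (cval s u)"
  by (simp add: e_sval_def e_sbeta_def e_sgamma_def sval_def sdisc_def sbeta_def sgamma_def)

definition e_pt_conic :: "cexp \<Rightarrow> rexp list" where
  "e_pt_conic q = [RSub (rnum 1) (e_sq e_alpha), rnum 0, RSub (rnum 1) (e_sq e_alpha),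
     RMul (rneg (rnum 2)) (fst q), RMul (rneg (rnum 2)) (snd q), e_dot q q]"
definition e_ln_conic :: "cexp \<Rightarrow> cexp \<Rightarrow> rexp list" where
  "e_ln_conic a b = (let d = e_sub b a; c = e_cross a b; l = RMul (e_sq e_alpha) (e_dot d d) in
     [RSub (e_sq (snd d)) l, RMul (RMul (rneg (rnum 2)) (fst d)) (snd d), RSub (e_sq (fst d)) l,
      RMul (RMul (rneg (rnum 2)) c) (snd d), RMul (RMul (rnum 2) c) (fst d), e_sq c])"

lemma length_e_conic [simp]: "length (e_pt_conic q) = 6" "length (e_ln_conic a b) = 6"
  by (simp_all add: e_pt_conic_def e_ln_conic_def Let_def)

lemma rval_e_conic:
  assumes "reals s 2 2 = \<alpha>"
  shows "map (rval s) (e_pt_conic q) = pt_conic \<alpha> (cval s q)"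
    "map (rval s) (e_ln_conic a b) = ln_conic \<alpha> (cval s a) (cval s b)"
  by (simp_all add: e_pt_conic_def pt_conic_def e_ln_conic_def ln_conic_def Let_def rval_e_alpha assms algebra_simps)

definition b_pt_valid :: "cexp \<Rightarrow> cexp \<Rightarrow> bexp" where
  "b_pt_valid q u = BAnd (RLess (rnum 0) (RSub (e_sq (e_dot q u))
       (RMul (e_dot q q) (RMul (RSub (rnum 1) (e_sq e_alpha)) (e_sq (e_norm u))))))
     (RLess (rnum 0) (e_dot q u))"
definition b_ln_valid :: "cexp \<Rightarrow> cexp \<Rightarrow> cexp \<Rightarrow> bexp" where
  "b_ln_valid a b u = BAnd (RLess (rnum 0) (e_cross a b)) (BAnd
     (RLess (rnum 0) (RSub (RMul (e_norm (e_sub b a)) (e_cross a u))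
       (RMul (RMul e_alpha (e_norm u)) (e_dot a (e_sub b a)))))
     (RLess (rnum 0) (RAdd (RMul (e_norm (e_sub b a)) (e_cross u b))
       (RMul (RMul e_alpha (e_norm u)) (e_dot b (e_sub b a))))))"
text \<open>For oriented edges a cross product that is not positive is 0. The disjunction is
  expressed by negations, as \<open>bexp\<close> offers only negation and conjunction.\<close>

definition b_blocks :: "cexp \<Rightarrow> cexp \<Rightarrow> cexp \<Rightarrow> bexp" where
  "b_blocks a b u = BAnd (BNot (RLess (rnum 0) (e_cross a b))) (BAnd (BNot (RLess (rnum 0) (e_dot a b)))
     (BNot (BAnd (BNot (b_pt_valid a u)) (BNot (b_pt_valid b u)))))"

lemma bval_valid:
  assumes "reals s 2 2 = \<alpha>"
  shows "bval s (b_pt_valid q u) \<longleftrightarrow> pt_valid \<alpha> (cval s q) (cval s u)"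
    "bval s (b_ln_valid a b u) \<longleftrightarrow> ln_valid \<alpha> (cval s a) (cval s b) (cval s u)"
    "bval s (b_blocks a b u) \<longleftrightarrow> \<not> cross (cval s a) (cval s b) > 0 \<and> dot (cval s a) (cval s b) \<le> 0 \<and>
       (pt_valid \<alpha> (cval s a) (cval s u) \<or> pt_valid \<alpha> (cval s b) (cval s u))"
  by (auto simp: b_pt_valid_def pt_valid_def pt_disc_def b_ln_valid_def ln_valid_def ln_T1_def ln_T2_def b_blocks_def
    rval_e_alpha assms)

abbreviation e_u :: cexp where "e_u \<equiv> e_dir (rv 13)"

definition improve :: "bexp \<Rightarrow> rexp list \<Rightarrow> com" where
  "improve b ks = Cond (BAnd b (RLess (rv 16) (e_sval ks e_u)))
     (Seq (RAssign 16 (NConst 0) (e_sval ks e_u)) (store 17 (NConst 0) 0 ks)) Skip"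

lemma written_improve [simp]: "nats_written (improve b ks) = {}"
  and reals_written_improve: "x \<in> reals_written (improve b ks) \<Longrightarrow> x = 16 \<or> x = 17"
  by (auto simp: improve_def dest: reals_written_store)

text \<open>Roots of valid obstacles are positive, so the value 0 can stand for the maximum of the
  empty set.\<close>

definition best_ok :: "complex \<Rightarrow> real list set \<Rightarrow> state \<Rightarrow> bool" where
  "best_ok u F s \<longleftrightarrow> (\<forall>k\<in>F. sval k u \<le> reals s 16 0) \<and>
     ((reals s 16 0 = 0 \<and> F = {}) \<or> (\<exists>k\<in>F. reals s 16 0 = sval k u \<and> (\<forall>j<6. reals s 17 j = k ! j)))"

text \<open>Nine steps: the test, the assignment of the root, and the unrolled storing of six
  coefficients with its final \<open>Skip\<close>.\<close>

lemma runs_improve: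
  assumes ok: "best_ok u F s" and u: "cval s e_u = u" and ks: "length ks = 6" "map (rval s) ks = k"
    and fr: "list_all (rfree 16) ks" "list_all (rfree 17) ks"
    and b: "bval s b \<longleftrightarrow> v" and pos: "v \<Longrightarrow> sval k u > 0"
  shows "runs (improve b ks) s 9 (best_ok u (F \<union> (if v then {k} else {})))"
proof -
  have S: "rval s (e_sval ks e_u) = sval k u" using rval_e_sval[OF ks(1), of s e_u] ks(2) u by simp
  define s1 where "s1 = s\<lparr>reals := upd2 (reals s) 16 0 (sval k u)\<rparr>"
  have s1: "rval s1 e = rval s e" if "e \<in> set ks" for e
    using fr(1) that unfolding s1_def by (auto simp: list_all_iff rval_rfree)
  have asg: "runs (RAssign 16 (NConst 0) (e_sval ks e_u)) s 1 (\<lambda>s'. s' = s1)"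
    by (rule runs_RAssign) (simp add: s1_def S)
  have "runs (improve b ks) s (Suc (1 + (length ks + 1))) (best_ok u (F \<union> (if v then {k} else {})))"
    unfolding improve_def
  proof (rule runs_Cond)
    assume bv: "bval s (BAnd b (RLess (rv 16) (e_sval ks e_u)))"
    then have v: v and lt: "reals s 16 0 < sval k u" using b S by auto
    show "runs (Seq (RAssign 16 (NConst 0) (e_sval ks e_u)) (store 17 (NConst 0) 0 ks)) s (1 + (length ks + 1))
        (best_ok u (F \<union> (if v then {k} else {})))"
    proof (rule runs_Seq[OF asg])
      fix s1' assume s1': "s1' = s1"
      show "runs (store 17 (NConst 0) 0 ks) s1' (length ks + 1) (best_ok u (F \<union> (if v then {k} else {})))"
        unfolding s1'
      proof (rule runs_mono[OF runs_store[OF fr(2), where B = 0]])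
        fix s' assume st: "\<forall>y. reals s' 17 y =
          (if 0 + 0 \<le> y \<and> y < 0 + 0 + length ks then rval s1 (ks ! (y - (0 + 0))) else reals s1 17 y)"
          and un: "unchanged (store 17 (NConst 0) 0 ks) s1 s'"
        have "16 \<notin> reals_written (store 17 (NConst 0) 0 ks)" by (auto dest: reals_written_store)
        then have r16: "reals s' 16 0 = sval k u" using unchangedD(2)[OF un] by (simp add: s1_def upd2_apply)
        have "reals s' 17 j = k ! j" if "j < 6" for j
          using st that ks s1[of "ks ! j"] by (auto simp flip: ks(2))
        moreover have "sval k' u \<le> sval k u" if "k' \<in> F" for k'
          using ok that lt by (force simp: best_ok_def)
        ultimately show "best_ok u (F \<union> (if v then {k} else {})) s'"
          using v r16 by (auto simp: best_ok_def)
      qed (simp_all add: s1_def)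
    qed
  next
    assume bv: "\<not> bval s (BAnd b (RLess (rv 16) (e_sval ks e_u)))"
    have "best_ok u (F \<union> (if v then {k} else {})) s"
    proof (cases v)
      case True
      then have le: "sval k u \<le> reals s 16 0" using bv b S by auto
      then have "\<not> (reals s 16 0 = 0 \<and> F = {})" using pos[OF True] by auto
      then show ?thesis using ok le True by (auto simp: best_ok_def)
    qed (use ok in simp)
    then show "runs Skip s (1 + (length ks + 1)) (best_ok u (F \<union> (if v then {k} else {})))"
      by (intro runs_mono[OF runs_Skip]) auto
  qed
  then show ?thesis using ks(1) by simp
qed

definition eval_body :: com where
  "eval_body = Seq (improve (b_pt_valid (qe (nv 3)) e_u) (e_pt_conic (qe (nv 3))))
     (Seq (improve (b_ln_valid (ae (nv 3)) (be (nv 3)) e_u) (e_ln_conic (ae (nv 3)) (be (nv 3))))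
       (Cond (b_blocks (ae (nv 3)) (be (nv 3)) e_u) (NAssign 10 (NConst 0) (NConst 1)) Skip))"

lemma written_eval_body [simp]: "nats_written eval_body = {10}"
  and reals_written_eval_body: "x \<in> reals_written eval_body \<Longrightarrow> x = 16 \<or> x = 17"
  by (auto simp: eval_body_def dest: reals_written_improve)

text \<open>Agrees with \<open>feats\<close> on the full input, but takes vertices and edges as
  separate lists, so that the loop can be described by prefixes of both.\<close>

definition sel :: "real \<Rightarrow> complex \<Rightarrow> complex list \<Rightarrow> (complex \<times> complex) list \<Rightarrow> real list set" where
  "sel \<alpha> u qs es = {pt_conic \<alpha> q | q. q \<in> set qs \<and> pt_valid \<alpha> q u} \<union>
     {ln_conic \<alpha> a b | a b. (a, b) \<in> set es \<and> ln_valid \<alpha> a b u}"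

lemma sval_ln_pos: "ln_valid \<alpha> a b u \<Longrightarrow> \<alpha> > 0 \<Longrightarrow> sval (ln_conic \<alpha> a b) u > 0"
  using ln_num_pos[of \<alpha> a b u] sval_ln[of a b \<alpha> u]
  by (simp add: ln_valid_def ln_num_def[symmetric])

lemma sel_take_Suc:
  assumes "i < length es" "length qs = length es"
  shows "sel \<alpha> u (take (Suc i) qs) (take (Suc i) es) = sel \<alpha> u (take i qs) (take i es)
      \<union> (if pt_valid \<alpha> (qs ! i) u then {pt_conic \<alpha> (qs ! i)} else {})
      \<union> (if ln_valid \<alpha> (fst (es ! i)) (snd (es ! i)) u then {ln_conic \<alpha> (fst (es ! i)) (snd (es ! i))} else {})"
proof -
  obtain a b where e: "es ! i = (a, b)" by fastforce
  have 1: "set (take (Suc i) qs) = insert (qs ! i) (set (take i qs))"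
    "set (take (Suc i) es) = insert (a, b) (set (take i es))"
    using assms by (auto simp: take_Suc_conv_app_nth e)
  show ?thesis unfolding sel_def 1 e fst_conv snd_conv by auto
qed

lemma blocked_take_Suc:
  assumes "i < length es" "cross (fst (es ! i)) (snd (es ! i)) \<ge> 0"
  shows "blocked \<alpha> (take (Suc i) es) u \<longleftrightarrow> blocked \<alpha> (take i es) u \<or>
    (\<not> cross (fst (es ! i)) (snd (es ! i)) > 0 \<and> dot (fst (es ! i)) (snd (es ! i)) \<le> 0 \<and>
       (pt_valid \<alpha> (fst (es ! i)) u \<or> pt_valid \<alpha> (snd (es ! i)) u))"
proof -
  have 1: "set (take (Suc i) es) = insert (fst (es ! i), snd (es ! i)) (set (take i es))"
    using assms by (auto simp: take_Suc_conv_app_nth)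
  have 2: "\<not> cross (fst (es ! i)) (snd (es ! i)) > 0 \<longleftrightarrow> cross (fst (es ! i)) (snd (es ! i)) = 0" using assms by linarith
  show ?thesis unfolding blocked_def 1 2 by auto
qed

definition eval_inv where
  "eval_inv es qs \<alpha> p sg t i s \<longleftrightarrow> mem es qs \<alpha> p sg s \<and> reals s 13 0 = t \<and>
     (nats s 10 0 = 0 \<longleftrightarrow> \<not> blocked \<alpha> (take i es) (dir sg t)) \<and>
     best_ok (dir sg t) (sel \<alpha> (dir sg t) (take i qs) (take i es)) s"

lemma runs_eval_body:
  assumes inv: "eval_inv es qs \<alpha> p sg t i s" and i: "i < length es" "nats s 3 0 = i" and \<alpha>: "\<alpha> > 0"
    and or: "cross (fst (es ! i)) (snd (es ! i)) \<ge> 0"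
  shows "runs eval_body s 20 (eval_inv es qs \<alpha> p sg t (Suc i))"
proof -
  let ?u = "dir sg t"
  let ?q = "qs ! i" let ?a = "fst (es ! i)" let ?b = "snd (es ! i)"
  let ?F = "sel \<alpha> ?u (take i qs) (take i es)"
  let ?F1 = "?F \<union> (if pt_valid \<alpha> ?q ?u then {pt_conic \<alpha> ?q} else {})"
  let ?F2 = "?F1 \<union> (if ln_valid \<alpha> ?a ?b ?u then {ln_conic \<alpha> ?a ?b} else {})"
  have fr: "list_all (rfree 16) (e_pt_conic (qe n))" "list_all (rfree 17) (e_pt_conic (qe n))"
    "list_all (rfree 16) (e_ln_conic (ae n) (be n))" "list_all (rfree 17) (e_ln_conic (ae n) (be n))" for n
    by (simp_all add: e_pt_conic_def e_ln_conic_def qe_def ae_def be_def Let_def e_alpha_def)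
  have vals: "cval s e_u = ?u" "reals s 2 2 = \<alpha>" "cval s (qe (nv 3)) = ?q" "cval s (ae (nv 3)) = ?a" "cval s (be (nv 3)) = ?b"
    if "mem es qs \<alpha> p sg s" "reals s 13 0 = t" "nats s 3 0 = i" for s
    using that mem_cvals[OF that(1), of "nv 3"] i by (auto simp: cval_e_dir mem_def)
  have keep: "mem es qs \<alpha> p sg s' \<and> reals s' 13 0 = t \<and> nats s' = nats s"
    if "unchanged (improve b ks) s s'" "mem es qs \<alpha> p sg s" "reals s 13 0 = t" for b ks s s'
  proof (intro conjI)
    show "mem es qs \<alpha> p sg s'" by (rule mem_unchanged[OF that(2,1)]) (auto dest: reals_written_improve)
    have "13 \<notin> reals_written (improve b ks)" by (auto dest: reals_written_improve)
    then show "reals s' 13 0 = t" using unchangedD(2)[OF that(1)] that(3) by simp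
    show "nats s' = nats s" by (rule ext) (simp add: unchangedD(1)[OF that(1)])
  qed
  have m: "mem es qs \<alpha> p sg s" "reals s 13 0 = t" using inv by (auto simp: eval_inv_def)
  have len: "length qs = length es" using m by (simp add: mem_def)
  have bl: "nats s 10 0 = 0 \<longleftrightarrow> \<not> blocked \<alpha> (take i es) ?u" using inv by (simp add: eval_inv_def)
  note v = vals[OF m i(2)]
  have 1: "runs (improve (b_pt_valid (qe (nv 3)) e_u) (e_pt_conic (qe (nv 3)))) s 9 (best_ok ?u ?F1)"
  proof (rule runs_improve[OF _ v(1) length_e_conic(1) _ fr(1,2)])
    show "best_ok ?u ?F s" using inv by (simp add: eval_inv_def)
    show "map (rval s) (e_pt_conic (qe (nv 3))) = pt_conic \<alpha> ?q" using rval_e_conic(1)[OF v(2)] v by simp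
    show "bval s (b_pt_valid (qe (nv 3)) e_u) \<longleftrightarrow> pt_valid \<alpha> ?q ?u" using bval_valid(1)[OF v(2)] v by simp
  qed (rule sval_pt_pos)
  have "runs eval_body s (9 + (9 + 2)) (eval_inv es qs \<alpha> p sg t (Suc i))"
    unfolding eval_body_def
  proof (rule runs_Seq[OF 1])
    fix s1 assume ok1: "best_ok ?u ?F1 s1" and u1: "unchanged (improve (b_pt_valid (qe (nv 3)) e_u) (e_pt_conic (qe (nv 3)))) s s1"
    from keep[OF u1 m] have m1: "mem es qs \<alpha> p sg s1" "reals s1 13 0 = t" and n1: "nats s1 = nats s" by auto
    have i1: "nats s1 3 0 = i" using n1 i by simp
    note v1 = vals[OF m1 i1]
    have 2: "runs (improve (b_ln_valid (ae (nv 3)) (be (nv 3)) e_u) (e_ln_conic (ae (nv 3)) (be (nv 3)))) s1 9 (best_ok ?u ?F2)"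
    proof (rule runs_improve[OF ok1 v1(1) length_e_conic(2) _ fr(3,4)])
      show "map (rval s1) (e_ln_conic (ae (nv 3)) (be (nv 3))) = ln_conic \<alpha> ?a ?b" using rval_e_conic(2)[OF v1(2)] v1 by simp
      show "bval s1 (b_ln_valid (ae (nv 3)) (be (nv 3)) e_u) \<longleftrightarrow> ln_valid \<alpha> ?a ?b ?u" using bval_valid(2)[OF v1(2)] v1 by simp
    qed (rule sval_ln_pos[OF _ \<alpha>])
    show "runs (Seq (improve (b_ln_valid (ae (nv 3)) (be (nv 3)) e_u) (e_ln_conic (ae (nv 3)) (be (nv 3))))
       (Cond (b_blocks (ae (nv 3)) (be (nv 3)) e_u) (NAssign 10 (NConst 0) (NConst 1)) Skip)) s1 (9 + 2) (eval_inv es qs \<alpha> p sg t (Suc i))"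
    proof (rule runs_Seq[OF 2])
      fix s2 assume ok2: "best_ok ?u ?F2 s2" and u2: "unchanged (improve (b_ln_valid (ae (nv 3)) (be (nv 3)) e_u) (e_ln_conic (ae (nv 3)) (be (nv 3)))) s1 s2"
      from keep[OF u2 m1] have m2: "mem es qs \<alpha> p sg s2" "reals s2 13 0 = t" and n2: "nats s2 = nats s" using n1 by auto
      have i2: "nats s2 3 0 = i" using n2 i by simp
      note v2 = vals[OF m2 i2]
      let ?B = "\<not> cross ?a ?b > 0 \<and> dot ?a ?b \<le> 0 \<and> (pt_valid \<alpha> ?a ?u \<or> pt_valid \<alpha> ?b ?u)"
      have b: "bval s2 (b_blocks (ae (nv 3)) (be (nv 3)) e_u) \<longleftrightarrow> ?B" using bval_valid(3)[OF v2(2)] v2 by simp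
      have F2: "sel \<alpha> ?u (take (Suc i) qs) (take (Suc i) es) = ?F2" by (rule sel_take_Suc[OF i(1) len])
      have bs: "blocked \<alpha> (take (Suc i) es) ?u \<longleftrightarrow> blocked \<alpha> (take i es) ?u \<or> ?B" by (rule blocked_take_Suc[OF i(1) or])
      have "runs (Cond (b_blocks (ae (nv 3)) (be (nv 3)) e_u) (NAssign 10 (NConst 0) (NConst 1)) Skip) s2 (Suc 1) (eval_inv es qs \<alpha> p sg t (Suc i))"
      proof (rule runs_Cond)
        assume "bval s2 (b_blocks (ae (nv 3)) (be (nv 3)) e_u)"
        then have B: ?B using b by blast
        show "runs (NAssign 10 (NConst 0) (NConst 1)) s2 1 (eval_inv es qs \<alpha> p sg t (Suc i))"
        proof (rule runs_NAssign)
          have "mem es qs \<alpha> p sg (s2\<lparr>nats := upd2 (nats s2) 10 0 1\<rparr>)" by (rule mem_cong[OF m2(1)]) (auto simp: upd2_apply)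
          moreover have "best_ok ?u ?F2 (s2\<lparr>nats := upd2 (nats s2) 10 0 1\<rparr>)" using ok2 by (simp add: best_ok_def)
          ultimately show "eval_inv es qs \<alpha> p sg t (Suc i) (s2\<lparr>nats := upd2 (nats s2) 10 (nval s2 (NConst 0)) (nval s2 (NConst 1))\<rparr>)"
            unfolding eval_inv_def F2 bs using B m2(2) by (simp add: upd2_apply)
        qed
      next
        assume "\<not> bval s2 (b_blocks (ae (nv 3)) (be (nv 3)) e_u)"
        then have B: "\<not> ?B" using b by blast
        show "runs Skip s2 1 (eval_inv es qs \<alpha> p sg t (Suc i))"
          by (rule runs_Skip) (unfold eval_inv_def F2 bs, use B m2 ok2 bl n2 in simp)
      qed
      then show "runs (Cond (b_blocks (ae (nv 3)) (be (nv 3)) e_u) (NAssign 10 (NConst 0) (NConst 1)) Skip) s2 2 (eval_inv es qs \<alpha> p sg t (Suc i))"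
        by (simp add: numeral_2_eq_2)
    qed
  qed
  then show ?thesis by simp
qed

section \<open>Parity of the crossings at the sample point\<close>

definition b_crosses :: "cexp \<Rightarrow> cexp \<Rightarrow> cexp \<Rightarrow> bexp" where
  "b_crosses a b z = BNot (BAnd
     (BNot (BAnd (RLess (snd a) (snd z)) (BAnd (BNot (RLess (snd b) (snd z)))
       (RLess (e_cross (e_sub a z) (e_sub b z)) (rnum 0)))))
     (BNot (BAnd (RLess (snd b) (snd z)) (BAnd (BNot (RLess (snd a) (snd z)))
       (RLess (rnum 0) (e_cross (e_sub a z) (e_sub b z)))))))"

lemma bval_b_crosses: "bval s (b_crosses a b z) \<longleftrightarrow> crosses (cval s a, cval s b) (cval s z)"
  by (auto simp: b_crosses_def crosses_def not_less)

text \<open>The tip of the probed ray, relative to \<open>p\<close>. If no obstacle was found, the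
  divisor is 0 and the point is meaningless; in that case \<open>step\<close> writes no
  piece.\<close>

definition e_probe :: cexp where
  "e_probe = (RDiv (fst e_u) (rv 16), RDiv (snd e_u) (rv 16))"

lemma cval_e_probe: "cval s e_probe = of_real (1 / reals s 16 0) * dir (reals s 10 0) (reals s 13 0)"
  using cval_e_dir[of s "rv 13"] unfolding e_probe_def by (simp add: complex_eq_iff e_dir_def)

definition parity_body :: com where
  "parity_body = Cond (b_crosses (ae (nv 3)) (be (nv 3)) e_probe)
     (NAssign 11 (NConst 0) (NSub (NConst 1) (nv 11))) Skip"

definition eval :: com where
  "eval = Seq (RAssign 16 (NConst 0) (rnum 0)) (Seq (NAssign 10 (NConst 0) (NConst 0))
     (Seq (For 3 (nv 2) eval_body) (Seq (NAssign 11 (NConst 0) (NConst 0)) (For 3 (nv 2) parity_body))))"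

lemma written_eval [simp]: "nats_written parity_body = {11}" "reals_written parity_body = {}"
    "nats_written eval = {3, 10, 11}"
  and reals_written_eval: "x \<in> reals_written eval \<Longrightarrow> x = 16 \<or> x = 17"
  by (auto simp: eval_def parity_body_def dest: reals_written_eval_body)

definition parity_of :: "(complex \<times> complex) list \<Rightarrow> complex \<Rightarrow> nat" where
  "parity_of es z = length (filter (\<lambda>e. crosses e z) es) mod 2"

lemma runs_eval_loop:
  assumes m: "mem es qs \<alpha> p sg s" and t: "reals s 13 0 = t" and z: "nats s 10 0 = 0" "reals s 16 0 = 0" and \<alpha>: "\<alpha> > 0"
    and or: "\<And>i. i < length es \<Longrightarrow> cross (fst (es ! i)) (snd (es ! i)) \<ge> 0"
  shows "runs (For 3 (nv 2) eval_body) s (2 + length es * 22) (eval_inv es qs \<alpha> p sg t (length es))"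
proof -
  have upd: "eval_inv es qs \<alpha> p sg t k (s\<lparr>nats := upd2 (nats s) 3 0 j\<rparr>)" if "eval_inv es qs \<alpha> p sg t k s" for k j s
    using that by (auto simp: eval_inv_def best_ok_def upd2_apply intro: mem_cong)
  have "runs (For 3 (nv 2) eval_body) s (2 + length es * (20 + 2)) (eval_inv es qs \<alpha> p sg t (length es))"
  proof (rule runs_For)
    show "eval_inv es qs \<alpha> p sg t 0 (s\<lparr>nats := upd2 (nats s) 3 0 0\<rparr>)"
      by (rule upd) (use m t z in \<open>simp add: eval_inv_def blocked_def sel_def best_ok_def\<close>)
    fix k s assume inv: "eval_inv es qs \<alpha> p sg t k s" and k: "k < length es" "nats s 3 0 = k"
    show "runs eval_body s 20 (\<lambda>s'. nats s' 3 0 = k \<and>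
        eval_inv es qs \<alpha> p sg t (Suc k) (s'\<lparr>nats := upd2 (nats s') 3 0 (Suc k)\<rparr>))"
    proof (rule runs_mono[OF runs_eval_body[OF inv k \<alpha> or[OF k(1)]]])
      fix s' assume "eval_inv es qs \<alpha> p sg t (Suc k) s'" "unchanged eval_body s s'"
      then show "nats s' 3 0 = k \<and> eval_inv es qs \<alpha> p sg t (Suc k) (s'\<lparr>nats := upd2 (nats s') 3 0 (Suc k)\<rparr>)"
        using k upd unchangedD(1)[of eval_body s s' 3] by simp
    qed simp
  qed (auto simp: eval_inv_def mem_def)
  then show ?thesis by simp
qed

lemma runs_parity_loop:
  assumes inv: "eval_inv es qs \<alpha> p sg t (length es) s" and z: "z = of_real (1 / reals s 16 0) * dir sg t"
    and n: "nats s 11 0 = 0"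
  shows "runs (For 3 (nv 2) parity_body) s (2 + length es * 4) (\<lambda>s'. nats s' 11 0 = parity_of es z)"
proof -
  let ?I = "\<lambda>k s'. mem es qs \<alpha> p sg s' \<and> reals s' = reals s \<and> nats s' 11 0 = parity_of (take k es) z"
  have "runs (For 3 (nv 2) parity_body) s (2 + length es * (2 + 2)) (?I (length es))"
  proof (rule runs_For)
    show "?I 0 (s\<lparr>nats := upd2 (nats s) 3 0 0\<rparr>)"
      using inv n by (auto simp: eval_inv_def parity_of_def upd2_apply intro: mem_cong)
    fix k s1 assume I: "?I k s1" and k: "k < length es" "nats s1 3 0 = k"
    have m: "mem es qs \<alpha> p sg s1" using I by simp
    have v: "cval s1 (ae (nv 3)) = fst (es ! k)" "cval s1 (be (nv 3)) = snd (es ! k)"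
      using mem_cvals[OF m, of "nv 3"] k by auto
    have zz: "cval s1 e_probe = z" using I m inv by (simp add: cval_e_probe z eval_inv_def mem_def)
    have b: "bval s1 (b_crosses (ae (nv 3)) (be (nv 3)) e_probe) \<longleftrightarrow> crosses (es ! k) z"
      unfolding bval_b_crosses v zz by simp
    have par: "parity_of (take (Suc k) es) z = (if crosses (es ! k) z then 1 - parity_of (take k es) z else parity_of (take k es) z)"
      using k(1) by (simp add: parity_of_def take_Suc_conv_app_nth) presburger
    have "runs parity_body s1 (Suc 1) (\<lambda>s'. nats s' 3 0 = k \<and> ?I (Suc k) (s'\<lparr>nats := upd2 (nats s') 3 0 (Suc k)\<rparr>))"
      unfolding parity_body_def
    proof (rule runs_Cond)
      assume "bval s1 (b_crosses (ae (nv 3)) (be (nv 3)) e_probe)"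
      then show "runs (NAssign 11 (NConst 0) (NSub (NConst 1) (nv 11))) s1 1
          (\<lambda>s'. nats s' 3 0 = k \<and> ?I (Suc k) (s'\<lparr>nats := upd2 (nats s') 3 0 (Suc k)\<rparr>))"
        using I k b par by (intro runs_NAssign) (auto simp: upd2_apply intro: mem_cong)
    next
      assume "\<not> bval s1 (b_crosses (ae (nv 3)) (be (nv 3)) e_probe)"
      then show "runs Skip s1 1 (\<lambda>s'. nats s' 3 0 = k \<and> ?I (Suc k) (s'\<lparr>nats := upd2 (nats s') 3 0 (Suc k)\<rparr>))"
        using I k b par by (intro runs_Skip) (auto simp: upd2_apply intro: mem_cong)
    qed
    then show "runs parity_body s1 2 (\<lambda>s'. nats s' 3 0 = k \<and> ?I (Suc k) (s'\<lparr>nats := upd2 (nats s') 3 0 (Suc k)\<rparr>))"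
      by (simp add: numeral_2_eq_2)
  qed (auto simp: mem_def)
  then show ?thesis by (rule runs_mono) auto
qed

lemma runs_eval:
  assumes m: "mem es qs \<alpha> p sg s" and t: "reals s 13 0 = t" and \<alpha>: "\<alpha> > 0"
    and or: "\<And>i. i < length es \<Longrightarrow> cross (fst (es ! i)) (snd (es ! i)) \<ge> 0"
  shows "runs eval s (7 + length es * 26) (\<lambda>s'.
     (nats s' 10 0 = 0 \<longleftrightarrow> \<not> blocked \<alpha> es (dir sg t)) \<and> best_ok (dir sg t) (sel \<alpha> (dir sg t) qs es) s' \<and>
     nats s' 11 0 = parity_of es (of_real (1 / reals s' 16 0) * dir sg t))" (is "runs _ _ _ ?Q")
proof -
  have "runs eval s (1 + (1 + ((2 + length es * 22) + (1 + (2 + length es * 4))))) ?Q"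
    unfolding eval_def
  proof (rule runs_Seq[OF runs_RAssign[where Q = "\<lambda>s'. s' = s\<lparr>reals := upd2 (reals s) 16 0 0\<rparr>"]], simp)
    fix s1 assume s1: "s1 = s\<lparr>reals := upd2 (reals s) 16 0 0\<rparr>"
    have m1: "mem es qs \<alpha> p sg s1" "reals s1 13 0 = t" "reals s1 16 0 = 0"
      using t by (auto simp: s1 upd2_apply intro!: mem_cong[OF m])
    show "runs (Seq (NAssign 10 (NConst 0) (NConst 0)) (Seq (For 3 (nv 2) eval_body)
        (Seq (NAssign 11 (NConst 0) (NConst 0)) (For 3 (nv 2) parity_body)))) s1
        (1 + ((2 + length es * 22) + (1 + (2 + length es * 4)))) ?Q"
    proof (rule runs_Seq[OF runs_NAssign[where Q = "\<lambda>s'. s' = s1\<lparr>nats := upd2 (nats s1) 10 0 0\<rparr>"]], simp)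
      fix s2 assume s2: "s2 = s1\<lparr>nats := upd2 (nats s1) 10 0 0\<rparr>"
      have m2: "mem es qs \<alpha> p sg s2" "reals s2 13 0 = t" "nats s2 10 0 = 0" "reals s2 16 0 = 0"
        using m1(2,3) by (auto simp: s2 upd2_apply intro!: mem_cong[OF m1(1)])
      show "runs (Seq (For 3 (nv 2) eval_body) (Seq (NAssign 11 (NConst 0) (NConst 0)) (For 3 (nv 2) parity_body))) s2
          ((2 + length es * 22) + (1 + (2 + length es * 4))) ?Q"
      proof (rule runs_Seq[OF runs_eval_loop[OF m2 \<alpha> or]], assumption)
        fix s3 assume inv3: "eval_inv es qs \<alpha> p sg t (length es) s3"
        show "runs (Seq (NAssign 11 (NConst 0) (NConst 0)) (For 3 (nv 2) parity_body)) s3 (1 + (2 + length es * 4)) ?Q"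
        proof (rule runs_Seq[OF runs_NAssign[where Q = "\<lambda>s'. s' = s3\<lparr>nats := upd2 (nats s3) 11 0 0\<rparr>"]], simp)
          fix s4 assume s4: "s4 = s3\<lparr>nats := upd2 (nats s3) 11 0 0\<rparr>"
          have inv4: "eval_inv es qs \<alpha> p sg t (length es) s4"
            using inv3 mem_cong[of es qs \<alpha> p sg s3 s4]
            by (simp add: s4 eval_inv_def best_ok_def upd2_apply)
          have len: "length qs = length es" using m by (simp add: mem_def)
          show "runs (For 3 (nv 2) parity_body) s4 (2 + length es * 4) ?Q"
          proof (rule runs_mono[OF runs_parity_loop[OF inv4 refl]])
            show "nats s4 11 0 = 0" by (simp add: s4 upd2_apply)
            fix s5 assume 5: "nats s5 11 0 = parity_of es (of_real (1 / reals s4 16 0) * dir sg t)"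
              and u: "unchanged (For 3 (nv 2) parity_body) s4 s5"
            have r: "reals s5 = reals s4" by (rule ext) (simp add: unchangedD(2)[OF u])
            have n: "nats s5 10 = nats s4 10" by (simp add: unchangedD(1)[OF u])
            show "?Q s5" using inv4 5 r n len by (simp add: eval_inv_def best_ok_def)
          qed simp
        qed
      qed
    qed
  qed
  then show ?thesis by (rule runs_mono) auto
qed

section \<open>Writing one piece\<close>

definition e_K :: "rexp list" where "e_K = map (\<lambda>j. RCell 17 (NConst j)) [0..<6]"

definition e_tip :: "rexp \<Rightarrow> rexp list" where
  "e_tip t = (let S = e_sval e_K (e_dir t) in
     [RAdd (fst e_p) (RMul (RDiv (rnum 1) S) (fst (e_dir t))), RAdd (snd e_p) (RMul (RDiv (rnum 1) S) (snd (e_dir t)))])"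

definition e_shift :: "rexp list" where
  "e_shift = (let k = (\<lambda>j. RCell 17 (NConst j)); x = fst e_p; y = snd e_p in
     [k 0, k 1, k 2, RSub (RSub (k 3) (RMul (RMul (rnum 2) (k 0)) x)) (RMul (k 1) y),
      RSub (RSub (k 4) (RMul (RMul (rnum 2) (k 2)) y)) (RMul (k 1) x),
      RSub (RSub (RAdd (RAdd (RAdd (k 5) (RMul (k 0) (e_sq x))) (RMul (RMul (k 1) x) y)) (RMul (k 2) (e_sq y)))
        (RMul (k 3) x)) (RMul (k 4) y)])"

definition emit :: com where
  "emit = Seq (store 3 (nv 9) 0 (e_tip (rv 14) @ e_tip (rv 15) @ e_shift))
     (Seq (NAssign 9 (NConst 0) (NAdd (nv 9) (NConst 10))) (NAssign 1 (NConst 0) (NAdd (nv 1) (NConst 1))))"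

lemma written_emit [simp]: "nats_written emit = {9, 1}"
  and reals_written_emit: "x \<in> reals_written emit \<Longrightarrow> x = 3"
  by (auto simp: emit_def dest: reals_written_store)

lemma length_shift_conic: "length (shift_conic p k) = 6"
  by (simp add: shift_conic_def)

text \<open>Natural variable 9 is maintained as ten times the number of pieces, because the machine
  cannot multiply integers. The new piece fills the next ten cells and leaves all earlier pieces
  intact.\<close>

lemma runs_emit:
  assumes m: "mem es qs \<alpha> p sg s" and t: "reals s 14 0 = t1" "reals s 15 0 = t2"
    and k: "length k = 6" "\<And>j. j < 6 \<Longrightarrow> reals s 17 j = k ! j" and pos: "nats s 9 0 = 10 * nats s 1 0"
  shows "runs emit s 13 (\<lambda>s'. nats s' 9 0 = 10 * nats s' 1 0 \<and>
    read_output s' = read_output s @ [sector_piece p k sg t1 t2])"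
proof -
  let ?o = "e_tip (rv 14) @ e_tip (rv 15) @ e_shift"
  have K: "map (rval s) e_K = k"
    by (rule nth_equalityI) (use k in \<open>auto simp: e_K_def\<close>)
  have lK: "length e_K = 6" by (simp add: e_K_def)
  have pv: "rval s (fst e_p) = Re p" "rval s (snd e_p) = Im p" and sg: "reals s 10 0 = sg"
    using m by (auto simp: mem_def e_p_def)
  have tip: "map (rval s) (e_tip e) = [Re (tip_at p k sg t), Im (tip_at p k sg t)]" if "rval s e = t" for e t
  proof -
    have d: "cval s (e_dir e) = dir sg t" using cval_e_dir[of s e] sg that by simp
    then have d': "rval s (fst (e_dir e)) = Re (dir sg t)" "rval s (snd (e_dir e)) = Im (dir sg t)"
      by (metis Re_cval, metis Im_cval)
    have "rval s (e_sval e_K (e_dir e)) = sval k (dir sg t)" using rval_e_sval[OF lK, of s "e_dir e"] K d by simp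
    then show ?thesis by (simp add: e_tip_def Let_def tip_at_def pv d' del: Re_dir Im_dir)
  qed
  have sh: "map (rval s) e_shift = shift_conic p k"
    using k(2)[of 0] k(2)[of 1] k(2)[of 2] k(2)[of 3] k(2)[of 4] k(2)[of 5]
    by (simp add: e_shift_def shift_conic_def Let_def pv)
  define v where "v = [Re (tip_at p k sg t1), Im (tip_at p k sg t1), Re (tip_at p k sg t2), Im (tip_at p k sg t2)] @ shift_conic p k"
  have out: "map (rval s) ?o = v" using tip[of "rv 14" t1] tip[of "rv 15" t2] t sh by (simp add: v_def)
  have "length (map (rval s) ?o) = 10" unfolding out by (simp add: v_def length_shift_conic)
  then have lo: "length ?o = 10" by (simp only: length_map)
  have fr: "list_all (rfree 3) ?o"
    by (auto simp: e_tip_def e_shift_def e_sval_def e_sbeta_def e_sgamma_def e_K_def e_p_def e_dir_def Let_def)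
  have nv: "rval s (?o ! j) = v ! j" if "j < 10" for j
  proof -
    have "map (rval s) ?o ! j = rval s (?o ! j)" by (rule nth_map) (use that lo in simp)
    then show ?thesis unfolding out by simp
  qed
  have "runs emit s ((length ?o + 1) + (1 + 1)) (\<lambda>s'. nats s' 9 0 = 10 * nats s' 1 0 \<and>
    read_output s' = read_output s @ [sector_piece p k sg t1 t2])"
    unfolding emit_def
  proof (rule runs_Seq[OF runs_store[OF fr refl]])
    fix s1 assume st: "\<forall>y. reals s1 3 y = (if nval s (nv 9) + 0 \<le> y \<and> y < nval s (nv 9) + 0 + length ?o
        then rval s (?o ! (y - (nval s (nv 9) + 0))) else reals s 3 y)"
      and u: "unchanged (store 3 (nv 9) 0 ?o) s s1"
    define c where "c = nats s 1 0"
    have st': "reals s1 3 y = (if 10 * c \<le> y \<and> y < 10 * c + 10 then v ! (y - 10 * c) else reals s 3 y)" for y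
    proof -
      have B: "nval s (nv 9) + 0 = 10 * c" using pos by (simp add: c_def)
      have "y - 10 * c < 10" if "10 * c \<le> y \<and> y < 10 * c + 10" using that by linarith
      then show ?thesis using spec[OF st, of y] nv[of "y - 10 * c"] unfolding B lo by auto
    qed
    have n: "nats s1 = nats s" by (rule ext) (simp add: unchangedD(1)[OF u])
    define s2 where "s2 = s1\<lparr>nats := upd2 (upd2 (nats s1) 9 0 (10 * c + 10)) 1 0 (c + 1)\<rparr>"
    have old: "read_piece s2 i = read_piece s i" if "i < c" for i
    proof -
      have r: "reals s2 3 (10 * i + j) = reals s 3 (10 * i + j)" if "j < 10" for j
        using \<open>i < c\<close> that by (simp add: s2_def st')
      have "map (\<lambda>j. reals s2 3 (10 * i + j)) [4..<10] = map (\<lambda>j. reals s 3 (10 * i + j)) [4..<10]"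
        by (rule map_cong) (auto simp: r)
      then show ?thesis using r[of 0] r[of 1] r[of 2] r[of 3] by (simp add: read_piece_def Let_def)
    qed
    have new: "read_piece s2 c = sector_piece p k sg t1 t2"
    proof -
      have r: "reals s2 3 (10 * c + j) = v ! j" if "j < 10" for j using that by (simp add: s2_def st')
      have "map (\<lambda>j. reals s2 3 (10 * c + j)) [4..<10] = map (\<lambda>j. v ! j) [4..<10]" by (rule map_cong) (auto simp: r)
      also have "\<dots> = shift_conic p k"
        by (simp add: v_def nth_append shift_conic_def)
      finally show ?thesis using r[of 0] r[of 1] r[of 2] r[of 3]
        by (simp add: read_piece_def Let_def sector_piece_def v_def complex_eq_iff)
    qed
    have out2: "read_output s2 = read_output s @ [sector_piece p k sg t1 t2]"
    proof -
      have "nats s2 1 0 = Suc c" by (simp add: s2_def upd2_apply)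
      moreover have "map (read_piece s2) [0..<c] = map (read_piece s) [0..<c]" using old by simp
      ultimately show ?thesis using new by (simp add: read_output_def c_def)
    qed
    show "runs (Seq (NAssign 9 (NConst 0) (NAdd (nv 9) (NConst 10))) (NAssign 1 (NConst 0) (NAdd (nv 1) (NConst 1)))) s1 (1 + 1)
       (\<lambda>s'. nats s' 9 0 = 10 * nats s' 1 0 \<and> read_output s' = read_output s @ [sector_piece p k sg t1 t2])"
    proof (rule runs_Seq[OF runs_NAssign[where Q = "\<lambda>s'. s' = s1\<lparr>nats := upd2 (nats s1) 9 0 (10 * c + 10)\<rparr>"]])
      fix s' assume s': "s' = s1\<lparr>nats := upd2 (nats s1) 9 0 (10 * c + 10)\<rparr>"
      have eq: "s'\<lparr>nats := upd2 (nats s') 1 (nval s' (NConst 0)) (nval s' (NAdd (nv 1) (NConst 1)))\<rparr> = s2"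
        by (simp add: s' s2_def upd2_apply n c_def)
      show "runs (NAssign 1 (NConst 0) (NAdd (nv 1) (NConst 1))) s' 1
         (\<lambda>s'. nats s' 9 0 = 10 * nats s' 1 0 \<and> read_output s' = read_output s @ [sector_piece p k sg t1 t2])"
        by (rule runs_NAssign, unfold eq) (use out2 in \<open>simp add: s2_def upd2_apply\<close>)
    qed (simp add: n pos c_def)
  qed
  then show ?thesis using lo by simp
qed

section \<open>Counting critical directions\<close>

text \<open>A piece is written only if the direction is not blocked, has an obstacle, and the tip
  lies in the region. Otherwise the sector contributes no point besides \<open>p\<close>.\<close>

definition step :: com where
  "step = Seq eval (Cond (BAnd (BAnd (NLess (nv 10) (NConst 1)) (RLess (rnum 0) (rv 16))) (NLess (NConst 0) (nv 11))) emit Skip)"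

lemma written_step [simp]: "nats_written step = {3, 10, 11, 9, 1}"
  and reals_written_step: "x \<in> reals_written step \<Longrightarrow> x = 16 \<or> x = 17 \<or> x = 3"
  by (auto simp: step_def dest: reals_written_eval reals_written_emit)

definition piece_ok :: "complex set \<Rightarrow> complex \<Rightarrow> piece \<Rightarrow> bool" where
  "piece_ok V p T \<longleftrightarrow> corners_on_arc p T \<and> cell p T \<subseteq> V"

lemma sel_eq_feats: "set qs = ends es \<Longrightarrow> sel \<alpha> u qs es = feats \<alpha> es u"
  by (simp add: sel_def feats_def ends_def)

lemma feats_sval_pos: "k \<in> feats \<alpha> es u \<Longrightarrow> \<alpha> > 0 \<Longrightarrow> sval k u > 0"
  by (auto simp: feats_def intro: sval_pt_pos sval_ln_pos)

lemma feats_length: "k \<in> feats \<alpha> es u \<Longrightarrow> length k = 6"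
  by (auto simp: feats_def pt_conic_def ln_conic_def Let_def)

text \<open>The tests fail in the situations of \<open>blocked_empty\<close>,
  \<open>no_feats_empty\<close> and \<open>even_empty\<close>; if all are passed,
  \<open>odd_piece\<close> applies.\<close>

lemma (in star_region) runs_step:
  assumes sg: "\<bar>sg\<bar> = 1" and t: "-1 \<le> t1" "t2 \<le> 1" "t1 < 1" "\<not> (t1 = -1 \<and> t2 = 1)"
    and tt: "(t1 = tt \<and> tt = t2) \<or> (t1 < tt \<and> tt < t2)"
    and unif: "\<And>f. f \<in> crit_funs \<alpha> es \<Longrightarrow> uniform sg ({t1<..<t2} \<union> {tt}) f"
    and m: "mem es qs \<alpha> p sg s" and qs: "set qs = ends es"
    and r: "reals s 13 0 = tt" "reals s 14 0 = t1" "reals s 15 0 = t2"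
    and pos: "nats s 9 0 = 10 * nats s 1 0"
  shows "runs step s (21 + length es * 26) (\<lambda>s'. nats s' 9 0 = 10 * nats s' 1 0 \<and>
    (\<exists>Ts. read_output s' = read_output s @ Ts \<and> length Ts \<le> 1 \<and>
      (\<forall>T\<in>set Ts. piece_ok V p T \<and> interior (cell p T) \<subseteq> sector_set p sg t1 t2) \<and>
      (\<forall>x\<in>{t1<..<t2} \<union> {tt}. \<forall>l>0. p + of_real l * dir sg x \<in> V \<longrightarrow> (\<exists>T\<in>set Ts. p + of_real l * dir sg x \<in> cell p T))))"
    (is "runs _ _ _ ?Q")
proof -
  let ?I = "{t1<..<t2} \<union> {tt}"
  let ?u = "dir sg tt"
  have or: "cross (fst (es ! i)) (snd (es ! i)) \<ge> 0" if "i < length es" for i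
    using oriented[of "fst (es ! i)" "snd (es ! i)"] that by simp
  have "runs step s ((7 + length es * 26) + Suc 13) ?Q"
    unfolding step_def
  proof (rule runs_Seq[OF runs_eval[OF m r(1) alpha(1) or]], assumption)
    fix s1 assume q: "(nats s1 10 0 = 0 \<longleftrightarrow> \<not> blocked \<alpha> es ?u) \<and> best_ok ?u (sel \<alpha> ?u qs es) s1 \<and>
        nats s1 11 0 = parity_of es (of_real (1 / reals s1 16 0) * ?u)"
      and u: "unchanged eval s s1"
    have m1: "mem es qs \<alpha> p sg s1" by (rule mem_unchanged[OF m u]) (auto dest: reals_written_eval)
    have nw: "a \<notin> reals_written eval" if "a \<noteq> 16" "a \<noteq> 17" for a using that reals_written_eval by blast
    have r1: "reals s1 14 0 = t1" "reals s1 15 0 = t2" "reals s1 3 = reals s 3"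
      using unchangedD(2)[OF u nw] r by simp_all
    have n1: "nats s1 9 0 = 10 * nats s1 1 0" "nats s1 1 = nats s 1"
      using unchangedD(1)[OF u] pos by simp_all
    have out1: "read_output s1 = read_output s"
      using n1(2) r1(3) by (simp add: read_output_def read_piece_def)
    have bl: "nats s1 10 0 = 0 \<longleftrightarrow> \<not> blocked \<alpha> es ?u" using q by blast
    have best: "best_ok ?u (feats \<alpha> es ?u) s1" using q sel_eq_feats[OF qs] by simp
    have par: "nats s1 11 0 = parity_of es (of_real (1 / reals s1 16 0) * ?u)" using q by blast
    show "runs (Cond (BAnd (BAnd (NLess (nv 10) (NConst 1)) (RLess (rnum 0) (rv 16))) (NLess (NConst 0) (nv 11))) emit Skip) s1 (Suc 13) ?Q"
    proof (rule runs_Cond)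
      assume "bval s1 (BAnd (BAnd (NLess (nv 10) (NConst 1)) (RLess (rnum 0) (rv 16))) (NLess (NConst 0) (nv 11)))"
      then have b: "nats s1 10 0 = 0" "reals s1 16 0 > 0" "nats s1 11 0 > 0" by auto
      then obtain k where k: "k \<in> feats \<alpha> es ?u" "reals s1 16 0 = sval k ?u" "\<And>j. j < 6 \<Longrightarrow> reals s1 17 j = k ! j"
        using best unfolding best_ok_def by auto
      have kmax: "sval k' ?u \<le> sval k ?u" if "k' \<in> feats \<alpha> es ?u" for k'
        using best that k(2) by (auto simp: best_ok_def)
      have nb: "\<not> blocked \<alpha> es ?u" using bl b by simp
      have odd: "odd (length (filter (\<lambda>e. crosses e (of_real (1 / sval k ?u) * ?u)) es))"
        using b(3) par k(2) by (simp add: parity_of_def mod_greater_zero_iff_not_dvd)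
      note op = odd_piece[OF sg t tt refl unif k(1) kmax nb odd]
      show "runs emit s1 13 ?Q"
      proof (rule runs_mono[OF runs_emit[OF m1 r1(1,2) feats_length[OF k(1)] k(3) n1(1)]])
        fix s' assume e: "nats s' 9 0 = 10 * nats s' 1 0 \<and> read_output s' = read_output s1 @ [sector_piece p k sg t1 t2]"
        have "\<exists>Ts. read_output s' = read_output s @ Ts \<and> length Ts \<le> 1 \<and>
          (\<forall>T\<in>set Ts. piece_ok V p T \<and> interior (cell p T) \<subseteq> sector_set p sg t1 t2) \<and>
          (\<forall>x\<in>?I. \<forall>l>0. p + of_real l * dir sg x \<in> V \<longrightarrow> (\<exists>T\<in>set Ts. p + of_real l * dir sg x \<in> cell p T))"
        proof (intro exI[of _ "[sector_piece p k sg t1 t2]"] conjI ballI allI impI)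
          show "read_output s' = read_output s @ [sector_piece p k sg t1 t2]" using e out1 by simp
          show "piece_ok V p T" "interior (cell p T) \<subseteq> sector_set p sg t1 t2" if "T \<in> set [sector_piece p k sg t1 t2]" for T
            using that op(1,2,3) by (auto simp: piece_ok_def)
          show "\<exists>T\<in>set [sector_piece p k sg t1 t2]. p + of_real l * dir sg x \<in> cell p T"
            if "x \<in> ?I" "l > 0" "p + of_real l * dir sg x \<in> V" for x l
          proof -
            have "p + of_real l * dir sg x \<in> cell p (sector_piece p k sg t1 t2)"
              by (rule op(4)) (assumption | rule that)+
            then show ?thesis by simp
          qed
        qed simp
        then show "?Q s'" using e by blast
      qed auto
    next
      assume "\<not> bval s1 (BAnd (BAnd (NLess (nv 10) (NConst 1)) (RLess (rnum 0) (rv 16))) (NLess (NConst 0) (nv 11)))"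
      then have b: "nats s1 10 0 \<noteq> 0 \<or> \<not> reals s1 16 0 > 0 \<or> nats s1 11 0 = 0" by auto
      have empty: "p + of_real l * dir sg x \<notin> V" if xl: "x \<in> ?I" "l > 0" for x l
      proof (cases "blocked \<alpha> es ?u")
        case True
        then show ?thesis using blocked_empty[OF sg t tt refl unif _ xl] by blast
      next
        case nb: False
        show ?thesis
        proof (cases "feats \<alpha> es ?u = {}")
          case True
          then show ?thesis using no_feats_empty[OF sg t tt refl unif _ xl] by blast
        next
          case False
          then obtain k where k: "k \<in> feats \<alpha> es ?u" "reals s1 16 0 = sval k ?u"
            using best unfolding best_ok_def by blast
          have kmax: "sval k' ?u \<le> sval k ?u" if "k' \<in> feats \<alpha> es ?u" for k'
            using best that k(2) by (auto simp: best_ok_def)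
          have "reals s1 16 0 > 0" using feats_sval_pos[OF k(1) alpha(1)] k(2) by simp
          then have "nats s1 11 0 = 0" using b bl nb by simp
          then have "even (length (filter (\<lambda>e. crosses e (of_real (1 / sval k ?u) * ?u)) es))"
            using par k(2) by (simp add: parity_of_def even_iff_mod_2_eq_zero)
          from even_empty[OF sg t tt refl unif k(1) kmax nb this xl] show ?thesis .
        qed
      qed
      show "runs Skip s1 13 ?Q"
      proof (rule runs_mono[OF runs_Skip[where Q = "\<lambda>s'. s' = s1"]])
        fix s' assume "s' = s1"
        then show "?Q s'" using n1 out1 empty by (auto intro!: exI[of _ "[]"])
      qed auto
    qed
  qed
  then show ?thesis by (rule runs_mono) auto
qed


section \<open>The number of critical directions\<close>

lemma zeros_bound:
  assumes "\<And>t. peval s cs t = f t"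
  shows "finite (zeros f)" "card (zeros f) \<le> length cs" "continuous_on A f"
proof -
  let ?c = "map (rval s) cs"
  have f: "f = poly (Poly ?c)" using assms by (simp add: fun_eq_iff poly_peval)
  have "finite (zeros f) \<and> card (zeros f) \<le> length cs"
  proof (cases "\<forall>t. f t = 0")
    case False
    then have nz: "Poly ?c \<noteq> 0" using f by auto
    have z: "zeros f = {t. poly (Poly ?c) t = 0}" using False by (simp add: zeros_def f)
    have "card {t. poly (Poly ?c) t = 0} \<le> degree (Poly ?c)" by (rule card_poly_roots_bound[OF nz])
    also have "\<dots> \<le> length cs" by (rule degree_le) (auto simp: coeff_Poly_eq nth_default_def)
    finally show ?thesis unfolding z using poly_roots_finite[OF nz] by simp
  qed (simp add: zeros_def)
  then show "finite (zeros f)" "card (zeros f) \<le> length cs" by auto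
  show "continuous_on A f" unfolding f by (intro continuous_on_poly continuous_on_id)
qed

text \<open>The coefficient lists in the program itself witness that the functions are polynomials
  of bounded degree; \<open>st i j\<close> is a state whose loop variables point to the entries
  \<open>i\<close> and \<open>j\<close>.\<close>

lemma all_funs_rep:
  assumes m: "mem es qs \<alpha> p sg s" and sg: "\<bar>sg\<bar> = 1"
  shows "f \<in> all_funs \<alpha> sg es qs \<Longrightarrow> continuous_on A f"
    "finite (\<Union>f\<in>all_funs \<alpha> sg es qs. zeros f)"
    "card (\<Union>f\<in>all_funs \<alpha> sg es qs. zeros f) \<le> length es * (T_outer + length es * T_inner)"
proof -
  define st where "st i j = s\<lparr>nats := upd2 (upd2 (nats s) 3 0 i) 4 0 j\<rparr>" for i j
  have ms: "mem es qs \<alpha> p sg (st i j)" for i j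
    by (rule mem_cong[OF m]) (auto simp: st_def upd2_apply)
  have sr: "reals (st i j) 2 2 = \<alpha>" "reals (st i j) 10 0 = sg" for i j
    using ms[of i j] by (auto simp: mem_def)
  have cv: "cval (st i j) (qe (nv 3)) = qs ! i" "cval (st i j) (ae (nv 3)) = fst (es ! i)" "cval (st i j) (be (nv 3)) = snd (es ! i)"
    "cval (st i j) (qe (nv 4)) = qs ! j" "cval (st i j) (ae (nv 4)) = fst (es ! j)" "cval (st i j) (be (nv 4)) = snd (es ! j)"
    if "i < length es" "j < length es" for i j
    using mem_cvals[OF ms[of i j], of "nv 3"] mem_cvals[OF ms[of i j], of "nv 4"] that by (auto simp: st_def upd2_apply)
  have three: "finite (\<Union>f\<in>{f1, f2, f3}. zeros f) \<and> card (\<Union>f\<in>{f1, f2, f3}. zeros f) \<le> n1 + (n2 + n3)"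
    if "finite (zeros f1)" "card (zeros f1) \<le> n1" "finite (zeros f2)" "card (zeros f2) \<le> n2" "finite (zeros f3)" "card (zeros f3) \<le> n3"
    for f1 f2 f3 n1 n2 n3
  proof -
    have "card (zeros f1 \<union> (zeros f2 \<union> zeros f3)) \<le> card (zeros f1) + (card (zeros f2) + card (zeros f3))"
      by (meson add_left_mono card_Un_le order_trans)
    then show ?thesis using that by auto
  qed
  have single: "finite (\<Union>f\<in>single_funs \<alpha> sg (qs ! i) (es ! i). zeros f) \<and>
      card (\<Union>f\<in>single_funs \<alpha> sg (qs ! i) (es ! i). zeros f) \<le> T_outer \<and>
      (\<forall>f\<in>single_funs \<alpha> sg (qs ! i) (es ! i). continuous_on A f)" if i: "i < length es" for i A
  proof -
    note z1 = zeros_bound[of "st i i" "p_disc (qe (nv 3))" "\<lambda>t. pt_disc \<alpha> (qs ! i) (dir sg t)"]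
    note z2 = zeros_bound[of "st i i" "p_T1 (ae (nv 3)) (be (nv 3))" "\<lambda>t. ln_T1 \<alpha> (fst (es ! i)) (snd (es ! i)) (dir sg t)"]
    note z3 = zeros_bound[of "st i i" "p_T2 (ae (nv 3)) (be (nv 3))" "\<lambda>t. ln_T2 \<alpha> (fst (es ! i)) (snd (es ! i)) (dir sg t)"]
    have p: "peval (st i i) (p_disc (qe (nv 3))) t = pt_disc \<alpha> (qs ! i) (dir sg t)"
      "peval (st i i) (p_T1 (ae (nv 3)) (be (nv 3))) t = ln_T1 \<alpha> (fst (es ! i)) (snd (es ! i)) (dir sg t)"
      "peval (st i i) (p_T2 (ae (nv 3)) (be (nv 3))) t = ln_T2 \<alpha> (fst (es ! i)) (snd (es ! i)) (dir sg t)" for t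
      unfolding peval_p_disc[OF sg sr] peval_p_T1[OF sg sr] peval_p_T2[OF sg sr] cv[OF i i] by simp_all
    note t = three[OF z1(1)[OF p(1)] z1(2)[OF p(1)] z2(1)[OF p(2)] z2(2)[OF p(2)] z3(1)[OF p(3)] z3(2)[OF p(3)]]
    have le: "length (p_disc (qe (nv 3))) + (length (p_T1 (ae (nv 3)) (be (nv 3))) + length (p_T2 (ae (nv 3)) (be (nv 3)))) \<le> T_outer"
      by (simp add: T_outer_def)
    have "\<forall>f\<in>single_funs \<alpha> sg (qs ! i) (es ! i). continuous_on A f"
      unfolding single_funs_def using z1(3)[OF p(1), of A] z2(3)[OF p(2), of A] z3(3)[OF p(3), of A] by simp
    then show ?thesis using conjunct1[OF t] order_trans[OF conjunct2[OF t] le] unfolding single_funs_def by blast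
  qed
  have pair: "finite (\<Union>f\<in>pair_funs \<alpha> sg (qs ! i) (es ! i) (qs ! j) (es ! j). zeros f) \<and>
      card (\<Union>f\<in>pair_funs \<alpha> sg (qs ! i) (es ! i) (qs ! j) (es ! j). zeros f) \<le> T_inner \<and>
      (\<forall>f\<in>pair_funs \<alpha> sg (qs ! i) (es ! i) (qs ! j) (es ! j). continuous_on A f)"
    if ij: "i < length es" "j < length es" for i j A
  proof -
    note z1 = zeros_bound[of "st i j" "p_Rpp (qe (nv 3)) (qe (nv 4))" "\<lambda>t. Rpp \<alpha> (qs ! i) (qs ! j) (dir sg t)"]
    note z2 = zeros_bound[of "st i j" "p_Rpl (qe (nv 3)) (ae (nv 4)) (be (nv 4))" "\<lambda>t. Rpl \<alpha> (qs ! i) (fst (es ! j)) (snd (es ! j)) (dir sg t)"]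
    note z3 = zeros_bound[of "st i j" "p_Rll (ae (nv 3)) (be (nv 3)) (ae (nv 4)) (be (nv 4))"
        "\<lambda>t. Rll \<alpha> (fst (es ! i)) (snd (es ! i)) (fst (es ! j)) (snd (es ! j)) (dir sg t)"]
    have p: "peval (st i j) (p_Rpp (qe (nv 3)) (qe (nv 4))) t = Rpp \<alpha> (qs ! i) (qs ! j) (dir sg t)"
      "peval (st i j) (p_Rpl (qe (nv 3)) (ae (nv 4)) (be (nv 4))) t = Rpl \<alpha> (qs ! i) (fst (es ! j)) (snd (es ! j)) (dir sg t)"
      "peval (st i j) (p_Rll (ae (nv 3)) (be (nv 3)) (ae (nv 4)) (be (nv 4))) t =
        Rll \<alpha> (fst (es ! i)) (snd (es ! i)) (fst (es ! j)) (snd (es ! j)) (dir sg t)" for t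
      unfolding peval_p_Rpp[OF sg sr] peval_p_Rpl[OF sg sr] peval_p_Rll[OF sg sr] cv[OF ij] by simp_all
    note t = three[OF z1(1)[OF p(1)] z1(2)[OF p(1)] z2(1)[OF p(2)] z2(2)[OF p(2)] z3(1)[OF p(3)] z3(2)[OF p(3)]]
    have le: "length (p_Rpp (qe (nv 3)) (qe (nv 4))) + (length (p_Rpl (qe (nv 3)) (ae (nv 4)) (be (nv 4))) +
        length (p_Rll (ae (nv 3)) (be (nv 3)) (ae (nv 4)) (be (nv 4)))) \<le> T_inner"
      by (simp add: T_inner_def)
    have "\<forall>f\<in>pair_funs \<alpha> sg (qs ! i) (es ! i) (qs ! j) (es ! j). continuous_on A f"
      unfolding pair_funs_def using z1(3)[OF p(1), of A] z2(3)[OF p(2), of A] z3(3)[OF p(3), of A] by simp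
    then show ?thesis using conjunct1[OF t] order_trans[OF conjunct2[OF t] le] unfolding pair_funs_def by blast
  qed
  show "f \<in> all_funs \<alpha> sg es qs \<Longrightarrow> continuous_on A f"
  proof -
    assume "f \<in> all_funs \<alpha> sg es qs"
    then obtain i where i: "i < length es" and "f \<in> single_funs \<alpha> sg (qs ! i) (es ! i) \<or>
        (\<exists>j<length es. f \<in> pair_funs \<alpha> sg (qs ! i) (es ! i) (qs ! j) (es ! j))"
      unfolding all_funs_def by blast
    then show "continuous_on A f" using single[OF i, of A] pair[OF i, of _ A] by blast
  qed
  have eq: "(\<Union>f\<in>all_funs \<alpha> sg es qs. zeros f) = (\<Union>i<length es. (\<Union>f\<in>single_funs \<alpha> sg (qs ! i) (es ! i). zeros f) \<union>
      (\<Union>j<length es. \<Union>f\<in>pair_funs \<alpha> sg (qs ! i) (es ! i) (qs ! j) (es ! j). zeros f))"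
    unfolding all_funs_def by blast
  show "finite (\<Union>f\<in>all_funs \<alpha> sg es qs. zeros f)"
  proof -
    have "finite ((\<Union>f\<in>single_funs \<alpha> sg (qs ! i) (es ! i). zeros f) \<union>
      (\<Union>j<length es. \<Union>f\<in>pair_funs \<alpha> sg (qs ! i) (es ! i) (qs ! j) (es ! j). zeros f))" if i: "i < length es" for i
    proof (rule finite_UnI[OF conjunct1[OF single[OF i]]])
      show "finite (\<Union>j<length es. \<Union>f\<in>pair_funs \<alpha> sg (qs ! i) (es ! i) (qs ! j) (es ! j). zeros f)"
        by (rule finite_UN_I[OF finite_lessThan]) (use conjunct1[OF pair[OF i]] in blast)
    qed
    then show ?thesis unfolding eq by (intro finite_UN_I finite_lessThan) blast
  qed
  have "card (\<Union>j<length es. \<Union>f\<in>pair_funs \<alpha> sg (qs ! i) (es ! i) (qs ! j) (es ! j). zeros f) \<le> length es * T_inner"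
    if i: "i < length es" for i
  proof -
    have "card (\<Union>j<length es. \<Union>f\<in>pair_funs \<alpha> sg (qs ! i) (es ! i) (qs ! j) (es ! j). zeros f) \<le>
        (\<Sum>j<length es. card (\<Union>f\<in>pair_funs \<alpha> sg (qs ! i) (es ! i) (qs ! j) (es ! j). zeros f))"
      by (rule card_UN_le) simp
    also have "\<dots> \<le> (\<Sum>j<length es. T_inner)" by (rule sum_mono) (use conjunct1[OF conjunct2[OF pair[OF i]]] in blast)
    finally show ?thesis by simp
  qed
  note col = this
  have row: "card ((\<Union>f\<in>single_funs \<alpha> sg (qs ! i) (es ! i). zeros f) \<union>
      (\<Union>j<length es. \<Union>f\<in>pair_funs \<alpha> sg (qs ! i) (es ! i) (qs ! j) (es ! j). zeros f)) \<le> T_outer + length es * T_inner"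
    if i: "i < length es" for i
    by (rule order_trans[OF card_Un_le add_mono[OF conjunct1[OF conjunct2[OF single[OF i]]] col[OF i]]])
  have "card (\<Union>f\<in>all_funs \<alpha> sg es qs. zeros f) \<le> (\<Sum>i<length es. card ((\<Union>f\<in>single_funs \<alpha> sg (qs ! i) (es ! i). zeros f) \<union>
      (\<Union>j<length es. \<Union>f\<in>pair_funs \<alpha> sg (qs ! i) (es ! i) (qs ! j) (es ! j). zeros f)))"
    unfolding eq by (rule card_UN_le) simp
  also have "\<dots> \<le> (\<Sum>i<length es. T_outer + length es * T_inner)" by (rule sum_mono) (use row in blast)
  finally show "card (\<Union>f\<in>all_funs \<alpha> sg es qs. zeros f) \<le> length es * (T_outer + length es * T_inner)" by simp
qed

text \<open>The double loop over indices meets every critical function, because \<open>qs\<close>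
  enumerates all ends of edges.\<close>

lemma crit_funs_all_funs:
  assumes f: "f \<in> crit_funs \<alpha> es" and qs: "set qs = ends es" "length qs = length es"
  shows "(\<lambda>t. f (dir sg t)) \<in> all_funs \<alpha> sg es qs"
proof -
  have q: "\<exists>i<length es. q = qs ! i" if "q \<in> ends es" for q
    using that qs by (metis in_set_conv_nth)
  have e: "\<exists>i<length es. e = es ! i" if "e \<in> set es" for e
    using that by (metis in_set_conv_nth)
  have S: "g \<in> all_funs \<alpha> sg es qs" if "g \<in> single_funs \<alpha> sg (qs ! i) (es ! i)" "i < length es" for g i
    using that unfolding all_funs_def by blast
  have P: "g \<in> all_funs \<alpha> sg es qs" if "g \<in> pair_funs \<alpha> sg (qs ! i) (es ! i) (qs ! j) (es ! j)" "i < length es" "j < length es" for g i j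
    using that unfolding all_funs_def by blast
  consider (1) q where "q \<in> ends es" "f = pt_disc \<alpha> q" | (2) e where "e \<in> set es" "f = ln_T1 \<alpha> (fst e) (snd e)"
    | (3) e where "e \<in> set es" "f = ln_T2 \<alpha> (fst e) (snd e)"
    | (4) q r where "q \<in> ends es" "r \<in> ends es" "f = Rpp \<alpha> q r"
    | (5) q e where "q \<in> ends es" "e \<in> set es" "f = Rpl \<alpha> q (fst e) (snd e)"
    | (6) e e' where "e \<in> set es" "e' \<in> set es" "f = Rll \<alpha> (fst e) (snd e) (fst e') (snd e')"
    using f unfolding crit_funs_def by (auto simp: split_beta)
  then show ?thesis
  proof cases
    case 1
    obtain i where "i < length es" "q = qs ! i" using q[OF 1(1)] by blast
    then show ?thesis by (intro S[of _ i]) (simp_all add: 1(2) single_funs_def)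
  next
    case 2
    obtain i where "i < length es" "e = es ! i" using e[OF 2(1)] by blast
    then show ?thesis by (intro S[of _ i]) (simp_all add: 2(2) single_funs_def)
  next
    case 3
    obtain i where "i < length es" "e = es ! i" using e[OF 3(1)] by blast
    then show ?thesis by (intro S[of _ i]) (simp_all add: 3(2) single_funs_def)
  next
    case 4
    obtain i j where "i < length es" "q = qs ! i" "j < length es" "r = qs ! j" using q[OF 4(1)] q[OF 4(2)] by blast
    then show ?thesis by (intro P[of _ i j]) (simp_all add: 4(3) pair_funs_def)
  next
    case 5
    obtain i j where "i < length es" "q = qs ! i" "j < length es" "e = es ! j" using q[OF 5(1)] e[OF 5(2)] by blast
    then show ?thesis by (intro P[of _ i j]) (simp_all add: 5(3) pair_funs_def)
  next
    case 6
    obtain i j where "i < length es" "e = es ! i" "j < length es" "e' = es ! j" using e[OF 6(1)] e[OF 6(2)] by blast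
    then show ?thesis by (intro P[of _ i j]) (simp_all add: 6(3) pair_funs_def)
  qed
qed

lemma gap_uniform:
  assumes g: "gap (\<lambda>t. f (dir sg t)) x y" and c: "continuous_on {x<..<y} (\<lambda>t. f (dir sg t))" and t: "x < t" "t < y"
  shows "uniform sg ({x<..<y} \<union> {t}) f"
proof -
  have I: "{x<..<y} \<union> {t} = {x<..<y}" using t by auto
  show ?thesis
  proof (cases "\<forall>t. f (dir sg t) = 0")
    case False
    then have nz: "f (dir sg s) \<noteq> 0" if "s \<in> {x<..<y}" for s using g that by (auto simp: gap_def)
    have tI: "t \<in> {x<..<y}" using t by simp
    show ?thesis
    proof (cases "f (dir sg t) > 0")
      case True
      have "f (dir sg s) > 0" if "s \<in> {x<..<y}" for s
        by (rule positive_on_interval[OF _ c nz tI that True]) simp_all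
      then show ?thesis unfolding I uniform_def by blast
    next
      case False
      then have pos: "- f (dir sg t) > 0" using nz[OF tI] by linarith
      have "- f (dir sg s) > 0" if "s \<in> {x<..<y}" for s
        by (rule positive_on_interval[of "{x<..<y}" "\<lambda>s. - f (dir sg s)" t]) (use continuous_on_minus[OF c] nz tI that pos in simp_all)
      then have "\<forall>s\<in>{x<..<y}. f (dir sg s) < 0" by simp
      then show ?thesis unfolding I uniform_def by blast
    qed
  qed (simp add: uniform_def)
qed

section \<open>The invariant of the sweep\<close>

definition disjoint_cells :: "complex \<Rightarrow> piece list \<Rightarrow> bool" where
  "disjoint_cells p Ts \<longleftrightarrow> (\<forall>i<length Ts. \<forall>j<length Ts. i \<noteq> j \<longrightarrow>
     interior (cell p (Ts ! i)) \<inter> interior (cell p (Ts ! j)) = {})"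

lemma disjoint_cells_append:
  assumes "disjoint_cells p Ts" "length Us \<le> 1"
    and d: "\<And>T U. T \<in> set Ts \<Longrightarrow> U \<in> set Us \<Longrightarrow> interior (cell p T) \<inter> interior (cell p U) = {}"
  shows "disjoint_cells p (Ts @ Us)"
proof (cases Us)
  case (Cons U Us')
  then have U: "Us = [U]" using assms(2) by simp
  have d': "interior (cell p (Ts ! i)) \<inter> interior (cell p U) = {}" if "i < length Ts" for i
    using d[of "Ts ! i" U] that U by simp
  show ?thesis unfolding disjoint_cells_def U
  proof (intro allI impI)
    fix i j assume ij: "i < length (Ts @ [U])" "j < length (Ts @ [U])" "i \<noteq> j"
    consider "i < length Ts" "j < length Ts" | "i < length Ts" "j = length Ts" | "i = length Ts" "j < length Ts"
      using ij by fastforce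
    then show "interior (cell p ((Ts @ [U]) ! i)) \<inter> interior (cell p ((Ts @ [U]) ! j)) = {}"
    proof cases
      case 1
      then show ?thesis using assms(1) ij(3) by (simp add: nth_append disjoint_cells_def)
    next
      case 2
      then show ?thesis using d'[of i] by (simp add: nth_append)
    next
      case 3
      then show ?thesis using d'[of j] by (simp add: nth_append Int_commute)
    qed
  qed
qed (use assms in simp)

text \<open>The open sectors still to be swept. The chart 1 comes first, so during its sweep the
  whole second chart is still to come.\<close>

definition rest :: "complex \<Rightarrow> real \<Rightarrow> real \<Rightarrow> complex set" where
  "rest p sg x = sector_set p sg x 1 \<union> (if sg = 1 then sector_set p (-1) (-1) 1 else {})"

text \<open>The sweep stands at parameter \<open>x\<close> of chart \<open>sg\<close>. The
  directions before \<open>x\<close> are covered, and the interiors of the pieces stay away from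
  \<open>rest\<close>, where all later pieces have their interiors.\<close>

definition good :: "complex set \<Rightarrow> complex \<Rightarrow> real \<Rightarrow> real \<Rightarrow> piece list \<Rightarrow> bool" where
  "good V p sg x Ts \<longleftrightarrow> (\<forall>T\<in>set Ts. piece_ok V p T \<and> interior (cell p T) \<inter> rest p sg x = {}) \<and>
     disjoint_cells p Ts \<and> (\<exists>T\<in>set Ts. p \<in> cell p T) \<and>
     (\<forall>sg' y l. (sg' = sg \<and> -1 \<le> y \<and> y < x \<or> sg' = 1 \<and> sg = -1 \<and> -1 \<le> y \<and> y < 1) \<and> l > 0 \<and>
        p + of_real l * dir sg' y \<in> V \<longrightarrow> (\<exists>T\<in>set Ts. p + of_real l * dir sg' y \<in> cell p T))"

lemma sector_set_disjoint:
  assumes sg: "\<bar>sg\<bar> = 1" "\<bar>sg'\<bar> = 1" and t: "-1 \<le> x" "y \<le> 1" "-1 \<le> x'" "y' \<le> 1"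
    and d: "sg \<noteq> sg' \<or> y \<le> x'"
  shows "sector_set p sg x y \<inter> sector_set p sg' x' y' = {}"
proof (rule ccontr)
  assume "\<not> ?thesis"
  then obtain l t l' t' where a: "l > 0" "x < t" "t < y" "l' > 0" "x' < t'" "t' < y'"
    "p + of_real l * dir sg t = p + of_real l' * dir sg' t'"
    unfolding sector_set_def by auto
  have "sg = sg' \<and> t = t'"
    by (rule dir_unique[OF sg a(1,4)]) (use a assms in auto)
  then show False using d a by auto
qed

text \<open>\<open>As\<close> comes from the single direction \<open>x\<close> and has empty
  interior, so it overlaps nothing; \<open>Bs\<close> comes from the open sector between
  \<open>x\<close> and \<open>y\<close>, which was part of \<open>rest\<close> before.\<close>

lemma good_extend:
  assumes g: "good V p sg x Ts" and sg: "\<bar>sg\<bar> = 1" and xy: "-1 \<le> x" "x < y" "y \<le> 1"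
    and As: "length As \<le> 1" "\<And>T. T \<in> set As \<Longrightarrow> piece_ok V p T \<and> interior (cell p T) \<subseteq> sector_set p sg x x"
      "\<And>l. l > 0 \<Longrightarrow> p + of_real l * dir sg x \<in> V \<Longrightarrow> \<exists>T\<in>set As. p + of_real l * dir sg x \<in> cell p T"
    and Bs: "length Bs \<le> 1" "\<And>T. T \<in> set Bs \<Longrightarrow> piece_ok V p T \<and> interior (cell p T) \<subseteq> sector_set p sg x y"
      "\<And>l t. x < t \<Longrightarrow> t < y \<Longrightarrow> l > 0 \<Longrightarrow> p + of_real l * dir sg t \<in> V \<Longrightarrow> \<exists>T\<in>set Bs. p + of_real l * dir sg t \<in> cell p T"
  shows "good V p sg y (Ts @ As @ Bs)"
proof -
  have e: "sector_set p sg x x = {}" by (auto simp: sector_set_def)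
  have mono: "sector_set p sg y 1 \<subseteq> sector_set p sg x 1" "sector_set p sg x y \<subseteq> sector_set p sg x 1"
    using xy by (force simp: sector_set_def)+
  have A: "interior (cell p T) = {}" if "T \<in> set As" for T using As(2)[OF that] e by blast
  have rm: "rest p sg y \<subseteq> rest p sg x" using mono by (auto simp: rest_def)
  have d1: "disjoint_cells p (Ts @ As)"
    by (rule disjoint_cells_append) (use g As(1) A in \<open>auto simp: good_def\<close>)
  have d2: "disjoint_cells p ((Ts @ As) @ Bs)"
  proof (rule disjoint_cells_append[OF d1 Bs(1)])
    fix T U assume T: "T \<in> set (Ts @ As)" and U: "U \<in> set Bs"
    have "interior (cell p U) \<subseteq> rest p sg x" using Bs(2)[OF U] mono by (auto simp: rest_def)
    moreover have "interior (cell p T) \<inter> rest p sg x = {}" using T A g by (auto simp: good_def)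
    ultimately show "interior (cell p T) \<inter> interior (cell p U) = {}" by blast
  qed
  have dis: "sector_set p sg x y \<inter> rest p sg y = {}"
    using sector_set_disjoint[of sg sg x y y 1 p] sector_set_disjoint[of sg "-1" x y "-1" 1 p] sg xy
    by (auto simp: rest_def)
  have r: "piece_ok V p T \<and> interior (cell p T) \<inter> rest p sg y = {}" if "T \<in> set (Ts @ As @ Bs)" for T
  proof -
    consider "T \<in> set Ts" | "T \<in> set As" | "T \<in> set Bs" using \<open>T \<in> _\<close> by auto
    then show ?thesis
    proof cases
      case 1 then show ?thesis using g rm by (auto simp: good_def)
    next
      case 2 then show ?thesis using A As(2) by blast
    next
      case 3 then show ?thesis using Bs(2) dis by blast
    qed
  qed
  have c: "\<exists>T\<in>set (Ts @ As @ Bs). p + of_real l * dir sg' t \<in> cell p T"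
    if h: "sg' = sg \<and> -1 \<le> t \<and> t < y \<or> sg' = 1 \<and> sg = -1 \<and> -1 \<le> t \<and> t < 1" and "l > 0" "p + of_real l * dir sg' t \<in> V" for sg' t l
  proof -
    consider "sg' = sg \<and> -1 \<le> t \<and> t < x \<or> sg' = 1 \<and> sg = -1 \<and> -1 \<le> t \<and> t < 1"
      | "sg' = sg" "t = x" | "sg' = sg" "x < t" "t < y" using h less_linear[of t x] by blast
    then show ?thesis
    proof cases
      case 1
      then have "\<exists>T\<in>set Ts. p + of_real l * dir sg' t \<in> cell p T" using g that(2,3) unfolding good_def by blast
      then show ?thesis by auto
    next
      case 2
      then have "\<exists>T\<in>set As. p + of_real l * dir sg' t \<in> cell p T" using As(3)[of l] that by simp
      then show ?thesis by auto
    next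
      case 3
      then have "\<exists>T\<in>set Bs. p + of_real l * dir sg' t \<in> cell p T" using Bs(3)[of t l] that by simp
      then show ?thesis by auto
    qed
  qed
  have "\<exists>T\<in>set (Ts @ As @ Bs). p \<in> cell p T" using g by (auto simp: good_def)
  moreover have "disjoint_cells p (Ts @ As @ Bs)" using d2 by (simp only: append_assoc)
  ultimately show ?thesis unfolding good_def using r c by (intro conjI allI impI ballI) (blast | assumption)+
qed

section \<open>Sweeping the directions\<close>

definition probe :: "rexp \<Rightarrow> rexp \<Rightarrow> com" where
  "probe e f = Seq (RAssign 13 (NConst 0) e) (Seq (RAssign 14 (NConst 0) (rv 11)) (Seq (RAssign 15 (NConst 0) f) step))"

text \<open>The search starts from the candidate 0 or 1. Stopping at 0 prevents a sector over the
  whole half circle, which \<open>wedge_dir\<close> excludes.\<close>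

definition init_next :: com where
  "init_next = Cond (RLess (rv 11) (rnum 0)) (RAssign 12 (NConst 0) (rnum 0)) (RAssign 12 (NConst 0) (rnum 1))"

definition mid :: rexp where "mid = RDiv (RAdd (rv 11) (rv 12)) (rnum 2)"

definition chart_body :: com where
  "chart_body = Seq (probe (rv 11) (rv 11)) (Seq init_next (Seq next_crit
     (Seq (probe mid (rv 12)) (RAssign 11 (NConst 0) (rv 12)))))"

definition chart :: "rexp \<Rightarrow> com" where
  "chart e = Seq (RAssign 10 (NConst 0) e) (Seq (RAssign 11 (NConst 0) (rneg (rnum 1)))
     (While (RLess (rv 11) (rnum 1)) chart_body))"

lemma written_probe [simp]: "nats_written (probe e f) = {3, 10, 11, 9, 1}"
  and reals_written_probe: "x \<in> reals_written (probe e f) \<Longrightarrow> x \<in> {13, 14, 15, 16, 17, 3}"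
  by (auto simp: probe_def dest: reals_written_step)

definition T_step :: "nat \<Rightarrow> nat" where "T_step n = 24 + n * 26"
definition T_next :: "nat \<Rightarrow> nat" where "T_next n = 2 + n * (T_outer + (2 + n * (T_inner + 2)) + 2)"
definition T_body :: "nat \<Rightarrow> nat" where "T_body n = T_step n + (2 + (T_next n + (T_step n + 1)))"
text \<open>The summand 2 accounts for the parameters 0 and 1, which are treated as critical as
  well.\<close>

definition crit_bound :: "nat \<Rightarrow> nat" where "crit_bound n = 2 + n * (T_outer + n * T_inner)"

definition T_chart :: "nat \<Rightarrow> nat" where
  "T_chart n = 1 + (1 + (1 + crit_bound n * Suc (T_body n)))"

definition above :: "real set \<Rightarrow> real \<Rightarrow> nat" where "above Z x = card {z \<in> Z. x < z}"

context star_region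
begin

lemma runs_probe:
  assumes sg: "\<bar>sg\<bar> = 1" and t: "-1 \<le> t1" "t2 \<le> 1" "t1 < 1" "\<not> (t1 = -1 \<and> t2 = 1)"
    and tt: "(t1 = tt \<and> tt = t2) \<or> (t1 < tt \<and> tt < t2)"
    and unif: "\<And>f. f \<in> crit_funs \<alpha> es \<Longrightarrow> uniform sg ({t1<..<t2} \<union> {tt}) f"
    and m: "mem es qs \<alpha> p sg s" and qs: "set qs = ends es"
    and r: "rval s e = tt" "reals s 11 0 = t1" "rval s f = t2" and fr: "rfree 13 f" "rfree 14 f"
    and pos: "nats s 9 0 = 10 * nats s 1 0"
  shows "runs (probe e f) s (T_step (length es)) (\<lambda>s'. nats s' 9 0 = 10 * nats s' 1 0 \<and>
    (\<exists>Ts. read_output s' = read_output s @ Ts \<and> length Ts \<le> 1 \<and>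
      (\<forall>T\<in>set Ts. piece_ok V p T \<and> interior (cell p T) \<subseteq> sector_set p sg t1 t2) \<and>
      (\<forall>x\<in>{t1<..<t2} \<union> {tt}. \<forall>l>0. p + of_real l * dir sg x \<in> V \<longrightarrow> (\<exists>T\<in>set Ts. p + of_real l * dir sg x \<in> cell p T))))"
    (is "runs _ _ _ ?Q")
proof -
  define s1 where "s1 = s\<lparr>reals := upd2 (reals s) 13 0 tt\<rparr>"
  define s2 where "s2 = s1\<lparr>reals := upd2 (reals s1) 14 0 t1\<rparr>"
  define s3 where "s3 = s2\<lparr>reals := upd2 (reals s2) 15 0 t2\<rparr>"
  have f: "rval s1 f = t2" "rval s2 f = t2"
    using rval_rfree[OF fr(1), of s 0 tt] rval_rfree[OF fr(2), of s1 0 t1] r(3) by (simp_all add: s1_def s2_def)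
  have m3: "mem es qs \<alpha> p sg s3" by (rule mem_cong[OF m]) (auto simp: s1_def s2_def s3_def upd2_apply)
  have r3: "reals s3 13 0 = tt" "reals s3 14 0 = t1" "reals s3 15 0 = t2" "nats s3 = nats s" "reals s3 3 = reals s 3"
    by (simp_all add: s1_def s2_def s3_def upd2_apply)
  have out: "read_output s3 = read_output s" using r3(4,5) by (simp add: read_output_def read_piece_def)
  have pos3: "nats s3 9 0 = 10 * nats s3 1 0" using pos r3(4) by simp
  have st: "runs step s3 (21 + length es * 26) ?Q"
    using runs_step[OF sg t tt unif m3 qs r3(1-3) pos3] unfolding out by blast
  have "runs (probe e f) s (1 + (1 + (1 + (21 + length es * 26)))) ?Q"
    unfolding probe_def
  proof (rule runs_Seq[OF runs_RAssign[where Q = "\<lambda>s'. s' = s1"]])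
    show "s\<lparr>reals := upd2 (reals s) 13 (nval s (NConst 0)) (rval s e)\<rparr> = s1" by (simp add: s1_def r)
    fix s1' assume e1: "s1' = s1"
    show "runs (Seq (RAssign 14 (NConst 0) (rv 11)) (Seq (RAssign 15 (NConst 0) f) step)) s1' (1 + (1 + (21 + length es * 26))) ?Q"
      unfolding e1
    proof (rule runs_Seq[OF runs_RAssign[where Q = "\<lambda>s'. s' = s2"]])
      show "s1\<lparr>reals := upd2 (reals s1) 14 (nval s1 (NConst 0)) (rval s1 (rv 11))\<rparr> = s2"
        using r(2) by (simp add: s2_def s1_def upd2_apply)
      fix s2' assume e2: "s2' = s2"
      show "runs (Seq (RAssign 15 (NConst 0) f) step) s2' (1 + (21 + length es * 26)) ?Q" unfolding e2
      proof (rule runs_Seq[OF runs_RAssign[where Q = "\<lambda>s'. s' = s3"]])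
        show "s2\<lparr>reals := upd2 (reals s2) 15 (nval s2 (NConst 0)) (rval s2 f)\<rparr> = s3" by (simp add: s3_def f)
        fix s3' assume e3: "s3' = s3"
        show "runs step s3' (21 + length es * 26) ?Q" unfolding e3 by (rule st)
      qed
    qed
  qed
  then show ?thesis by (rule runs_mono) (auto simp: T_step_def)
qed

text \<open>A round writes at most two pieces and moves past at least one member of
  \<open>Z\<close>; the last conjunct turns this into a bound on the output.\<close>

definition chart_inv :: "complex list \<Rightarrow> real set \<Rightarrow> real \<Rightarrow> nat \<Rightarrow> state \<Rightarrow> bool" where
  "chart_inv qs Z sg B s \<longleftrightarrow> mem es qs \<alpha> p sg s \<and> nats s 9 0 = 10 * nats s 1 0 \<and> -1 \<le> reals s 11 0 \<and> reals s 11 0 \<le> 1 \<and>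
     good V p sg (reals s 11 0) (read_output s) \<and> length (read_output s) + 2 * above Z (reals s 11 0) \<le> B"

lemma runs_chart_body:
  assumes sg: "\<bar>sg\<bar> = 1" and qs: "set qs = ends es" "length qs = length es"
    and Z: "finite Z" "0 \<in> Z" "1 \<in> Z" "\<And>f. f \<in> all_funs \<alpha> sg es qs \<Longrightarrow> zeros f \<subseteq> Z"
    and inv: "chart_inv qs Z sg B s" and lt: "reals s 11 0 < 1"
  shows "runs chart_body s (T_body (length es)) (\<lambda>s'. chart_inv qs Z sg B s' \<and> above Z (reals s' 11 0) < above Z (reals s 11 0))"
    (is "runs _ _ _ ?Q")
proof -
  define x where "x = reals s 11 0"
  define y0 where "y0 = (if x < 0 then 0 else 1 :: real)"
  have x: "-1 \<le> x" "x < 1" using inv lt by (auto simp: chart_inv_def x_def)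
  have y0: "x < y0" "y0 \<le> 1" "y0 \<in> Z" "\<not> (x = -1 \<and> y0 = 1)" using x Z by (auto simp: y0_def)
  have m: "mem es qs \<alpha> p sg s" and pos: "nats s 9 0 = 10 * nats s 1 0" and g: "good V p sg x (read_output s)"
    and B: "length (read_output s) + 2 * above Z x \<le> B" using inv by (auto simp: chart_inv_def x_def)
  \<comment> \<open>On a single direction every function is uniform, so the current direction can be
    probed before any search.\<close>
  have u1: "uniform sg ({x<..<x} \<union> {x}) f" for f by (auto simp: uniform_def)
  have pr1: "runs (probe (rv 11) (rv 11)) s (T_step (length es)) (\<lambda>s'. nats s' 9 0 = 10 * nats s' 1 0 \<and>
    (\<exists>Ts. read_output s' = read_output s @ Ts \<and> length Ts \<le> 1 \<and>
      (\<forall>T\<in>set Ts. piece_ok V p T \<and> interior (cell p T) \<subseteq> sector_set p sg x x) \<and>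
      (\<forall>z\<in>{x<..<x} \<union> {x}. \<forall>l>0. p + of_real l * dir sg z \<in> V \<longrightarrow> (\<exists>T\<in>set Ts. p + of_real l * dir sg z \<in> cell p T))))"
    by (rule runs_probe[OF sg _ _ _ _ _ u1 m qs(1) _ _ _ _ _ pos]) (use x in \<open>simp_all add: x_def\<close>)
  have "runs chart_body s (T_step (length es) + (2 + (T_next (length es) + (T_step (length es) + 1)))) ?Q"
    unfolding chart_body_def
  proof (rule runs_Seq[OF pr1])
    fix s1 assume q1: "nats s1 9 0 = 10 * nats s1 1 0 \<and>
      (\<exists>Ts. read_output s1 = read_output s @ Ts \<and> length Ts \<le> 1 \<and>
      (\<forall>T\<in>set Ts. piece_ok V p T \<and> interior (cell p T) \<subseteq> sector_set p sg x x) \<and>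
      (\<forall>z\<in>{x<..<x} \<union> {x}. \<forall>l>0. p + of_real l * dir sg z \<in> V \<longrightarrow> (\<exists>T\<in>set Ts. p + of_real l * dir sg z \<in> cell p T)))"
      and un1: "unchanged (probe (rv 11) (rv 11)) s s1"
    from q1 obtain As where As: "read_output s1 = read_output s @ As" "length As \<le> 1"
      "\<And>T. T \<in> set As \<Longrightarrow> piece_ok V p T \<and> interior (cell p T) \<subseteq> sector_set p sg x x"
      "\<And>l. l > 0 \<Longrightarrow> p + of_real l * dir sg x \<in> V \<Longrightarrow> \<exists>T\<in>set As. p + of_real l * dir sg x \<in> cell p T"
      by blast
    have pos1: "nats s1 9 0 = 10 * nats s1 1 0" using q1 by blast
    have m1: "mem es qs \<alpha> p sg s1" by (rule mem_unchanged[OF m un1]) (auto dest: reals_written_probe)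
    have "11 \<notin> reals_written (probe (rv 11) (rv 11))" by (auto dest: reals_written_probe)
    then have x1: "reals s1 11 0 = x" using unchangedD(2)[OF un1] by (simp add: x_def)
    define s2 where "s2 = s1\<lparr>reals := upd2 (reals s1) 12 0 y0\<rparr>"
    have "runs init_next s1 (Suc 1) (\<lambda>s'. s' = s2)"
      unfolding init_next_def by (rule runs_Cond; rule runs_RAssign) (use x1 in \<open>auto simp: s2_def y0_def\<close>)
    then have in2: "runs init_next s1 2 (\<lambda>s'. s' = s2)" by (simp add: numeral_2_eq_2)
    have m2: "mem es qs \<alpha> p sg s2" by (rule mem_cong[OF m1]) (auto simp: s2_def upd2_apply)
    have inv2: "next_inv x y0 Z {} s2" using x1 y0 by (simp add: next_inv_def s2_def upd2_apply)
    show "runs (Seq init_next (Seq next_crit (Seq (probe mid (rv 12)) (RAssign 11 (NConst 0) (rv 12))))) s1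
       (2 + (T_next (length es) + (T_step (length es) + 1))) ?Q"
    proof (rule runs_Seq[OF in2])
      fix s2' assume e2: "s2' = s2"
      show "runs (Seq next_crit (Seq (probe mid (rv 12)) (RAssign 11 (NConst 0) (rv 12)))) s2'
         (T_next (length es) + (T_step (length es) + 1)) ?Q" unfolding e2
        unfolding T_next_def
      proof (rule runs_Seq[OF runs_next_crit[OF m2 sg inv2 Z(4,2)]], assumption)
        fix s3 assume inv3: "next_inv x y0 Z (all_funs \<alpha> sg es qs) s3" and un3: "unchanged next_crit s2 s3"
        define y where "y = reals s3 12 0"
        have y: "x < y" "y \<le> y0" "y \<in> Z" "reals s3 11 0 = x" "reals s3 12 0 = y"
          and gap: "\<And>f. f \<in> all_funs \<alpha> sg es qs \<Longrightarrow> gap f x y"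
          using inv3 by (auto simp: next_inv_def y_def)
        have y1: "y \<le> 1" "\<not> (x = -1 \<and> y = 1)" using y y0 by auto
        have m3: "mem es qs \<alpha> p sg s3" by (rule mem_unchanged[OF m2 un3]) (auto dest: reals_written_next)
        have "3 \<notin> reals_written next_crit" by (auto dest: reals_written_next)
        then have "reals s3 3 = reals s1 3" "nats s3 1 = nats s1 1" "nats s3 9 = nats s1 9"
          using unchangedD[OF un3] by (simp_all add: s2_def upd2_apply)
        then have out3: "read_output s3 = read_output s1" and pos3: "nats s3 9 0 = 10 * nats s3 1 0"
          using pos1 by (simp_all add: read_output_def read_piece_def)
        have t: "x < (x + y) / 2" "(x + y) / 2 < y" using y(1) by simp_all
        have u3: "uniform sg ({x<..<y} \<union> {(x + y) / 2}) f" if "f \<in> crit_funs \<alpha> es" for f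
        proof -
          note c = crit_funs_all_funs[OF that qs, of sg]
          show ?thesis by (rule gap_uniform[OF gap[OF c] all_funs_rep(1)[OF m3 sg c] t])
        qed
        have pr3: "runs (probe mid (rv 12)) s3 (T_step (length es)) (\<lambda>s'. nats s' 9 0 = 10 * nats s' 1 0 \<and>
          (\<exists>Ts. read_output s' = read_output s3 @ Ts \<and> length Ts \<le> 1 \<and>
            (\<forall>T\<in>set Ts. piece_ok V p T \<and> interior (cell p T) \<subseteq> sector_set p sg x y) \<and>
            (\<forall>z\<in>{x<..<y} \<union> {(x + y) / 2}. \<forall>l>0. p + of_real l * dir sg z \<in> V \<longrightarrow> (\<exists>T\<in>set Ts. p + of_real l * dir sg z \<in> cell p T))))"
          by (rule runs_probe[OF sg x(1) y1(1) x(2) y1(2) _ u3 m3 qs(1) _ y(4) _ _ _ pos3]) (use t y in \<open>simp_all add: mid_def\<close>)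
        show "runs (Seq (probe mid (rv 12)) (RAssign 11 (NConst 0) (rv 12))) s3 (T_step (length es) + 1) ?Q"
        proof (rule runs_Seq[OF pr3])
          fix s4 assume q4: "nats s4 9 0 = 10 * nats s4 1 0 \<and>
            (\<exists>Ts. read_output s4 = read_output s3 @ Ts \<and> length Ts \<le> 1 \<and>
            (\<forall>T\<in>set Ts. piece_ok V p T \<and> interior (cell p T) \<subseteq> sector_set p sg x y) \<and>
            (\<forall>z\<in>{x<..<y} \<union> {(x + y) / 2}. \<forall>l>0. p + of_real l * dir sg z \<in> V \<longrightarrow> (\<exists>T\<in>set Ts. p + of_real l * dir sg z \<in> cell p T)))"
            and un4: "unchanged (probe mid (rv 12)) s3 s4"
          from q4 obtain Bs where Bs: "read_output s4 = read_output s3 @ Bs" "length Bs \<le> 1"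
            "\<And>T. T \<in> set Bs \<Longrightarrow> piece_ok V p T \<and> interior (cell p T) \<subseteq> sector_set p sg x y"
            "\<And>z l. z \<in> {x<..<y} \<union> {(x + y) / 2} \<Longrightarrow> l > 0 \<Longrightarrow> p + of_real l * dir sg z \<in> V \<Longrightarrow> \<exists>T\<in>set Bs. p + of_real l * dir sg z \<in> cell p T"
            by blast
          have Bs': "\<exists>T\<in>set Bs. p + of_real l * dir sg z \<in> cell p T"
            if "x < z" "z < y" "l > 0" "p + of_real l * dir sg z \<in> V" for z l
            by (rule Bs(4)) (use that in auto)
          have m4: "mem es qs \<alpha> p sg s4" by (rule mem_unchanged[OF m3 un4]) (auto dest: reals_written_probe)
          have "12 \<notin> reals_written (probe mid (rv 12))" by (auto dest: reals_written_probe)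
          then have y4: "reals s4 12 0 = y" using unchangedD(2)[OF un4] y(5) by simp
          define s5 where "s5 = s4\<lparr>reals := upd2 (reals s4) 11 0 y\<rparr>"
          have m5: "mem es qs \<alpha> p sg s5" by (rule mem_cong[OF m4]) (auto simp: s5_def upd2_apply)
          have out5: "read_output s5 = read_output s @ As @ Bs"
          proof -
            have "read_piece s5 = read_piece s4" by (rule ext) (simp add: s5_def read_piece_def upd2_apply)
            moreover have "nats s5 = nats s4" by (simp add: s5_def)
            ultimately have "read_output s5 = read_output s4" by (simp add: read_output_def)
            then show ?thesis using As(1) Bs(1) out3 by simp
          qed
          have g5: "good V p sg y (read_output s5)" unfolding out5
            by (rule good_extend[OF g sg x(1) y(1) y1(1) As(2,3,4) Bs(2,3) Bs'])
          \<comment> \<open>The new position \<open>y\<close> belongs to \<open>Z\<close> and is no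
            longer counted.\<close>
          have sub: "{z \<in> Z. y < z} \<subset> {z \<in> Z. x < z}" using y(1,3) by auto
          have fin: "finite {z \<in> Z. x < z}" using Z(1) by simp
          have less: "above Z y < above Z x" unfolding above_def by (rule psubset_card_mono[OF fin sub])
          have "?Q s5"
            unfolding chart_inv_def using m5 g5 less B As(2) Bs(2) x y1 y q4 out5
            by (simp add: s5_def upd2_apply x_def)
          moreover have "s4\<lparr>reals := upd2 (reals s4) 11 (nval s4 (NConst 0)) (rval s4 (rv 12))\<rparr> = s5"
            by (simp add: s5_def y4)
          ultimately show "runs (RAssign 11 (NConst 0) (rv 12)) s4 1 ?Q" by (intro runs_RAssign) simp
        qed
      qed
    qed
  qed
  then show ?thesis by (simp add: T_body_def)
qed

lemma runs_chart:
  assumes sg: "\<bar>sg\<bar> = 1" and qs: "set qs = ends es" "length qs = length es"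
    and m: "mem es qs \<alpha> p (reals s 10 0) s" and pos: "nats s 9 0 = 10 * nats s 1 0"
    and g: "good V p sg (-1) (read_output s)" and e: "rval s e = sg"
  shows "runs (chart e) s (T_chart (length es)) (\<lambda>s'. mem es qs \<alpha> p sg s' \<and> nats s' 9 0 = 10 * nats s' 1 0 \<and>
    good V p sg 1 (read_output s') \<and> length (read_output s') \<le> length (read_output s) + 2 * crit_bound (length es))"
    (is "runs _ _ _ ?Q")
proof -
  define s1 where "s1 = s\<lparr>reals := upd2 (reals s) 10 0 sg\<rparr>"
  define s2 where "s2 = s1\<lparr>reals := upd2 (reals s1) 11 0 (-1)\<rparr>"
  have m1: "mem es qs \<alpha> p sg s1" using m by (auto simp: mem_def s1_def upd2_apply)
  have m2: "mem es qs \<alpha> p sg s2" by (rule mem_cong[OF m1]) (auto simp: s2_def upd2_apply)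
  have out: "read_output s2 = read_output s" by (simp add: s1_def s2_def read_output_def read_piece_def upd2_apply)
  \<comment> \<open>Besides the roots, the values 0 and 1 set by \<open>init_next\<close>; 0 is also
    the default value of \<open>RRoot\<close>.\<close>
  define Z where "Z = {0, 1} \<union> (\<Union>f\<in>all_funs \<alpha> sg es qs. zeros f)"
  note rep = all_funs_rep(2,3)[OF m2 sg]
  have Z: "finite Z" "0 \<in> Z" "1 \<in> Z" "\<And>f. f \<in> all_funs \<alpha> sg es qs \<Longrightarrow> zeros f \<subseteq> Z"
    using rep(1) unfolding Z_def by auto
  have "card Z \<le> card {0, 1 :: real} + card (\<Union>f\<in>all_funs \<alpha> sg es qs. zeros f)"
    unfolding Z_def by (rule card_Un_le)
  then have "card Z \<le> crit_bound (length es)" using rep(2) by (simp add: crit_bound_def)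
  then have ab: "above Z w \<le> crit_bound (length es)" for w
    unfolding above_def using card_mono[OF Z(1), of "{z \<in> Z. w < z}"] by simp
  define B where "B = length (read_output s) + 2 * crit_bound (length es)"
  have inv2: "chart_inv qs Z sg B s2"
    using m2 g pos ab[of "-1"] unfolding chart_inv_def out by (simp add: s1_def s2_def upd2_apply B_def)
  have W: "runs (While (RLess (rv 11) (rnum 1)) chart_body) s2 (1 + crit_bound (length es) * Suc (T_body (length es)))
      (\<lambda>s'. chart_inv qs Z sg B s' \<and> \<not> bval s' (RLess (rv 11) (rnum 1)))"
  proof (rule runs_While[where m = "\<lambda>s. above Z (reals s 11 0)"])
    fix s assume "chart_inv qs Z sg B s" "bval s (RLess (rv 11) (rnum 1))"
    then show "runs chart_body s (T_body (length es)) (\<lambda>s'. chart_inv qs Z sg B s' \<and> above Z (reals s' 11 0) < above Z (reals s 11 0))"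
      by (intro runs_chart_body[OF sg qs Z]) simp_all
  qed (use inv2 ab in simp_all)
  have W': "runs (While (RLess (rv 11) (rnum 1)) chart_body) s2 (1 + crit_bound (length es) * Suc (T_body (length es))) ?Q"
  proof (rule runs_mono[OF W])
    fix s' assume a: "chart_inv qs Z sg B s' \<and> \<not> bval s' (RLess (rv 11) (rnum 1))"
    then have "reals s' 11 0 = 1" by (auto simp: chart_inv_def)
    then show "?Q s'" using a by (simp add: chart_inv_def B_def)
  qed simp
  show ?thesis unfolding chart_def T_chart_def
  proof (rule runs_Seq[OF runs_RAssign[where Q = "\<lambda>s'. s' = s1"]])
    show "s\<lparr>reals := upd2 (reals s) 10 (nval s (NConst 0)) (rval s e)\<rparr> = s1" by (simp add: s1_def e)
    fix s1' assume e1: "s1' = s1"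
    show "runs (Seq (RAssign 11 (NConst 0) (rneg (rnum 1))) (While (RLess (rv 11) (rnum 1)) chart_body)) s1'
        (1 + (1 + crit_bound (length es) * Suc (T_body (length es)))) ?Q" unfolding e1
    proof (rule runs_Seq[OF runs_RAssign[where Q = "\<lambda>s'. s' = s2"]])
      show "s1\<lparr>reals := upd2 (reals s1) 11 (nval s1 (NConst 0)) (rval s1 (rneg (rnum 1)))\<rparr> = s2" by (simp add: s2_def)
      fix s2' assume e2: "s2' = s2"
      show "runs (While (RLess (rv 11) (rnum 1)) chart_body) s2' (1 + crit_bound (length es) * Suc (T_body (length es))) ?Q"
        unfolding e2 by (rule W')
    qed
  qed
qed

text \<open>At the end of the first chart nothing of it is left, and \<open>rest\<close> is exactly
  the second chart.\<close>

lemma good_switch: "good V p 1 1 Ts \<Longrightarrow> good V p (-1) (-1) Ts"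
  by (auto simp: good_def rest_def)

text \<open>By \<open>dir_cover\<close> every point other than \<open>p\<close> lies in one of the
  two half-open charts, both of which have been swept.\<close>

lemma good_describes:
  assumes g: "good V p (-1) 1 Ts"
  shows "describes p Ts V"
proof -
  have "V \<subseteq> (\<Union>T\<in>set Ts. cell p T)"
  proof
    fix v assume v: "v \<in> V"
    show "v \<in> (\<Union>T\<in>set Ts. cell p T)"
    proof (cases "v = p")
      case False
      then obtain sg y l where d: "sg \<in> {1, -1}" "-1 \<le> y" "y < 1" "l > 0" "v - p = of_real l * dir sg y"
        using dir_cover[of "v - p"] by auto
      then have e: "p + of_real l * dir sg y = v" by (metis add_diff_cancel_left' diff_add_cancel add.commute)
      have "sg = -1 \<and> -1 \<le> y \<and> y < 1 \<or> sg = 1 \<and> (-1::real) = -1 \<and> -1 \<le> y \<and> y < 1" using d by auto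
      then have "\<exists>T\<in>set Ts. p + of_real l * dir sg y \<in> cell p T" using g d(4) v e unfolding good_def by blast
      then show ?thesis using e by auto
    qed (use g in \<open>auto simp: good_def\<close>)
  qed
  then show ?thesis using g by (auto simp: describes_def good_def piece_ok_def disjoint_cells_def)
qed

end

section \<open>Reading the input\<close>

lemma concat_nth_take:
  assumes "c < length xs" "k < length (xs ! c)"
  shows "concat xs ! (length (concat (take c xs)) + k) = xs ! c ! k"
    "length (concat (take c xs)) + k < length (concat xs)"
    "length (concat (take (Suc c) xs)) = length (concat (take c xs)) + length (xs ! c)"
proof -
  have "xs = take c xs @ xs ! c # drop (Suc c) xs" using assms(1) by (rule id_take_nth_drop)
  then have e: "concat xs = concat (take c xs) @ xs ! c @ concat (drop (Suc c) xs)"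
    by (metis concat.simps(2) concat_append)
  show "concat xs ! (length (concat (take c xs)) + k) = xs ! c ! k"
    unfolding e using assms(2) by (simp add: nth_append)
  show "length (concat (take c xs)) + k < length (concat xs)"
    unfolding e using assms(2) by simp
  show "length (concat (take (Suc c) xs)) = length (concat (take c xs)) + length (xs ! c)"
    using assms(1) by (simp add: take_Suc_conv_app_nth)
qed

definition in_idx :: nexp where "in_idx = NAdd (nv 7) (nv 6)"
definition in_vertex :: "nexp \<Rightarrow> cexp" where
  "in_vertex i = (RSub (RCell 0 i) (fst e_p), RSub (RCell 1 i) (snd e_p))"

definition set_edge :: "cexp \<Rightarrow> cexp \<Rightarrow> com" where
  "set_edge a b = Seq (RAssign 6 in_idx (fst a)) (Seq (RAssign 7 in_idx (snd a))
     (Seq (RAssign 8 in_idx (fst b)) (RAssign 9 in_idx (snd b))))"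

text \<open>The successor of a vertex is in the next cell, except at the end of a cycle: there
  natural variable 7, the index of the first vertex of the cycle, is used.\<close>

definition pre_body :: com where
  "pre_body = Seq (Cond (NLess (NAdd (nv 6) (NConst 1)) (NCell 0 (NAdd (nv 5) (NConst 1))))
       (NAssign 4 (NConst 0) (NAdd in_idx (NConst 1))) (NAssign 4 (NConst 0) (nv 7)))
     (Seq (RAssign 4 in_idx (fst (in_vertex in_idx))) (Seq (RAssign 5 in_idx (snd (in_vertex in_idx)))
       (Cond (RLess (e_cross (in_vertex in_idx) (in_vertex (nv 4))) (rnum 0))
         (set_edge (in_vertex (nv 4)) (in_vertex in_idx)) (set_edge (in_vertex in_idx) (in_vertex (nv 4))))))"

definition pre_cycle :: com where
  "pre_cycle = Seq (For 6 (NCell 0 (NAdd (nv 5) (NConst 1))) pre_body)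
     (NAssign 7 (NConst 0) (NAdd (nv 7) (NCell 0 (NAdd (nv 5) (NConst 1)))))"

definition pre :: com where
  "pre = Seq (NAssign 7 (NConst 0) (NConst 0)) (Seq (For 5 (NCell 0 (NConst 0)) pre_cycle) (NAssign 2 (NConst 0) (nv 7)))"

lemma written_pre [simp]: "nats_written pre_body = {4}" "nats_written pre_cycle = {4, 6, 7}" "nats_written pre = {2, 4, 5, 6, 7}"
    "reals_written pre_body = {4, 5, 6, 7, 8, 9}" "reals_written pre_cycle = {4, 5, 6, 7, 8, 9}" "reals_written pre = {4, 5, 6, 7, 8, 9}"
  by (auto simp: pre_body_def set_edge_def pre_cycle_def pre_def)

context
  fixes D :: domain and p :: complex and \<alpha> :: real
begin

abbreviation "cycles \<equiv> boundary_cycles D"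
abbreviation "rel_edges \<equiv> centred_edges D p"
definition rel_vertices :: "complex list" where "rel_vertices = map (\<lambda>v. v - p) (vertices D)"

definition base :: "nat \<Rightarrow> nat" where "base c = length (concat (take c cycles))"

lemma base_edges: "length (concat (take c (map cyclic_edges cycles))) = base c"
  by (simp add: base_def length_concat take_map o_def)

lemma length_es: "length rel_edges = num_vertices D"
  by (simp add: centred_edges_def domain_edges_def num_vertices_def vertices_def length_concat o_def)

lemma length_qs: "length rel_vertices = num_vertices D"
  by (simp add: rel_vertices_def num_vertices_def)

lemma entry:
  assumes c: "c < length cycles" and k: "k < length (cycles ! c)"
  shows "base c + k < num_vertices D" "vertices D ! (base c + k) = cycles ! c ! k"
    "rel_vertices ! (base c + k) = cycles ! c ! k - p"
    "rel_edges ! (base c + k) = orient (cycles ! c ! k - p, cycles ! c ! (Suc k mod length (cycles ! c)) - p)"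
    "base (Suc c) = base c + length (cycles ! c)"
proof -
  note v = concat_nth_take[OF c k, folded base_def vertices_def num_vertices_def]
  show 1: "base c + k < num_vertices D" "vertices D ! (base c + k) = cycles ! c ! k"
    using v(1,2) by (simp_all add: num_vertices_def)
  show "base (Suc c) = base c + length (cycles ! c)" using v(3) by (simp add: base_def)
  show "rel_vertices ! (base c + k) = cycles ! c ! k - p" using 1 by (simp add: rel_vertices_def num_vertices_def)
  have c': "c < length (map cyclic_edges cycles)" "k < length (map cyclic_edges cycles ! c)" using c k by simp_all
  have e: "domain_edges D ! (base c + k) = (cycles ! c ! k, cycles ! c ! (Suc k mod length (cycles ! c)))"
    using concat_nth_take(1)[OF c', unfolded base_edges] c k
    by (simp add: domain_edges_def cyclic_edges_def)
  have "base c + k < length (domain_edges D)" using 1(1) length_es by (simp add: centred_edges_def)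
  then show "rel_edges ! (base c + k) = orient (cycles ! c ! k - p, cycles ! c ! (Suc k mod length (cycles ! c)) - p)"
    using e by (simp add: centred_edges_def)
qed

text \<open>Each vertex begins the edge with its index, and orienting the edge preserves its set of
  ends.\<close>

lemma ends_es: "set rel_vertices = ends rel_edges"
proof -
  have un: "ends xs = (\<Union>e\<in>set xs. {fst e, snd e})" for xs
    by (auto simp: ends_def)
  have o: "{fst (orient e), snd (orient e)} = {fst e, snd e}" for e
    by (auto simp: orient_def)
  have "set rel_edges = (\<lambda>e. orient (fst e - p, snd e - p)) ` set (domain_edges D)"
    by (simp add: centred_edges_def split_beta)
  then have e: "ends rel_edges = (\<Union>e\<in>set (domain_edges D). {fst e - p, snd e - p})"
    unfolding un by (simp only: image_image UN_simps o fst_conv snd_conv)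
  have d: "set (domain_edges D) = (\<Union>vs\<in>set cycles. set (cyclic_edges vs))"
    by (simp add: domain_edges_def)
  have cy: "(\<Union>e\<in>set (cyclic_edges vs). {fst e - p, snd e - p}) = (\<lambda>v. v - p) ` set vs" for vs
  proof (intro equalityI subsetI)
    fix x assume "x \<in> (\<Union>e\<in>set (cyclic_edges vs). {fst e - p, snd e - p})"
    then obtain i where i: "i < length vs" "x = vs ! i - p \<or> x = vs ! (Suc i mod length vs) - p"
      by (auto simp: cyclic_edges_def)
    have "Suc i mod length vs < length vs" using i(1) by (intro mod_less_divisor) auto
    then have "vs ! i \<in> set vs" "vs ! (Suc i mod length vs) \<in> set vs" using i(1) by (simp_all only: nth_mem)
    then show "x \<in> (\<lambda>v. v - p) ` set vs" using i(2) by blast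
  next
    fix x assume "x \<in> (\<lambda>v. v - p) ` set vs"
    then obtain v where v: "v \<in> set vs" "x = v - p" by blast
    then obtain i where i: "i < length vs" "v = vs ! i" by (metis in_set_conv_nth)
    then have "(v, vs ! (Suc i mod length vs)) \<in> set (cyclic_edges vs)" by (simp add: cyclic_edges_def)
    then show "x \<in> (\<Union>e\<in>set (cyclic_edges vs). {fst e - p, snd e - p})" unfolding v(2) by (rule UN_I) simp
  qed
  have "ends rel_edges = (\<Union>vs\<in>set cycles. \<Union>e\<in>set (cyclic_edges vs). {fst e - p, snd e - p})" unfolding e d by blast
  also have "\<dots> = set rel_vertices" unfolding cy by (auto simp: rel_vertices_def vertices_def)
  finally show ?thesis by simp
qed

definition in_ok :: "state \<Rightarrow> bool" where
  "in_ok s \<longleftrightarrow> nats s 0 = nats (input_state D \<alpha> p) 0 \<and> (\<forall>a\<in>{0,1,2}. reals s a = reals (input_state D \<alpha> p) a)"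

lemma in_okD:
  assumes "in_ok s"
  shows "nats s 0 0 = length cycles" "c < length cycles \<Longrightarrow> nats s 0 (Suc c) = length (cycles ! c)"
    "i < num_vertices D \<Longrightarrow> reals s 0 i = Re (vertices D ! i)" "i < num_vertices D \<Longrightarrow> reals s 1 i = Im (vertices D ! i)"
    "reals s 2 0 = Re p" "reals s 2 1 = Im p" "reals s 2 2 = \<alpha>"
  using assms by (auto simp: in_ok_def input_state_def array_of_def num_vertices_def)

lemma in_ok_cong: "in_ok s \<Longrightarrow> nats s' 0 = nats s 0 \<Longrightarrow> (\<And>a. a \<in> {0,1,2} \<Longrightarrow> reals s' a = reals s a) \<Longrightarrow> in_ok s'"
  by (simp add: in_ok_def)

definition filled :: "nat \<Rightarrow> state \<Rightarrow> bool" where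
  "filled m s \<longleftrightarrow> (\<forall>i<m. Complex (reals s 4 i) (reals s 5 i) = rel_vertices ! i \<and>
     Complex (reals s 6 i) (reals s 7 i) = fst (rel_edges ! i) \<and> Complex (reals s 8 i) (reals s 9 i) = snd (rel_edges ! i))"

lemma filled_nats [simp]: "filled m (s\<lparr>nats := n\<rparr>) \<longleftrightarrow> filled m s"
  by (simp add: filled_def)

lemma in_ok_nats [simp]: "a \<noteq> 0 \<Longrightarrow> in_ok (s\<lparr>nats := upd2 (nats s) a i x\<rparr>) \<longleftrightarrow> in_ok s"
  by (simp add: in_ok_def upd2_apply)

lemma runs_pre_body:
  assumes ok: "in_ok s" and f: "filled (base c + k) s" and c: "c < length cycles" and k: "k < length (cycles ! c)"
    and n: "nats s 5 0 = c" "nats s 6 0 = k" "nats s 7 0 = base c"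
  shows "runs pre_body s 9 (filled (base c + Suc k))"
proof -
  define m where "m = base c + k"
  define j where "j = base c + Suc k mod length (cycles ! c)"
  define v where "v = cycles ! c ! k - p"
  define w where "w = cycles ! c ! (Suc k mod length (cycles ! c)) - p"
  have k': "Suc k mod length (cycles ! c) < length (cycles ! c)" using k by (intro mod_less_divisor) auto
  note e1 = entry[OF c k] and e2 = entry[OF c k']
  define s1 where "s1 = s\<lparr>nats := upd2 (nats s) 4 0 j\<rparr>"
  define s2 where "s2 = s1\<lparr>reals := upd2 (reals s1) 4 m (Re v)\<rparr>"
  define s3 where "s3 = s2\<lparr>reals := upd2 (reals s2) 5 m (Im v)\<rparr>"
  have idx: "nval s' in_idx = m" "nval s' (nv 4) = j" if "nats s' = nats s1" for s'
    using that n by (simp_all add: in_idx_def s1_def upd2_apply m_def)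
  have vert: "cval s' (in_vertex in_idx) = v" "cval s' (in_vertex (nv 4)) = w"
    if ns: "nats s' = nats s1" and rs: "\<And>a. a \<in> {0,1,2} \<Longrightarrow> reals s' a = reals s a" for s'
  proof -
    have "in_ok s'" by (rule in_ok_cong[OF ok]) (use ns rs in \<open>simp_all add: s1_def upd2_apply\<close>)
    note i = in_okD[OF this]
    show "cval s' (in_vertex in_idx) = v" "cval s' (in_vertex (nv 4)) = w"
      using idx[OF ns] i(3)[of m] i(4)[of m] i(3)[of j] i(4)[of j] i(5,6) e1(1,2) e2(1,2)
      by (simp_all add: in_vertex_def e_p_def complex_eq_iff v_def w_def m_def j_def)
  qed
  have st1: "runs (Cond (NLess (NAdd (nv 6) (NConst 1)) (NCell 0 (NAdd (nv 5) (NConst 1))))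
       (NAssign 4 (NConst 0) (NAdd in_idx (NConst 1))) (NAssign 4 (NConst 0) (nv 7))) s (Suc 1) (\<lambda>s'. s' = s1)"
  proof (rule runs_Cond; rule runs_NAssign)
    assume "bval s (NLess (NAdd (nv 6) (NConst 1)) (NCell 0 (NAdd (nv 5) (NConst 1))))"
    then have "Suc k < length (cycles ! c)" using n in_okD(2)[OF ok c] by simp
    then show "s\<lparr>nats := upd2 (nats s) 4 (nval s (NConst 0)) (nval s (NAdd in_idx (NConst 1)))\<rparr> = s1"
      using n by (simp add: s1_def j_def in_idx_def)
  next
    assume "\<not> bval s (NLess (NAdd (nv 6) (NConst 1)) (NCell 0 (NAdd (nv 5) (NConst 1))))"
    then have "Suc k = length (cycles ! c)" using n in_okD(2)[OF ok c] k by simp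
    then show "s\<lparr>nats := upd2 (nats s) 4 (nval s (NConst 0)) (nval s (nv 7))\<rparr> = s1"
      using n by (simp add: s1_def j_def)
  qed
  have se: "runs (set_edge a b) s3 4 (\<lambda>s'. filled (Suc m) s')"
    if ab: "cval s3 a = fst (rel_edges ! m)" "cval s3 b = snd (rel_edges ! m)"
      and fr: "\<And>x. x \<in> {6,7,8,9} \<Longrightarrow> cfree x a \<and> cfree x b" for a b
  proof -
    define t1 where "t1 = s3\<lparr>reals := upd2 (reals s3) 6 m (Re (fst (rel_edges ! m)))\<rparr>"
    define t2 where "t2 = t1\<lparr>reals := upd2 (reals t1) 7 m (Im (fst (rel_edges ! m)))\<rparr>"
    define t3 where "t3 = t2\<lparr>reals := upd2 (reals t2) 8 m (Re (snd (rel_edges ! m)))\<rparr>"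
    define t4 where "t4 = t3\<lparr>reals := upd2 (reals t3) 9 m (Im (snd (rel_edges ! m)))\<rparr>"
    have nn: "nats s3 = nats s1" "nats t1 = nats s1" "nats t2 = nats s1" "nats t3 = nats s1"
      by (simp_all add: s2_def s3_def t1_def t2_def t3_def)
    have r: "rval s3 (fst a) = Re (fst (rel_edges ! m))" "rval s3 (snd a) = Im (fst (rel_edges ! m))"
      "rval s3 (fst b) = Re (snd (rel_edges ! m))" "rval s3 (snd b) = Im (snd (rel_edges ! m))"
      using ab by (metis Re_cval, metis Im_cval, metis Re_cval, metis Im_cval)
    \<comment> \<open>The coordinates are not read from the four arrays being written, so earlier
      assignments do not affect them.\<close>
    have q: "rval t1 (snd a) = Im (fst (rel_edges ! m))" "rval t2 (fst b) = Re (snd (rel_edges ! m))" "rval t3 (snd b) = Im (snd (rel_edges ! m))"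
    proof -
      have w: "rfree 6 e \<Longrightarrow> rval t1 e = rval s3 e" "rfree 7 e \<Longrightarrow> rval t2 e = rval t1 e" "rfree 8 e \<Longrightarrow> rval t3 e = rval t2 e" for e
        unfolding t1_def t2_def t3_def by (rule rval_rfree; assumption)+
      show "rval t1 (snd a) = Im (fst (rel_edges ! m))" "rval t2 (fst b) = Re (snd (rel_edges ! m))" "rval t3 (snd b) = Im (snd (rel_edges ! m))"
        using w fr[of 6] fr[of 7] fr[of 8] r by simp_all
    qed
    have fin: "filled (Suc m) t4"
      unfolding filled_def
    proof (intro allI impI)
      fix i assume "i < Suc m"
      then consider "i < m" | "i = m" by linarith
      then show "Complex (reals t4 4 i) (reals t4 5 i) = rel_vertices ! i \<and>
         Complex (reals t4 6 i) (reals t4 7 i) = fst (rel_edges ! i) \<and> Complex (reals t4 8 i) (reals t4 9 i) = snd (rel_edges ! i)"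
      proof cases
        case 1
        then show ?thesis using f by (simp add: filled_def m_def t1_def t2_def t3_def t4_def s1_def s2_def s3_def upd2_apply)
      next
        case 2
        then show ?thesis using e1(3) by (simp add: m_def v_def t1_def t2_def t3_def t4_def s1_def s2_def s3_def upd2_apply complex_eq_iff)
      qed
    qed
    have "runs (set_edge a b) s3 (1 + (1 + (1 + 1))) (\<lambda>s'. s' = t4)"
      unfolding set_edge_def
    proof (rule runs_Seq[OF runs_RAssign[where Q = "\<lambda>s'. s' = t1"]])
      show "s3\<lparr>reals := upd2 (reals s3) 6 (nval s3 in_idx) (rval s3 (fst a))\<rparr> = t1" by (simp add: t1_def idx[OF nn(1)] r)
      fix t1' assume 1: "t1' = t1"
      show "runs (Seq (RAssign 7 in_idx (snd a)) (Seq (RAssign 8 in_idx (fst b)) (RAssign 9 in_idx (snd b)))) t1' (1 + (1 + 1)) (\<lambda>s'. s' = t4)"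
        unfolding 1
      proof (rule runs_Seq[OF runs_RAssign[where Q = "\<lambda>s'. s' = t2"]])
        show "t1\<lparr>reals := upd2 (reals t1) 7 (nval t1 in_idx) (rval t1 (snd a))\<rparr> = t2" by (simp add: t2_def idx[OF nn(2)] q)
        fix t2' assume 2: "t2' = t2"
        show "runs (Seq (RAssign 8 in_idx (fst b)) (RAssign 9 in_idx (snd b))) t2' (1 + 1) (\<lambda>s'. s' = t4)"
          unfolding 2
        proof (rule runs_Seq[OF runs_RAssign[where Q = "\<lambda>s'. s' = t3"]])
          show "t2\<lparr>reals := upd2 (reals t2) 8 (nval t2 in_idx) (rval t2 (fst b))\<rparr> = t3" by (simp add: t3_def idx[OF nn(3)] q)
          fix t3' assume 3: "t3' = t3"
          show "runs (RAssign 9 in_idx (snd b)) t3' 1 (\<lambda>s'. s' = t4)"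
            unfolding 3 by (rule runs_RAssign) (simp add: t4_def idx[OF nn(4)] q)
        qed
      qed
    qed
    then show ?thesis by (rule runs_mono) (use fin in auto)
  qed
  have v3: "cval s3 (in_vertex in_idx) = v" "cval s3 (in_vertex (nv 4)) = w"
    by (rule vert; auto simp: s1_def s2_def s3_def upd2_apply)+
  have em: "rel_edges ! m = orient (v, w)" using e1(4) by (simp add: m_def v_def w_def)
  have fr: "cfree x (in_vertex i)" if "x \<in> {6,7,8,9}" for x i using that by (auto simp: in_vertex_def e_p_def)
  have "runs (Cond (RLess (e_cross (in_vertex in_idx) (in_vertex (nv 4))) (rnum 0))
         (set_edge (in_vertex (nv 4)) (in_vertex in_idx)) (set_edge (in_vertex in_idx) (in_vertex (nv 4)))) s3 (Suc 4) (filled (Suc m))"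
  proof (rule runs_Cond)
    assume "bval s3 (RLess (e_cross (in_vertex in_idx) (in_vertex (nv 4))) (rnum 0))"
    then have "cross v w < 0" using v3 by simp
    then show "runs (set_edge (in_vertex (nv 4)) (in_vertex in_idx)) s3 4 (filled (Suc m))"
      by (intro se) (use v3 em fr in \<open>simp_all add: orient_def\<close>)
  next
    assume "\<not> bval s3 (RLess (e_cross (in_vertex in_idx) (in_vertex (nv 4))) (rnum 0))"
    then have "\<not> cross v w < 0" using v3 by simp
    then show "runs (set_edge (in_vertex in_idx) (in_vertex (nv 4))) s3 4 (filled (Suc m))"
      by (intro se) (use v3 em fr in \<open>simp_all add: orient_def\<close>)
  qed
  note last = this
  have "runs pre_body s (Suc 1 + (1 + (1 + Suc 4))) (filled (Suc m))"
    unfolding pre_body_def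
  proof (rule runs_Seq[OF st1])
    fix s1' assume 1: "s1' = s1"
    have n1: "nats s1 = nats s1" "nats s2 = nats s1" by (simp_all add: s2_def)
    have "cval s1 (in_vertex in_idx) = v" "cval s2 (in_vertex in_idx) = v"
      by (rule vert(1); auto simp: s1_def s2_def upd2_apply)+
    then have v1: "rval s1 (fst (in_vertex in_idx)) = Re v" "rval s2 (snd (in_vertex in_idx)) = Im v"
      by (metis Re_cval, metis Im_cval)
    show "runs (Seq (RAssign 4 in_idx (fst (in_vertex in_idx))) (Seq (RAssign 5 in_idx (snd (in_vertex in_idx)))
       (Cond (RLess (e_cross (in_vertex in_idx) (in_vertex (nv 4))) (rnum 0))
         (set_edge (in_vertex (nv 4)) (in_vertex in_idx)) (set_edge (in_vertex in_idx) (in_vertex (nv 4)))))) s1' (1 + (1 + Suc 4)) (filled (Suc m))"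
      unfolding 1
    proof (rule runs_Seq[OF runs_RAssign[where Q = "\<lambda>s'. s' = s2"]])
      show "s1\<lparr>reals := upd2 (reals s1) 4 (nval s1 in_idx) (rval s1 (fst (in_vertex in_idx)))\<rparr> = s2"
        by (simp add: s2_def idx[OF n1(1)] v1)
      fix s2' assume 2: "s2' = s2"
      show "runs (Seq (RAssign 5 in_idx (snd (in_vertex in_idx)))
       (Cond (RLess (e_cross (in_vertex in_idx) (in_vertex (nv 4))) (rnum 0))
         (set_edge (in_vertex (nv 4)) (in_vertex in_idx)) (set_edge (in_vertex in_idx) (in_vertex (nv 4))))) s2' (1 + Suc 4) (filled (Suc m))"
        unfolding 2
      proof (rule runs_Seq[OF runs_RAssign[where Q = "\<lambda>s'. s' = s3"]])
        show "s2\<lparr>reals := upd2 (reals s2) 5 (nval s2 in_idx) (rval s2 (snd (in_vertex in_idx)))\<rparr> = s3"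
          by (simp add: s3_def idx[OF n1(2)] v1)
      qed (use last in simp)
    qed
  qed
  then show ?thesis by (simp add: m_def)
qed

lemma runs_pre_cycle:
  assumes ok: "in_ok s" and f: "filled (base c) s" and c: "c < length cycles" "cycles ! c \<noteq> []"
    and n: "nats s 5 0 = c" "nats s 7 0 = base c"
  shows "runs pre_cycle s (3 + num_vertices D * 11) (\<lambda>s'. in_ok s' \<and> filled (base (Suc c)) s' \<and> nats s' 7 0 = base (Suc c))"
proof -
  let ?L = "length (cycles ! c)"
  let ?I = "\<lambda>k s. in_ok s \<and> filled (base c + k) s \<and> nats s 5 0 = c \<and> nats s 7 0 = base c"
  have upd: "?I k (s\<lparr>nats := upd2 (nats s) 6 0 i\<rparr>)" if "?I k s" for k s i
    using that by (simp add: upd2_apply)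
  have loop: "runs (For 6 (NCell 0 (NAdd (nv 5) (NConst 1))) pre_body) s (2 + ?L * (9 + 2)) (?I ?L)"
  proof (rule runs_For)
    show "?I 0 (s\<lparr>nats := upd2 (nats s) 6 0 0\<rparr>)" by (rule upd) (use assms in simp)
    show "nval s (NCell 0 (NAdd (nv 5) (NConst 1))) = ?L" if "?I k s" for k s
      using that in_okD(2)[of s c] c(1) by simp
    fix k s assume I: "?I k s" and k: "k < ?L" "nats s 6 0 = k"
    show "runs pre_body s 9 (\<lambda>s'. nats s' 6 0 = k \<and> ?I (Suc k) (s'\<lparr>nats := upd2 (nats s') 6 0 (Suc k)\<rparr>))"
    proof (rule runs_mono[OF runs_pre_body[OF _ _ c(1) k(1) _ k(2)]])
      fix s' assume f': "filled (base c + Suc k) s'" and u: "unchanged pre_body s s'"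
      have n': "nats s' 5 = nats s 5" "nats s' 6 = nats s 6" "nats s' 7 = nats s 7" "nats s' 0 = nats s 0"
        by (simp_all add: unchangedD(1)[OF u])
      have ok': "in_ok s'"
      proof (rule in_ok_cong)
        show "in_ok s" using I by blast
        show "nats s' 0 = nats s 0" by (rule n'(4))
        show "reals s' a = reals s a" if "a \<in> {0,1,2}" for a
          by (rule unchangedD(2)[OF u]) (use that in auto)
      qed
      have I': "?I (Suc k) s'" using f' ok' n' I by simp
      then show "nats s' 6 0 = k \<and> ?I (Suc k) (s'\<lparr>nats := upd2 (nats s') 6 0 (Suc k)\<rparr>)"
        using upd[OF I', of "Suc k"] n'(2) k(2) by simp
    qed (use I in auto)
  qed
  have bs: "base (Suc c) = base c + ?L" "?L \<le> num_vertices D"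
  proof -
    have "0 < ?L" "?L - 1 < ?L" using c(2) by simp_all
    then show "base (Suc c) = base c + ?L" "?L \<le> num_vertices D"
      using entry(5)[OF c(1), of 0] entry(1)[OF c(1), of "?L - 1"] by linarith+
  qed
  have "runs pre_cycle s ((2 + ?L * (9 + 2)) + 1) (\<lambda>s'. in_ok s' \<and> filled (base (Suc c)) s' \<and> nats s' 7 0 = base (Suc c))"
    unfolding pre_cycle_def
  proof (rule runs_Seq[OF loop])
    fix s1 assume I: "?I ?L s1"
    then have "in_ok (s1\<lparr>nats := upd2 (nats s1) 7 0 (base (Suc c))\<rparr>)" "filled (base (Suc c)) (s1\<lparr>nats := upd2 (nats s1) 7 0 (base (Suc c))\<rparr>)"
      using bs by simp_all
    moreover have "nval s1 (NAdd (nv 7) (NCell 0 (NAdd (nv 5) (NConst 1)))) = base (Suc c)"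
      using I in_okD(2)[of s1 c] c(1) bs by simp
    ultimately show "runs (NAssign 7 (NConst 0) (NAdd (nv 7) (NCell 0 (NAdd (nv 5) (NConst 1))))) s1 1
        (\<lambda>s'. in_ok s' \<and> filled (base (Suc c)) s' \<and> nats s' 7 0 = base (Suc c))"
      by (intro runs_NAssign) (simp add: upd2_apply)
  qed
  then show ?thesis by (rule runs_mono) (use mult_le_mono1[OF bs(2), of 11] in simp_all)
qed

lemma runs_pre:
  assumes ne: "\<And>c. c < length cycles \<Longrightarrow> cycles ! c \<noteq> []"
  shows "runs pre (input_state D \<alpha> p) (4 + num_vertices D * (3 + num_vertices D * 11 + 2)) (\<lambda>s. mem rel_edges rel_vertices \<alpha> p (reals s 10 0) s)"
proof -
  let ?s = "input_state D \<alpha> p"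
  define s1 where "s1 = ?s\<lparr>nats := upd2 (nats ?s) 7 0 0\<rparr>"
  let ?I = "\<lambda>c s. in_ok s \<and> filled (base c) s \<and> nats s 7 0 = base c"
  let ?T = "3 + num_vertices D * 11"
  have "in_ok ?s" by (simp add: in_ok_def)
  then have ok1: "in_ok s1" by (rule in_ok_cong) (auto simp: s1_def upd2_apply)
  have upd: "?I c (s\<lparr>nats := upd2 (nats s) 5 0 i\<rparr>)" if "?I c s" for c s i
    using that by (simp add: upd2_apply)
  have loop: "runs (For 5 (NCell 0 (NConst 0)) pre_cycle) s1 (2 + length cycles * (?T + 2)) (?I (length cycles))"
  proof (rule runs_For)
    show "?I 0 (s1\<lparr>nats := upd2 (nats s1) 5 0 0\<rparr>)"
      by (rule upd) (use ok1 in \<open>simp add: base_def filled_def s1_def upd2_apply\<close>)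
    show "nval s (NCell 0 (NConst 0)) = length cycles" if "?I k s" for k s using that in_okD(1) by simp
    fix c s assume I: "?I c s" and c: "c < length cycles" "nats s 5 0 = c"
    show "runs pre_cycle s ?T (\<lambda>s'. nats s' 5 0 = c \<and> ?I (Suc c) (s'\<lparr>nats := upd2 (nats s') 5 0 (Suc c)\<rparr>))"
    proof (rule runs_mono[OF runs_pre_cycle[OF _ _ c(1) ne[OF c(1)] c(2)]])
      fix s' assume I': "in_ok s' \<and> filled (base (Suc c)) s' \<and> nats s' 7 0 = base (Suc c)" and u: "unchanged pre_cycle s s'"
      have "nats s' 5 = nats s 5" by (simp add: unchangedD(1)[OF u])
      then show "nats s' 5 0 = c \<and> ?I (Suc c) (s'\<lparr>nats := upd2 (nats s') 5 0 (Suc c)\<rparr>)"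
        using upd[OF I'] c(2) by simp
    qed (use I in auto)
  qed
  have bl: "base (length cycles) = num_vertices D" by (simp add: base_def num_vertices_def vertices_def)
  \<comment> \<open>No cycle is empty, so the number of cycles is at most that of the vertices and
    disappears from the time bound.\<close>
  have le: "length cycles \<le> num_vertices D"
  proof -
    have "length xs \<le> length (concat xs)" if "\<forall>x\<in>set xs. x \<noteq> []" for xs :: "complex list list"
      using that
    proof (induction xs)
      case (Cons x xs)
      then obtain y ys where "x = y # ys" by (cases x) auto
      moreover have "length xs \<le> length (concat xs)" using Cons by simp
      ultimately show ?case by simp
    qed simp
    moreover have "\<forall>x\<in>set cycles. x \<noteq> []" using ne by (auto simp: in_set_conv_nth)
    ultimately show ?thesis by (simp add: num_vertices_def vertices_def)
  qed
  have "runs pre ?s (1 + ((2 + length cycles * (?T + 2)) + 1)) (\<lambda>s. mem rel_edges rel_vertices \<alpha> p (reals s 10 0) s)"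
    unfolding pre_def
  proof (rule runs_Seq[OF runs_NAssign[where Q = "\<lambda>s'. s' = s1"]])
    show "?s\<lparr>nats := upd2 (nats ?s) 7 (nval ?s (NConst 0)) (nval ?s (NConst 0))\<rparr> = s1" by (simp add: s1_def)
    fix s1' assume 1: "s1' = s1"
    show "runs (Seq (For 5 (NCell 0 (NConst 0)) pre_cycle) (NAssign 2 (NConst 0) (nv 7))) s1' ((2 + length cycles * (?T + 2)) + 1)
        (\<lambda>s. mem rel_edges rel_vertices \<alpha> p (reals s 10 0) s)" unfolding 1
    proof (rule runs_Seq[OF loop])
      fix s2 assume I: "?I (length cycles) s2"
      then have ok2: "in_ok s2" and f2: "filled (num_vertices D) s2" and n2: "nats s2 7 0 = num_vertices D" using bl by auto
      show "runs (NAssign 2 (NConst 0) (nv 7)) s2 1 (\<lambda>s. mem rel_edges rel_vertices \<alpha> p (reals s 10 0) s)"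
        by (rule runs_NAssign)
          (use in_okD(5-7)[OF ok2] f2 n2 in \<open>simp add: mem_def length_es length_qs upd2_apply filled_def\<close>)
    qed
  qed
  then show ?thesis by (rule runs_mono) (use le in simp_all)
qed

end

section \<open>The program\<close>

text \<open>The degenerate piece with the single point \<open>p\<close> and the zero conic ensures
  that \<open>p\<close> is covered even if no sector contributes.\<close>

definition point_piece :: com where
  "point_piece = Seq (store 3 (NConst 0) 0 [fst e_p, snd e_p, fst e_p, snd e_p])
     (Seq (NAssign 9 (NConst 0) (NConst 10)) (NAssign 1 (NConst 0) (NConst 1)))"

definition pad_body :: com where "pad_body = NAssign 12 (NConst 0) (NAdd (nv 12) (NConst 1))"

text \<open>Counting up to the number of pieces makes the running time at least the length of the
  output.\<close>

definition pad :: com where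
  "pad = Seq (NAssign 12 (NConst 0) (NConst 0)) (While (NLess (nv 12) (nv 1)) pad_body)"

definition program :: com where
  "program = Seq pre (Seq point_piece (Seq (chart (rnum 1)) (Seq (chart (rneg (rnum 1))) pad)))"

text \<open>A lower bound on the time, for which \<open>runs\<close> is unsuitable; every round
  takes at least one step and raises the counter by one.\<close>

lemma exec_pad_loop: "exec c s t s' \<Longrightarrow> c = While (NLess (nv 12) (nv 1)) pad_body \<Longrightarrow> nats s 1 0 \<le> nats s 12 0 + t"
proof (induction rule: exec.induct)
  case (WhileTrue s b c t s' u s'')
  then have "exec pad_body s t s'" by simp
  then have "nats s' 1 0 = nats s 1 0" "nats s' 12 0 = Suc (nats s 12 0)"
    unfolding pad_body_def by (auto elim!: NAssignE simp: upd2_apply)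
  then show ?case using WhileTrue by simp
qed auto

lemma runs_pad:
  "\<exists>t s'. exec pad s t s' \<and> t \<le> 2 + nats s 1 0 * 2 \<and> nats s 1 0 \<le> t \<and> read_output s' = read_output s"
proof -
  define s1 where "s1 = s\<lparr>nats := upd2 (nats s) 12 0 0\<rparr>"
  let ?w = "While (NLess (nv 12) (nv 1)) pad_body"
  have "runs ?w s1 (1 + nats s 1 0 * Suc 1) (\<lambda>s'. True \<and> \<not> bval s' (NLess (nv 12) (nv 1)))"
  proof (rule runs_While[where m = "\<lambda>s. nats s 1 0 - nats s 12 0"])
    fix s assume "bval s (NLess (nv 12) (nv 1))"
    then show "runs pad_body s 1 (\<lambda>s'. True \<and> nats s' 1 0 - nats s' 12 0 < nats s 1 0 - nats s 12 0)"
      unfolding pad_body_def by (intro runs_NAssign) (auto simp: upd2_apply)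
  qed (auto simp: s1_def upd2_apply)
  then obtain t s' where e: "exec ?w s1 t s'" "t \<le> 1 + nats s 1 0 * 2" by (auto simp: runs_def numeral_2_eq_2)
  have ge: "nats s 1 0 \<le> t" using exec_pad_loop[OF e(1) refl] by (simp add: s1_def upd2_apply)
  have u: "unchanged ?w s1 s'" by (rule exec_unchanged[OF e(1)])
  have "reals s' 3 = reals s1 3" "nats s' 1 = nats s1 1"
    using unchangedD[OF u] by (simp_all add: pad_body_def)
  then have "read_output s' = read_output s"
    by (simp add: read_output_def read_piece_def s1_def upd2_apply)
  moreover have "exec pad s (1 + t) s'"
    unfolding pad_def using exec.NAssign[of 12 "NConst 0" "NConst 0" s] e(1)
    by (intro exec.Seq) (simp_all add: s1_def)
  ultimately show ?thesis using e(2) ge by (intro exI[of _ "1 + t"] exI[of _ s']) auto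
qed

lemma point_cell: "cell p \<lparr>corner1 = p, corner2 = p, conic = k\<rparr> = {p}"
  by (auto simp: cell_def wedge_def)

lemma runs_point_piece:
  assumes m: "mem es qs \<alpha> p sg s" and z: "reals s 3 = (\<lambda>_. 0)"
  shows "runs point_piece s 7 (\<lambda>s'. nats s' 9 0 = 10 * nats s' 1 0 \<and>
    read_output s' = [\<lparr>corner1 = p, corner2 = p, conic = [0,0,0,0,0,0]\<rparr>])" (is "runs _ _ _ ?Q")
proof -
  let ?o = "[fst e_p, snd e_p, fst e_p, snd e_p]"
  have fr: "list_all (rfree 3) ?o" by (simp add: e_p_def)
  have pv: "rval s (fst e_p) = Re p" "rval s (snd e_p) = Im p" using m by (simp_all add: mem_def e_p_def)
  have B: "nval s (NConst 0) = 0" by simp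
  have "runs point_piece s ((length ?o + 1) + (1 + 1)) ?Q"
    unfolding point_piece_def
  proof (rule runs_Seq[OF runs_store[OF fr B]])
    fix s1 :: state assume st: "\<forall>y. reals s1 3 y = (if 0 + 0 \<le> y \<and> y < 0 + 0 + length ?o then rval s (?o ! (y - (0 + 0))) else reals s 3 y)"
    have r: "reals s1 3 0 = Re p" "reals s1 3 1 = Im p" "reals s1 3 2 = Re p" "reals s1 3 3 = Im p"
      "\<And>y. 4 \<le> y \<Longrightarrow> reals s1 3 y = 0"
      using spec[OF st, of 0] spec[OF st, of 1] spec[OF st, of 2] spec[OF st, of 3] st z pv by simp_all
    define s2 where "s2 = s1\<lparr>nats := upd2 (upd2 (nats s1) 9 0 10) 1 0 1\<rparr>"
    have "map (\<lambda>k. reals s2 3 (10 * 0 + k)) [4..<10] = map (\<lambda>k. 0) [4..<10]"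
      by (rule map_cong) (auto simp: s2_def r)
    also have "\<dots> = [0,0,0,0,0,0]" by (simp add: upt_rec)
    finally have "read_piece s2 0 = \<lparr>corner1 = p, corner2 = p, conic = [0,0,0,0,0,0]\<rparr>"
      using r(1-4) by (simp add: read_piece_def Let_def s2_def complex_eq_iff)
    then have Q: "?Q s2" by (simp add: read_output_def s2_def upd2_apply)
    show "runs (Seq (NAssign 9 (NConst 0) (NConst 10)) (NAssign 1 (NConst 0) (NConst 1))) s1 (1 + 1) ?Q"
    proof (rule runs_Seq[OF runs_NAssign[where Q = "\<lambda>s'. s' = s1\<lparr>nats := upd2 (nats s1) 9 0 10\<rparr>"]])
      fix s' assume s': "s' = s1\<lparr>nats := upd2 (nats s1) 9 0 10\<rparr>"
      have eq: "s'\<lparr>nats := upd2 (nats s') 1 (nval s' (NConst 0)) (nval s' (NConst 1))\<rparr> = s2"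
        by (simp add: s' s2_def)
      show "runs (NAssign 1 (NConst 0) (NConst 1)) s' 1 ?Q" by (rule runs_NAssign) (unfold eq, rule Q)
    qed simp
  qed
  then show ?thesis by (rule runs_mono) auto
qed

lemma good_point:
  assumes "p \<in> V"
  shows "good V p 1 (-1) [\<lparr>corner1 = p, corner2 = p, conic = [0,0,0,0,0,0]\<rparr>]"
proof -
  let ?T = "\<lparr>corner1 = p, corner2 = p, conic = [0,0,0,0,0,0]\<rparr>"
  have "corners_on_arc p ?T" unfolding corners_on_arc_def point_cell by (simp add: conic_val_def)
  then have "piece_ok V p ?T" using assms by (simp add: piece_ok_def point_cell)
  then show ?thesis by (simp add: good_def point_cell disjoint_cells_def)
qed

definition time_bound :: "nat \<Rightarrow> nat" where
  "time_bound n = (4 + n * (3 + n * 11 + 2)) + (7 + (T_chart n + (T_chart n + (2 + (1 + 4 * crit_bound n) * 2))))"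

lemma runs_program:
  assumes D: "polygonal_domain D" and p: "p \<in> region D" and \<alpha>: "0 < \<alpha>" "\<alpha> \<le> 1"
  shows "\<exists>t s. exec program (input_state D \<alpha> p) t s \<and> t \<le> time_bound (num_vertices D) \<and>
    length (read_output s) \<le> t \<and> describes p (read_output s) (Vis_inv (region D) \<alpha> p)"
proof -
  let ?V = "Vis_inv (region D) \<alpha> p"
  let ?es = "centred_edges D p" and ?qs = "rel_vertices D p"
  let ?n = "num_vertices D"
  interpret star_region "region D" ?V p \<alpha> ?es by (rule star_region_Vis_inv[OF D p \<alpha>])
  have ne: "boundary_cycles D ! c \<noteq> []" if "c < length (boundary_cycles D)" for c
  proof -
    have "boundary_cycles D ! c \<in> set (boundary_cycles D)" using that by simp
    then have "simple_polygon (boundary_cycles D ! c)"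
      using outer_simple[OF D] hole_simple[OF D] by (auto simp: boundary_cycles_def)
    then show ?thesis by (auto simp: simple_polygon_def)
  qed
  note qs = ends_es[of D p] and len = length_es[of D p]
  have lq: "length ?qs = length ?es" using length_qs len by simp
  let ?s0 = "input_state D \<alpha> p"
  obtain t1 s1 where 1: "exec pre ?s0 t1 s1" "t1 \<le> 4 + ?n * (3 + ?n * 11 + 2)" "mem ?es ?qs \<alpha> p (reals s1 10 0) s1"
    using runs_pre[OF ne] unfolding runs_def by blast
  have u1: "unchanged pre ?s0 s1" by (rule exec_unchanged[OF 1(1)])
  have "reals s1 3 = (\<lambda>_. 0)" using unchangedD(2)[OF u1, of 3] by (simp add: input_state_def)
  from runs_point_piece[OF 1(3) this] obtain t2 s2 where 2: "exec point_piece s1 t2 s2" "t2 \<le> 7"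
    "nats s2 9 0 = 10 * nats s2 1 0" "read_output s2 = [\<lparr>corner1 = p, corner2 = p, conic = [0,0,0,0,0,0]\<rparr>]"
    unfolding runs_def by blast
  have u2: "unchanged point_piece s1 s2" by (rule exec_unchanged[OF 2(1)])
  have w2: "nats_written point_piece = {9, 1}" "\<And>x. x \<in> reals_written point_piece \<Longrightarrow> x = 3"
    by (auto simp: point_piece_def)
  have "mem ?es ?qs \<alpha> p (reals s1 10 0) s2" by (rule mem_unchanged[OF 1(3) u2]) (use w2(1) in simp, drule w2(2), simp)
  moreover have "reals s2 10 = reals s1 10" using unchangedD(2)[OF u2, of 10] w2(2)[of 10] by auto
  ultimately have m2: "mem ?es ?qs \<alpha> p (reals s2 10 0) s2" by simp
  have g2: "good ?V p 1 (-1) (read_output s2)" unfolding 2(4) by (rule good_point[OF p_V])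
  obtain t3 s3 where 3: "exec (chart (rnum 1)) s2 t3 s3" "t3 \<le> T_chart ?n" "mem ?es ?qs \<alpha> p 1 s3"
    "nats s3 9 0 = 10 * nats s3 1 0" "good ?V p 1 1 (read_output s3)"
    "length (read_output s3) \<le> length (read_output s2) + 2 * crit_bound ?n"
    using runs_chart[OF _ qs lq m2 2(3) g2, of "rnum 1"] unfolding runs_def len by auto
  have m3: "mem ?es ?qs \<alpha> p (reals s3 10 0) s3" using 3(3) by (simp add: mem_def)
  obtain t4 s4 where 4: "exec (chart (rneg (rnum 1))) s3 t4 s4" "t4 \<le> T_chart ?n"
    "good ?V p (-1) 1 (read_output s4)"
    "length (read_output s4) \<le> length (read_output s3) + 2 * crit_bound ?n"
    using runs_chart[OF _ qs lq m3 3(4) good_switch[OF 3(5)], of "rneg (rnum 1)"] unfolding runs_def len by auto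
  \<comment> \<open>One piece for \<open>p\<close> and, in each of the two charts, at most two for
    each critical direction.\<close>
  have l4: "nats s4 1 0 \<le> 1 + 4 * crit_bound ?n" 
  proof -
    have "length (read_output s2) = 1" "length (read_output s4) = nats s4 1 0"
      unfolding 2(4) by (simp_all add: read_output_def)
    then show ?thesis using 4(4) 3(6) by linarith
  qed
  obtain t5 s5 where 5: "exec pad s4 t5 s5" "t5 \<le> 2 + nats s4 1 0 * 2" "nats s4 1 0 \<le> t5" "read_output s5 = read_output s4"
    using runs_pad by blast
  have e: "exec program ?s0 (t1 + (t2 + (t3 + (t4 + t5)))) s5"
    unfolding program_def
    by (rule exec.Seq[OF 1(1) exec.Seq[OF 2(1) exec.Seq[OF 3(1) exec.Seq[OF 4(1) 5(1)]]]])
  have "2 + nats s4 1 0 * 2 \<le> 2 + (1 + 4 * crit_bound ?n) * 2" using l4 by simp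
  then have t: "t1 + (t2 + (t3 + (t4 + t5))) \<le> time_bound ?n"
    unfolding time_bound_def using 1(2) 2(2) 3(2) 4(2) 5(2) by linarith
  have "length (read_output s5) = nats s4 1 0" using 5(4) by (simp add: read_output_def)
  then have "length (read_output s5) \<le> t1 + (t2 + (t3 + (t4 + t5)))" using 5(3) by simp
  moreover have "describes p (read_output s5) ?V" unfolding 5(4) by (rule good_describes[OF 4(3)])
  ultimately show ?thesis using e t by blast
qed

section \<open>Polynomial running time\<close>

definition poly_fun :: "(nat \<Rightarrow> nat) \<Rightarrow> bool" where
  "poly_fun f \<longleftrightarrow> (\<exists>T :: nat poly. \<forall>n. f n = poly T n)"

lemma poly_fun_intros:
  "poly_fun (\<lambda>n. c)" "poly_fun (\<lambda>n. n)"
  "poly_fun f \<Longrightarrow> poly_fun g \<Longrightarrow> poly_fun (\<lambda>n. f n + g n)"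
  "poly_fun f \<Longrightarrow> poly_fun g \<Longrightarrow> poly_fun (\<lambda>n. f n * g n)"
proof -
  show "poly_fun (\<lambda>n. c)" unfolding poly_fun_def by (intro exI[of _ "[:c:]"]) simp
  show "poly_fun (\<lambda>n. n)" unfolding poly_fun_def by (intro exI[of _ "[:0, 1:]"]) simp
  assume f: "poly_fun f" and g: "poly_fun g"
  obtain P Q where "\<forall>n. f n = poly P n" "\<forall>n. g n = poly Q n" using f g unfolding poly_fun_def by blast
  then show "poly_fun (\<lambda>n. f n + g n)" "poly_fun (\<lambda>n. f n * g n)" unfolding poly_fun_def
    by (intro exI[of _ "P + Q"], simp, intro exI[of _ "P * Q"], simp)
qed

lemma poly_fun_time_bound: "poly_fun time_bound"
  unfolding time_bound_def T_chart_def T_body_def T_step_def T_next_def crit_bound_def Suc_eq_plus1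
  by (intro poly_fun_intros)

theorem lemma11:
  shows "\<exists>(c :: com) (T :: nat poly).
    \<forall>(D :: domain) (\<phi> :: real) (\<alpha> :: real) (p :: complex).
      polygonal_domain D \<and> \<phi> = smallest_internal_angle D \<and>
      0 < \<alpha> \<and> \<alpha> \<le> sin (\<phi> / 2) \<and> p \<in> region D \<longrightarrow>
      (\<exists>t s. exec c (input_state D \<alpha> p) t s \<and>
             t \<le> poly T (num_vertices D) \<and>
             length (read_output s) \<le> t \<and>
             describes p (read_output s) (Vis_inv (region D) \<alpha> p))"
proof -
  obtain T :: "nat poly" where T: "\<forall>n. time_bound n = poly T n"
    using poly_fun_time_bound unfolding poly_fun_def by blast
  show ?thesis
  proof (intro exI[of _ program] exI[of _ T] allI impI)
    fix D \<phi> \<alpha> p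
    assume a: "polygonal_domain D \<and> \<phi> = smallest_internal_angle D \<and>
      0 < \<alpha> \<and> \<alpha> \<le> sin (\<phi> / 2) \<and> p \<in> region D"
    \<comment> \<open>The bound by a sine yields the form that \<open>runs_program\<close>
      requires.\<close>
    then have "\<alpha> \<le> 1" using sin_le_one order_trans by blast
    then show "\<exists>t s. exec program (input_state D \<alpha> p) t s \<and> t \<le> poly T (num_vertices D) \<and>
        length (read_output s) \<le> t \<and> describes p (read_output s) (Vis_inv (region D) \<alpha> p)"
      using runs_program[of D p \<alpha>] a T by simp
  qed
qed

end
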